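(* Let $\mathcal{D}=\{(x_1,t_1),(x_2,t_2),\ldots\}$ be an (ordered) deterministic countable dense subset of $\mathbb{R}^2$, let $\{\tilde W_1,\tilde W_1^b,\tilde W_2,\tilde W_2^b,\ldots\}$ be the double Brownian web skeleton with starting set $\mathcal{D}$, and for $j\ge 1$ let $\tilde W_j^F$ be the doubly infinite path $$\tilde W_j^F(t)=\begin{cases}\tilde W_j^b(t), & t\le t_j,\\ \tilde W_j(t), & t\ge t_j.\end{cases}$$ Let $\bar{\mathcal{W}}^F$ be the closure of $\mathcal{W}^F=\{\tilde W_1^F,\tilde W_2^F,\ldots\}$ in $(\Pi^F,d^F)$. Then, almost surely, $\bar{\mathcal{W}}^F$ is compact (and so $\bar{\mathcal{W}}^F$ is an $(\mathcal{H}^F,d_{\mathcal{H}^F})$-valued random variable), and the distribution of $\bar{\mathcal{W}}^F$ does not depend on $\mathcal{D}$ or its ordering.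
   Context: Doubly infinite paths. Put $\Phi(x,t)=\tanh(x)/(1+|t|)$ and $\Psi(t)=\tanh(t)$ for $(x,t)\in[-\infty,\infty]^2$ (so $\Phi(x,\pm\infty)=0$). $\Pi^F$ is the set of functions $f:[-\infty,\infty]\to[-\infty,\infty]$ such that $t\mapsto\Phi(f(t),t)$ is continuous (functions differing only at $t=\pm\infty$ are identified), with metric $d^F(f_1,f_2)=\sup_{-\infty\le t\le\infty}|\Phi(f_1(t),t)-\Phi(f_2(t),t)|$. An element $f\in\Pi^F$ is identified with its space-time path $\{(f(s),s)\}$. $\mathcal{H}^F$ is the set of compact subsets of $(\Pi^F,d^F)$, with the induced Hausdorff metric $d_{\mathcal{H}^F}$. Coalescing Brownian motions. Coalescing Brownian motions (unit diffusion constant) started from space-time points are Brownian motions started at the given points, evolving independently until two of them meet, after which those two coincide forever. Backward coalescing Brownian motions are the analogous objects run backward in time (their image under $(x,t)\mapsto(-x,-t)$ is a family of coalescing Brownian motions). Two paths cross if on their common time domain there are times $s,t$ at which their difference is strictly positive and strictly negative, respectively. Double Brownian web skeleton. For a deterministic countable dense $\mathcal{D}=\{(x_1,t_1),(x_2,t_2),\ldots\}\subset\mathbb{R}^2$, the double Brownian web skeleton $\{\tilde W_1,\tilde W_1^b,\tilde W_2,\tilde W_2^b,\ldots\}$ is the family of coalescing/reflecting forward/backward Brownian motions starting at the points of $\mathcal{D}$: $\tilde W_j$ is a forward path from $(x_j,t_j)$ (defined for times $\ge t_j$), $\tilde W_j^b$ is a backward path from $(x_j,t_j)$ (defined for times $\le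 t_j$), the forward paths are distributed as coalescing Brownian motions, the backward paths as backward coalescing Brownian motions, and almost surely no forward path crosses a backward path (forward and backward paths reflect off each other); these properties determine the joint law. *)

theory Defs
  imports "HOL-Probability.Probability"
begin

section \<open>The space of doubly infinite paths\<close>

definition tanh_ereal :: "ereal \<Rightarrow> real" where
  "tanh_ereal x = (case x of ereal r \<Rightarrow> tanh r | PInfty \<Rightarrow> 1 | MInfty \<Rightarrow> -1)"

definition Phi :: "ereal \<Rightarrow> ereal \<Rightarrow> real" where
  "Phi x t = (case t of ereal r \<Rightarrow> tanh_ereal x / (1 + \<bar>r\<bar>) | PInfty \<Rightarrow> 0 | MInfty \<Rightarrow> 0)"

definition bipath_fun :: "(ereal \<Rightarrow> ereal) \<Rightarrow> bool" where
  "bipath_fun f \<longleftrightarrow> continuous_on UNIV (\<lambda>t. Phi (f t) t)"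

text \<open>Functions that differ only at the times \<open>\<infinity>\<close> and \<open>-\<infinity>\<close> are identified.\<close>

definition bipath_eq :: "(ereal \<Rightarrow> ereal) \<Rightarrow> (ereal \<Rightarrow> ereal) \<Rightarrow> bool" where
  "bipath_eq f g \<longleftrightarrow> bipath_fun f \<and> bipath_fun g \<and> (\<forall>r::real. f (ereal r) = g (ereal r))"

lemma bipath_fun_0: "bipath_fun (\<lambda>_. 0)"
proof -
  have "(\<lambda>t. Phi 0 t) = (\<lambda>_. 0)"
    by (auto simp: Phi_def tanh_ereal_def zero_ereal_def split: ereal.split)
  then show ?thesis by (simp add: bipath_fun_def)
qed

quotient_type bipath = "ereal \<Rightarrow> ereal" / partial: bipath_eq
proof (rule part_equivpI)
  show "\<exists>f. bipath_eq f f"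
    using bipath_fun_0 by (auto simp: bipath_eq_def)
qed (auto simp: bipath_eq_def symp_def transp_def)

lemma abs_tanh_ereal_le: "\<bar>tanh_ereal x\<bar> \<le> 1"
proof (cases x)
  case (real r)
  then show ?thesis
    using tanh_real_lt_1[of r] tanh_real_gt_neg1[of r] by (simp add: tanh_ereal_def abs_le_iff)
qed (auto simp: tanh_ereal_def)

lemma abs_Phi_le: "\<bar>Phi x t\<bar> \<le> 1"
proof (cases t)
  case (real r)
  have "\<bar>tanh_ereal x\<bar> \<le> 1 + \<bar>r\<bar>"
    using abs_tanh_ereal_le[of x] by linarith
  then show ?thesis
    using real by (simp add: Phi_def abs_divide divide_le_eq_1) linarith
qed (auto simp: Phi_def)

lemma tanh_ereal_inj: "tanh_ereal x = tanh_ereal y \<longleftrightarrow> x = y"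
proof -
  have "tanh r \<noteq> 1" "tanh r \<noteq> -1" "1 \<noteq> tanh r" "-1 \<noteq> tanh r" for r :: real
    using tanh_real_lt_1[of r] tanh_real_gt_neg1[of r] by auto
  then show ?thesis
    by (cases x; cases y) (auto simp: tanh_ereal_def)
qed

lemma Phi_inj: "Phi x (ereal r) = Phi y (ereal r) \<longleftrightarrow> x = y"
proof -
  have "1 + \<bar>r\<bar> \<noteq> 0" by linarith
  then show ?thesis by (simp add: Phi_def tanh_ereal_inj)
qed

definition dF :: "(ereal \<Rightarrow> ereal) \<Rightarrow> (ereal \<Rightarrow> ereal) \<Rightarrow> real" where
  "dF f g = (SUP t. \<bar>Phi (f t) t - Phi (g t) t\<bar>)"

lemma dF_bdd: "bdd_above (range (\<lambda>t. \<bar>Phi (f t) t - Phi (g t) t\<bar>))"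
proof -
  have "\<bar>Phi (f t) t - Phi (g t) t\<bar> \<le> 2" for t
    using abs_Phi_le[of "f t" t] abs_Phi_le[of "g t" t] by linarith
  then show ?thesis
    by (intro bdd_aboveI[of _ 2]) auto
qed

lemma dF_upper: "\<bar>Phi (f t) t - Phi (g t) t\<bar> \<le> dF f g"
  using cSUP_upper[OF UNIV_I[of t] dF_bdd[of f g]] by (simp only: dF_def)

lemma dF_triangle: "dF f g \<le> dF f h + dF g h"
  unfolding dF_def[of f g]
proof (rule cSUP_least[OF UNIV_not_empty])
  show "\<bar>Phi (f t) t - Phi (g t) t\<bar> \<le> dF f h + dF g h" for t
    using dF_upper[of f t h] dF_upper[of g t h] by linarith
qed

lemma dF_eq_0:
  assumes "bipath_fun f" "bipath_fun g"
  shows "dF f g = 0 \<longleftrightarrow> bipath_eq f g"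
proof
  assume "dF f g = 0"
  then have "Phi (f t) t = Phi (g t) t" for t
    using dF_upper[of f t g] by simp
  then have "f (ereal r) = g (ereal r)" for r
    using Phi_inj by blast
  then show "bipath_eq f g"
    using assms by (simp add: bipath_eq_def)
next
  assume "bipath_eq f g"
  then have "Phi (f t) t = Phi (g t) t" for t
    by (cases t) (auto simp: bipath_eq_def Phi_def)
  then show "dF f g = 0"
    by (simp add: dF_def)
qed

instantiation bipath :: metric_space
begin

lift_definition dist_bipath :: "bipath \<Rightarrow> bipath \<Rightarrow> real" is dF
proof -
  fix f f' g g' assume eq: "bipath_eq f f'" "bipath_eq g g'"
  have "Phi (f t) t = Phi (f' t) t \<and> Phi (g t) t = Phi (g' t) t" for t
    using eq by (cases t) (auto simp: bipath_eq_def Phi_def)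
  then show "dF f g = dF f' g'"
    by (simp add: dF_def)
qed

definition uniformity_bipath :: "(bipath \<times> bipath) filter" where
  "uniformity_bipath = (INF e\<in>{0<..}. principal {(x, y). dist x y < e})"

definition open_bipath :: "bipath set \<Rightarrow> bool" where
  "open_bipath U \<longleftrightarrow> (\<forall>x\<in>U. \<forall>\<^sub>F (x', y) in uniformity. x' = x \<longrightarrow> y \<in> U)"

instance
proof
  fix p q r :: bipath
  show "dist p q = 0 \<longleftrightarrow> p = q"
    by transfer (use dF_eq_0 in \<open>auto simp: bipath_eq_def\<close>)
  show "dist p q \<le> dist p r + dist q r"
    by transfer (rule dF_triangle)
qed (simp_all only: uniformity_bipath_def open_bipath_def)

end


section \<open>The space of compact subsets with the Hausdorff metric\<close>

text \<open>The Hausdorff distance is a metric on the nonempty compact sets only.\<close>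

typedef (overloaded) ('a::metric_space) compacts = "{K::'a set. compact K \<and> K \<noteq> {}}"
  morphisms set_of_compacts Compacts
  by (rule exI[of _ "{undefined}"]) simp

definition hausdorff_dist :: "'a::metric_space set \<Rightarrow> 'a set \<Rightarrow> real" where
  "hausdorff_dist K L = max (SUP x\<in>K. infdist x L) (SUP y\<in>L. infdist y K)"

lemma bdd_above_infdist:
  fixes K L :: "'a::metric_space set"
  assumes "compact K"
  shows "bdd_above ((\<lambda>x. infdist x L) ` K)"
  by (intro bounded_imp_bdd_above compact_imp_bounded compact_continuous_image assms
      continuous_on_infdist continuous_on_id)

lemma hausdorff_excess_triangle:
  fixes K L H :: "'a::metric_space set"
  assumes K: "compact K" "K \<noteq> {}" and L: "compact L" "L \<noteq> {}" and H: "compact H" "H \<noteq> {}"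
  shows "(SUP x\<in>K. infdist x L) \<le> (SUP x\<in>K. infdist x H) + (SUP x\<in>H. infdist x L)"
proof (rule cSUP_least[OF K(2)])
  fix x assume x: "x \<in> K"
  have "continuous_on H (dist x)"
    by (intro continuous_intros)
  then obtain h where h: "h \<in> H" and min: "\<And>y. y \<in> H \<Longrightarrow> dist x h \<le> dist x y"
    using continuous_attains_inf[OF H] by blast
  have le: "dist x h \<le> infdist x H"
    unfolding infdist_notempty[OF H(2)] by (rule cINF_greatest[OF H(2) min])
  have "infdist x L \<le> infdist h L + dist x h"
    by (rule infdist_triangle)
  also have "infdist h L \<le> (SUP x\<in>H. infdist x L)"
    by (rule cSUP_upper[OF h bdd_above_infdist[OF H(1)]])
  also note le
  also have "infdist x H \<le> (SUP x\<in>K. infdist x H)"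
    by (rule cSUP_upper[OF x bdd_above_infdist[OF K(1)]])
  finally show "infdist x L \<le> (SUP x\<in>K. infdist x H) + (SUP x\<in>H. infdist x L)"
    by simp
qed

lemma hausdorff_excess_0:
  fixes K L :: "'a::metric_space set"
  assumes K: "compact K" and L: "compact L" "L \<noteq> {}" and le: "(SUP x\<in>K. infdist x L) \<le> 0"
  shows "K \<subseteq> L"
proof
  fix x assume x: "x \<in> K"
  have "infdist x L \<le> 0"
    using cSUP_upper[OF x bdd_above_infdist[OF K, of L]] le by linarith
  then have "infdist x L = 0"
    using infdist_nonneg[of x L] by linarith
  then show "x \<in> L"
    using in_closed_iff_infdist_zero[OF compact_imp_closed[OF L(1)] L(2)] by blast
qed

instantiation compacts :: (metric_space) metric_space
begin

definition dist_compacts :: "'a compacts \<Rightarrow> 'a compacts \<Rightarrow> real" where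
  "dist_compacts K L = hausdorff_dist (set_of_compacts K) (set_of_compacts L)"

definition uniformity_compacts :: "('a compacts \<times> 'a compacts) filter" where
  "uniformity_compacts = (INF e\<in>{0<..}. principal {(x, y). dist x y < e})"

definition open_compacts :: "'a compacts set \<Rightarrow> bool" where
  "open_compacts U \<longleftrightarrow> (\<forall>x\<in>U. \<forall>\<^sub>F (x', y) in uniformity. x' = x \<longrightarrow> y \<in> U)"

instance
proof
  fix K L H :: "'a compacts"
  have c: "compact (set_of_compacts X)" "set_of_compacts X \<noteq> {}" for X :: "'a compacts"
    using set_of_compacts[of X] by auto
  show "dist K L = 0 \<longleftrightarrow> K = L"
  proof
    assume "dist K L = 0"
    then have "(SUP x\<in>set_of_compacts K. infdist x (set_of_compacts L)) \<le> 0"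
      "(SUP x\<in>set_of_compacts L. infdist x (set_of_compacts K)) \<le> 0"
      unfolding dist_compacts_def hausdorff_dist_def by linarith+
    then have "set_of_compacts K = set_of_compacts L"
      by (intro subset_antisym hausdorff_excess_0 c)
    then show "K = L"
      by (simp add: set_of_compacts_inject)
  next
    assume "K = L"
    then show "dist K L = 0"
      using c[of L] by (simp add: dist_compacts_def hausdorff_dist_def cong: SUP_cong_simp)
  qed
  show "dist K L \<le> dist K H + dist L H"
    using hausdorff_excess_triangle[OF c c c, of K L H]
      hausdorff_excess_triangle[OF c c c, of L K H]
    unfolding dist_compacts_def hausdorff_dist_def by linarith
qed (simp_all only: uniformity_compacts_def open_compacts_def)

end

text \<open>
  The family \<open>K\<close> of sets is, up to a null set, the random variable \<open>X\<close> with values in the space of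
  compact sets; in particular almost every \<open>K \<omega>\<close> is compact.
\<close>

definition random_compact_of :: "'s measure \<Rightarrow> ('s \<Rightarrow> 'a::metric_space set) \<Rightarrow> ('s \<Rightarrow> 'a compacts) \<Rightarrow> bool" where
  "random_compact_of M K X \<longleftrightarrow>
     X \<in> borel_measurable M \<and> (AE \<omega> in M. set_of_compacts (X \<omega>) = K \<omega>)"


section \<open>Coalescing Brownian motions\<close>

text \<open>
  Space-time points are pairs \<open>(x, t)\<close>. A path started from \<open>(x, t)\<close> is a function on all of
  \<open>real\<close> whose values before time \<open>t\<close> are irrelevant (after time \<open>t\<close> for a backward path).
\<close>

definition brownian_motion :: "'s measure \<Rightarrow> real \<times> real \<Rightarrow> ('s \<Rightarrow> real \<Rightarrow> real) \<Rightarrow> bool" where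
  "brownian_motion M p B \<longleftrightarrow>
     (\<forall>t\<ge>snd p. (\<lambda>\<omega>. B \<omega> t) \<in> borel_measurable M) \<and>
     (AE \<omega> in M. B \<omega> (snd p) = fst p) \<and>
     (AE \<omega> in M. continuous_on {snd p..} (B \<omega>)) \<and>
     (\<forall>s t. snd p \<le> s \<and> s < t \<longrightarrow>
        distributed M lborel (\<lambda>\<omega>. B \<omega> t - B \<omega> s) (normal_density 0 (sqrt (t - s)))) \<and>
     (\<forall>(n::nat) \<tau>. mono \<tau> \<and> snd p \<le> \<tau> 0 \<longrightarrow>
        prob_space.indep_vars M (\<lambda>_. borel) (\<lambda>i \<omega>. B \<omega> (\<tau> (Suc i)) - B \<omega> (\<tau> i)) {..<n})"

definition independent_brownian_motions ::
    "'s measure \<Rightarrow> (nat \<Rightarrow> real \<times> real) \<Rightarrow> (nat \<Rightarrow> 's \<Rightarrow> real \<Rightarrow> real) \<Rightarrow> bool" where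
  "independent_brownian_motions M z B \<longleftrightarrow>
     (\<forall>j. brownian_motion M (z j) (B j)) \<and>
     prob_space.indep_vars M (\<lambda>j. \<Pi>\<^sub>M t\<in>{snd (z j)..}. borel)
       (\<lambda>j \<omega>. restrict (B j \<omega>) {snd (z j)..}) UNIV"

text \<open>
  \<open>w\<close> is the coalescing system driven by the paths \<open>b\<close>: two paths that meet coincide from then on,
  and \<open>w j\<close> follows its own \<open>b j\<close> until it first meets a path of smaller index.
\<close>

definition coalescence_of ::
    "(nat \<Rightarrow> real \<times> real) \<Rightarrow> (nat \<Rightarrow> real \<Rightarrow> real) \<Rightarrow> (nat \<Rightarrow> real \<Rightarrow> real) \<Rightarrow> bool" where
  "coalescence_of z b w \<longleftrightarrow>
     (\<forall>j. continuous_on {snd (z j)..} (w j) \<and> w j (snd (z j)) = fst (z j)) \<and>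
     (\<forall>i j s t. snd (z i) \<le> s \<and> snd (z j) \<le> s \<and> s \<le> t \<and> w i s = w j s \<longrightarrow> w i t = w j t) \<and>
     (\<forall>j. \<forall>t\<ge>snd (z j).
        (\<forall>i<j. \<forall>s. snd (z i) \<le> s \<and> snd (z j) \<le> s \<and> s \<le> t \<longrightarrow> w i s \<noteq> w j s) \<longrightarrow> w j t = b j t)"

definition continuous_paths ::
    "'s measure \<Rightarrow> (nat \<Rightarrow> real \<times> real) \<Rightarrow> (nat \<Rightarrow> 's \<Rightarrow> real \<Rightarrow> real) \<Rightarrow> bool" where
  "continuous_paths M z W \<longleftrightarrow>
     (\<forall>j. \<forall>t\<ge>snd (z j). (\<lambda>\<omega>. W j \<omega> t) \<in> borel_measurable M) \<and>
     (\<forall>j. AE \<omega> in M. continuous_on {snd (z j)..} (W j \<omega>))"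

definition paths_law ::
    "'s measure \<Rightarrow> (nat \<Rightarrow> real \<times> real) \<Rightarrow> (nat \<Rightarrow> 's \<Rightarrow> real \<Rightarrow> real) \<Rightarrow> (nat \<times> real \<Rightarrow> real) measure" where
  "paths_law M z W =
     (let I = {(j, t). snd (z j) \<le> t}
      in distr M (\<Pi>\<^sub>M _\<in>I. borel) (\<lambda>\<omega>. \<lambda>(j, t)\<in>I. W j \<omega> t))"

text \<open>
  The joint law of \<open>W\<close> is that of the coalescing system driven by independent Brownian motions on
  an auxiliary probability space. The sample type of the latter is large enough to carry the
  canonical versions of these processes, so fixing it is no restriction.
\<close>

definition coalescing_brownian_motions ::
    "'s measure \<Rightarrow> (nat \<Rightarrow> real \<times> real) \<Rightarrow> (nat \<Rightarrow> 's \<Rightarrow> real \<Rightarrow> real) \<Rightarrow> bool" where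
  "coalescing_brownian_motions M z W \<longleftrightarrow>
     continuous_paths M z W \<and>
     (\<exists>(N :: (nat \<Rightarrow> real \<Rightarrow> real) measure) B C.
        prob_space N \<and>
        independent_brownian_motions N z B \<and>
        continuous_paths N z C \<and>
        (AE \<omega> in N. coalescence_of z (\<lambda>j. B j \<omega>) (\<lambda>j. C j \<omega>)) \<and>
        paths_law M z W = paths_law N z C)"

definition backward_coalescing_brownian_motions ::
    "'s measure \<Rightarrow> (nat \<Rightarrow> real \<times> real) \<Rightarrow> (nat \<Rightarrow> 's \<Rightarrow> real \<Rightarrow> real) \<Rightarrow> bool" where
  "backward_coalescing_brownian_motions M z W \<longleftrightarrow>
     coalescing_brownian_motions M (\<lambda>j. - z j) (\<lambda>j \<omega> t. - W j \<omega> (- t))"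


section \<open>The double Brownian web skeleton\<close>

definition cross_on :: "real set \<Rightarrow> (real \<Rightarrow> real) \<Rightarrow> (real \<Rightarrow> real) \<Rightarrow> bool" where
  "cross_on T f g \<longleftrightarrow> (\<exists>s\<in>T. \<exists>t\<in>T. f s - g s > 0 \<and> f t - g t < 0)"

definition double_web_skeleton ::
    "'s measure \<Rightarrow> (nat \<Rightarrow> real \<times> real) \<Rightarrow> (nat \<Rightarrow> 's \<Rightarrow> real \<Rightarrow> real) \<Rightarrow> (nat \<Rightarrow> 's \<Rightarrow> real \<Rightarrow> real) \<Rightarrow> bool" where
  "double_web_skeleton M z W Wb \<longleftrightarrow>
     prob_space M \<and>
     coalescing_brownian_motions M z W \<and>
     backward_coalescing_brownian_motions M z Wb \<and>
     (AE \<omega> in M. \<forall>i j. \<not> cross_on ({snd (z i)..} \<inter> {..snd (z j)}) (W i \<omega>) (Wb j \<omega>))"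

text \<open>
  The sequence \<open>z\<close> enumerates without repetition the countable dense set \<open>range z\<close>.
\<close>

definition dense_enumeration :: "(nat \<Rightarrow> real \<times> real) \<Rightarrow> bool" where
  "dense_enumeration z \<longleftrightarrow> inj z \<and> closure (range z) = UNIV"

text \<open>
  The doubly infinite path that is \<open>wb\<close> up to time \<open>t0\<close> and \<open>w\<close> afterwards. If the glued function
  is not continuous, which happens on a null set only, the value is unspecified. The value of
  the representing function at \<open>\<infinity>\<close> and \<open>-\<infinity>\<close> is irrelevant.
\<close>

definition glue_paths :: "real \<Rightarrow> (real \<Rightarrow> real) \<Rightarrow> (real \<Rightarrow> real) \<Rightarrow> bipath" where
  "glue_paths t0 wb w =
     abs_bipath (\<lambda>t. case t of ereal r \<Rightarrow> ereal (if r \<le> t0 then wb r else w r) | PInfty \<Rightarrow> 0 | MInfty \<Rightarrow> 0)"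

definition full_skeleton ::
    "(nat \<Rightarrow> real \<times> real) \<Rightarrow> (nat \<Rightarrow> 's \<Rightarrow> real \<Rightarrow> real) \<Rightarrow> (nat \<Rightarrow> 's \<Rightarrow> real \<Rightarrow> real) \<Rightarrow> 's \<Rightarrow> bipath set" where
  "full_skeleton z W Wb \<omega> = range (\<lambda>j. glue_paths (snd (z j)) (Wb j \<omega>) (W j \<omega>))"

end

theory Submission
  imports Defs
begin

text \<open>
  Compactness: finitely many forward paths form a fence that no backward path crosses, so on a short time interval
  every backward path moves little, and by time reversal so does every forward path. The doubly infinite paths are
  therefore equicontinuous in the coordinate \<open>tanh\<close>, and the Arzela-Ascoli argument applies.

  Law: the backward paths are functions of the forward paths, which they separate. A random compact set is determined in
  law by the probabilities of hitting open sets, so only the joint law of the forward paths matters. It depends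
  continuously on the starting points: in a random walk scheme, merged walks may be led by any member of their
  cluster without changing the law, so finitely many tracked paths can be put first in the coalescence order, and in
  that order the scheme converges pathwise. Approximating the points of one starting set by those of another, each
  skeleton is realised inside the closure of the other; hence the hitting probabilities agree.
\<close>

section \<open>The space of doubly infinite paths\<close>

text \<open>The coalescence rule favours smaller indices, so a law that should be symmetric in the
  labels is given in an order-dependent form, and approximating points taken from another starting
  set carry arbitrary labels there. Only a discrete scheme allows the leader of a cluster to be
  changed by permuting increments. Merged walks are kept a small distance apart instead of being
  identified, which costs at most \<open>2 * J * J\<close> times the largest increment for
  \<open>J\<close> walks; since \<open>J\<close> grows with the approximation, the mesh has to be
  chosen after it. The scheme sees meetings only as sign changes, so tangential contact must be
  excluded beforehand. A Gaussian small-ball bound does this: the first increment of a driver shifts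
  a whole later stretch of its path and is independent of everything else. In the comparison of two
  skeletons, limits of doubly infinite paths are only known to lie in the closure of the other web,
  which yields an inequality of hitting probabilities; equality comes from interchanging the two
  starting sets.\<close>

definition val :: "bipath \<Rightarrow> real \<Rightarrow> real" where
  "val f t = tanh_ereal (rep_bipath f (ereal t))"

lemma bipath_fun_rep: "bipath_fun (rep_bipath f)"
  using Quotient3_rel_rep[OF Quotient3_bipath, of f f] by (auto simp: bipath_eq_def)

lemma Phi_rep: "Phi (rep_bipath f (ereal t)) (ereal t) = val f t / (1 + \<bar>t\<bar>)"
  by (simp add: Phi_def val_def)

lemma abs_val_le: "\<bar>val f t\<bar> \<le> 1"
  by (simp add: val_def abs_tanh_ereal_le)

lemma continuous_val: "continuous_on UNIV (val f)"
proof -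
  have "continuous_on UNIV (\<lambda>t. Phi (rep_bipath f t) t)"
    using bipath_fun_rep by (simp add: bipath_fun_def)
  then have "continuous_on UNIV (\<lambda>t. Phi (rep_bipath f (ereal t)) (ereal t))"
    by (rule continuous_on_compose2) (auto intro!: continuous_intros)
  then have "continuous_on UNIV (\<lambda>t. Phi (rep_bipath f (ereal t)) (ereal t) * (1 + \<bar>t\<bar>))"
    by (intro continuous_intros)
  moreover have "Phi (rep_bipath f (ereal t)) (ereal t) * (1 + \<bar>t\<bar>) = val f t" for t
    unfolding Phi_rep by (simp add: divide_simps)
  ultimately show ?thesis by simp
qed

text \<open>The infinite times contribute 0 to the supremum because \<open>Phi\<close> vanishes
  there. What remains is a weighted uniform distance of the coordinates \<open>val\<close> over real
  times.\<close>

lemma dist_bipath_le: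
  assumes "0 \<le> e"
  shows "dist f g \<le> e \<longleftrightarrow> (\<forall>t. \<bar>val f t - val g t\<bar> \<le> e * (1 + \<bar>t\<bar>))"
proof -
  have *: "\<bar>Phi (rep_bipath f (ereal t)) (ereal t) - Phi (rep_bipath g (ereal t)) (ereal t)\<bar>
      = \<bar>val f t - val g t\<bar> / (1 + \<bar>t\<bar>)" for t
    unfolding Phi_rep diff_divide_distrib[symmetric] by simp
  have d: "dist f g = dF (rep_bipath f) (rep_bipath g)"
    by (rule dist_bipath.rep_eq)
  have "dist f g \<le> e \<longleftrightarrow> (\<forall>t. \<bar>Phi (rep_bipath f t) t - Phi (rep_bipath g t) t\<bar> \<le> e)"
  proof
    assume "dist f g \<le> e"
    then show "\<forall>t. \<bar>Phi (rep_bipath f t) t - Phi (rep_bipath g t) t\<bar> \<le> e"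
      unfolding d using dF_upper[of "rep_bipath f" _ "rep_bipath g"] by (blast intro: order_trans)
  next
    assume "\<forall>t. \<bar>Phi (rep_bipath f t) t - Phi (rep_bipath g t) t\<bar> \<le> e"
    then show "dist f g \<le> e"
      unfolding d dF_def by (intro cSUP_least) auto
  qed
  also have "\<dots> \<longleftrightarrow> (\<forall>t. \<bar>Phi (rep_bipath f (ereal t)) (ereal t) - Phi (rep_bipath g (ereal t)) (ereal t)\<bar> \<le> e)"
  proof safe
    fix t assume a: "\<forall>t. \<bar>Phi (rep_bipath f (ereal t)) (ereal t) - Phi (rep_bipath g (ereal t)) (ereal t)\<bar> \<le> e"
    show "\<bar>Phi (rep_bipath f t) t - Phi (rep_bipath g t) t\<bar> \<le> e"
      using a assms by (cases t) (auto simp: Phi_def)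
  qed auto
  also have "\<dots> \<longleftrightarrow> (\<forall>t. \<bar>val f t - val g t\<bar> \<le> e * (1 + \<bar>t\<bar>))"
  proof -
    have p: "0 < 1 + \<bar>t\<bar>" for t :: real by linarith
    show ?thesis unfolding * pos_divide_le_eq[OF p] ..
  qed
  finally show ?thesis .
qed

lemma val_dist: "\<bar>val f t - val g t\<bar> \<le> dist f g * (1 + \<bar>t\<bar>)"
  using dist_bipath_le[of "dist f g" f g] by simp

text \<open>At the infinite times boundedness of \<open>g\<close> is enough: beyond modulus
  \<open>1 / e\<close> the quotient is below \<open>e\<close> in absolute value.\<close>

lemma continuous_on_ereal_damped:
  assumes "continuous_on UNIV (g::real \<Rightarrow> real)" "\<And>t. \<bar>g t\<bar> \<le> 1"
  shows "continuous_on UNIV (\<lambda>t::ereal. case t of ereal r \<Rightarrow> g r / (1 + \<bar>r\<bar>) | PInfty \<Rightarrow> 0 | MInfty \<Rightarrow> 0)"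
    (is "continuous_on UNIV ?F")
proof -
  have lim: "(?F \<longlongrightarrow> 0) (at x)" if "x = \<infinity> \<or> x = -\<infinity>" for x :: ereal
  proof (rule tendstoI)
    fix e :: real assume e: "e > 0"
    have b: "dist (?F t) 0 < e" if "t > ereal (1/e) \<or> t < ereal (-(1/e))" for t
    proof (cases t)
      case (real r)
      then have "\<bar>r\<bar> > 1 / e" using that e by auto
      then have "1 < e * (1 + \<bar>r\<bar>)" using e by (simp add: field_simps)
      moreover have "\<bar>g r\<bar> \<le> 1" using assms by auto
      moreover have "0 < 1 + \<bar>r\<bar>" by linarith
      ultimately show ?thesis using real by (simp add: pos_divide_less_eq)
    qed (use e in auto)
    have o: "open ({ereal (1/e)<..} \<union> {..<ereal (-(1/e))})" by auto
    show "\<forall>\<^sub>F t in at x. dist (?F t) 0 < e"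
      unfolding eventually_at_topological
      by (rule exI[of _ "{ereal (1/e)<..} \<union> {..<ereal (-(1/e))}"]) (use o b that in auto)
  qed
  have "isCont ?F x" for x
  proof (cases x)
    case (real r)
    have "isCont (\<lambda>r. g r / (1 + \<bar>r\<bar>)) r"
      using assms by (intro continuous_intros continuous_on_interior[OF assms(1)]) auto
    then show ?thesis unfolding real isCont_def unfolding at_ereal filterlim_filtermap by simp
  qed (use lim in \<open>auto simp: isCont_def\<close>)
  then show ?thesis by (simp add: continuous_at_imp_continuous_on)
qed

lemma bipath_fun_iff:
  assumes "continuous_on UNIV (\<lambda>r. tanh_ereal (F (ereal r)))"
  shows "bipath_fun F"
proof -
  have "(\<lambda>t. Phi (F t) t) = (\<lambda>t::ereal. case t of ereal r \<Rightarrow> tanh_ereal (F (ereal r)) / (1 + \<bar>r\<bar>) | PInfty \<Rightarrow> 0 | MInfty \<Rightarrow> 0)"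
    by (auto simp: Phi_def split: ereal.split)
  then show ?thesis
    unfolding bipath_fun_def using continuous_on_ereal_damped[OF assms abs_tanh_ereal_le] by (simp only:)
qed

lemma val_abs_bipath:
  assumes "continuous_on UNIV (\<lambda>r. tanh_ereal (F (ereal r)))"
  shows "val (abs_bipath F) t = tanh_ereal (F (ereal t))"
proof -
  have "bipath_eq F F" using bipath_fun_iff[OF assms] by (simp add: bipath_eq_def)
  then have "bipath_eq (rep_bipath (abs_bipath F)) F"
    by (rule rep_abs_rsp_left[OF Quotient3_bipath])
  then show ?thesis by (simp add: val_def bipath_eq_def)
qed

lemma val_glue_paths:
  assumes "continuous_on {..t0} wb" "continuous_on {t0..} w" "wb t0 = w t0"
  shows "val (glue_paths t0 wb w) r = tanh (if r \<le> t0 then wb r else w r)"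
proof -
  have "continuous_on ({..t0} \<union> {t0..}) (\<lambda>r. if r \<in> {..t0} then wb r else w r)"
    using assms by (intro continuous_on_cases) auto
  moreover have "{..t0} \<union> {t0..} = UNIV" by auto
  ultimately have "continuous_on UNIV (\<lambda>r. if r \<le> t0 then wb r else w r)" by simp
  then have "continuous_on UNIV (\<lambda>r. tanh (if r \<le> t0 then wb r else w r))"
    by (intro continuous_intros) auto
  then show ?thesis
    unfolding glue_paths_def by (subst val_abs_bipath) (auto simp: tanh_ereal_def)
qed

lemma tanh_ereal_surj:
  assumes "\<bar>y\<bar> \<le> 1" shows "\<exists>x. tanh_ereal x = y"
proof -
  consider "y = 1" | "y = -1" | "\<bar>y\<bar> < 1" using assms by linarith
  then show ?thesis
  proof cases
    case 3
    have "\<exists>r. tanh r = y"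
    proof
      have "(1 + y) / (1 - y) > 0" using 3 by (intro divide_pos_pos) auto
      then show "tanh (ln ((1 + y) / (1 - y)) / 2) = y"
        using 3 by (simp add: tanh_real_altdef exp_minus divide_simps)
    qed
    then obtain r where "tanh r = y" by blast
    then have "tanh_ereal (ereal r) = y" by (simp add: tanh_ereal_def)
    then show ?thesis by blast
  qed (auto simp: tanh_ereal_def intro: exI[of _ "\<infinity>"] exI[of _ "-\<infinity>"])
qed

text \<open>Since \<open>val\<close> is also injective (\<open>val_inj\<close>), a path is the same
  as a continuous function from the reals to \<open>[-1, 1]\<close>, and limits may be built in this
  coordinate.\<close>

lemma ex_val:
  assumes "continuous_on UNIV g" "\<And>t. \<bar>g t\<bar> \<le> 1"
  shows "\<exists>f. val f = g"
proof -
  obtain F where F: "tanh_ereal (F t) = g t" for t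
    using tanh_ereal_surj[OF assms(2)] by metis
  have "val (abs_bipath (\<lambda>t. F (real_of_ereal t))) t = g t" for t
    by (subst val_abs_bipath) (auto simp: F assms)
  then show ?thesis by blast
qed

text \<open>The weight \<open>1 + \<bar>t\<bar>\<close> is bounded on bounded time intervals, so a
  Cauchy sequence converges locally uniformly and its pointwise limit is continuous.\<close>

lemma complete_bipath: "uniform_space_class.complete (UNIV :: bipath set)"
proof (rule completeI)
  fix X :: "nat \<Rightarrow> bipath" assume X: "Cauchy X"
  have "Cauchy (\<lambda>n. val (X n) t)" for t
  proof (rule metric_CauchyI)
    fix e :: real assume "e > 0"
    then have "e / (1 + \<bar>t\<bar>) > 0" by auto
    then obtain N where N: "\<forall>m\<ge>N. \<forall>n\<ge>N. dist (X m) (X n) < e / (1 + \<bar>t\<bar>)"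
      using X unfolding Cauchy_def by blast
    have "dist (val (X m) t) (val (X n) t) < e" if "m \<ge> N" "n \<ge> N" for m n
    proof -
      have "dist (X m) (X n) * (1 + \<bar>t\<bar>) < e"
        using N that by (simp add: pos_less_divide_eq)
      then show ?thesis using val_dist[of "X m" t "X n"] by (simp add: dist_real_def)
    qed
    then show "\<exists>M. \<forall>m\<ge>M. \<forall>n\<ge>M. dist (val (X m) t) (val (X n) t) < e" by blast
  qed
  then obtain g where g: "(\<lambda>n. val (X n) t) \<longlonglongrightarrow> g t" for t
    by (meson Cauchy_convergent convergentD)
  have unif: "\<bar>val (X n) t - g t\<bar> \<le> e * (1 + \<bar>t\<bar>)"
    if "\<forall>m\<ge>N. \<forall>n\<ge>N. dist (X m) (X n) < e" "n \<ge> N" for e N n t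
  proof -
    have "(\<lambda>m. \<bar>val (X n) t - val (X m) t\<bar>) \<longlonglongrightarrow> \<bar>val (X n) t - g t\<bar>"
      by (intro tendsto_intros g)
    moreover have "\<forall>m\<ge>N. \<bar>val (X n) t - val (X m) t\<bar> \<le> e * (1 + \<bar>t\<bar>)"
    proof safe
      fix m assume "m \<ge> N"
      then have "dist (X n) (X m) * (1 + \<bar>t\<bar>) \<le> e * (1 + \<bar>t\<bar>)"
        using that by (intro mult_right_mono) (auto intro: less_imp_le)
      then show "\<bar>val (X n) t - val (X m) t\<bar> \<le> e * (1 + \<bar>t\<bar>)"
        using val_dist[of "X n" t "X m"] by linarith
    qed
    ultimately show ?thesis by (rule LIMSEQ_le_const2[OF _ exI])
  qed
  have cont: "isCont g t" for t
  proof -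
    have "continuous_on (ball t 1) g"
    proof (rule uniform_limit_theorem[where F=sequentially and f="\<lambda>n. val (X n)"])
      show "uniform_limit (ball t 1) (\<lambda>n. val (X n)) g sequentially"
        unfolding uniform_limit_sequentially_iff
      proof safe
        fix e :: real assume e: "e > 0"
        \<comment> \<open>On \<open>ball t 1\<close> the weight is at most
          \<open>2 + \<bar>t\<bar>\<close>, so this choice turns the weighted bound into
          \<open>e / 2\<close>.\<close>
        define e' where "e' = e / (2 * (2 + \<bar>t\<bar>))"
        have e': "e' > 0" using e by (simp add: e'_def)
        then obtain N where N: "\<forall>m\<ge>N. \<forall>n\<ge>N. dist (X m) (X n) < e'"
          using X unfolding Cauchy_def by blast
        have "dist (val (X n) s) (g s) < e" if "n \<ge> N" "s \<in> ball t 1" for n s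
        proof -
          have "\<bar>s\<bar> \<le> 1 + \<bar>t\<bar>" using that by (auto simp: dist_real_def)
          then have "e' * (1 + \<bar>s\<bar>) \<le> e' * (2 + \<bar>t\<bar>)"
            using e' by (intro mult_left_mono) auto
          also have "\<dots> = e / 2" using e by (simp add: e'_def field_simps)
          finally show ?thesis using unif[OF N \<open>n \<ge> N\<close>, of s] e by (simp add: dist_real_def)
        qed
        then show "\<exists>N. \<forall>n\<ge>N. \<forall>s\<in>ball t 1. dist (val (X n) s) (g s) < e" by blast
      qed
      show "\<forall>\<^sub>F n in sequentially. continuous_on (ball t 1) (val (X n))"
        by (rule always_eventually) (auto intro: continuous_on_subset[OF continuous_val])
    qed auto
    then show ?thesis by (simp add: continuous_on_eq_continuous_at)
  qed
  have b: "\<bar>g t\<bar> \<le> 1" for t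
    by (rule LIMSEQ_le_const2[OF tendsto_rabs[OF g]]) (auto simp: abs_val_le)
  obtain f where f: "val f = g"
    using ex_val[of g] cont b by (auto simp: continuous_at_imp_continuous_on)
  have "X \<longlonglongrightarrow> f"
  proof (rule metric_LIMSEQ_I)
    fix e :: real assume e: "e > 0"
    then obtain N where N: "\<forall>m\<ge>N. \<forall>n\<ge>N. dist (X m) (X n) < e/2"
      using X unfolding Cauchy_def by (meson half_gt_zero)
    have "dist (X n) f \<le> e / 2" if "n \<ge> N" for n
      using unif[OF N that] e by (subst dist_bipath_le) (auto simp: f)
    then show "\<exists>no. \<forall>n\<ge>no. dist (X n) f < e" using e by force
  qed
  then show "\<exists>l\<in>UNIV. X \<longlonglongrightarrow> l" by blast
qed

section \<open>Equicontinuity, compactness and separability\<close>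

definition bipath_modulus :: "real \<Rightarrow> real \<Rightarrow> real \<Rightarrow> bipath set" where
  "bipath_modulus e T d = {f. \<forall>s t. \<bar>s\<bar> \<le> T \<longrightarrow> \<bar>t\<bar> \<le> T \<longrightarrow> \<bar>s - t\<bar> \<le> d \<longrightarrow> \<bar>val f s - val f t\<bar> \<le> e}"

text \<open>A path is encoded by its values on the grid of mesh \<open>d\<close>, rounded down to
  multiples of \<open>e\<close>. Equal codes leave an error \<open>e\<close> from rounding and
  \<open>e\<close> from the modulus of each path. Outside \<open>[-T, T]\<close> the trivial bound 2
  suffices, because the weight is at least \<open>1 / e\<close> there.\<close>

lemma bipath_modulus_net:
  assumes e: "e > 0" and d: "d > 0" and T: "1 \<le> e * (1 + T)" "T \<ge> 0"
  shows "\<exists>P. finite P \<and> P \<subseteq> S \<and> (\<forall>f\<in>S \<inter> bipath_modulus e T d. \<exists>p\<in>P. dist f p \<le> 3 * e)"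
proof -
  define A where "A = \<lfloor>T / d\<rfloor>"
  define B where "B = \<lceil>1 / e\<rceil> + 1"
  define c where "c f = (\<lambda>k\<in>{-A..A}. \<lfloor>val f (of_int k * d) / e\<rfloor>)" for f
  let ?S = "S \<inter> bipath_modulus e T d"
  have "\<lfloor>val f t / e\<rfloor> \<in> {-B..B}" for f t
  proof -
    have "\<bar>val f t / e\<bar> \<le> 1 / e" using abs_val_le[of f t] e by (simp add: divide_right_mono)
    then have "- (1 / e) \<le> val f t / e" "val f t / e \<le> 1 / e" by (simp_all only: abs_le_iff) linarith
    then show ?thesis unfolding B_def by (simp; linarith)
  qed
  then have "c ` ?S \<subseteq> {-A..A} \<rightarrow>\<^sub>E {-B..B}" by (auto simp: c_def)
  moreover have "finite ({-A..A} \<rightarrow>\<^sub>E {-B..B})" by (intro finite_PiE) auto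
  ultimately have fin: "finite (c ` ?S)" by (rule finite_subset)
  define P where "P = (\<lambda>y. SOME f. f \<in> ?S \<and> c f = y) ` (c ` ?S)"
  have some: "(SOME g. g \<in> ?S \<and> c g = c f) \<in> ?S \<and> c (SOME g. g \<in> ?S \<and> c g = c f) = c f" if "f \<in> ?S" for f
    by (rule someI[where x=f]) (use that in auto)
  have "dist f g \<le> 3 * e" if f: "f \<in> ?S" and g: "g \<in> ?S" and c: "c f = c g" for f g
    unfolding dist_bipath_le[OF mult_nonneg_nonneg, OF zero_le_numeral less_imp_le[OF e]]
  proof
    fix t
    show "\<bar>val f t - val g t\<bar> \<le> 3 * e * (1 + \<bar>t\<bar>)"
    proof (cases "\<bar>t\<bar> \<le> T")
      case False
      then have "e * (1 + \<bar>t\<bar>) \<ge> e * (1 + T)" using e by auto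
      then show ?thesis using abs_val_le[of f t] abs_val_le[of g t] T by linarith
    next
      case True
      \<comment> \<open>Rounding towards 0 keeps the grid time \<open>k * d\<close> inside
        \<open>[-T, T]\<close>, where the modulus is available.\<close>
      define k where "k = (if t \<ge> 0 then \<lfloor>\<bar>t\<bar> / d\<rfloor> else - \<lfloor>\<bar>t\<bar> / d\<rfloor>)"
      have fl: "\<lfloor>\<bar>t\<bar> / d\<rfloor> * d \<le> \<bar>t\<bar>" "\<bar>t\<bar> < (of_int \<lfloor>\<bar>t\<bar> / d\<rfloor> + 1) * d"
        using floor_divide_lower[OF d] floor_divide_upper[OF d] by blast+
      have fl0: "\<lfloor>\<bar>t\<bar> / d\<rfloor> \<ge> 0" using d by simp
      have fl0': "real_of_int \<lfloor>\<bar>t\<bar> / d\<rfloor> * d \<ge> 0" using d by simp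
      have k1: "\<bar>of_int k * d\<bar> \<le> \<bar>t\<bar>" "\<bar>t - of_int k * d\<bar> \<le> d"
      proof -
        define N where "N = real_of_int \<lfloor>\<bar>t\<bar> / d\<rfloor> * d"
        have "of_int k * d = (if t \<ge> 0 then N else - N)" by (simp add: k_def N_def)
        moreover have "N \<le> \<bar>t\<bar>" "\<bar>t\<bar> < N + d" "0 \<le> N"
          using fl fl0' unfolding N_def by (auto simp: distrib_right)
        ultimately show "\<bar>of_int k * d\<bar> \<le> \<bar>t\<bar>" "\<bar>t - of_int k * d\<bar> \<le> d" by auto
      qed
      have "\<lfloor>\<bar>t\<bar> / d\<rfloor> \<le> A"
        unfolding A_def using True d by (intro floor_mono divide_right_mono) auto
      then have kA: "k \<in> {-A..A}" using fl0 unfolding k_def by (simp del: zero_le_floor floor_le_zero) linarith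
      have "\<bar>val f t - val f (of_int k * d)\<bar> \<le> e" "\<bar>val g t - val g (of_int k * d)\<bar> \<le> e"
        using f g True k1 by (auto simp: bipath_modulus_def)
      moreover have "\<lfloor>val f (of_int k * d) / e\<rfloor> = \<lfloor>val g (of_int k * d) / e\<rfloor>"
        using fun_cong[OF c, of k] kA by (simp add: c_def)
      then have "\<bar>val f (of_int k * d) / e - val g (of_int k * d) / e\<bar> \<le> 1" by linarith
      then have "\<bar>val f (of_int k * d) - val g (of_int k * d)\<bar> \<le> e"
        using e by (simp add: diff_divide_distrib[symmetric] divide_le_eq)
      ultimately have "\<bar>val f t - val g t\<bar> \<le> 3 * e" by linarith
      also have "\<dots> \<le> 3 * e * (1 + \<bar>t\<bar>)" using e by simp
      finally show ?thesis .
    qed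
  qed
  then have "\<forall>f\<in>?S. \<exists>p\<in>P. dist f p \<le> 3 * e"
    unfolding P_def using some by (intro ballI bexI[OF _ imageI[OF imageI]]) auto
  moreover have "P \<subseteq> S" using some by (auto simp: P_def)
  ultimately show ?thesis using fin by (intro exI[of _ P]) (auto simp: P_def)
qed

lemma compact_closure_bipath:
  assumes "\<And>e T. e > 0 \<Longrightarrow> \<exists>d>0. S \<subseteq> bipath_modulus e T d"
  shows "compact (closure S)"
  unfolding compact_eq_totally_bounded
proof safe
  show "uniform_space_class.complete (closure S)"
    by (metis closed_closure closed_subset complete_bipath complete_closed_subset subset_UNIV)
  fix e :: real assume e: "e > 0"
  \<comment> \<open>Accuracy \<open>e / 6\<close> gives a net of radius \<open>e / 2\<close> and
    leaves room for the \<open>e / 3\<close> lost in passing to the closure.\<close>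
  define T where "T = 1 / (e/6)"
  have T: "1 \<le> e / 6 * (1 + T)" "T \<ge> 0" using e by (auto simp: T_def field_simps)
  obtain d where d: "d > 0" "S \<subseteq> bipath_modulus (e/6) T d" using assms[of "e/6" T] e by auto
  obtain P where P: "finite P" "\<forall>f\<in>S. \<exists>p\<in>P. dist f p \<le> 3 * (e/6)"
    using bipath_modulus_net[of "e/6" d T S] d T e by (auto simp: Int_absorb2)
  have "closure S \<subseteq> (\<Union>x\<in>P. ball x e)"
  proof
    fix f assume "f \<in> closure S"
    then obtain g where g: "g \<in> S" "dist g f < e / 3"
      using e by (metis closure_approachable divide_pos_pos zero_less_numeral)
    then obtain p where p: "p \<in> P" "dist g p \<le> e/2" using P by auto
    then have "dist p f < e" using g dist_triangle[of p f g] e by (simp add: dist_commute)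
    then show "f \<in> (\<Union>x\<in>P. ball x e)" using p by auto
  qed
  then show "\<exists>k. finite k \<and> closure S \<subseteq> (\<Union>x\<in>k. ball x e)" using P by blast
qed

text \<open>A path is uniformly continuous on every window, so for each \<open>n\<close> it lies in
  one of the modulus classes indexed by \<open>m\<close>. The finite nets of these countably many
  classes together are dense.\<close>

lemma separable_bipath: "\<exists>D::bipath set. countable D \<and> closure D = UNIV"
proof -
  have "\<exists>P. finite P \<and> (\<forall>f\<in>bipath_modulus (1 / (1 + real n)) (real n) (1 / (1 + real m)). \<exists>p\<in>P. dist f p \<le> 3 * (1 / (1 + real n)))" for n m
    using bipath_modulus_net[of "1 / (1 + real n)" "1 / (1 + real m)" "real n" UNIV] by auto
  then obtain P where P: "finite (P n m)"
    "\<And>f. f\<in>bipath_modulus (1 / (1 + real n)) (real n) (1 / (1 + real m)) \<Longrightarrow> \<exists>p\<in>P n m. dist f p \<le> 3 * (1 / (1 + real n))" for n m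
    by metis
  define D where "D = (\<Union>n m. P n m)"
  have "f \<in> closure D" for f
    unfolding closure_approachable
  proof safe
    fix e :: real assume e: "e > 0"
    obtain n :: nat where n: "3 / e < real n" using reals_Archimedean2 by blast
    then have n': "3 * (1 / (1 + real n)) < e" using e by (simp add: field_simps)
    have "uniformly_continuous_on {-real n..real n} (val f)"
      by (intro compact_uniformly_continuous) (auto intro: continuous_on_subset[OF continuous_val])
    moreover have "1 / (1 + real n) > 0" by simp
    ultimately obtain d where d: "d > 0" "\<And>s t. \<bar>s\<bar> \<le> real n \<Longrightarrow> \<bar>t\<bar> \<le> real n \<Longrightarrow> \<bar>s - t\<bar> < d \<Longrightarrow> \<bar>val f s - val f t\<bar> < 1 / (1 + real n)"
      unfolding uniformly_continuous_on_def dist_real_def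
      by (metis abs_le_iff atLeastAtMost_iff minus_le_iff)
    obtain m :: nat where "1 / d < real m" using reals_Archimedean2 by blast
    then have "1 / (1 + real m) < d" using d(1) by (simp add: field_simps)
    then have "f \<in> bipath_modulus (1 / (1 + real n)) (real n) (1 / (1 + real m))"
      unfolding bipath_modulus_def using d(2) by (auto intro!: less_imp_le)
    then obtain p where "p \<in> P n m" "dist f p \<le> 3 * (1 / (1 + real n))" using P(2) by blast
    then show "\<exists>y\<in>D. dist y f < e" using n' unfolding D_def dist_commute[of _ f] by (intro bexI[of _ p]) auto
  qed
  then show ?thesis using P(1) by (intro exI[of _ D]) (auto simp: D_def countable_finite)
qed

section \<open>Random compact sets\<close>

definition hitting :: "'a::metric_space set \<Rightarrow> 'a compacts set" where
  "hitting U = {K. set_of_compacts K \<inter> U \<noteq> {}}"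

lemma compact_set_of_compacts: "compact (set_of_compacts K)" "set_of_compacts K \<noteq> {}"
  using set_of_compacts[of K] by auto

lemma infdist_le_dist_compacts:
  assumes "x \<in> set_of_compacts K" shows "infdist x (set_of_compacts L) \<le> dist K L"
proof -
  have "infdist x (set_of_compacts L) \<le> (SUP x\<in>set_of_compacts K. infdist x (set_of_compacts L))"
    by (rule cSUP_upper[OF assms bdd_above_infdist[OF compact_set_of_compacts(1)]])
  then show ?thesis unfolding dist_compacts_def hausdorff_dist_def by linarith
qed

lemma dist_compacts_le_iff:
  "dist K L \<le> e \<longleftrightarrow> (\<forall>x\<in>set_of_compacts K. infdist x (set_of_compacts L) \<le> e) \<and>
     (\<forall>x\<in>set_of_compacts L. infdist x (set_of_compacts K) \<le> e)"
proof safe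
  assume "\<forall>x\<in>set_of_compacts K. infdist x (set_of_compacts L) \<le> e"
    "\<forall>x\<in>set_of_compacts L. infdist x (set_of_compacts K) \<le> e"
  then show "dist K L \<le> e" unfolding dist_compacts_def hausdorff_dist_def
    by (intro max.boundedI cSUP_least compact_set_of_compacts) auto
qed (auto dest: infdist_le_dist_compacts[of _ K L] infdist_le_dist_compacts[of _ L K] simp: dist_commute)

lemma infdist_attained:
  assumes "compact L" "L \<noteq> {}" shows "\<exists>y\<in>L. infdist x L = dist x y"
proof -
  have "continuous_on L (dist x)" by (intro continuous_intros)
  then obtain y where "y \<in> L" "\<And>z. z \<in> L \<Longrightarrow> dist x y \<le> dist x z"
    using continuous_attains_inf[OF assms] by blast
  moreover from this have "infdist x L = dist x y"
    unfolding infdist_notempty[OF assms(2)] by (intro antisym cINF_greatest cINF_lower2) (auto simp: assms intro: bdd_belowI[of _ 0])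
  ultimately show ?thesis by blast
qed

lemma open_hitting:
  assumes "open U" shows "open (hitting U :: 'a::metric_space compacts set)"
  unfolding open_dist
proof
  fix K :: "'a compacts" assume "K \<in> hitting U"
  then obtain x where x: "x \<in> set_of_compacts K" "x \<in> U" by (auto simp: hitting_def)
  then obtain e where e: "e > 0" "ball x e \<subseteq> U" using assms open_contains_ball by blast
  have "L \<in> hitting U" if "dist L K < e" for L
  proof -
    have "infdist x (set_of_compacts L) < e"
      using infdist_le_dist_compacts[OF x(1), of L] that by (simp add: dist_commute)
    then obtain y where "y \<in> set_of_compacts L" "dist x y < e"
      using infdist_attained[OF compact_set_of_compacts, of L x] by auto
    then show ?thesis using e by (auto simp: hitting_def)
  qed
  then show "\<exists>e>0. \<forall>L. dist L K < e \<longrightarrow> L \<in> hitting U" using e by blast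
qed

text \<open>Lists make the family stable under intersection by concatenation, and \<open>[]\<close>
  yields the whole space.\<close>

definition hit_all :: "'a::metric_space set list \<Rightarrow> 'a compacts set" where
  "hit_all Us = (\<Inter>U\<in>set Us. hitting U)"

text \<open>Closeness at level \<open>q\<close> says that \<open>K\<close> meets every ball of
  radius \<open>q\<close> about a point of \<open>L\<close> and does not leave the union of the
  closed balls; as \<open>L\<close> is finite, the complement of that union is open. Rational
  \<open>q\<close> below \<open>r\<close> turn the strict inequality into a countable union.\<close>

lemma finite_ball_compacts:
  fixes L :: "'a::metric_space compacts"
  assumes "finite (set_of_compacts L)" "0 < r"
  shows "{K. dist L K < r} = (\<Union>q\<in>{q\<in>\<rat>. 0 < q \<and> q < r}.
    (\<Inter>x\<in>set_of_compacts L. hitting (ball x q)) - hitting (- (\<Union>x\<in>set_of_compacts L. cball x q)))"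
    (is "?l = ?r")
proof safe
  fix K assume "dist L K < r"
  then obtain q where q: "q \<in> \<rat>" "dist L K < q" "q < r" using Rats_dense_in_real by blast
  then have q0: "0 < q" by (meson le_less_trans zero_le_dist)
  have 1: "K \<in> hitting (ball x q)" if "x \<in> set_of_compacts L" for x
    using infdist_attained[OF compact_set_of_compacts, of K x] infdist_le_dist_compacts[OF that, of K] q
    by (auto simp: hitting_def intro: le_less_trans)
  have "y \<in> (\<Union>x\<in>set_of_compacts L. cball x q)" if y: "y \<in> set_of_compacts K" for y
  proof -
    obtain x where x: "x \<in> set_of_compacts L" "infdist y (set_of_compacts L) = dist y x"
      using infdist_attained[OF compact_set_of_compacts] by blast
    then have "dist x y \<le> q"
      using infdist_le_dist_compacts[OF y, of L] q by (simp add: dist_commute)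
    then show ?thesis using x by auto
  qed
  then have "K \<notin> hitting (- (\<Union>x\<in>set_of_compacts L. cball x q))" unfolding hitting_def by blast
  then show "K \<in> ?r" using 1 q q0 by blast
next
  fix K q assume q: "q \<in> \<rat>" "0 < q" "q < r" and 1: "K \<in> (\<Inter>x\<in>set_of_compacts L. hitting (ball x q))"
    and 2: "K \<notin> hitting (- (\<Union>x\<in>set_of_compacts L. cball x q))"
  have "dist L K \<le> q"
    unfolding dist_compacts_le_iff
  proof safe
    fix x assume "x \<in> set_of_compacts L"
    then have "\<exists>y. y \<in> set_of_compacts K \<and> y \<in> ball x q" using 1 unfolding hitting_def by blast
    then obtain y where "y \<in> set_of_compacts K" "dist x y < q" by auto
    then show "infdist x (set_of_compacts K) \<le> q" by (meson infdist_le2 less_imp_le)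
  next
    fix y assume "y \<in> set_of_compacts K"
    then have "y \<in> (\<Union>x\<in>set_of_compacts L. cball x q)" using 2 unfolding hitting_def by blast
    then obtain x where "x \<in> set_of_compacts L" "dist x y \<le> q" by auto
    then show "infdist y (set_of_compacts L) \<le> q" by (metis dist_commute infdist_le2)
  qed
  then show "dist L K < r" using q by simp
qed

lemma separable_compacts:
  fixes D :: "'a::metric_space set"
  assumes "countable D" "closure D = UNIV"
  shows "\<exists>E :: 'a compacts set. countable E \<and> (\<forall>L\<in>E. finite (set_of_compacts L)) \<and>
    (\<forall>K e. 0 < e \<longrightarrow> (\<exists>L\<in>E. dist L K < e))"
proof (intro exI conjI allI impI)
  let ?E = "Compacts ` {F. finite F \<and> F \<subseteq> D \<and> F \<noteq> {}}"
  have S: "set_of_compacts (Compacts F) = F" if "finite F" "F \<noteq> {}" for F :: "'a set"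
    using that by (simp add: Compacts_inverse finite_imp_compact)
  have "countable {F. finite F \<and> F \<subseteq> D}"
    using assms(1) by (rule countable_Collect_finite_subset)
  then show "countable ?E" by (intro countable_image) (auto elim: countable_subset[rotated])
  show "\<forall>L\<in>?E. finite (set_of_compacts L)" using S by auto
  fix K :: "'a compacts" and e :: real assume e: "0 < e"
  have dense: "\<exists>d\<in>D. dist d x < e/4" for x
    using assms(2) e closure_approachable[of x D] zero_less_divide_iff[of e 4] by (metis UNIV_I zero_less_numeral)
  have cov: "set_of_compacts K \<subseteq> (\<Union>x\<in>set_of_compacts K. ball x (e/4))" using e by force
  obtain k where k: "k \<subseteq> set_of_compacts K" "finite k" "set_of_compacts K \<subseteq> (\<Union>x\<in>k. ball x (e/4))"
    by (rule compactE_image[OF compact_set_of_compacts(1) _ cov]) auto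
  have k0: "k \<noteq> {}" using k compact_set_of_compacts(2)[of K] by auto
  obtain d where d: "\<And>x. d x \<in> D" "\<And>x. dist (d x) x < e/4" using dense by metis
  define F where "F = d ` k"
  have F: "finite F" "F \<subseteq> D" "F \<noteq> {}" using k k0 d by (auto simp: F_def)
  have "dist (Compacts F) K \<le> e/2"
    unfolding dist_compacts_le_iff S[OF F(1,3)]
  proof safe
    fix x assume "x \<in> F"
    then show "infdist x (set_of_compacts K) \<le> e / 2"
    proof -
      obtain y where "y \<in> k" "x = d y" using \<open>x \<in> F\<close> by (auto simp: F_def)
      then show ?thesis using d(2)[of y] k e by (intro infdist_le2[of y]) auto
    qed
  next
    fix x assume "x \<in> set_of_compacts K"
    then obtain y where y: "y \<in> k" "dist y x < e/4" using k by auto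
    then have "dist x (d y) \<le> e/2" using d(2)[of y] dist_triangle[of x "d y" y] by (simp add: dist_commute)
    then show "infdist x F \<le> e/2" using y unfolding F_def by (intro infdist_le2[of "d y"]) auto
  qed
  then show "\<exists>L\<in>?E. dist L K < e" using F e by (intro bexI[of _ "Compacts F"]) auto
qed

text \<open>Finite subsets of \<open>D\<close> are dense among the compact sets, so every open set
  is a countable union of rational balls about them, and each such ball is built from hitting events
  of open sets.\<close>

lemma borel_compacts_eq:
  fixes D :: "'a::metric_space set"
  assumes "countable D" "closure D = UNIV"
  shows "sets (borel :: 'a compacts measure) = sigma_sets UNIV (hit_all ` {Us. \<forall>U\<in>set Us. open U})"
proof -
  let ?G = "hit_all ` {Us. \<forall>U\<in>set Us. open U} :: 'a compacts set set"
  interpret G: sigma_algebra UNIV "sigma_sets UNIV ?G" by (rule sigma_algebra_sigma_sets) simp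
  have hit: "hitting U \<in> sigma_sets UNIV ?G" if "open U" for U
    using that by (intro sigma_sets.Basic) (auto simp: hit_all_def intro!: image_eqI[where x="[U]"])
  obtain E :: "'a compacts set" where E: "countable E" "\<And>L. L \<in> E \<Longrightarrow> finite (set_of_compacts L)"
    "\<And>K e. 0 < e \<Longrightarrow> (\<exists>L\<in>E. dist L K < e)"
    using separable_compacts[OF assms] by auto
  have ball: "ball L q \<in> sigma_sets UNIV ?G" if "L \<in> E" "q > 0" for L q
  proof -
    have "ball L q = {K. dist L K < q}" by auto
    also have "\<dots> \<in> sigma_sets UNIV ?G"
      unfolding finite_ball_compacts[OF E(2)[OF that(1)] that(2)]
    proof (rule G.countable_UN')
      show "countable {qa \<in> \<rat>. 0 < qa \<and> qa < q}"
        by (rule countable_subset[OF _ countable_rat]) auto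
      have "open (- (\<Union>x\<in>set_of_compacts L. cball x r))" for r
        using E(2)[OF that(1)] by (intro open_Compl closed_UN) auto
      then have "(\<Inter>x\<in>set_of_compacts L. hitting (ball x r)) - hitting (- (\<Union>x\<in>set_of_compacts L. cball x r))
          \<in> sigma_sets UNIV ?G" for r
        using E(2)[OF that(1)] compact_set_of_compacts(2)[of L]
        by (intro G.Diff G.finite_INT hit) auto
      then show "(\<lambda>q. (\<Inter>x\<in>set_of_compacts L. hitting (ball x q)) - hitting (- (\<Union>x\<in>set_of_compacts L. cball x q)))
         ` {qa \<in> \<rat>. 0 < qa \<and> qa < q} \<subseteq> sigma_sets UNIV ?G" by blast
    qed
    finally show ?thesis .
  qed
  have op: "V \<in> sigma_sets UNIV ?G" if "open V" for V :: "'a compacts set"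
  proof -
    define I where "I = {(L,q). L \<in> E \<and> q \<in> \<rat> \<and> 0 < q \<and> ball L q \<subseteq> V}"
    have "V = (\<Union>(L,q)\<in>I. ball L q)"
    proof safe
      fix K assume "K \<in> V"
      then obtain e where e: "e > 0" "ball K e \<subseteq> V" using openE[OF \<open>open V\<close>] by metis
        obtain L where L: "L \<in> E" "dist L K < e/2" using E(3)[OF half_gt_zero[OF e(1)]] by blast
      obtain q where q: "q \<in> \<rat>" "dist L K < q" "q < e/2" using L Rats_dense_in_real by blast
      have "ball L q \<subseteq> V"
      proof
        fix H assume "H \<in> ball L q"
        then have "dist K H < e" using dist_triangle[of K H L] q by (auto simp: dist_commute)
        then show "H \<in> V" using e by auto
      qed
      moreover have "0 < q" using q(2) by (meson le_less_trans zero_le_dist)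
      ultimately have "(L, q) \<in> I" "K \<in> ball L q" using L q by (auto simp: I_def)
      then show "K \<in> (\<Union>(L,q)\<in>I. ball L q)" by blast
    qed (auto simp: I_def)
    also have "\<dots> \<in> sigma_sets UNIV ?G"
    proof (rule G.countable_UN')
      have "I \<subseteq> E \<times> \<rat>" by (auto simp: I_def)
      then show "countable I" using E(1) countable_rat by (blast intro: countable_subset countable_SIGMA)
      show "(\<lambda>(L,q). ball L q) ` I \<subseteq> sigma_sets UNIV ?G" using ball by (auto simp: I_def)
    qed
    finally show ?thesis .
  qed
  have "sigma_sets UNIV {S. open S} = sigma_sets UNIV ?G"
  proof (intro sigma_sets_eqI)
    fix V assume "V \<in> {S. open (S :: 'a compacts set)}" then show "V \<in> sigma_sets UNIV ?G" using op by auto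
  next
    fix V assume "V \<in> ?G"
    then obtain Us where "V = hit_all Us" "\<forall>U\<in>set Us. open U" by auto
    then show "V \<in> sigma_sets UNIV {S. open S}"
      by (auto simp: hit_all_def intro!: sigma_sets.Basic open_INT open_hitting)
  qed
  then show ?thesis unfolding borel_def by (simp add: sets_measure_of)
qed

lemma measurable_compacts:
  fixes D :: "'a::metric_space set" and X :: "'b \<Rightarrow> 'a compacts"
  assumes "countable D" "closure D = UNIV"
    and "\<And>U. open U \<Longrightarrow> {\<omega>\<in>space M. X \<omega> \<in> hitting U} \<in> sets M"
  shows "X \<in> borel_measurable M"
proof -
  have "X -` A \<inter> space M \<in> sets M" if "A \<in> hit_all ` {Us. \<forall>U\<in>set Us. open (U::'a set)}" for A
  proof -
    from that obtain Us where Us: "A = hit_all Us" "\<forall>U\<in>set Us. open U" by auto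
  have "X -` A \<inter> space M = {\<omega>\<in>space M. \<forall>U\<in>set Us. X \<omega> \<in> hitting U}"
    by (auto simp: Us hit_all_def)
  also have "\<dots> \<in> sets M" using Us(2) assms(3) by (intro sets.sets_Collect_finite_All) auto
  finally show "X -` A \<inter> space M \<in> sets M" .
  qed
  then show ?thesis
    using assms(1,2) by (intro measurable_sigma_sets[OF borel_compacts_eq]) auto
qed

lemma distr_compacts_eqI:
  fixes D :: "'a::metric_space set"
  assumes "countable D" "closure D = UNIV" "prob_space M" "prob_space M'"
    and X: "X \<in> borel_measurable M" "X' \<in> borel_measurable M'"
    and eq: "\<And>Us. \<forall>U\<in>set Us. open U \<Longrightarrow>
       measure M {\<omega>\<in>space M. X \<omega> \<in> hit_all Us} = measure M' {\<omega>\<in>space M'. X' \<omega> \<in> hit_all Us}"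
  shows "distr M borel X = distr M' borel (X' :: _ \<Rightarrow> 'a compacts)"
proof -
  interpret M: prob_space M by fact
  interpret M': prob_space M' by fact
  let ?G = "hit_all ` {Us. \<forall>U\<in>set Us. open U} :: 'a compacts set set"
  have G: "A \<in> sets borel" if "A \<in> ?G" for A
    using that by (auto simp: hit_all_def intro!: borel_open open_INT open_hitting)
  show ?thesis
  proof (rule measure_eqI_generator_eq[where E="?G" and \<Omega>=UNIV and A="\<lambda>_. UNIV"])
    show "Int_stable ?G"
    proof (rule Int_stableI)
      fix a b assume "a \<in> ?G" "b \<in> ?G"
      then obtain U V where "a = hit_all U" "b = hit_all V" "\<forall>x\<in>set U. open x" "\<forall>x\<in>set V. open x" by auto
      then show "a \<inter> b \<in> ?G" by (intro image_eqI[of _ _ "U @ V"]) (auto simp: hit_all_def)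
    qed
    show "emeasure (distr M borel X) A = emeasure (distr M' borel X') A" if "A \<in> ?G" for A
    proof -
      from that obtain Us where "A = hit_all Us" "\<forall>x\<in>set Us. open x" by blast
      moreover have "X -` A \<inter> space M = {\<omega>\<in>space M. X \<omega> \<in> A}" "X' -` A \<inter> space M' = {\<omega>\<in>space M'. X' \<omega> \<in> A}" by auto
      ultimately show ?thesis using eq G[OF that] X
        by (simp add: emeasure_distr M.emeasure_eq_measure M'.emeasure_eq_measure)
    qed
    show "range (\<lambda>_::nat. UNIV) \<subseteq> ?G" by (auto intro!: image_eqI[of _ _ "[]"] simp: hit_all_def)
    show "emeasure (distr M borel X) UNIV \<noteq> \<infinity>" for i :: nat
      using X by (simp add: emeasure_distr M.emeasure_eq_measure)
  qed (auto simp: borel_compacts_eq[OF assms(1,2)])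
qed

section \<open>Brownian motion\<close>

lemma brownian_motionD:
  assumes "brownian_motion M p B"
  shows "\<And>t. snd p \<le> t \<Longrightarrow> (\<lambda>\<omega>. B \<omega> t) \<in> borel_measurable M"
    and "AE \<omega> in M. B \<omega> (snd p) = fst p"
    and "AE \<omega> in M. continuous_on {snd p..} (B \<omega>)"
    and "\<And>s t. snd p \<le> s \<Longrightarrow> s < t \<Longrightarrow>
        distributed M lborel (\<lambda>\<omega>. B \<omega> t - B \<omega> s) (normal_density 0 (sqrt (t - s)))"
    and "\<And>n \<tau>. mono \<tau> \<Longrightarrow> snd p \<le> \<tau> 0 \<Longrightarrow>
        prob_space.indep_vars M (\<lambda>_. borel) (\<lambda>i \<omega>. B \<omega> (\<tau> (Suc i)) - B \<omega> (\<tau> i)) {..<n::nat}"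
  using assms unfolding brownian_motion_def by blast+

lemma ibmD: "independent_brownian_motions M z B \<Longrightarrow> brownian_motion M (z j) (B j)"
  by (simp add: independent_brownian_motions_def)

lemma (in prob_space) indep_vars_reindex_inj:
  assumes "indep_vars M' X UNIV" "inj f"
  shows "indep_vars (\<lambda>j. M' (f j)) (\<lambda>j. X (f j)) UNIV"
  unfolding indep_vars_def2
proof (intro conjI ballI indep_setsI)
  show rv: "random_variable (M' (f j)) (X (f j))" for j
    using assms(1) by (auto simp: indep_vars_def)
  show "{X (f j) -` A \<inter> space M |A. A \<in> sets (M' (f j))} \<subseteq> events" for j
    using measurable_sets[OF rv] by auto
  fix A J assume J: "J \<noteq> {}" "finite J" and A: "\<forall>j\<in>J. A j \<in> {X (f j) -` A \<inter> space M |A. A \<in> sets (M' (f j))}"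
  have "(\<Inter>j\<in>J. A j) = (\<Inter>i\<in>f ` J. A (inv f i))" using assms(2) by auto
  also have "prob \<dots> = (\<Prod>i\<in>f ` J. prob (A (inv f i)))"
    using assms(1) J A unfolding indep_vars_def2
    by (intro indep_setsD[where I=UNIV]) (auto simp: assms(2))
  also have "\<dots> = (\<Prod>j\<in>J. prob (A j))"
    using assms(2) by (subst prod.reindex) (auto intro: inj_on_subset)
  finally show "prob (\<Inter>j\<in>J. A j) = (\<Prod>j\<in>J. prob (A j))" .
qed

lemma ibm_reindex:
  assumes "prob_space M" "independent_brownian_motions M z B" "inj f"
  shows "independent_brownian_motions M (\<lambda>j. z (f j)) (\<lambda>j. B (f j))"
proof -
  interpret prob_space M by fact
  have "indep_vars (\<lambda>j. \<Pi>\<^sub>M t\<in>{snd (z (f j))..}. borel) (\<lambda>j \<omega>. restrict (B (f j) \<omega>) {snd (z (f j))..}) UNIV"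
    using assms(2,3) unfolding independent_brownian_motions_def
    by (elim conjE) (rule indep_vars_reindex_inj[where X="\<lambda>j \<omega>. restrict (B j \<omega>) {snd (z j)..}" and M'="\<lambda>j. \<Pi>\<^sub>M t\<in>{snd (z j)..}. borel"])
  then show ?thesis using assms(2) unfolding independent_brownian_motions_def by blast
qed

text \<open>Events about finitely many increments are grouped by path: independence of the paths
  factors the groups, independence of increments factors each group. Every path has its own time
  grid because the driving paths start at different times.\<close>

lemma ibm_array_indep:
  assumes "prob_space M" "independent_brownian_motions M z B"
    and \<tau>: "\<And>i. mono (\<tau> i)" "\<And>i. snd (z i) \<le> \<tau> i 0"
  shows "prob_space.indep_vars M (\<lambda>_. borel) (\<lambda>p \<omega>. B (fst p) \<omega> (\<tau> (fst p) (Suc (snd p))) - B (fst p) \<omega> (\<tau> (fst p) (snd p))) UNIV"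
    (is "prob_space.indep_vars M (\<lambda>_. borel) ?X UNIV")
proof -
  interpret prob_space M by fact
  note bm = ibmD[OF assms(2)]
  have ge: "snd (z i) \<le> \<tau> i k" for i k using \<tau>(2)[of i] monoD[OF \<tau>(1)[of i], of 0 k] by simp
  have meas: "?X p \<in> borel_measurable M" for p
    by (intro borel_measurable_diff brownian_motionD(1)[OF bm] ge)
  let ?path = "\<lambda>i \<omega>. restrict (B i \<omega>) {snd (z i)..}"
  have paths: "indep_vars (\<lambda>j. \<Pi>\<^sub>M t\<in>{snd (z j)..}. borel) ?path UNIV"
    using assms(2) by (simp add: independent_brownian_motions_def)
  show ?thesis unfolding indep_vars_def2
  proof (intro conjI ballI meas indep_setsI)
    show "{?X p -` A \<inter> space M |A. A \<in> sets borel} \<subseteq> events" for p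
      using measurable_sets[OF meas] by auto
    fix A P assume P: "P \<noteq> {}" "finite (P :: (nat \<times> nat) set)" and A: "\<forall>p\<in>P. A p \<in> {?X p -` A \<inter> space M |A. A \<in> sets borel}"
    then have "\<forall>p\<in>P. \<exists>S\<in>sets borel. A p = ?X p -` S \<inter> space M" by blast
    then obtain S where S: "\<And>p. p \<in> P \<Longrightarrow> S p \<in> sets borel" "\<And>p. p \<in> P \<Longrightarrow> A p = ?X p -` S p \<inter> space M" by metis
    define I where "I = fst ` P"
    define Ks where "Ks i = {k. (i, k) \<in> P}" for i
    have fin: "finite I" "finite (Ks i)" for i
    proof -
      show "finite I" using P(2) by (simp add: I_def)
      have "Ks i \<subseteq> snd ` P" by (force simp: Ks_def)
      then show "finite (Ks i)" using P(2) finite_surj by blast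
    qed
    have ne: "I \<noteq> {}" "i \<in> I \<Longrightarrow> Ks i \<noteq> {}" for i using P(1) by (auto simp: I_def Ks_def)
    have Sig: "P = Sigma I Ks" by (force simp: I_def Ks_def)
    define E where "E i = {x \<in> space (\<Pi>\<^sub>M t\<in>{snd (z i)..}. borel::real measure). \<forall>k\<in>Ks i. x (\<tau> i (Suc k)) - x (\<tau> i k) \<in> S (i, k)}" for i
    have E: "E i \<in> sets (\<Pi>\<^sub>M t\<in>{snd (z i)..}. borel)" for i
      unfolding E_def
    proof (intro sets.sets_Collect_finite_All fin)
      fix k assume "k \<in> Ks i"
      then have "S (i, k) \<in> sets borel" using S(1) by (auto simp: Ks_def)
      moreover have "(\<lambda>x. x (\<tau> i (Suc k)) - x (\<tau> i k)) \<in> borel_measurable (\<Pi>\<^sub>M t\<in>{snd (z i)..}. borel::real measure)"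
      proof -
        have c: "(\<lambda>x. x (\<tau> i k)) \<in> borel_measurable (\<Pi>\<^sub>M t\<in>{snd (z i)..}. borel::real measure)" for k
          using ge by (intro measurable_component_singleton[where M="\<lambda>_. borel"]) simp
        show ?thesis by (rule borel_measurable_diff[OF c c])
      qed
      ultimately show "{x \<in> space (\<Pi>\<^sub>M t\<in>{snd (z i)..}. borel). x (\<tau> i (Suc k)) - x (\<tau> i k) \<in> S (i, k)} \<in> sets (\<Pi>\<^sub>M t\<in>{snd (z i)..}. borel)"
        using measurable_sets[of "\<lambda>x. x (\<tau> i (Suc k)) - x (\<tau> i k)" _ borel "S (i, k)"] by (simp add: vimage_def Int_def conj_commute)
    qed
    have pre: "?path i -` E i \<inter> space M = (\<Inter>k\<in>Ks i. A (i, k))" if "i \<in> I" for i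
      using ne(2)[OF that] S(2) ge unfolding E_def Ks_def by (auto simp: space_PiM)
    have "(\<Inter>p\<in>P. A p) = (\<Inter>i\<in>I. \<Inter>k\<in>Ks i. A (i, k))" unfolding Sig by auto
    also have "\<dots> = (\<Inter>i\<in>I. ?path i -` E i \<inter> space M)" using pre by auto
    also have "prob \<dots> = (\<Prod>i\<in>I. prob (?path i -` E i \<inter> space M))"
      using E by (intro indep_varsD[OF paths ne(1) fin(1)]) auto
    also have "\<dots> = (\<Prod>i\<in>I. \<Prod>k\<in>Ks i. prob (A (i, k)))"
    proof (rule prod.cong[OF refl])
      fix i assume i: "i \<in> I"
      obtain n where n: "Ks i \<subseteq> {..<n}" using finite_nat_iff_bounded fin(2) by blast
      have "prob (\<Inter>k\<in>Ks i. ?X (i, k) -` S (i, k) \<inter> space M) = (\<Prod>k\<in>Ks i. prob (?X (i, k) -` S (i, k) \<inter> space M))"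
        using brownian_motionD(5)[OF bm \<tau>, of i n] ne(2)[OF i] fin n S(1)
        by (intro indep_varsD[where I="{..<n}" and M'="\<lambda>_. borel"]) (auto simp: Ks_def)
      then show "prob (?path i -` E i \<inter> space M) = (\<Prod>k\<in>Ks i. prob (A (i, k)))"
        unfolding pre[OF i] using S(2) by (auto simp: Ks_def)
    qed
    also have "\<dots> = (\<Prod>p\<in>P. prob (A p))" unfolding Sig using fin by (subst prod.Sigma) auto
    finally show "prob (\<Inter>p\<in>P. A p) = (\<Prod>p\<in>P. prob (A p))" .
  qed
qed

section \<open>A maximal inequality for Brownian motion\<close>

text \<open>The event is split by the first index at which the partial sum exceeds
  \<open>2 * e\<close>. The remaining increments are independent of this and add up to at most
  \<open>e\<close> with probability at least 1/2; then the full sum exceeds \<open>e\<close>. This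
  accounts for the factor 2.\<close>

lemma (in prob_space) ottaviani:
  fixes X :: "nat \<Rightarrow> 'a \<Rightarrow> real"
  assumes ind: "indep_vars (\<lambda>_. borel) X {..<n}"
    and half: "\<And>k. k \<le> n \<Longrightarrow> prob {\<omega>\<in>space M. \<bar>\<Sum>i=k..<n. X i \<omega>\<bar> > e} \<le> 1/2"
  shows "prob {\<omega>\<in>space M. \<exists>k\<le>n. \<bar>\<Sum>i<k. X i \<omega>\<bar> > 2 * e} \<le> 2 * prob {\<omega>\<in>space M. \<bar>\<Sum>i<n. X i \<omega>\<bar> > e}"
proof -
  have [measurable]: "X i \<in> borel_measurable M" if "i < n" for i
    using ind that by (auto simp: indep_vars_def)
  define A where "A k = {\<omega>\<in>space M. \<bar>\<Sum>i<k. X i \<omega>\<bar> > 2 * e \<and> (\<forall>j<k. \<bar>\<Sum>i<j. X i \<omega>\<bar> \<le> 2 * e)}" for k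
  define D where "D k = {\<omega>\<in>space M. \<bar>\<Sum>i=k..<n. X i \<omega>\<bar> \<le> e}" for k
  have sumlt: "(\<lambda>\<omega>. \<Sum>i<k. X i \<omega>) \<in> borel_measurable M" if "k \<le> n" for k
    using that by (intro borel_measurable_sum) auto
  have summ: "(\<lambda>\<omega>. \<Sum>i=k..<n. X i \<omega>) \<in> borel_measurable M" for k
    by (intro borel_measurable_sum) auto
  have Am: "A k \<in> events" if "k \<le> n" for k
  proof -
    have "{\<omega>\<in>space M. \<bar>\<Sum>i<j. X i \<omega>\<bar> \<le> 2 * e} \<in> events" if "j < k" for j
      using sumlt[OF order_trans[OF less_imp_le[OF \<open>j < k\<close>] \<open>k \<le> n\<close>]] by measurable
    then have "{\<omega>\<in>space M. \<forall>j\<in>{..<k}. \<bar>\<Sum>i<j. X i \<omega>\<bar> \<le> 2 * e} \<in> events"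
      by (intro sets.sets_Collect_finite_All) auto
    moreover have "{\<omega>\<in>space M. \<bar>\<Sum>i<k. X i \<omega>\<bar> > 2 * e} \<in> events"
      using sumlt[OF that] by measurable
    ultimately have "{\<omega>\<in>space M. \<bar>\<Sum>i<k. X i \<omega>\<bar> > 2 * e} \<inter> {\<omega>\<in>space M. \<forall>j\<in>{..<k}. \<bar>\<Sum>i<j. X i \<omega>\<bar> \<le> 2 * e} \<in> events"
      by blast
    also have "{\<omega>\<in>space M. \<bar>\<Sum>i<k. X i \<omega>\<bar> > 2 * e} \<inter> {\<omega>\<in>space M. \<forall>j\<in>{..<k}. \<bar>\<Sum>i<j. X i \<omega>\<bar> \<le> 2 * e} = A k"
      by (auto simp: A_def)
    finally show ?thesis .
  qed
  have Dm: "D k \<in> events" for k unfolding D_def using summ by measurable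
  have Dp: "prob (D k) \<ge> 1/2" if "k \<le> n" for k
  proof -
    have "D k = space M - {\<omega>\<in>space M. \<bar>\<Sum>i=k..<n. X i \<omega>\<bar> > e}" by (auto simp: D_def)
    moreover have "{\<omega>\<in>space M. \<bar>\<Sum>i=k..<n. X i \<omega>\<bar> > e} \<in> events" using summ by measurable
    ultimately show ?thesis using half[OF that] prob_compl by simp
  qed
  have AD: "prob (A k \<inter> D k) = prob (A k) * prob (D k)" if "k \<le> n" for k
  proof -
    let ?l = "\<lambda>\<omega>. restrict (\<lambda>i. X i \<omega>) {..<k}" and ?r = "\<lambda>\<omega>. restrict (\<lambda>i. X i \<omega>) {k..<n}"
    have iv: "indep_var (PiM {..<k} (\<lambda>_. borel)) ?l (PiM {k..<n} (\<lambda>_. borel)) ?r"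
      using that by (intro indep_var_restrict[OF ind]) auto
    let ?A = "{x \<in> space (PiM {..<k} (\<lambda>_. borel::real measure)). \<bar>\<Sum>i<k. x i\<bar> > 2 * e \<and> (\<forall>j<k. \<bar>\<Sum>i<j. x i\<bar> \<le> 2 * e)}"
    let ?D = "{x \<in> space (PiM {k..<n} (\<lambda>_. borel::real measure)). \<bar>\<Sum>i=k..<n. x i\<bar> \<le> e}"
    have comp: "(\<lambda>x. \<Sum>i\<in>I. x i) \<in> borel_measurable (PiM J (\<lambda>_. borel::real measure))" if "I \<subseteq> J" for I J :: "nat set"
      using that by (intro borel_measurable_sum measurable_component_singleton) auto
    have "{x \<in> space (PiM {..<k} (\<lambda>_. borel::real measure)). \<bar>\<Sum>i<j. x i\<bar> \<le> 2 * e} \<in> sets (PiM {..<k} (\<lambda>_. borel))" if "j < k" for j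
    proof -
      have "{..<j} \<subseteq> {..<k}" using that by auto
      note comp[OF this, measurable]
      show ?thesis by measurable
    qed
    then have "{x \<in> space (PiM {..<k} (\<lambda>_. borel::real measure)). \<forall>j\<in>{..<k}. \<bar>\<Sum>i<j. x i\<bar> \<le> 2 * e} \<in> sets (PiM {..<k} (\<lambda>_. borel))"
      by (intro sets.sets_Collect_finite_All) auto
    moreover have "{x \<in> space (PiM {..<k} (\<lambda>_. borel::real measure)). \<bar>\<Sum>i<k. x i\<bar> > 2 * e} \<in> sets (PiM {..<k} (\<lambda>_. borel))"
      using comp[of "{..<k}" "{..<k}"] by measurable
    ultimately have "{x \<in> space (PiM {..<k} (\<lambda>_. borel::real measure)). \<bar>\<Sum>i<k. x i\<bar> > 2 * e} \<inter>
       {x \<in> space (PiM {..<k} (\<lambda>_. borel::real measure)). \<forall>j\<in>{..<k}. \<bar>\<Sum>i<j. x i\<bar> \<le> 2 * e} \<in> sets (PiM {..<k} (\<lambda>_. borel))"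
      by blast
    also have "{x \<in> space (PiM {..<k} (\<lambda>_. borel::real measure)). \<bar>\<Sum>i<k. x i\<bar> > 2 * e} \<inter>
       {x \<in> space (PiM {..<k} (\<lambda>_. borel::real measure)). \<forall>j\<in>{..<k}. \<bar>\<Sum>i<j. x i\<bar> \<le> 2 * e} = ?A" by auto
    finally have mA: "?A \<in> sets (PiM {..<k} (\<lambda>_. borel))" .
    have mD: "?D \<in> sets (PiM {k..<n} (\<lambda>_. borel))"
      using comp[of "{k..<n}" "{k..<n}"] by measurable
    have rw: "(\<Sum>i<j. restrict (\<lambda>i. X i \<omega>) {..<k} i) = (\<Sum>i<j. X i \<omega>)" if "j \<le> k" for j \<omega>
      using that by (intro sum.cong) auto
    have "A k = ?l -` ?A \<inter> space M" unfolding A_def by (auto simp: space_PiM rw less_imp_le simp del: restrict_apply)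
    moreover have "D k = ?r -` ?D \<inter> space M" unfolding D_def by (auto simp: space_PiM)
    moreover have "A k \<inter> D k = (\<lambda>x. (?l x, ?r x)) -` (?A \<times> ?D) \<inter> space M"
      using calculation by blast
    ultimately show ?thesis using indep_varD[OF iv mA mD] by simp
  qed
  have sub: "A k \<inter> D k \<subseteq> {\<omega>\<in>space M. \<bar>\<Sum>i<n. X i \<omega>\<bar> > e}" if "k \<le> n" for k
  proof
    fix \<omega> assume "\<omega> \<in> A k \<inter> D k"
    moreover have "(\<Sum>i<n. X i \<omega>) = (\<Sum>i<k. X i \<omega>) + (\<Sum>i=k..<n. X i \<omega>)"
      using sum.atLeastLessThan_concat[of 0 k n "\<lambda>i. X i \<omega>"] that by (simp add: atLeast0LessThan)
    ultimately show "\<omega> \<in> {\<omega>\<in>space M. \<bar>\<Sum>i<n. X i \<omega>\<bar> > e}" by (auto simp: A_def D_def)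
  qed
  have "False" if "\<omega> \<in> A m" "\<omega> \<in> A k" "m < k" for \<omega> m k using that by (force simp: A_def)
  then have disj: "disjoint_family_on A {..n}"
    unfolding disjoint_family_on_def disjoint_iff by (metis linorder_neqE_nat)
  have un: "{\<omega>\<in>space M. \<exists>k\<le>n. \<bar>\<Sum>i<k. X i \<omega>\<bar> > 2 * e} = (\<Union>k\<in>{..n}. A k)"
  proof safe
    fix \<omega> k assume w: "\<omega> \<in> space M" "k \<le> n" "2 * e < \<bar>\<Sum>i<k. X i \<omega>\<bar>"
    define m where "m = (LEAST k. 2 * e < \<bar>\<Sum>i<k. X i \<omega>\<bar>)"
    have "2 * e < \<bar>\<Sum>i<m. X i \<omega>\<bar>" unfolding m_def using w(3) by (rule LeastI)
    moreover have "\<bar>\<Sum>i<j. X i \<omega>\<bar> \<le> 2 * e" if "j < m" for j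
      using not_less_Least[OF that[unfolded m_def]] by simp
    moreover have "m \<le> k" unfolding m_def using w(3) by (rule Least_le)
    ultimately show "\<omega> \<in> (\<Union>k\<in>{..n}. A k)" using w by (auto simp: A_def)
  qed (auto simp: A_def)
  have "prob (\<Union>k\<in>{..n}. A k) = (\<Sum>k\<le>n. prob (A k))"
    using Am disj by (intro finite_measure_finite_Union) auto
  also have "\<dots> \<le> (\<Sum>k\<le>n. 2 * prob (A k \<inter> D k))"
  proof (rule sum_mono)
    fix k assume "k \<in> {..n}"
    then have k: "k \<le> n" by simp
    have "prob (A k) * (1/2) \<le> prob (A k) * prob (D k)" using Dp[OF k] by (intro mult_left_mono) auto
    then show "prob (A k) \<le> 2 * prob (A k \<inter> D k)" using AD[OF k] by simp
  qed
  also have "\<dots> = 2 * prob (\<Union>k\<in>{..n}. A k \<inter> D k)"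
    unfolding sum_distrib_left[symmetric] using Am Dm disj
    by (subst finite_measure_finite_Union) (fastforce simp: disjoint_family_on_def)+
  also have "\<dots> \<le> 2 * prob {\<omega>\<in>space M. \<bar>\<Sum>i<n. X i \<omega>\<bar> > e}"
    using sub sumlt[of n] by (intro mult_left_mono finite_measure_mono) auto
  finally show ?thesis unfolding un .
qed

text \<open>The fourth moment is used because the equicontinuity argument sums over a number of time
  cells inversely proportional to their duration: a bound quadratic in the duration survives this
  sum, whereas the linear bound from the second moment would not.\<close>

lemma (in prob_space) normal_tail:
  assumes D: "distributed M lborel X (normal_density 0 (sqrt v))" and v: "0 < v" and e: "0 < e"
  shows "prob {\<omega>\<in>space M. \<bar>X \<omega>\<bar> > e} \<le> 3 * v\<^sup>2 / e ^ 4"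
proof -
  have [measurable]: "X \<in> borel_measurable M" using distributed_measurable[OF D] by simp
  have s: "0 < sqrt v" using v by simp
  have hb: "has_bochner_integral lborel (\<lambda>x. normal_density 0 (sqrt v) x * x ^ 4) (3 * v\<^sup>2)"
    using normal_moment_even[OF s, of 0 2] v by (simp add: fact_numeral field_simps)
  have int: "integrable M (\<lambda>\<omega>. X \<omega> ^ 4)"
    using distributed_integrable[OF D, of "\<lambda>x. x ^ 4"] hb by (auto intro: integrable.intros)
  have E: "expectation (\<lambda>\<omega>. X \<omega> ^ 4) = 3 * v\<^sup>2"
    using distributed_integral[OF D, of "\<lambda>x. x ^ 4"] has_bochner_integral_integral_eq[OF hb] by simp
  have "prob {\<omega>\<in>space M. \<bar>X \<omega>\<bar> > e} \<le> prob {\<omega>\<in>space M. X \<omega> ^ 4 \<ge> e ^ 4}"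
  proof (intro finite_measure_mono subsetI)
    fix \<omega> assume "\<omega> \<in> {\<omega>\<in>space M. \<bar>X \<omega>\<bar> > e}"
    then show "\<omega> \<in> {\<omega>\<in>space M. X \<omega> ^ 4 \<ge> e ^ 4}"
      using power_mono[of e "\<bar>X \<omega>\<bar>" 4] e by (simp add: power_even_abs)
  qed measurable
  also have "\<dots> \<le> expectation (\<lambda>\<omega>. X \<omega> ^ 4) / e ^ 4"
    using e by (intro integral_Markov_inequality_measure[OF int, where A="{}", simplified]) (auto intro: always_eventually)
  finally show ?thesis by (simp add: E)
qed

text \<open>The factor 6 is twice the constant of \<open>normal_tail\<close>. When the tail bound
  exceeds 1/2, so that \<open>ottaviani\<close> is not applicable, the claimed bound exceeds 1 and
  is trivial.\<close>

lemma brownian_max: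
  fixes \<tau> :: "nat \<Rightarrow> real"
  assumes "prob_space M" and B: "brownian_motion M p B" and \<tau>: "mono \<tau>" "snd p \<le> \<tau> 0" "\<tau> n \<le> \<tau> 0 + d"
    and e: "0 < e" and d: "0 < d"
  shows "measure M {\<omega>\<in>space M. \<exists>k\<le>n. \<bar>B \<omega> (\<tau> k) - B \<omega> (\<tau> 0)\<bar> > 2 * e} \<le> 6 * d\<^sup>2 / e ^ 4"
proof -
  interpret prob_space M by fact
  define X where "X i \<omega> = B \<omega> (\<tau> (Suc i)) - B \<omega> (\<tau> i)" for i \<omega>
  have tel: "(\<Sum>i=k..<m. X i \<omega>) = B \<omega> (\<tau> m) - B \<omega> (\<tau> k)" if "k \<le> m" for k m \<omega>
    unfolding X_def using that by (rule sum_Suc_diff')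
  have tel0: "(\<Sum>i<m. X i \<omega>) = B \<omega> (\<tau> m) - B \<omega> (\<tau> 0)" for m \<omega>
    using tel[of 0 m] by (simp add: atLeast0LessThan)
  have tail: "prob {\<omega>\<in>space M. \<bar>\<Sum>i=k..<n. X i \<omega>\<bar> > e} \<le> 3 * d\<^sup>2 / e ^ 4" if k: "k \<le> n" for k
  proof (cases "\<tau> k < \<tau> n")
    case True
    have ge: "snd p \<le> \<tau> k" using \<tau>(2) monoD[OF \<tau>(1), of 0 k] by simp
    have "prob {\<omega>\<in>space M. \<bar>B \<omega> (\<tau> n) - B \<omega> (\<tau> k)\<bar> > e} \<le> 3 * (\<tau> n - \<tau> k)\<^sup>2 / e ^ 4"
      using brownian_motionD(4)[OF B ge True] True e by (intro normal_tail) auto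
    also have "\<dots> \<le> 3 * d\<^sup>2 / e ^ 4"
      using True \<tau>(3) monoD[OF \<tau>(1), of 0 k] e by (intro divide_right_mono mult_left_mono power_mono) auto
    finally show ?thesis unfolding tel[OF k] .
  next
    case False
    then have "\<tau> n = \<tau> k" using monoD[OF \<tau>(1) k] by simp
    then show ?thesis unfolding tel[OF k] using e by simp
  qed
  show ?thesis
  proof (cases "3 * d\<^sup>2 / e ^ 4 \<le> 1/2")
    case True
    have ind: "indep_vars (\<lambda>_. borel) X {..<n}"
      using brownian_motionD(5)[OF B \<tau>(1,2)] by (simp add: X_def[abs_def])
    have "prob {\<omega>\<in>space M. \<exists>k\<le>n. \<bar>\<Sum>i<k. X i \<omega>\<bar> > 2 * e} \<le> 2 * prob {\<omega>\<in>space M. \<bar>\<Sum>i<n. X i \<omega>\<bar> > e}"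
      by (rule ottaviani[OF ind order_trans[OF tail True]])
    also have "\<dots> \<le> 2 * (3 * d\<^sup>2 / e ^ 4)" using tail[of 0] by (simp add: atLeast0LessThan)
    finally show ?thesis by (simp add: tel0)
  next
    case False
    then have "1 \<le> 6 * d\<^sup>2 / e ^ 4" by simp
    then show ?thesis using prob_le_1 order_trans by blast
  qed
qed

lemma brownian_max_finite:
  assumes M: "prob_space M" and B: "brownian_motion M p B" and F: "finite F" "F \<subseteq> {snd p..snd p + d}"
    and e: "0 < e" and d: "0 < d"
  shows "measure M {\<omega>\<in>space M. \<exists>s\<in>F. \<bar>B \<omega> s - B \<omega> (snd p)\<bar> > 2 * e} \<le> 6 * d\<^sup>2 / e ^ 4"
proof -
  interpret prob_space M by fact
  define xs where "xs = sorted_list_of_set (insert (snd p) F)"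
  have xs: "set xs = insert (snd p) F" "sorted xs" "xs \<noteq> []" using F(1) by (auto simp: xs_def simp del: sorted_list_of_set_insert_remove)
  define n where "n = length xs - 1"
  have n: "Suc n = length xs" using xs(3) by (simp add: n_def)
  \<comment> \<open>Past its last point the sequence is continued constantly, since independence of
    increments is available along monotone sequences indexed by all natural numbers.\<close>
  define \<tau> where "\<tau> k = xs ! min k n" for k
  have mono: "mono \<tau>" unfolding \<tau>_def using xs(2) n by (intro monoI sorted_nth_mono) auto
  have in_set: "\<tau> k \<in> insert (snd p) F" for k
    unfolding \<tau>_def xs(1)[symmetric] using n by (intro nth_mem) auto
  obtain j where j: "j < length xs" "xs ! j = snd p" using xs(1) by (metis in_set_conv_nth insertI1)
  have \<tau>0: "\<tau> 0 = snd p"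
  proof -
    have "\<tau> 0 \<le> snd p" using sorted_nth_mono[OF xs(2), of 0 j] j by (simp add: \<tau>_def)
    moreover have "snd p \<le> \<tau> 0" using in_set[of 0] F(2) by auto
    ultimately show ?thesis by simp
  qed
  have "\<tau> n \<le> \<tau> 0 + d" using in_set[of n] F(2) d by (auto simp: \<tau>0)
  then have "prob {\<omega>\<in>space M. \<exists>k\<le>n. \<bar>B \<omega> (\<tau> k) - B \<omega> (\<tau> 0)\<bar> > 2 * e} \<le> 6 * d\<^sup>2 / e ^ 4"
    using \<tau>0 by (intro brownian_max[OF M B mono _ _ e d]) auto
  moreover have "{\<omega>\<in>space M. \<exists>s\<in>F. \<bar>B \<omega> s - B \<omega> (snd p)\<bar> > 2 * e} \<subseteq> {\<omega>\<in>space M. \<exists>k\<le>n. \<bar>B \<omega> (\<tau> k) - B \<omega> (\<tau> 0)\<bar> > 2 * e}"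
  proof safe
    fix \<omega> s assume "s \<in> F" "2 * e < \<bar>B \<omega> s - B \<omega> (snd p)\<bar>"
    moreover obtain k where "k < length xs" "xs ! k = s" using xs(1) \<open>s \<in> F\<close> by (metis in_set_conv_nth insertI2)
    moreover from this have "\<tau> k = s" "k \<le> n" using n by (auto simp: \<tau>_def min_def)
    ultimately show "\<exists>k\<le>n. 2 * e < \<bar>B \<omega> (\<tau> k) - B \<omega> (\<tau> 0)\<bar>" using \<tau>0 by auto
  qed
  moreover have "{\<omega>\<in>space M. \<exists>k\<le>n. \<bar>B \<omega> (\<tau> k) - B \<omega> (\<tau> 0)\<bar> > 2 * e} \<in> events"
  proof -
    have "{\<omega>\<in>space M. \<bar>B \<omega> (\<tau> k) - B \<omega> (\<tau> 0)\<bar> > 2 * e} \<in> events" for k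
    proof -
      have [measurable]: "(\<lambda>\<omega>. B \<omega> (\<tau> k)) \<in> borel_measurable M" for k
        using brownian_motionD(1)[OF B] in_set[of k] F(2) by auto
      show ?thesis by measurable
    qed
    then have "{\<omega>\<in>space M. \<exists>k\<in>{..n}. \<bar>B \<omega> (\<tau> k) - B \<omega> (\<tau> 0)\<bar> > 2 * e} \<in> events"
      by (intro sets.sets_Collect_finite_Ex) auto
    then show ?thesis by (simp only: Bex_def atMost_iff)
  qed
  ultimately show ?thesis using finite_measure_mono order_trans by blast
qed

section \<open>Small-ball estimates and absence of atoms\<close>

lemma normal_small_ball:
  assumes "0 < v" "0 < e"
  shows "measure (density lborel (normal_density 0 (sqrt v))) {r - e<..<r + e} \<le> 2 * e / sqrt (2 * pi * v)"
proof -
  interpret D: prob_space "density lborel (normal_density 0 (sqrt v))" using assms by (intro prob_space_normal_density) simp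
  have "emeasure (density lborel (normal_density 0 (sqrt v))) {r - e<..<r + e} =
      (\<integral>\<^sup>+x. ennreal (normal_density 0 (sqrt v) x) * indicator {r - e<..<r + e} x \<partial>lborel)"
    by (subst emeasure_density) auto
  also have "\<dots> \<le> (\<integral>\<^sup>+x. ennreal (1 / sqrt (2 * pi * v)) * indicator {r - e<..<r + e} x \<partial>lborel)"
  proof (intro nn_integral_mono mult_right_mono ennreal_leI)
    fix x
    have "exp (- x\<^sup>2 / (2 * v)) \<le> 1" using assms by simp
    then show "normal_density 0 (sqrt v) x \<le> 1 / sqrt (2 * pi * v)"
      using assms unfolding normal_density_def by (simp add: divide_right_mono)
  qed simp
  also have "\<dots> = ennreal (1 / sqrt (2 * pi * v)) * ennreal (2 * e)"
    using assms by (subst nn_integral_cmult_indicator) auto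
  also have "\<dots> = ennreal (2 * e / sqrt (2 * pi * v))" by (subst ennreal_mult[symmetric]) (use assms in auto)
  finally show ?thesis using assms by (simp add: D.emeasure_eq_measure)
qed

text \<open>Given \<open>R\<close>, the event confines \<open>U\<close> to an interval of length
  \<open>2 * e\<close>. The density bound does not depend on the centre of the interval, so an
  independent shift costs nothing.\<close>

lemma (in prob_space) normal_small_ball_indep:
  assumes D: "distributed M lborel U (normal_density 0 (sqrt v))" and v: "0 < v" and e: "0 < e"
    and ind: "indep_var borel U borel R"
  shows "prob {\<omega>\<in>space M. \<bar>U \<omega> + R \<omega>\<bar> < e} \<le> 2 * e / sqrt (2 * pi * v)"
proof -
  let ?D = "density lborel (normal_density 0 (sqrt v))"
  have UD: "distr M borel U = ?D"
    using distributed_distr_eq_density[OF D] by (simp cong: distr_cong)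
  have rv[measurable]: "U \<in> borel_measurable M" "R \<in> borel_measurable M"
    using indep_var_rv1[OF ind] indep_var_rv2[OF ind] by auto
  interpret D: prob_space ?D using v by (intro prob_space_normal_density) simp
  interpret RR: prob_space "distr M borel R" by (rule prob_space_distr) simp
  let ?S = "{p \<in> space (borel \<Otimes>\<^sub>M borel). \<bar>fst p + snd p\<bar> < e} :: (real \<times> real) set"
  have S: "?S \<in> sets (borel \<Otimes>\<^sub>M borel)" by measurable
  interpret P: pair_sigma_finite ?D "distr M borel R" ..
  have "emeasure M {\<omega>\<in>space M. \<bar>U \<omega> + R \<omega>\<bar> < e} = emeasure (distr M (borel \<Otimes>\<^sub>M borel) (\<lambda>x. (U x, R x))) ?S"
    using S by (subst emeasure_distr) (auto intro!: arg_cong[where f="emeasure M"] simp: space_pair_measure)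
  also have "\<dots> = emeasure (?D \<Otimes>\<^sub>M distr M borel R) ?S"
    using ind unfolding indep_var_distribution_eq by (simp add: UD)
  also have "\<dots> = (\<integral>\<^sup>+r. emeasure ?D ((\<lambda>x. (x, r)) -` ?S) \<partial>distr M borel R)"
    by (rule P.emeasure_pair_measure_alt2) (use S in \<open>simp cong: sets_pair_measure_cong\<close>)
  also have "\<dots> \<le> (\<integral>\<^sup>+r. ennreal (2 * e / sqrt (2 * pi * v)) \<partial>distr M borel R)"
  proof (rule nn_integral_mono)
    fix r
    have "(\<lambda>x. (x, r)) -` ?S = {- r - e<..<- r + e}" by (auto simp: space_pair_measure)
    then show "emeasure ?D ((\<lambda>x. (x, r)) -` ?S) \<le> ennreal (2 * e / sqrt (2 * pi * v))"
      using normal_small_ball[OF v e, of "- r"] by (simp add: D.emeasure_eq_measure ennreal_leI)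
  qed
  also have "\<dots> = ennreal (2 * e / sqrt (2 * pi * v))" using RR.emeasure_space_1 by simp
  finally show ?thesis using v e by (simp add: emeasure_eq_measure)
qed

lemma brownian_no_atom:
  assumes "prob_space M" and B: "brownian_motion M p B" and t: "snd p < t"
  shows "AE \<omega> in M. B \<omega> t \<noteq> x"
proof -
  interpret prob_space M by fact
  let ?D = "density lborel (normal_density 0 (sqrt (t - snd p)))"
  have D: "distributed M lborel (\<lambda>\<omega>. B \<omega> t - B \<omega> (snd p)) (normal_density 0 (sqrt (t - snd p)))"
    by (rule brownian_motionD(4)[OF B order_refl t])
  have "AE y in ?D. y \<noteq> x - fst p"
  proof (subst AE_density)
    have "AE y in lborel. y \<noteq> x - fst p" by (rule AE_lborel_singleton)
    then show "AE y in lborel. 0 < ennreal (normal_density 0 (sqrt (t - snd p)) y) \<longrightarrow> y \<noteq> x - fst p" by eventually_elim auto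
  qed simp
  then have "AE \<omega> in M. B \<omega> t - B \<omega> (snd p) \<noteq> x - fst p"
    unfolding distributed_distr_eq_density[OF D, symmetric]
    using distributed_measurable[OF D] by (subst (asm) AE_distr_iff) auto
  then show ?thesis using brownian_motionD(2)[OF B] by eventually_elim auto
qed

section \<open>Discrete approximation of coalescing paths\<close>

lemma LIMSEQ_subseqI:
  fixes X :: "nat \<Rightarrow> 'a::metric_space"
  assumes "\<And>s. strict_mono (s :: nat \<Rightarrow> nat) \<Longrightarrow> \<exists>s' :: nat \<Rightarrow> nat. strict_mono s' \<and> (\<lambda>m. X (s (s' m))) \<longlonglongrightarrow> L"
  shows "X \<longlonglongrightarrow> L"
proof (rule ccontr)
  assume "\<not> X \<longlonglongrightarrow> L"
  then obtain e where e: "e > 0" "\<And>N. \<exists>n\<ge>N. dist (X n) L \<ge> e"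
    unfolding lim_sequentially by (meson not_less)
  have "infinite {n. dist (X n) L \<ge> e}"
    unfolding infinite_nat_iff_unbounded_le using e(2) by auto
  then obtain s :: "nat \<Rightarrow> nat" where s: "strict_mono s" "\<And>n. s n \<in> {n. dist (X n) L \<ge> e}"
    using infinite_enumerate by blast
  obtain s' where "strict_mono s'" "(\<lambda>m. X (s (s' m))) \<longlonglongrightarrow> L" using assms[OF s(1)] by blast
  then obtain N where "dist (X (s (s' N))) L < e" using e(1) unfolding lim_sequentially by blast
  then show False using s(2)[of "s' N"] by auto
qed

lemma infinite_subseq:
  assumes "infinite {m. P m}"
  shows "\<exists>s :: nat \<Rightarrow> nat. strict_mono s \<and> (\<forall>m. P (s m))"
  using infinite_enumerate[OF assms] by auto

text \<open>Paths \<open>y m\<close> on a grid of mesh \<open>h m\<close>, where \<open>mg m i l k\<close> says that \<open>i\<close> and \<open>l\<close> have merged by step \<open>k\<close> and \<open>own m i\<close> is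
  the path that \<open>i\<close> follows until it merges with a path of smaller index. Since no driving path touches an earlier path
  without crossing it, meetings of the limiting paths are detected by sign changes on the grid.\<close>

locale scheme_limit =
  fixes n :: nat and t :: "nat \<Rightarrow> real" and b w :: "nat \<Rightarrow> real \<Rightarrow> real"
    and T0 :: "nat \<Rightarrow> real" and h :: "nat \<Rightarrow> real" and K :: "nat \<Rightarrow> nat" and \<kappa> :: "nat \<Rightarrow> nat \<Rightarrow> nat"
    and y own :: "nat \<Rightarrow> nat \<Rightarrow> nat \<Rightarrow> real" and mg :: "nat \<Rightarrow> nat \<Rightarrow> nat \<Rightarrow> nat \<Rightarrow> bool" and \<eta> :: "nat \<Rightarrow> real"
  assumes h_pos: "\<And>m. h m > 0" and h_lim: "h \<longlonglongrightarrow> 0"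
    and cont_w: "\<And>i. i < n \<Longrightarrow> continuous_on {t i..} (w i)"
    and cont_b: "\<And>i. i < n \<Longrightarrow> continuous_on {t i..} (b i)"
    and coal: "\<And>i l s u. i < n \<Longrightarrow> l < n \<Longrightarrow> t i \<le> s \<Longrightarrow> t l \<le> s \<Longrightarrow> s \<le> u \<Longrightarrow> w i s = w l s \<Longrightarrow> w i u = w l u"
    and follow: "\<And>i u. i < n \<Longrightarrow> t i \<le> u \<Longrightarrow>
      (\<And>l s. l < i \<Longrightarrow> t l \<le> s \<Longrightarrow> t i \<le> s \<Longrightarrow> s \<le> u \<Longrightarrow> w l s \<noteq> w i s) \<Longrightarrow> w i u = b i u"
    and apart: "\<And>i l. l < i \<Longrightarrow> i < n \<Longrightarrow> w l (max (t l) (t i)) \<noteq> w i (max (t l) (t i))"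
    and no_touch: "\<And>i l q r c. l < i \<Longrightarrow> i < n \<Longrightarrow> q \<in> \<rat> \<Longrightarrow> r \<in> \<rat> \<Longrightarrow> max (t l) (t i) < q \<Longrightarrow> q < r \<Longrightarrow>
      c \<in> {1, -1} \<Longrightarrow> (\<And>s. s \<in> {q..r} \<Longrightarrow> 0 \<le> c * (b i s - w l s)) \<Longrightarrow> (\<And>s. s \<in> {q..r} \<Longrightarrow> 0 < c * (b i s - w l s))"
    and birth: "\<And>i. i < n \<Longrightarrow> (\<lambda>m. T0 m + real (\<kappa> m i) * h m) \<longlonglongrightarrow> t i"
    and own: "\<And>m i k. i < n \<Longrightarrow> \<kappa> m i \<le> k \<Longrightarrow> k \<le> K m \<Longrightarrow> (\<And>l k'. l < i \<Longrightarrow> k' < k \<Longrightarrow> \<not> mg m i l k') \<Longrightarrow> y m i k = own m i k"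
    and driver: "\<And>i r k u. i < n \<Longrightarrow> strict_mono r \<Longrightarrow> (\<And>m. \<kappa> (r m) i \<le> k m) \<Longrightarrow> (\<And>m. k m \<le> K (r m)) \<Longrightarrow>
      (\<lambda>m. T0 (r m) + real (k m) * h (r m)) \<longlonglongrightarrow> u \<Longrightarrow> (\<lambda>m. own (r m) i (k m)) \<longlonglongrightarrow> b i u"
    and mg_close: "\<And>m i l k k'. i < n \<Longrightarrow> l < n \<Longrightarrow> mg m i l k \<Longrightarrow> k \<le> k' \<Longrightarrow> k' \<le> K m \<Longrightarrow> \<bar>y m i k' - y m l k'\<bar> \<le> \<eta> m"
    and \<eta>_lim: "\<eta> \<longlonglongrightarrow> 0"
    and mg_cross: "\<And>m i l k k'. i < n \<Longrightarrow> l < n \<Longrightarrow> \<kappa> m i \<le> k \<Longrightarrow> \<kappa> m l \<le> k \<Longrightarrow> k < k' \<Longrightarrow> k' \<le> K m \<Longrightarrow>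
      (y m i k - y m l k) * (y m i k' - y m l k') < 0 \<Longrightarrow> mg m i l k'"
    and mg_born: "\<And>m i l k. l < i \<Longrightarrow> i < n \<Longrightarrow> mg m i l k \<Longrightarrow> \<kappa> m i \<le> k \<and> \<kappa> m l \<le> k"
begin

definition gt :: "nat \<Rightarrow> nat \<Rightarrow> real" where "gt m k = T0 m + real k * h m"

lemma gt_less: "gt m k < gt m k' \<longleftrightarrow> k < k'" and gt_le: "gt m k \<le> gt m k' \<longleftrightarrow> k \<le> k'"
  using h_pos[of m] by (auto simp: gt_def)

text \<open>Convergence is demanded along every subsequence and for moving grid times, because the
  step at which two paths merge varies with \<open>m\<close> and has only subsequential
  limits.\<close>

definition conv :: "nat \<Rightarrow> bool" where
  "conv i \<longleftrightarrow> (\<forall>r k u. strict_mono r \<longrightarrow> (\<forall>m. \<kappa> (r m) i \<le> k m) \<longrightarrow> (\<forall>m. k m \<le> K (r m)) \<longrightarrow>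
      (\<lambda>m. gt (r m) (k m)) \<longlonglongrightarrow> u \<longrightarrow> (\<lambda>m. y (r m) i (k m)) \<longlonglongrightarrow> w i u)"

lemma driver': "i < n \<Longrightarrow> strict_mono r \<Longrightarrow> (\<And>m. \<kappa> (r m) i \<le> k m) \<Longrightarrow> (\<And>m. k m \<le> K (r m)) \<Longrightarrow>
      (\<lambda>m. gt (r m) (k m)) \<longlonglongrightarrow> u \<Longrightarrow> (\<lambda>m. own (r m) i (k m)) \<longlonglongrightarrow> b i u"
  unfolding gt_def by (rule driver)

lemma birth_subseq: "i < n \<Longrightarrow> strict_mono r \<Longrightarrow> (\<lambda>m. gt (r m) (\<kappa> (r m) i)) \<longlonglongrightarrow> t i"
  using LIMSEQ_subseq_LIMSEQ[OF birth, of i r] by (simp add: gt_def o_def)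

lemma grid_approx:
  assumes "\<forall>\<^sub>F m in sequentially. T0 (r m) \<le> u" "strict_mono r"
  shows "(\<lambda>m. gt (r m) (nat \<lceil>(u - T0 (r m)) / h (r m)\<rceil>)) \<longlonglongrightarrow> u"
proof (rule tendsto_sandwich[where f="\<lambda>_. u" and h="\<lambda>m. u + h (r m)"])
  have c: "u \<le> gt (r m) (nat \<lceil>(u - T0 (r m)) / h (r m)\<rceil>) \<and> gt (r m) (nat \<lceil>(u - T0 (r m)) / h (r m)\<rceil>) \<le> u + h (r m)"
    if "T0 (r m) \<le> u" for m
  proof -
    let ?N = "real (nat \<lceil>(u - T0 (r m)) / h (r m)\<rceil>)"
    have "(u - T0 (r m)) / h (r m) \<le> ?N" "?N \<le> (u - T0 (r m)) / h (r m) + 1"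
      using that h_pos[of "r m"] by (auto simp: of_nat_ceiling)
    then have "u - T0 (r m) \<le> ?N * h (r m)" "?N * h (r m) \<le> u - T0 (r m) + h (r m)"
      using mult_right_mono[of _ _ "h (r m)"] h_pos[of "r m"] by (fastforce simp: distrib_right)+
    then show ?thesis by (simp add: gt_def)
  qed
  show "\<forall>\<^sub>F m in sequentially. u \<le> gt (r m) (nat \<lceil>(u - T0 (r m)) / h (r m)\<rceil>)"
    "\<forall>\<^sub>F m in sequentially. gt (r m) (nat \<lceil>(u - T0 (r m)) / h (r m)\<rceil>) \<le> u + h (r m)"
    using assms(1) by (auto elim!: eventually_mono dest: c)
  show "(\<lambda>m. u + h (r m)) \<longlonglongrightarrow> u"
    using tendsto_add[OF tendsto_const[of u] LIMSEQ_subseq_LIMSEQ[OF h_lim assms(2)]] by (simp add: o_def)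
qed auto

lemma T0_less:
  assumes "i < n" "strict_mono r" "t i < u"
  shows "\<forall>\<^sub>F m in sequentially. T0 (r m) \<le> u"
  using order_tendstoD(2)[OF birth_subseq[OF assms(1,2)] assms(3)]
proof eventually_elim
  case (elim m)
  have "0 \<le> real (\<kappa> (r m) i) * h (r m)" using h_pos[of "r m"] by simp
  then show ?case using elim by (simp add: gt_def)
qed

text \<open>The times at which \<open>w i\<close> meets an earlier path form a closed set, so there
  is a first one, and \<open>apart\<close> places it strictly after both births. Up to and including
  that time \<open>w i\<close> equals its driver, at the endpoint by continuity; a first meeting
  exactly at \<open>u\<close> therefore falls under the first alternative.\<close>

lemma first_meeting:
  assumes i: "i < n" and u: "t i \<le> u"
  shows "w i u = b i u \<or> (\<exists>\<tau> l. l < i \<and> max (t l) (t i) < \<tau> \<and> \<tau> < u \<and> w l \<tau> = b i \<tau> \<and>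
     (\<forall>s. max (t l) (t i) \<le> s \<longrightarrow> s < \<tau> \<longrightarrow> w l s \<noteq> b i s))"
proof -
  define A where "A l = {s. t l \<le> s \<and> t i \<le> s \<and> s \<le> u \<and> w l s = w i s}" for l
  define B where "B = (\<Union>l<i. A l)"
  show ?thesis
  proof (cases "B = {}")
    case True
    then show ?thesis using follow[OF i u] by (auto simp: A_def B_def)
  next
    case False
    have "closed (A l)" if "l < i" for l
    proof -
      have "closed {s \<in> {max (t l) (t i)..u}. w l s = w i s}"
        using that i
        by (intro continuous_closed_preimage_constant[where a=0 and f="\<lambda>s. w l s - w i s", simplified]
             continuous_intros continuous_on_subset[OF cont_w]) auto
      moreover have "{s \<in> {max (t l) (t i)..u}. w l s = w i s} = A l" by (auto simp: A_def)
      ultimately show ?thesis by simp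
    qed
    then have "closed B" unfolding B_def by (intro closed_UN) auto
    moreover have bdd: "bdd_below B" unfolding B_def A_def by (intro bdd_belowI[of _ "t i"]) auto
    ultimately have "Inf B \<in> B" using False by (intro closed_contains_Inf)
    then obtain l where l: "l < i" "Inf B \<in> A l" by (auto simp: B_def)
    define \<tau> where "\<tau> = Inf B"
    have \<tau>: "t l \<le> \<tau>" "t i \<le> \<tau>" "\<tau> \<le> u" "w l \<tau> = w i \<tau>" using l(2) by (auto simp: A_def \<tau>_def)
    have max: "max (t l) (t i) < \<tau>" using \<tau> apart[OF l(1) i] by (cases "max (t l) (t i) = \<tau>") auto
    have nomeet: "w l' s \<noteq> w i s" if "l' < i" "t l' \<le> s" "t i \<le> s" "s < \<tau>" for l' s
    proof
      assume "w l' s = w i s"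
      then have "s \<in> B" using that \<tau> by (auto simp: B_def A_def)
      then show False using cInf_lower[OF _ bdd] that by (force simp: \<tau>_def)
    qed
    have eq: "w i s = b i s" if "t i \<le> s" "s < \<tau>" for s
      by (rule follow[OF i that(1)]) (use nomeet that in force)
    have eq\<tau>: "w i \<tau> = b i \<tau>"
    proof -
      have ti: "t i < \<tau>" using max by simp
      have "((\<lambda>s. w i s - b i s) \<longlongrightarrow> w i \<tau> - b i \<tau>) (at \<tau> within {t i..})"
        using continuous_on_diff[OF cont_w[OF i] cont_b[OF i]] ti unfolding continuous_on_def by auto
      then have lim: "((\<lambda>s. w i s - b i s) \<longlongrightarrow> w i \<tau> - b i \<tau>) (at \<tau> within {t i<..<\<tau>})"
        by (rule tendsto_within_subset) auto
      have "((\<lambda>s. w i s - b i s) \<longlongrightarrow> 0) (at \<tau> within {t i<..<\<tau>})"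
        by (rule tendsto_eventually) (auto simp: eventually_at_filter eq)
      moreover have "at \<tau> within {t i<..<\<tau>} \<noteq> bot"
        using ti by (simp add: at_within_eq_bot_iff islimpt_greaterThanLessThan2 trivial_limit_within)
      ultimately show ?thesis using tendsto_unique lim by fastforce
    qed
    show ?thesis
    proof (cases "\<tau> = u")
      case True then show ?thesis using eq\<tau> by simp
    next
      case False
      then show ?thesis using l \<tau> max eq\<tau> eq nomeet[OF l(1)] by (intro disjI2 exI[of _ \<tau>] exI[of _ l]) auto
    qed
  qed
qed

text \<open>After its first contact with \<open>w l\<close> the driver must cross it, by
  \<open>no_touch\<close>, so the difference has opposite signs at some \<open>q\<close> before and
  \<open>p'\<close> after the contact. As long as nothing has merged, the grid paths converge at
  both times and inherit the signs, and \<open>mg_cross\<close> forces a merger.\<close>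

lemma meeting_detected:
  assumes i: "i < n" and IH: "\<And>l. l < i \<Longrightarrow> conv l" and r: "strict_mono r"
    and k: "\<And>m. k m \<le> K (r m)" and lim: "(\<lambda>m. gt (r m) (k m)) \<longlonglongrightarrow> v"
    and l: "l < i" "max (t l) (t i) < \<tau>" "\<tau> < v" "w l \<tau> = b i \<tau>"
      "\<And>s. max (t l) (t i) \<le> s \<Longrightarrow> s < \<tau> \<Longrightarrow> w l s \<noteq> b i s"
  shows "\<exists>m k' l'. l' < i \<and> k' < k m \<and> mg (r m) i l' k'"
proof -
  obtain q where q: "q \<in> \<rat>" "max (t l) (t i) < q" "q < \<tau>" using Rats_dense_in_real[OF l(2)] by blast
  obtain p where p: "p \<in> \<rat>" "\<tau> < p" "p < v" using Rats_dense_in_real[OF l(3)] by blast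
  define c :: real where "c = (if b i q > w l q then 1 else -1)"
  have c: "c \<in> {1,-1}" "0 < c * (b i q - w l q)" using l(5)[of q] q by (auto simp: c_def)
  have "\<not> (\<forall>s\<in>{q..p}. 0 \<le> c * (b i s - w l s))"
  proof
    assume nn: "\<forall>s\<in>{q..p}. 0 \<le> c * (b i s - w l s)"
    have "0 < c * (b i \<tau> - w l \<tau>)"
      by (rule no_touch[OF l(1) i q(1) p(1) q(2) _ c(1)]) (use nn q p in auto)
    then show False using l(4) by simp
  qed
  then obtain p' where p': "q \<le> p'" "p' \<le> p" "c * (b i p' - w l p') < 0" by force
  then have "q < p'" using c by (cases "q = p'") auto
  define k1 where "k1 m = nat \<lceil>(q - T0 (r m)) / h (r m)\<rceil>" for m
  define k2 where "k2 m = nat \<lceil>(p' - T0 (r m)) / h (r m)\<rceil>" for m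
  have T0: "\<forall>\<^sub>F m in sequentially. T0 (r m) \<le> q" "\<forall>\<^sub>F m in sequentially. T0 (r m) \<le> p'"
    using q \<open>q < p'\<close> by (auto intro!: T0_less[OF i r])
  have k1: "(\<lambda>m. gt (r m) (k1 m)) \<longlonglongrightarrow> q" and k2: "(\<lambda>m. gt (r m) (k2 m)) \<longlonglongrightarrow> p'"
    unfolding k1_def k2_def using T0 r by (auto intro: grid_approx)
  have ln: "l < n" using l i by simp
  have less: "\<forall>\<^sub>F m in sequentially. X m < Y m" if "X \<longlonglongrightarrow> x" "Y \<longlonglongrightarrow> z" "x < z" for X Y :: "nat \<Rightarrow> real" and x z
  proof -
    have "(\<lambda>m. Y m - X m) \<longlonglongrightarrow> z - x" by (intro tendsto_intros that)
    then have "\<forall>\<^sub>F m in sequentially. 0 < Y m - X m" using that(3) by (intro order_tendstoD) auto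
    then show ?thesis by eventually_elim auto
  qed
  have "\<forall>\<^sub>F m in sequentially. gt (r m) (\<kappa> (r m) i) < gt (r m) (k1 m) \<and> gt (r m) (\<kappa> (r m) l) < gt (r m) (k1 m) \<and>
     gt (r m) (k1 m) < gt (r m) (k2 m) \<and> gt (r m) (k2 m) < gt (r m) (k m)"
    using q p p' \<open>q < p'\<close>
    by (intro eventually_conj less[OF birth_subseq[OF i r] k1] less[OF birth_subseq[OF ln r] k1] less[OF k1 k2] less[OF k2 lim]) auto
  then obtain N where N: "\<And>m. m \<ge> N \<Longrightarrow> \<kappa> (r m) i < k1 m \<and> \<kappa> (r m) l < k1 m \<and> k1 m < k2 m \<and> k2 m < k m"
    unfolding eventually_sequentially gt_less by blast
  show ?thesis
  proof (rule ccontr)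
    assume neg: "\<not> ?thesis"
    \<comment> \<open>The shift by \<open>N\<close> makes the eventual inequalities between grid
      indices hold for every \<open>m\<close>, as \<open>conv\<close> and \<open>driver\<close>
      require.\<close>
    define R where "R m = r (m + N)" for m
    define a where "a m = k1 (m + N)" for m
    define z where "z m = k2 (m + N)" for m
    have R: "strict_mono R" using r by (auto simp: R_def strict_mono_def)
    have N': "\<kappa> (R m) i < a m" "\<kappa> (R m) l < a m" "a m < z m" "z m < k (m + N)" for m
      using N[of "m + N"] by (auto simp: R_def a_def z_def)
    have KR: "k (m + N) \<le> K (R m)" for m using k[of "m + N"] by (simp add: R_def)
    have bd: "a m \<le> K (R m)" "z m \<le> K (R m)" "\<kappa> (R m) i \<le> a m" "\<kappa> (R m) l \<le> a m"
      "\<kappa> (R m) i \<le> z m" "\<kappa> (R m) l \<le> z m" for m using N'[of m] KR[of m] by auto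
    have lima: "(\<lambda>m. gt (R m) (a m)) \<longlonglongrightarrow> q" and limz: "(\<lambda>m. gt (R m) (z m)) \<longlonglongrightarrow> p'"
      using LIMSEQ_ignore_initial_segment[OF k1, of N] LIMSEQ_ignore_initial_segment[OF k2, of N]
      by (simp_all add: R_def a_def z_def)
    have nomg: "\<not> mg (R m) i l' k'" if "l' < i" "k' < k (m + N)" for m l' k'
      using neg that by (auto simp: R_def)
    have own': "y (R m) i (a m) = own (R m) i (a m)" "y (R m) i (z m) = own (R m) i (z m)" for m
      by (intro own i bd; meson nomg N' less_trans)+
    have "(\<lambda>m. (c * (y (R m) i (a m) - y (R m) l (a m))) * (c * (y (R m) i (z m) - y (R m) l (z m))))
        \<longlonglongrightarrow> (c * (b i q - w l q)) * (c * (b i p' - w l p'))"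
      unfolding own' using IH[OF l(1)] R bd lima limz
      by (intro tendsto_intros driver'[OF i R]) (auto simp: conv_def)
    moreover have "(c * (b i q - w l q)) * (c * (b i p' - w l p')) < 0"
      using c(2) p'(3) by (rule mult_pos_neg)
    ultimately have "\<forall>\<^sub>F m in sequentially. (c * (y (R m) i (a m) - y (R m) l (a m))) * (c * (y (R m) i (z m) - y (R m) l (z m))) < 0"
      by (rule order_tendstoD)
    then obtain m where "(c * (y (R m) i (a m) - y (R m) l (a m))) * (c * (y (R m) i (z m) - y (R m) l (z m))) < 0"
      by (auto simp: eventually_sequentially)
    then have "(y (R m) i (a m) - y (R m) l (a m)) * (y (R m) i (z m) - y (R m) l (z m)) < 0"
      using c(1) by (auto simp: algebra_simps)
    then have "mg (R m) i l (z m)"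
      using bd[of m] N'[of m] by (intro mg_cross[OF i ln]) auto
    then show False using nomg[OF l(1) N'(4)] by blast
  qed
qed

text \<open>Induction on the coalescence order, along subsequences. If path \<open>i\<close> has not
  merged with an earlier one before the time in question, it follows its driver on the grid, and by
  \<open>meeting_detected\<close> the limit does so too. Otherwise it is carried along by the
  partner of its first merger, whose convergence is known by induction.\<close>

theorem paths_converge: "i < n \<Longrightarrow> conv i"
proof (induction i rule: less_induct)
  case (less i)
  note i = less.prems
  have IH: "conv l" if "l < i" for l using less that by auto
  show ?case unfolding conv_def
  proof (intro allI impI)
    fix r k u assume r: "strict_mono (r :: nat \<Rightarrow> nat)" and \<kappa>: "\<forall>m. \<kappa> (r m) i \<le> k m" and K: "\<forall>m. k m \<le> K (r m)"
      and lim: "(\<lambda>m. gt (r m) (k m)) \<longlonglongrightarrow> u"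
    have tu: "t i \<le> u"
      by (rule LIMSEQ_le[OF birth_subseq[OF i r] lim]) (use \<kappa> in \<open>auto simp: gt_le\<close>)
    show "(\<lambda>m. y (r m) i (k m)) \<longlonglongrightarrow> w i u"
    proof (rule LIMSEQ_subseqI)
      fix s :: "nat \<Rightarrow> nat" assume s: "strict_mono s"
      define P where "P m \<longleftrightarrow> (\<exists>k' l. k' < k (s m) \<and> l < i \<and> mg (r (s m)) i l k')" for m
      show "\<exists>s'. strict_mono s' \<and> (\<lambda>m. y (r (s (s' m))) i (k (s (s' m)))) \<longlonglongrightarrow> w i u"
      proof (cases "infinite {m. \<not> P m}")
        case True
        then obtain s' :: "nat \<Rightarrow> nat" where s': "strict_mono s'" "\<And>m. \<not> P (s' m)"
          using infinite_subseq by blast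
        define R where "R m = r (s (s' m))" for m
        define kk where "kk m = k (s (s' m))" for m
        have ss: "strict_mono (\<lambda>m. s (s' m))" using s s' by (auto simp: strict_mono_def)
        have R: "strict_mono R" using r s s' by (auto simp: strict_mono_def R_def)
        have bd: "\<kappa> (R m) i \<le> kk m" "kk m \<le> K (R m)" for m using \<kappa> K by (auto simp: R_def kk_def)
        have lim': "(\<lambda>m. gt (R m) (kk m)) \<longlonglongrightarrow> u"
          using LIMSEQ_subseq_LIMSEQ[OF lim ss] by (simp add: o_def R_def kk_def)
        have nomg: "\<not> mg (R m) i l k'" if "l < i" "k' < kk m" for m l k'
          using s'(2)[of m] that by (auto simp: R_def kk_def P_def)
        have "(\<lambda>m. own (R m) i (kk m)) \<longlonglongrightarrow> b i u" by (intro driver' i R bd lim')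
        moreover have "y (R m) i (kk m) = own (R m) i (kk m)" for m by (intro own i bd nomg)
        moreover have "w i u = b i u"
          using first_meeting[OF i tu] meeting_detected[OF i IH R bd(2) lim'] nomg by blast
        ultimately show ?thesis using s'(1) by (auto simp: R_def kk_def)
      next
        case False
        then have "infinite {m. P m}" by (metis finite_Collect_not infinite_UNIV_nat)
        then obtain s1 :: "nat \<Rightarrow> nat" where s1: "strict_mono s1" "\<And>m. P (s1 m)"
          using infinite_subseq by blast
        define v1 where "v1 m = (LEAST k'. \<exists>l<i. mg (r (s (s1 m))) i l k')" for m
        have ex: "\<exists>k'. \<exists>l<i. mg (r (s (s1 m))) i l k'" for m using s1(2)[of m] by (auto simp: P_def)
        have v1: "\<exists>l<i. mg (r (s (s1 m))) i l (v1 m)" for m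
          unfolding v1_def by (rule LeastI_ex[OF ex])
        have v1_less: "v1 m < k (s (s1 m))" for m
          using s1(2)[of m] unfolding P_def v1_def by (auto intro: le_less_trans[OF Least_le])
        have v1_min: "\<not> mg (r (s (s1 m))) i l k'" if "l < i" "k' < v1 m" for m l k'
          using not_less_Least[OF that(2)[unfolded v1_def]] that(1) by auto
        obtain l1 where l1: "\<And>m. l1 m < i" "\<And>m. mg (r (s (s1 m))) i (l1 m) (v1 m)" using v1 by metis
        \<comment> \<open>The partner of the first merger may vary with \<open>m\<close>; there are
          only finitely many candidates, so one of them occurs infinitely often.\<close>
        have "\<exists>l\<in>{..<i}. infinite {m \<in> UNIV. l1 m = l}"
          using l1(1) by (intro pigeonhole_infinite_rel) auto
        then obtain l where l: "l < i" "infinite {m. l1 m = l}" by auto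
        obtain s2 :: "nat \<Rightarrow> nat" where s2: "strict_mono s2" "\<And>m. l1 (s2 m) = l"
          using infinite_subseq[OF l(2)] by auto
        have ss: "strict_mono (\<lambda>m. s (s1 (s2 m)))" using s s1 s2 by (auto simp: strict_mono_def)
        have lim2: "(\<lambda>m. gt (r (s (s1 (s2 m)))) (k (s (s1 (s2 m))))) \<longlonglongrightarrow> u"
          using LIMSEQ_subseq_LIMSEQ[OF lim ss] by (simp add: o_def)
        then obtain C where C: "\<And>m. gt (r (s (s1 (s2 m)))) (k (s (s1 (s2 m)))) \<le> C"
          using convergent_imp_Bseq[OF convergentI[OF lim2]] unfolding Bseq_def real_norm_def
          by (meson abs_le_D1)
        have ss': "strict_mono (\<lambda>m. r (s (s1 (s2 m))))" using ss r by (auto simp: strict_mono_def)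
        obtain C' where C': "\<And>m. - C' \<le> gt (r (s (s1 (s2 m)))) (\<kappa> (r (s (s1 (s2 m)))) i)"
          using convergent_imp_Bseq[OF convergentI[OF birth_subseq[OF i ss']]] unfolding Bseq_def real_norm_def
          by (meson abs_le_D2 minus_le_iff)
        \<comment> \<open>The time of the first merger lies between the birth of \<open>i\<close>
          and the observed time, both convergent, so a further subsequence has a limiting merger
          time \<open>v\<close>.\<close>
        have "bounded (range (\<lambda>m. gt (r (s (s1 (s2 m)))) (v1 (s2 m))))"
        proof (rule boundedI)
          fix x assume "x \<in> range (\<lambda>m. gt (r (s (s1 (s2 m)))) (v1 (s2 m)))"
          then obtain m where x: "x = gt (r (s (s1 (s2 m)))) (v1 (s2 m))" by auto
          have "gt (r (s (s1 (s2 m)))) (v1 (s2 m)) \<le> gt (r (s (s1 (s2 m)))) (k (s (s1 (s2 m))))"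
            using v1_less[of "s2 m"] by (simp add: gt_le)
          moreover have "gt (r (s (s1 (s2 m)))) (\<kappa> (r (s (s1 (s2 m)))) i) \<le> x"
            unfolding x gt_le using mg_born[OF _ i l1(2)[of "s2 m"]] l1(1) by auto
          ultimately show "norm x \<le> max \<bar>C\<bar> \<bar>C'\<bar>" using C[of m] C'[of m] by (auto simp: x)
        qed
        then obtain v s3 where s3: "strict_mono (s3 :: nat \<Rightarrow> nat)"
           and "((\<lambda>m. gt (r (s (s1 (s2 m)))) (v1 (s2 m))) \<circ> s3) \<longlonglongrightarrow> v"
          using bounded_imp_convergent_subsequence by blast
        then have limv: "(\<lambda>m. gt (r (s (s1 (s2 (s3 m))))) (v1 (s2 (s3 m)))) \<longlonglongrightarrow> v" by (simp add: o_def)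
        define s' where "s' m = s1 (s2 (s3 m))" for m
        define R where "R m = r (s (s' m))" for m
        define kk where "kk m = k (s (s' m))" for m
        define vv where "vv m = v1 (s2 (s3 m))" for m
        have s': "strict_mono s'" using s1 s2 s3 by (auto simp: strict_mono_def s'_def)
        have R: "strict_mono R" using r s s' by (auto simp: strict_mono_def R_def)
        have ln: "l < n" using l i by simp
        have limk: "(\<lambda>m. gt (R m) (kk m)) \<longlonglongrightarrow> u"
          using LIMSEQ_subseq_LIMSEQ[OF lim2 s3] by (simp add: o_def R_def kk_def s'_def)
        have limv': "(\<lambda>m. gt (R m) (vv m)) \<longlonglongrightarrow> v" using limv by (simp add: R_def vv_def s'_def)
        have mg: "mg (R m) i l (vv m)" for m
          using l1(2)[of "s2 (s3 m)"] s2(2)[of "s3 m"] by (simp add: R_def vv_def s'_def)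
        have nomg: "\<not> mg (R m) i l' k'" if "l' < i" "k' < vv m" for m l' k'
          using v1_min[of l' k' "s2 (s3 m)"] that by (simp add: R_def vv_def s'_def)
        have vk: "vv m < kk m" for m
          using v1_less[of "s2 (s3 m)"] by (simp add: kk_def vv_def s'_def)
        have kK: "kk m \<le> K (R m)" for m using K by (auto simp: R_def kk_def)
        have vK: "vv m \<le> K (R m)" for m using kK[of m] vk[of m] by simp
        have born: "\<kappa> (R m) i \<le> vv m" "\<kappa> (R m) l \<le> vv m" for m
          using mg_born[OF l(1) i mg[of m]] by auto
        have born': "\<kappa> (R m) l \<le> kk m" for m using born(2)[of m] vk[of m] by simp
        have tv: "t i \<le> v" "t l \<le> v"
          using LIMSEQ_le[OF birth_subseq[OF i R] limv'] LIMSEQ_le[OF birth_subseq[OF ln R] limv'] born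
          by (auto simp: gt_le)
        have vu: "v \<le> u" by (rule LIMSEQ_le[OF limv' limk]) (use vk in \<open>auto simp: gt_le less_imp_le\<close>)
        \<comment> \<open>A meeting of the limits strictly before \<open>v\<close> would have
          produced a merger before the first one.\<close>
        have wb: "w i v = b i v"
          using first_meeting[OF i tv(1)] meeting_detected[OF i IH R vK limv'] nomg by blast
        have \<eta>R: "(\<lambda>m. \<eta> (R m)) \<longlonglongrightarrow> 0" using LIMSEQ_subseq_LIMSEQ[OF \<eta>_lim R] by (simp add: o_def)
        have close: "(\<lambda>m. y (R m) i (a m) - y (R m) l (a m)) \<longlonglongrightarrow> 0"
          if "\<And>m. vv m \<le> a m" "\<And>m. a m \<le> K (R m)" for a
          by (rule Lim_null_comparison[OF _ \<eta>R]) (use mg_close[OF i ln mg] that in auto)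
        have yi: "(\<lambda>m. y (R m) i (vv m)) \<longlonglongrightarrow> b i v"
          using driver'[OF i R born(1) vK limv'] own[OF i born(1) vK nomg] by simp
        have yl: "(\<lambda>m. y (R m) l (vv m)) \<longlonglongrightarrow> w l v"
          using IH[OF l(1)] R born(2) vK limv' by (auto simp: conv_def)
        have "b i v - w l v = 0"
          by (rule LIMSEQ_unique[OF tendsto_diff[OF yi yl] close]) (auto simp: vK)
        then have "w i u = w l u" using coal[OF i ln tv vu] wb by simp
        moreover have "(\<lambda>m. y (R m) l (kk m)) \<longlonglongrightarrow> w l u"
          using IH[OF l(1)] R born' kK limk by (auto simp: conv_def)
        from tendsto_add[OF this close[of kk]] have "(\<lambda>m. y (R m) i (kk m)) \<longlonglongrightarrow> w l u"
          using vk kK by (simp add: less_imp_le)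
        ultimately show ?thesis using s' by (auto simp: R_def kk_def)
      qed
    qed
  qed
qed

end

section \<open>Exchanging the leaders of clusters\<close>

text \<open>The pairs in \<open>R\<close> are the edges of a graph on the particles;
  \<open>sel\<close> picks one vertex in each connected component.\<close>

definition valid_sel :: "nat \<Rightarrow> ((nat \<times> nat) set \<Rightarrow> nat \<Rightarrow> nat) \<Rightarrow> bool" where
  "valid_sel J sel \<longleftrightarrow> (\<forall>R i. R \<subseteq> {..<J} \<times> {..<J} \<longrightarrow> sym R \<longrightarrow> i < J \<longrightarrow>
     (i, sel R i) \<in> R\<^sup>* \<and> (\<forall>l. (i, l) \<in> R\<^sup>* \<longrightarrow> sel R l = sel R i))"

text \<open>For the identity as \<open>\<rho>\<close> the leader is the particle of smallest index,
  as in the coalescence rule. Other rankings allow a chosen family of particles to lead all the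
  rest.\<close>

definition rank_sel :: "(nat \<Rightarrow> nat) \<Rightarrow> (nat \<times> nat) set \<Rightarrow> nat \<Rightarrow> nat" where
  "rank_sel \<rho> R i = arg_min \<rho> (\<lambda>l. (i, l) \<in> R\<^sup>*)"

lemma rank_sel_in: "(i, rank_sel \<rho> R i) \<in> R\<^sup>*"
  unfolding rank_sel_def by (rule arg_min_natI[of _ i]) simp

lemma rank_sel_le: "(i, l) \<in> R\<^sup>* \<Longrightarrow> \<rho> (rank_sel \<rho> R i) \<le> \<rho> l"
  unfolding rank_sel_def by (rule arg_min_nat_le)

lemma valid_rank_sel: "valid_sel J (rank_sel \<rho>)"
  unfolding valid_sel_def
proof (intro allI impI conjI rank_sel_in)
  fix R :: "(nat \<times> nat) set" and i l assume "sym R" and il: "(i, l) \<in> R\<^sup>*"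
  then have "(l, i) \<in> R\<^sup>*" by (meson sym_rtrancl symD)
  then have "(\<lambda>j. (l, j) \<in> R\<^sup>*) = (\<lambda>j. (i, j) \<in> R\<^sup>*)" using il by (auto intro: rtrancl_trans)
  then show "rank_sel \<rho> R l = rank_sel \<rho> R i" by (simp add: rank_sel_def)
qed

text \<open>\<open>J\<close> random walks on a time grid, walk \<open>i\<close> being born at step \<open>\<kappa> i\<close>. Two walks are glued by the relation when their difference
  changes sign; afterwards they no longer coincide, but all walks of a cluster move by the increments of its leader, chosen
  by \<open>sel\<close>.\<close>

primrec chain :: "nat \<Rightarrow> (nat \<Rightarrow> nat) \<Rightarrow> (nat \<Rightarrow> real) \<Rightarrow> ((nat \<times> nat) set \<Rightarrow> nat \<Rightarrow> nat) \<Rightarrow>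
    (nat \<times> nat \<Rightarrow> real) \<Rightarrow> nat \<Rightarrow> (nat \<Rightarrow> real) \<times> (nat \<times> nat) set" where
  "chain J \<kappa> \<xi> sel \<zeta> 0 = (\<xi>, {})"
| "chain J \<kappa> \<xi> sel \<zeta> (Suc k) =
    (let y = fst (chain J \<kappa> \<xi> sel \<zeta> k); R = snd (chain J \<kappa> \<xi> sel \<zeta> k);
         y' = (\<lambda>i. if i < J \<and> \<kappa> i \<le> k then y i + \<zeta> (sel R i, k) else y i)
     in (y', R \<union> {(i, l). i < J \<and> l < J \<and> i \<noteq> l \<and> \<kappa> i \<le> k \<and> \<kappa> l \<le> k \<and> (y i - y l) * (y' i - y' l) \<le> 0}))"

abbreviation "pos J \<kappa> \<xi> sel \<zeta> k \<equiv> fst (chain J \<kappa> \<xi> sel \<zeta> k)"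
abbreviation "rel J \<kappa> \<xi> sel \<zeta> k \<equiv> snd (chain J \<kappa> \<xi> sel \<zeta> k)"

lemma pos_Suc: "pos J \<kappa> \<xi> sel \<zeta> (Suc k) i = (if i < J \<and> \<kappa> i \<le> k then pos J \<kappa> \<xi> sel \<zeta> k i + \<zeta> (sel (rel J \<kappa> \<xi> sel \<zeta> k) i, k)
    else pos J \<kappa> \<xi> sel \<zeta> k i)"
  by (simp add: Let_def)

lemma rel_Suc: "(i, l) \<in> rel J \<kappa> \<xi> sel \<zeta> (Suc k) \<longleftrightarrow> (i, l) \<in> rel J \<kappa> \<xi> sel \<zeta> k \<or>
   i < J \<and> l < J \<and> i \<noteq> l \<and> \<kappa> i \<le> k \<and> \<kappa> l \<le> k \<and>
    (pos J \<kappa> \<xi> sel \<zeta> k i - pos J \<kappa> \<xi> sel \<zeta> k l) * (pos J \<kappa> \<xi> sel \<zeta> (Suc k) i - pos J \<kappa> \<xi> sel \<zeta> (Suc k) l) \<le> 0"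
  by (simp add: Let_def)

declare chain.simps(2) [simp del]

lemma rel_subset: "rel J \<kappa> \<xi> sel \<zeta> k \<subseteq> {..<J} \<times> {..<J}"
  by (induction k) (auto simp: rel_Suc)

lemma rel_finite: "finite (rel J \<kappa> \<xi> sel \<zeta> k)"
  by (rule finite_subset[OF rel_subset]) simp

lemma rel_sym: "sym (rel J \<kappa> \<xi> sel \<zeta> k)"
proof (induction k)
  case (Suc k)
  then show ?case by (auto simp: sym_def rel_Suc algebra_simps)
qed (simp add: sym_def)

lemma rel_mono: "k \<le> k' \<Longrightarrow> rel J \<kappa> \<xi> sel \<zeta> k \<subseteq> rel J \<kappa> \<xi> sel \<zeta> k'"
proof (induction k' rule: dec_induct)
  case (step k') then show ?case by (auto simp: rel_Suc)
qed simp

lemma rel_born: "(i, l) \<in> rel J \<kappa> \<xi> sel \<zeta> k \<Longrightarrow> \<kappa> i < k \<and> \<kappa> l < k"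
  by (induction k) (auto simp: rel_Suc)

lemma rtrancl_rel_born: "(i, l) \<in> (rel J \<kappa> \<xi> sel \<zeta> k)\<^sup>* \<Longrightarrow> i \<noteq> l \<Longrightarrow> \<kappa> i < k \<and> \<kappa> l < k"
  by (meson converse_rtranclE rel_born rtranclE)

lemma rtrancl_rel_less: "(i, l) \<in> (rel J \<kappa> \<xi> sel \<zeta> k)\<^sup>* \<Longrightarrow> i < J \<Longrightarrow> l < J"
proof (induction rule: rtrancl_induct)
  case (step y z)
  then show ?case using rel_subset[of J \<kappa> \<xi> sel \<zeta> k] by blast
qed simp

lemma sel_rel:
  assumes "valid_sel J sel" "i < J"
  shows "(i, sel (rel J \<kappa> \<xi> s \<zeta> k) i) \<in> (rel J \<kappa> \<xi> s \<zeta> k)\<^sup>*"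
    and "(i, l) \<in> (rel J \<kappa> \<xi> s \<zeta> k)\<^sup>* \<Longrightarrow> sel (rel J \<kappa> \<xi> s \<zeta> k) l = sel (rel J \<kappa> \<xi> s \<zeta> k) i"
    and "sel (rel J \<kappa> \<xi> s \<zeta> k) i < J"
proof -
  show *: "(i, sel (rel J \<kappa> \<xi> s \<zeta> k) i) \<in> (rel J \<kappa> \<xi> s \<zeta> k)\<^sup>*"
    and "(i, l) \<in> (rel J \<kappa> \<xi> s \<zeta> k)\<^sup>* \<Longrightarrow> sel (rel J \<kappa> \<xi> s \<zeta> k) l = sel (rel J \<kappa> \<xi> s \<zeta> k) i"
    using assms(1)[unfolded valid_sel_def, rule_format, OF rel_subset rel_sym assms(2)] by blast+
  show "sel (rel J \<kappa> \<xi> s \<zeta> k) i < J" using rtrancl_rel_less[OF *] assms by simp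
qed

text \<open>At the step that glues a pair the difference does not keep its sign, hence is at most
  the change in that step. Afterwards both walks use the same leader and the difference is
  frozen.\<close>

lemma rel_close:
  assumes sel: "valid_sel J sel" and e: "\<And>a k'. a < J \<Longrightarrow> k' < k \<Longrightarrow> \<bar>\<zeta> (a, k')\<bar> \<le> e"
    and "(i, l) \<in> rel J \<kappa> \<xi> sel \<zeta> k"
  shows "\<bar>pos J \<kappa> \<xi> sel \<zeta> k i - pos J \<kappa> \<xi> sel \<zeta> k l\<bar> \<le> 2 * e"
  using e assms(3)
proof (induction k)
  case (Suc k)
  have il: "i < J" "l < J" using Suc.prems rel_subset by blast+
  have \<kappa>: "\<kappa> i \<le> k" "\<kappa> l \<le> k" using rel_born[OF Suc.prems(2)] by auto
  show ?case
  proof (cases "(i, l) \<in> rel J \<kappa> \<xi> sel \<zeta> k")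
    case True
    then have "sel (rel J \<kappa> \<xi> sel \<zeta> k) l = sel (rel J \<kappa> \<xi> sel \<zeta> k) i"
      by (intro sel_rel(2)[OF sel il(1)]) auto
    then show ?thesis using Suc.IH True Suc.prems(1) il \<kappa> by (simp add: pos_Suc)
  next
    case False
    let ?d = "pos J \<kappa> \<xi> sel \<zeta> k i - pos J \<kappa> \<xi> sel \<zeta> k l"
    let ?d' = "pos J \<kappa> \<xi> sel \<zeta> (Suc k) i - pos J \<kappa> \<xi> sel \<zeta> (Suc k) l"
    have p: "?d * ?d' \<le> 0" using False Suc.prems(2) by (auto simp: rel_Suc)
    have "\<bar>?d' - ?d\<bar> \<le> 2 * e"
      using Suc.prems(1)[of "sel (rel J \<kappa> \<xi> sel \<zeta> k) i" k] Suc.prems(1)[of "sel (rel J \<kappa> \<xi> sel \<zeta> k) l" k]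
        sel_rel(3)[OF sel] il \<kappa> by (simp add: pos_Suc)
    moreover have "\<bar>?d'\<bar> \<le> \<bar>?d' - ?d\<bar>" using p by (auto simp: mult_le_0_iff)
    ultimately show ?thesis by linarith
  qed
qed simp

text \<open>Members of one cluster are joined by a chain of directly glued pairs; the crude bound on
  its length is the number of possible pairs.\<close>

lemma rtrancl_rel_close:
  assumes sel: "valid_sel J sel" and e: "\<And>a k'. a < J \<Longrightarrow> k' < k \<Longrightarrow> \<bar>\<zeta> (a, k')\<bar> \<le> e" "0 \<le> e"
    and "(i, l) \<in> (rel J \<kappa> \<xi> sel \<zeta> k)\<^sup>*"
  shows "\<bar>pos J \<kappa> \<xi> sel \<zeta> k i - pos J \<kappa> \<xi> sel \<zeta> k l\<bar> \<le> 2 * (real J * real J) * e"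
proof -
  let ?R = "rel J \<kappa> \<xi> sel \<zeta> k"
  have pow: "\<bar>pos J \<kappa> \<xi> sel \<zeta> k i - pos J \<kappa> \<xi> sel \<zeta> k l\<bar> \<le> 2 * real p * e" if "(i, l) \<in> ?R ^^ p" for p l
    using that
  proof (induction p arbitrary: l)
    case (Suc p)
    then obtain j where "(i, j) \<in> ?R ^^ p" "(j, l) \<in> ?R" by auto
    then show ?case using Suc.IH[of j] rel_close[where \<zeta>=\<zeta> and k=k and e=e and i=j and l=l and \<kappa>=\<kappa> and \<xi>=\<xi>, OF sel e(1)] by (auto simp: algebra_simps)
  qed simp
  obtain p where p: "(i, l) \<in> ?R ^^ p" "p \<le> card ?R"
    using assms(4) rtrancl_finite_eq_relpow[OF rel_finite] by fastforce
  have "card ?R \<le> J * J" using card_mono[OF _ rel_subset] by (auto simp: card_cartesian_product)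
  then have "real p \<le> real J * real J" using p(2) by (metis le_trans of_nat_le_iff of_nat_mult)
  then show ?thesis using pow[OF p(1)] e(2)
    by (smt (verit) mult_right_mono)
qed

lemma rel_cross:
  assumes "i < J" "l < J" "\<kappa> i \<le> k" "\<kappa> l \<le> k" "k < k'"
    and "(pos J \<kappa> \<xi> sel \<zeta> k i - pos J \<kappa> \<xi> sel \<zeta> k l) * (pos J \<kappa> \<xi> sel \<zeta> k' i - pos J \<kappa> \<xi> sel \<zeta> k' l) < 0"
  shows "(i, l) \<in> rel J \<kappa> \<xi> sel \<zeta> k'"
proof (rule ccontr)
  assume neg: "(i, l) \<notin> rel J \<kappa> \<xi> sel \<zeta> k'"
  let ?d = "\<lambda>k. pos J \<kappa> \<xi> sel \<zeta> k i - pos J \<kappa> \<xi> sel \<zeta> k l"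
  have il: "i \<noteq> l" using assms(6) by auto
  have step: "?d m * ?d (Suc m) > 0" if "k \<le> m" "m < k'" for m
  proof -
    have "(i, l) \<notin> rel J \<kappa> \<xi> sel \<zeta> (Suc m)" using neg rel_mono[of "Suc m" k' J \<kappa> \<xi> sel \<zeta>] that by auto
    then show ?thesis using assms that il by (auto simp: rel_Suc)
  qed
  have "m \<le> k' \<longrightarrow> ?d k * ?d m > 0" if "k \<le> m" for m
    using that
  proof (induction m rule: dec_induct)
    case base
    then show ?case using assms(6) by (auto simp: zero_less_mult_iff mult_less_0_iff)
  next
    case (step m)
    then show ?case using \<open>\<And>m. k \<le> m \<Longrightarrow> m < k' \<Longrightarrow> ?d m * ?d (Suc m) > 0\<close>[of m] by (auto simp: zero_less_mult_iff)
  qed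
  from this[of k'] show False using assms(5,6) by simp
qed

lemma pos_own:
  assumes "i < J" "\<kappa> i \<le> k" "\<And>k'. k' < k \<Longrightarrow> sel (rel J \<kappa> \<xi> sel \<zeta> k') i = i"
  shows "pos J \<kappa> \<xi> sel \<zeta> k i = \<xi> i + (\<Sum>k'=\<kappa> i..<k. \<zeta> (i, k'))"
proof -
  have "pos J \<kappa> \<xi> sel \<zeta> k i = (if \<kappa> i \<le> k then \<xi> i + (\<Sum>k'=\<kappa> i..<k. \<zeta> (i, k')) else \<xi> i)"
    using assms(3)
  proof (induction k)
    case (Suc k)
    then show ?case using assms(1) by (auto simp: pos_Suc not_le less_Suc_eq_le)
  qed auto
  then show ?thesis using assms(2) by simp
qed

text \<open>The chain is non-anticipating: its state at step \<open>k\<close> is a function of the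
  increments before \<open>k\<close>. This is what makes a permutation of the increments at step
  \<open>k\<close>, chosen from that state, harmless for their law.\<close>

lemma chain_cong:
  assumes "valid_sel J sel" "\<And>a k'. a < J \<Longrightarrow> k' < k \<Longrightarrow> \<zeta> (a, k') = \<zeta>' (a, k')"
  shows "chain J \<kappa> \<xi> sel \<zeta> k = chain J \<kappa> \<xi> sel \<zeta>' k"
  using assms(2)
proof (induction k)
  case (Suc k)
  have IH: "chain J \<kappa> \<xi> sel \<zeta> k = chain J \<kappa> \<xi> sel \<zeta>' k" using Suc by auto
  have "pos J \<kappa> \<xi> sel \<zeta> (Suc k) = pos J \<kappa> \<xi> sel \<zeta>' (Suc k)"
    using Suc.prems sel_rel(3)[OF assms(1)] by (auto simp: pos_Suc IH fun_eq_iff)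
  then show ?case by (auto simp: prod_eq_iff rel_Suc IH)
qed simp

text \<open>In each cluster this is the transposition of the two leaders, so that altogether it is
  an involution of the particles determined by the past.\<close>

definition swap_sel :: "((nat \<times> nat) set \<Rightarrow> nat \<Rightarrow> nat) \<Rightarrow> ((nat \<times> nat) set \<Rightarrow> nat \<Rightarrow> nat) \<Rightarrow> (nat \<times> nat) set \<Rightarrow> nat \<Rightarrow> nat" where
  "swap_sel s s' R a = (if a = s R a then s' R a else if a = s' R a then s R a else a)"

lemma swap_sel:
  assumes v: "valid_sel J s" "valid_sel J s'" and R: "R \<subseteq> {..<J} \<times> {..<J}" "sym R" and a: "a < J"
  shows "swap_sel s s' R (swap_sel s s' R a) = a" "swap_sel s s' R a < J" "swap_sel s s' R (s R a) = s' R a"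
proof -
  have less: "l < J" if "(i, l) \<in> R\<^sup>*" "i < J" for i l
    using that R(1) by (induction rule: rtrancl_induct) blast+
  have 1: "(a, s R a) \<in> R\<^sup>*" "(a, s' R a) \<in> R\<^sup>*" "\<And>l. (a, l) \<in> R\<^sup>* \<Longrightarrow> s R l = s R a \<and> s' R l = s' R a"
    using v R a unfolding valid_sel_def by blast+
  show "swap_sel s s' R a < J" using less[OF 1(1) a] less[OF 1(2) a] a by (auto simp: swap_sel_def)
  show "swap_sel s s' R (s R a) = s' R a" "swap_sel s s' R (swap_sel s s' R a) = a"
    using 1(3)[OF 1(1)] 1(3)[OF 1(2)] by (auto simp: swap_sel_def)
qed

definition exchange :: "nat \<Rightarrow> (nat \<Rightarrow> nat) \<Rightarrow> (nat \<Rightarrow> real) \<Rightarrow> ((nat \<times> nat) set \<Rightarrow> nat \<Rightarrow> nat) \<Rightarrow> ((nat \<times> nat) set \<Rightarrow> nat \<Rightarrow> nat) \<Rightarrow>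
    nat \<Rightarrow> (nat \<times> nat \<Rightarrow> real) \<Rightarrow> (nat \<times> nat \<Rightarrow> real)" where
  "exchange J \<kappa> \<xi> s s' K \<zeta> = (\<lambda>(a, k)\<in>{..<J} \<times> {..<K}. \<zeta> (swap_sel s s' (rel J \<kappa> \<xi> s' \<zeta> k) a, k))"

text \<open>Under \<open>s\<close> the leader of a cluster receives exactly the increment that the
  leader under \<open>s'\<close> would have used. All positions then move alike, and inductively the
  two chains have the same clusters.\<close>

lemma chain_exchange:
  assumes v: "valid_sel J s" "valid_sel J s'" and "k \<le> K"
  shows "chain J \<kappa> \<xi> s (exchange J \<kappa> \<xi> s s' K \<zeta>) k = chain J \<kappa> \<xi> s' \<zeta> k"
  using assms(3)
proof (induction k)
  case (Suc k)
  let ?e = "exchange J \<kappa> \<xi> s s' K \<zeta>"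
  have IH: "chain J \<kappa> \<xi> s ?e k = chain J \<kappa> \<xi> s' \<zeta> k" using Suc by auto
  have "?e (s (rel J \<kappa> \<xi> s' \<zeta> k) i, k) = \<zeta> (s' (rel J \<kappa> \<xi> s' \<zeta> k) i, k)" if "i < J" for i
    using that Suc.prems sel_rel(3)[OF v(1) that] by (simp add: exchange_def swap_sel(3)[OF v rel_subset rel_sym that])
  then have "pos J \<kappa> \<xi> s ?e (Suc k) = pos J \<kappa> \<xi> s' \<zeta> (Suc k)"
    by (auto simp: pos_Suc IH fun_eq_iff)
  then show ?case by (auto simp: prod_eq_iff rel_Suc IH)
qed simp

section \<open>Measurability of the chain and invariance of the i.i.d. law\<close>

context
  fixes N :: "real measure" and J :: nat
  assumes N: "prob_space N" "sets N = sets borel"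
begin

text \<open>The relation takes finitely many values. Treating it as a discrete random element makes
  the increment of the randomly chosen leader measurable, and so the three claims are proved in one
  induction.\<close>

lemma chain_measurable:
  assumes v: "valid_sel J s" and "k \<le> K"
  shows "(\<lambda>\<zeta>. pos J \<kappa> \<xi> s \<zeta> k i) \<in> borel_measurable (PiM ({..<J} \<times> {..<K}) (\<lambda>_. N)) \<and>
    Measurable.pred (PiM ({..<J} \<times> {..<K}) (\<lambda>_. N)) (\<lambda>\<zeta>. p \<in> rel J \<kappa> \<xi> s \<zeta> k) \<and>
    (\<lambda>\<zeta>. rel J \<kappa> \<xi> s \<zeta> k) \<in> measurable (PiM ({..<J} \<times> {..<K}) (\<lambda>_. N)) (count_space (Pow ({..<J} \<times> {..<J})))"
  using assms(2)
proof (induction k arbitrary: i p)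
  case 0
  then show ?case by simp
next
  case (Suc k)
  let ?M = "PiM ({..<J} \<times> {..<K}) (\<lambda>_. N)"
  note IH = Suc.IH[OF Suc_leD[OF Suc.prems]]
  have [measurable]: "(\<lambda>\<zeta>. pos J \<kappa> \<xi> s \<zeta> k i) \<in> borel_measurable ?M" for i using IH by blast
  have [measurable]: "Measurable.pred ?M (\<lambda>\<zeta>. p \<in> rel J \<kappa> \<xi> s \<zeta> k)" for p using IH by blast
  have R: "(\<lambda>\<zeta>. rel J \<kappa> \<xi> s \<zeta> k) \<in> measurable ?M (count_space (Pow ({..<J} \<times> {..<J})))" using IH by blast
  have comp: "(\<lambda>\<zeta>. \<zeta> (a, k)) \<in> borel_measurable ?M" for a
  proof (cases "a < J")
    case True
    then have "(\<lambda>\<zeta>. \<zeta> (a, k)) \<in> measurable ?M N" using Suc.prems by (intro measurable_component_singleton) auto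
    then show ?thesis by (simp cong: measurable_cong_sets add: N(2))
  next
    \<comment> \<open>For an index outside the product the coordinate is \<open>undefined\<close>, a
      constant.\<close>
    case False
    have "(\<lambda>\<zeta>. \<zeta> (a, k)) \<in> borel_measurable ?M \<longleftrightarrow> (\<lambda>\<zeta>. undefined :: real) \<in> borel_measurable ?M"
      using False by (intro measurable_cong) (auto simp: space_PiM PiE_def extensional_def)
    then show ?thesis by simp
  qed
  have "(\<lambda>\<zeta>. \<zeta> (s (rel J \<kappa> \<xi> s \<zeta> k) i, k)) \<in> borel_measurable ?M" for i
    by (rule measurable_compose_countable'[OF comp R]) (auto intro: countable_finite)
  then have pos: "(\<lambda>\<zeta>. pos J \<kappa> \<xi> s \<zeta> (Suc k) i) \<in> borel_measurable ?M" for i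
    unfolding pos_Suc by simp
  note pos [measurable]
  have pred: "Measurable.pred ?M (\<lambda>\<zeta>. p \<in> rel J \<kappa> \<xi> s \<zeta> (Suc k))" for p
    by (cases p) (simp only: rel_Suc, measurable)
  note pred [measurable]
  have "(\<lambda>\<zeta>. rel J \<kappa> \<xi> s \<zeta> (Suc k)) \<in> measurable ?M (count_space (Pow ({..<J} \<times> {..<J})))"
  proof (subst measurable_count_space_eq_countable, safe)
    fix A
    have "(\<lambda>\<zeta>. rel J \<kappa> \<xi> s \<zeta> (Suc k)) -` {A} \<inter> space ?M =
      {\<zeta>\<in>space ?M. (\<forall>p\<in>{..<J} \<times> {..<J}. p \<in> rel J \<kappa> \<xi> s \<zeta> (Suc k) \<longleftrightarrow> p \<in> A) \<and> A \<subseteq> {..<J} \<times> {..<J}}"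
      using rel_subset by (fastforce simp: set_eq_iff)
    also have "\<dots> \<in> sets ?M" by measurable
    finally show "(\<lambda>\<zeta>. rel J \<kappa> \<xi> s \<zeta> (Suc k)) -` {A} \<inter> space ?M \<in> sets ?M" .
  qed (auto intro: countable_finite dest!: rel_subset[THEN subsetD])
  then show ?case using pos pred by blast
qed

lemma exchange_measurable:
  assumes v: "valid_sel J s" "valid_sel J s'"
  shows "exchange J \<kappa> \<xi> s s' K \<in> measurable (PiM ({..<J} \<times> {..<K}) (\<lambda>_. N)) (PiM ({..<J} \<times> {..<K}) (\<lambda>_. N))"
proof -
  let ?M = "PiM ({..<J} \<times> {..<K}) (\<lambda>_. N)"
  have "(\<lambda>\<zeta>. \<zeta> (swap_sel s s' (rel J \<kappa> \<xi> s' \<zeta> k) a, k)) \<in> measurable ?M N" if "a < J" "k < K" for a k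
  proof (rule measurable_compose_countable'[where f="\<lambda>R \<zeta>. \<zeta> (swap_sel s s' R a, k)" and I="{R\<in>Pow ({..<J} \<times> {..<J}). sym R}"])
    show "(\<lambda>\<zeta>. rel J \<kappa> \<xi> s' \<zeta> k) \<in> measurable ?M (count_space {R\<in>Pow ({..<J} \<times> {..<J}). sym R})"
    proof (subst measurable_count_space_eq_countable, safe)
      have R: "(\<lambda>\<zeta>. rel J \<kappa> \<xi> s' \<zeta> k) \<in> measurable ?M (count_space (Pow ({..<J} \<times> {..<J})))"
        using chain_measurable[OF v(2), of k K] that by auto
      fix A :: "(nat \<times> nat) set" assume "A \<subseteq> {..<J} \<times> {..<J}"
      then show "(\<lambda>\<zeta>. rel J \<kappa> \<xi> s' \<zeta> k) -` {A} \<inter> space ?M \<in> sets ?M"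
        by (intro measurable_sets[OF R]) auto
    qed (auto intro: countable_finite rel_sym dest!: rel_subset[THEN subsetD])
    show "(\<lambda>\<zeta>. \<zeta> (swap_sel s s' R a, k)) \<in> measurable ?M N" if "R \<in> {R\<in>Pow ({..<J} \<times> {..<J}). sym R}" for R
      using that swap_sel(2)[OF v, of R a] \<open>a < J\<close> \<open>k < K\<close> by (intro measurable_component_singleton) auto
  qed (auto intro: countable_finite)
  then show ?thesis unfolding exchange_def by (intro measurable_restrict) auto
qed

text \<open>The last step is integrated first. For fixed earlier increments the exchange acts on it
  as a fixed permutation of i.i.d. coordinates, which preserves the product measure; the earlier
  steps are covered by induction.\<close>

lemma nn_integral_exchange:
  assumes v: "valid_sel J s" "valid_sel J s'"
    and F: "F \<in> borel_measurable (PiM ({..<J} \<times> {..<K}) (\<lambda>_. N))"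
  shows "(\<integral>\<^sup>+\<zeta>. F (exchange J \<kappa> \<xi> s s' K \<zeta>) \<partial>PiM ({..<J} \<times> {..<K}) (\<lambda>_. N)) = (\<integral>\<^sup>+\<zeta>. F \<zeta> \<partial>PiM ({..<J} \<times> {..<K}) (\<lambda>_. N))"
  using F
proof (induction K arbitrary: F)
  case 0
  have "exchange J \<kappa> \<xi> s s' 0 \<zeta> = \<zeta>" if "\<zeta> \<in> space (PiM {} (\<lambda>_. N))" for \<zeta>
    using that by (auto simp: exchange_def space_PiM)
  then show ?case by (intro nn_integral_cong) simp
next
  case (Suc K)
  interpret product_prob_space "\<lambda>_::nat\<times>nat. N" UNIV
    using N(1) by (auto simp: product_prob_space_def product_prob_space_axioms_def product_sigma_finite_def prob_space_imp_sigma_finite)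
  let ?I = "{..<J} \<times> {..<K}" and ?L = "{..<J} \<times> {K}"
  let ?MI = "PiM ?I (\<lambda>_. N)" and ?MV = "PiM ?L (\<lambda>_. N)"
  have IL: "{..<J} \<times> {..<Suc K} = ?I \<union> ?L" "?I \<inter> ?L = {}" by (auto simp: less_Suc_eq)
  note F = Suc.prems[unfolded IL(1)]
  define rot where "rot R = (\<lambda>p::nat\<times>nat. (swap_sel s s' R (fst p), snd p))" for R
  have rot: "distr ?MV ?MV (\<lambda>y. \<lambda>p\<in>?L. y (rot R p)) = ?MV" if "R \<subseteq> {..<J} \<times> {..<J}" "sym R" for R
  proof (rule distr_PiM_reindex)
    show "inj_on (rot R) ?L"
    proof (rule inj_onI)
      fix x y assume "x \<in> ?L" "y \<in> ?L" "rot R x = rot R y"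
      then show "x = y" using swap_sel(1)[OF v that, of "fst x"] swap_sel(1)[OF v that, of "fst y"]
        by (auto simp: rot_def)
    qed
    show "rot R \<in> ?L \<rightarrow> ?L" using swap_sel(2)[OF v that] by (auto simp: rot_def)
  qed (use N in auto)
  have rel_merge: "rel J \<kappa> \<xi> s' (merge ?I ?L (x, y)) k = rel J \<kappa> \<xi> s' x k" if "k \<le> K" for x y k
    by (subst chain_cong[OF v(2)]) (use that in \<open>auto simp: merge_def\<close>)
  have mI: "merge ?I ?L (x, y) (a, k) = x (a, k)" if "a < J" "k < K" for x y a k
    using that by (simp add: merge_def)
  have mL: "merge ?I ?L (x, y) (a, K) = y (a, K)" if "a < J" for x y a
    using that by (simp add: merge_def)
  have ex: "exchange J \<kappa> \<xi> s s' (Suc K) (merge ?I ?L (x, y)) =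
      merge ?I ?L (exchange J \<kappa> \<xi> s s' K x, \<lambda>p\<in>?L. y (rot (rel J \<kappa> \<xi> s' x K) p))" for x y
  proof
    fix p
    consider (I) "p \<in> ?I" | (L) "p \<in> ?L" | (O) "p \<notin> ?I \<union> ?L" by blast
    then show "exchange J \<kappa> \<xi> s s' (Suc K) (merge ?I ?L (x, y)) p =
      merge ?I ?L (exchange J \<kappa> \<xi> s s' K x, \<lambda>p\<in>?L. y (rot (rel J \<kappa> \<xi> s' x K) p)) p"
    proof cases
      case I
      then obtain a k where p: "p = (a, k)" "a < J" "k < K" by auto
      then show ?thesis using swap_sel(2)[OF v rel_subset rel_sym p(2)]
        by (simp add: exchange_def rel_merge mI)
    next
      case L
      then obtain a where p: "p = (a, K)" "a < J" by auto
      then show ?thesis using swap_sel(2)[OF v rel_subset rel_sym p(2)]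
        by (simp add: exchange_def rel_merge mL rot_def)
    next
      case O
      then show ?thesis unfolding IL(1)[symmetric] by (auto simp: exchange_def merge_def)
    qed
  qed
  have Fm: "(\<lambda>y. F (merge ?I ?L (x, y))) \<in> borel_measurable ?MV" if "x \<in> space ?MI" for x
    using measurable_compose[OF measurable_Pair1'[OF that] measurable_compose[OF measurable_merge F]] by simp
  have "(\<integral>\<^sup>+\<zeta>. F (exchange J \<kappa> \<xi> s s' (Suc K) \<zeta>) \<partial>PiM (?I \<union> ?L) (\<lambda>_. N)) =
     (\<integral>\<^sup>+x. (\<integral>\<^sup>+y. F (exchange J \<kappa> \<xi> s s' (Suc K) (merge ?I ?L (x, y))) \<partial>?MV) \<partial>?MI)"
    using measurable_compose[OF exchange_measurable[OF v, of \<kappa> \<xi> "Suc K", unfolded IL(1)] F]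
    by (intro product_nn_integral_fold) (use IL(2) in auto)
  also have "\<dots> = (\<integral>\<^sup>+x. (\<integral>\<^sup>+y. F (merge ?I ?L (exchange J \<kappa> \<xi> s s' K x, y)) \<partial>?MV) \<partial>?MI)"
  proof (rule nn_integral_cong)
    fix x assume x: "x \<in> space ?MI"
    have ex': "exchange J \<kappa> \<xi> s s' K x \<in> space ?MI"
      using measurable_space[OF exchange_measurable[OF v] x] .
    have "(\<integral>\<^sup>+y. F (merge ?I ?L (exchange J \<kappa> \<xi> s s' K x, y)) \<partial>?MV) =
        (\<integral>\<^sup>+y. F (merge ?I ?L (exchange J \<kappa> \<xi> s s' K x, y)) \<partial>distr ?MV ?MV (\<lambda>y. \<lambda>p\<in>?L. y (rot (rel J \<kappa> \<xi> s' x K) p)))"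
      by (subst rot[OF rel_subset rel_sym]) simp
    also have "\<dots> = (\<integral>\<^sup>+y. F (exchange J \<kappa> \<xi> s s' (Suc K) (merge ?I ?L (x, y))) \<partial>?MV)"
      unfolding ex
    proof (rule nn_integral_distr)
      show "(\<lambda>y. F (merge ?I ?L (exchange J \<kappa> \<xi> s s' K x, y))) \<in> borel_measurable (distr ?MV ?MV (\<lambda>y. \<lambda>p\<in>?L. y (rot (rel J \<kappa> \<xi> s' x K) p)))"
        using Fm[OF ex'] by simp
      show "(\<lambda>y. \<lambda>p\<in>?L. y (rot (rel J \<kappa> \<xi> s' x K) p)) \<in> measurable ?MV ?MV"
        using swap_sel(2)[OF v rel_subset rel_sym]
        by (intro measurable_restrict measurable_component_singleton) (auto simp: rot_def)
    qed
    finally show "(\<integral>\<^sup>+y. F (exchange J \<kappa> \<xi> s s' (Suc K) (merge ?I ?L (x, y))) \<partial>?MV) =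
       (\<integral>\<^sup>+y. F (merge ?I ?L (exchange J \<kappa> \<xi> s s' K x, y)) \<partial>?MV)" ..
  qed
  also have "\<dots> = (\<integral>\<^sup>+x. (\<integral>\<^sup>+y. F (merge ?I ?L (x, y)) \<partial>?MV) \<partial>?MI)"
  proof (rule Suc.IH)
    interpret VL: prob_space ?MV by (rule prob_space_PiM) (use N in auto)
    show "(\<lambda>x. \<integral>\<^sup>+y. F (merge ?I ?L (x, y)) \<partial>?MV) \<in> borel_measurable ?MI"
      using measurable_compose[OF measurable_merge F]
      by (intro VL.borel_measurable_nn_integral) (simp add: case_prod_beta')
  qed
  also have "\<dots> = (\<integral>\<^sup>+\<zeta>. F \<zeta> \<partial>PiM (?I \<union> ?L) (\<lambda>_. N))"
    by (rule product_nn_integral_fold[symmetric]) (use F IL(2) in auto)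
  finally show ?case unfolding IL(1) .
qed

text \<open>Since \<open>exchange\<close> only permutes the increments of a step according to the past, it preserves their i.i.d. law;
  hence the law of the scheme does not depend on which particle leads a cluster.\<close>

theorem distr_exchange:
  assumes v: "valid_sel J s" "valid_sel J s'"
  shows "distr (PiM ({..<J} \<times> {..<K}) (\<lambda>_. N)) (PiM ({..<J} \<times> {..<K}) (\<lambda>_. N)) (exchange J \<kappa> \<xi> s s' K) = PiM ({..<J} \<times> {..<K}) (\<lambda>_. N)"
proof (rule measure_eqI)
  let ?M = "PiM ({..<J} \<times> {..<K}) (\<lambda>_. N)"
  fix A assume "A \<in> sets (distr ?M ?M (exchange J \<kappa> \<xi> s s' K))"
  then have A: "A \<in> sets ?M" by simp
  have "emeasure (distr ?M ?M (exchange J \<kappa> \<xi> s s' K)) A = (\<integral>\<^sup>+\<zeta>. indicator A \<zeta> \<partial>distr ?M ?M (exchange J \<kappa> \<xi> s s' K))"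
    using A by simp
  also have "\<dots> = (\<integral>\<^sup>+\<zeta>. indicator A (exchange J \<kappa> \<xi> s s' K \<zeta>) \<partial>?M)"
    using A exchange_measurable[OF v] by (intro nn_integral_distr) auto
  also have "\<dots> = emeasure ?M A" using A by (subst nn_integral_exchange[OF v]) auto
  finally show "emeasure (distr ?M ?M (exchange J \<kappa> \<xi> s s' K)) A = emeasure ?M A" .
qed simp

end

section \<open>Convergence of the discrete scheme\<close>

text \<open>A finite version, because the limiting system in \<open>coalescing_limit\<close>
  consists of \<open>n\<close> paths; for the one-path marginals it is applied with
  \<open>n = 1\<close> in a changed order of the labels.\<close>

definition coalescence_below :: "nat \<Rightarrow> (nat \<Rightarrow> real \<times> real) \<Rightarrow> (nat \<Rightarrow> real \<Rightarrow> real) \<Rightarrow> (nat \<Rightarrow> real \<Rightarrow> real) \<Rightarrow> bool" where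
  "coalescence_below n z b w \<longleftrightarrow>
     (\<forall>j<n. continuous_on {snd (z j)..} (w j) \<and> w j (snd (z j)) = fst (z j)) \<and>
     (\<forall>i<n. \<forall>j<n. \<forall>s t. snd (z i) \<le> s \<and> snd (z j) \<le> s \<and> s \<le> t \<and> w i s = w j s \<longrightarrow> w i t = w j t) \<and>
     (\<forall>j<n. \<forall>t\<ge>snd (z j).
        (\<forall>i<j. \<forall>s. snd (z i) \<le> s \<and> snd (z j) \<le> s \<and> s \<le> t \<longrightarrow> w i s \<noteq> w j s) \<longrightarrow> w j t = b j t)"

lemma coalescence_belowI: "coalescence_of z b w \<Longrightarrow> coalescence_below n z b w"
  unfolding coalescence_of_def coalescence_below_def by blast

lemma coalescence_below_mono: "coalescence_below n z b w \<Longrightarrow> m \<le> n \<Longrightarrow> coalescence_below m z b w"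
  unfolding coalescence_below_def by (meson less_le_trans)

lemma coalescence_belowD:
  assumes "coalescence_below n z b w"
  shows "\<And>j. j < n \<Longrightarrow> continuous_on {snd (z j)..} (w j)"
    and "\<And>j. j < n \<Longrightarrow> w j (snd (z j)) = fst (z j)"
    and "\<And>i j s t. i < n \<Longrightarrow> j < n \<Longrightarrow> snd (z i) \<le> s \<Longrightarrow> snd (z j) \<le> s \<Longrightarrow> s \<le> t \<Longrightarrow> w i s = w j s \<Longrightarrow> w i t = w j t"
    and "\<And>j t. j < n \<Longrightarrow> snd (z j) \<le> t \<Longrightarrow>
        (\<And>i s. i < j \<Longrightarrow> snd (z i) \<le> s \<Longrightarrow> snd (z j) \<le> s \<Longrightarrow> s \<le> t \<Longrightarrow> w i s \<noteq> w j s) \<Longrightarrow> w j t = b j t"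
  using assms unfolding coalescence_below_def by blast+

text \<open>At every time after its birth a coalescing path sits on a driver that was born earlier.
  Absence of atoms for the drivers thereby passes to the coalescing paths.\<close>

lemma coalescence_values:
  assumes c: "coalescence_below n z b w" and b: "\<And>j. j < n \<Longrightarrow> continuous_on {snd (z j)..} (b j)"
  shows "i < n \<Longrightarrow> snd (z i) < s \<Longrightarrow> \<exists>l\<le>i. snd (z l) < s \<and> w i s = b l s"
proof (induction i rule: less_induct)
  case (less i)
  show ?case
  proof (cases "\<exists>p<i. \<exists>u<s. snd (z p) \<le> u \<and> snd (z i) \<le> u \<and> w p u = w i u")
    case True
    then obtain p u where p: "p < i" "u < s" "snd (z p) \<le> u" "snd (z i) \<le> u" "w p u = w i u" by blast
    then have "w i s = w p s" using coalescence_belowD(3)[OF c, of p i u s] less.prems by simp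
    moreover obtain l where "l \<le> p" "snd (z l) < s" "w p s = b l s"
      using less.IH[of p] p less.prems by auto
    ultimately show ?thesis using p by (intro exI[of _ l]) auto
  next
    case False
    have eq: "w i u = b i u" if "snd (z i) \<le> u" "u < s" for u
      by (rule coalescence_belowD(4)[OF c less.prems(1) that(1)]) (use False that in force)
    have "((\<lambda>u. w i u - b i u) \<longlongrightarrow> w i s - b i s) (at s within {snd (z i)..})"
      using continuous_on_diff[OF coalescence_belowD(1)[OF c less.prems(1)] b[OF less.prems(1)]] less.prems
      unfolding continuous_on_def by auto
    then have lim: "((\<lambda>u. w i u - b i u) \<longlongrightarrow> w i s - b i s) (at s within {snd (z i)<..<s})"
      by (rule tendsto_within_subset) auto
    have "((\<lambda>u. w i u - b i u) \<longlongrightarrow> 0) (at s within {snd (z i)<..<s})"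
      by (rule tendsto_eventually) (auto simp: eventually_at_filter eq)
    moreover have "at s within {snd (z i)<..<s} \<noteq> bot"
      using less.prems by (simp add: at_within_eq_bot_iff islimpt_greaterThanLessThan2 trivial_limit_within)
    ultimately have "w i s = b i s" using tendsto_unique lim by fastforce
    then show ?thesis using less.prems by blast
  qed
qed

text \<open>Rational endpoints keep the event measurable.\<close>

definition no_touch :: "real \<Rightarrow> (real \<Rightarrow> real) \<Rightarrow> (real \<Rightarrow> real) \<Rightarrow> bool" where
  "no_touch t0 f g \<longleftrightarrow> (\<forall>q\<in>\<rat>. \<forall>r\<in>\<rat>. \<forall>c\<in>{1,-1}. t0 < q \<longrightarrow> q < r \<longrightarrow>
     (\<forall>s\<in>{q..r}. 0 \<le> c * (f s - g s)) \<longrightarrow> (\<forall>s\<in>{q..r}. 0 < c * (f s - g s)))"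

definition generic :: "nat \<Rightarrow> (nat \<Rightarrow> real \<times> real) \<Rightarrow> (nat \<Rightarrow> real \<Rightarrow> real) \<Rightarrow> (nat \<Rightarrow> real \<Rightarrow> real) \<Rightarrow> bool" where
  "generic n z b w \<longleftrightarrow> coalescence_below n z b w \<and> (\<forall>j<n. continuous_on {snd (z j)..} (b j)) \<and>
     (\<forall>j<n. b j (snd (z j)) = fst (z j)) \<and>
     (\<forall>i<n. \<forall>l<i. w l (max (snd (z l)) (snd (z i))) \<noteq> w i (max (snd (z l)) (snd (z i)))) \<and>
     (\<forall>i<n. \<forall>l<i. no_touch (max (snd (z l)) (snd (z i))) (b i) (w l))"

text \<open>The increments of the path \<open>b (q a)\<close> that drive particle \<open>a\<close>, born at step \<open>\<kappa> a\<close>. Before its birth, the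
  particle is assigned increments beyond the horizon \<open>K\<close>; they are never used, but make the whole array i.i.d.\<close>

definition drive_index :: "(nat \<Rightarrow> nat) \<Rightarrow> nat \<Rightarrow> nat \<Rightarrow> nat \<Rightarrow> nat" where
  "drive_index \<kappa> K a k = (if \<kappa> a \<le> k then k - \<kappa> a else K + k)"

definition drive :: "(nat \<Rightarrow> real \<times> real) \<Rightarrow> real \<Rightarrow> (nat \<Rightarrow> nat) \<Rightarrow> nat \<Rightarrow> (nat \<Rightarrow> nat) \<Rightarrow> (nat \<Rightarrow> real \<Rightarrow> real) \<Rightarrow> nat \<times> nat \<Rightarrow> real" where
  "drive z h \<kappa> K q b = (\<lambda>(a, k). b (q a) (snd (z (q a)) + real (Suc (drive_index \<kappa> K a k)) * h)
     - b (q a) (snd (z (q a)) + real (drive_index \<kappa> K a k) * h))"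

lemma drive_sum:
  assumes "\<kappa> a \<le> k"
  shows "(\<Sum>k'=\<kappa> a..<k. drive z h \<kappa> K q b (a, k')) = b (q a) (snd (z (q a)) + real (k - \<kappa> a) * h) - b (q a) (snd (z (q a)))"
  using assms
proof (induction k rule: dec_induct)
  case (step k)
  then show ?case by (simp add: drive_def drive_index_def Suc_diff_le)
qed simp

text \<open>The rank \<open>q m\<close> gives the tracked particle \<open>a m l\<close> the position
  \<open>l\<close>, before all untracked ones. The leader of a tracked particle is then itself
  tracked, so untracked particles never influence the motion, and being merged can be read as lying
  in the same cluster.\<close>

theorem scheme_converges:
  fixes z :: "nat \<Rightarrow> real \<times> real" and b w :: "nat \<Rightarrow> real \<Rightarrow> real" and T0 h :: "nat \<Rightarrow> real" and J K :: "nat \<Rightarrow> nat"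
    and \<kappa> q a :: "nat \<Rightarrow> nat \<Rightarrow> nat" and \<xi> :: "nat \<Rightarrow> nat \<Rightarrow> real"
  defines "\<zeta> \<equiv> \<lambda>m. drive z (h m) (\<kappa> m) (K m) (q m) b"
  assumes g: "generic n z b w" and h: "\<And>m. 0 < h m" "h \<longlonglongrightarrow> 0"
    and q: "\<And>m. inj (q m)" and qa: "\<And>m l. l < n \<Longrightarrow> q m (a m l) = l" and aJ: "\<And>m l. l < n \<Longrightarrow> a m l < J m"
    and birth: "\<And>l. l < n \<Longrightarrow> (\<lambda>m. T0 m + real (\<kappa> m (a m l)) * h m) \<longlonglongrightarrow> snd (z l)"
    and start: "\<And>l. l < n \<Longrightarrow> (\<lambda>m. \<xi> m (a m l)) \<longlonglongrightarrow> fst (z l)"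
    and e: "\<And>m i k. i < J m \<Longrightarrow> k < K m \<Longrightarrow> \<bar>\<zeta> m (i, k)\<bar> \<le> e m" "\<And>m. 0 \<le> e m"
      "(\<lambda>m. 2 * (real (J m) * real (J m)) * e m) \<longlonglongrightarrow> 0"
    and l: "l < n" and k: "\<And>m. \<kappa> m (a m l) \<le> k m" "\<And>m. k m \<le> K m" "(\<lambda>m. T0 m + real (k m) * h m) \<longlonglongrightarrow> u"
  shows "(\<lambda>m. pos (J m) (\<kappa> m) (\<xi> m) (rank_sel (q m)) (\<zeta> m) (k m) (a m l)) \<longlonglongrightarrow> w l u"
proof -
  let ?R = "\<lambda>m k. rel (J m) (\<kappa> m) (\<xi> m) (rank_sel (q m)) (\<zeta> m) k"
  define y where "y m i k = pos (J m) (\<kappa> m) (\<xi> m) (rank_sel (q m)) (\<zeta> m) k (a m i)" for m i k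
  define mg where "mg m i l k \<longleftrightarrow> (a m i, a m l) \<in> (?R m k)\<^sup>*" for m i l k
  define own where "own m i k = \<xi> m (a m i) + (\<Sum>k'=\<kappa> m (a m i)..<k. \<zeta> m (a m i, k'))" for m i k
  note v = valid_rank_sel
  have c: "coalescence_below n z b w" using g by (simp add: generic_def)
  have b: "continuous_on {snd (z j)..} (b j)" "b j (snd (z j)) = fst (z j)" if "j < n" for j
    using g that by (auto simp: generic_def)
  have aneq: "a m i \<noteq> a m l" if "i < n" "l < i" for m i l
    using qa[of i m] qa[of l m] that by auto
  interpret scheme_limit n "\<lambda>i. snd (z i)" b w T0 h K "\<lambda>m i. \<kappa> m (a m i)" y own mg
      "\<lambda>m. 2 * (real (J m) * real (J m)) * e m"
  proof
    show "y m i k = own m i k" if "i < n" "\<kappa> m (a m i) \<le> k" "k \<le> K m" "\<And>l k'. l < i \<Longrightarrow> k' < k \<Longrightarrow> \<not> mg m i l k'" for m i k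
      unfolding y_def own_def
    proof (rule pos_own[where \<kappa>="\<kappa> m", OF aJ[OF that(1)] that(2)])
      fix k' assume k': "k' < k"
      let ?c = "rank_sel (q m) (?R m k') (a m i)"
      have c: "(a m i, ?c) \<in> (?R m k')\<^sup>*" by (rule rank_sel_in)
      \<comment> \<open>A rank at most \<open>i\<close> is below \<open>n\<close>, so the leader is
        one of the tracked particles, and either \<open>a m i\<close> itself or one already merged
        with it.\<close>
      have le: "q m ?c \<le> i" using rank_sel_le[of "a m i" "a m i" "?R m k'" "q m"] qa[OF that(1)] by simp
      have "?c = a m (q m ?c)"
      proof (rule injD[OF q[of m]])
        show "q m ?c = q m (a m (q m ?c))" using qa[of "q m ?c" m] le that(1) by simp
      qed
      moreover have "\<not> q m ?c < i" using that(4)[OF _ k', of "q m ?c"] c calculation by (auto simp: mg_def)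
      ultimately show "?c = a m i" using le by (metis le_neq_implies_less)
    qed
    show "(\<lambda>m. own (r m) i (k m)) \<longlonglongrightarrow> b i u"
      if i: "i < n" and r: "strict_mono r" and k: "\<And>m. \<kappa> (r m) (a (r m) i) \<le> k m" "\<And>m. k m \<le> K (r m)"
        and lim: "(\<lambda>m. T0 (r m) + real (k m) * h (r m)) \<longlonglongrightarrow> u" for i r k u
    proof -
      \<comment> \<open>The driver is read from its own starting time although the particle is born
        at a grid time; the discrepancy tends to 0 by \<open>birth\<close>.\<close>
      let ?s = "\<lambda>m. snd (z i) + real (k m - \<kappa> (r m) (a (r m) i)) * h (r m)"
      have bi: "(\<lambda>m. T0 (r m) + real (\<kappa> (r m) (a (r m) i)) * h (r m)) \<longlonglongrightarrow> snd (z i)"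
        using LIMSEQ_subseq_LIMSEQ[OF birth[OF i] r] by (simp add: o_def)
      have "(\<lambda>m. snd (z i) + ((T0 (r m) + real (k m) * h (r m)) - (T0 (r m) + real (\<kappa> (r m) (a (r m) i)) * h (r m)))) \<longlonglongrightarrow> snd (z i) + (u - snd (z i))"
        by (intro tendsto_intros lim bi)
      then have s: "?s \<longlonglongrightarrow> u" using k(1) by (simp add: of_nat_diff algebra_simps)
      have ge: "snd (z i) \<le> ?s m" for m using h(1)[of "r m"] by simp
      then have "snd (z i) \<le> u" by (intro LIMSEQ_le_const[OF s]) auto
      then have "(\<lambda>m. b i (?s m)) \<longlonglongrightarrow> b i u"
        using continuous_on_tendsto_compose[OF b(1)[OF i] s] ge by auto
      moreover have "(\<lambda>m. \<xi> (r m) (a (r m) i)) \<longlonglongrightarrow> fst (z i)"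
        using LIMSEQ_subseq_LIMSEQ[OF start[OF i] r] by (simp add: o_def)
      ultimately have "(\<lambda>m. \<xi> (r m) (a (r m) i) + (b i (?s m) - b i (snd (z i)))) \<longlonglongrightarrow> fst (z i) + (b i u - b i (snd (z i)))"
        by (intro tendsto_intros)
      moreover have "own (r m) i (k m) = \<xi> (r m) (a (r m) i) + (b i (?s m) - b i (snd (z i)))" for m
        unfolding own_def \<zeta>_def using drive_sum[where \<kappa>="\<kappa> (r m)" and a="a (r m) i" and k="k m", OF k(1)] qa[OF i] by simp
      ultimately show ?thesis using b(2)[OF i] by simp
    qed
    show "\<bar>y m i k' - y m l k'\<bar> \<le> 2 * (real (J m) * real (J m)) * e m"
      if "i < n" "l < n" "mg m i l k" "k \<le> k'" "k' \<le> K m" for m i l k k'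
      unfolding y_def
    proof (rule rtrancl_rel_close[OF v])
      show "(a m i, a m l) \<in> (?R m k')\<^sup>*" using that(3) rtrancl_mono[OF rel_mono[OF that(4)]] unfolding mg_def by blast
    qed (use e that in auto)
    show "mg m i l k'" if "i < n" "l < n" "\<kappa> m (a m i) \<le> k" "\<kappa> m (a m l) \<le> k" "k < k'" "k' \<le> K m"
      "(y m i k - y m l k) * (y m i k' - y m l k') < 0" for m i l k k'
      using rel_cross[of "a m i" "J m" "a m l" "\<kappa> m" k k'] aJ that unfolding y_def mg_def by blast
    show "\<kappa> m (a m i) \<le> k \<and> \<kappa> m (a m l) \<le> k" if "l < i" "i < n" "mg m i l k" for m i l k
      using rtrancl_rel_born[of "a m i" "a m l"] aneq[of i l m] that unfolding mg_def by fastforce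
    show "0 < c * (b i s - w l s)" if "l < i" "i < n" "q \<in> \<rat>" "r \<in> \<rat>" "max (snd (z l)) (snd (z i)) < q" "q < r" "c \<in> {1, -1}"
      "\<And>s. s \<in> {q..r} \<Longrightarrow> 0 \<le> c * (b i s - w l s)" "s \<in> {q..r}" for i l q r c s
    proof -
      have "no_touch (max (snd (z l)) (snd (z i))) (b i) (w l)" using g that by (auto simp: generic_def)
      then show ?thesis using that unfolding no_touch_def by blast
    qed
    show "w l (max (snd (z l)) (snd (z i))) \<noteq> w i (max (snd (z l)) (snd (z i)))" if "l < i" "i < n" for i l
      using g that by (auto simp: generic_def)
    show "w i u = w l u" if "i < n" "l < n" "snd (z i) \<le> s" "snd (z l) \<le> s" "s \<le> u" "w i s = w l s" for i l s u
      by (rule coalescence_belowD(3)[OF c that])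
    show "w i u = b i u" if "i < n" "snd (z i) \<le> u"
      "\<And>l s. l < i \<Longrightarrow> snd (z l) \<le> s \<Longrightarrow> snd (z i) \<le> s \<Longrightarrow> s \<le> u \<Longrightarrow> w l s \<noteq> w i s" for i u
      by (rule coalescence_belowD(4)[OF c that])
  qed (fact h birth b(1) e(3) coalescence_belowD(1)[OF c])+
  show ?thesis
    using paths_converge[OF l, unfolded conv_def, rule_format, of "\<lambda>m. m" k u] k by (simp add: strict_mono_def gt_def y_def)
qed

section \<open>The scheme on a regular time grid\<close>

definition grid_index :: "real \<Rightarrow> real \<Rightarrow> real \<Rightarrow> nat" where
  "grid_index T0 h s = nat \<lceil>(s - T0) / h\<rceil>"

lemma grid_index_mono: "0 < h \<Longrightarrow> s \<le> s' \<Longrightarrow> grid_index T0 h s \<le> grid_index T0 h s'"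
  unfolding grid_index_def by (intro nat_mono ceiling_mono divide_right_mono) auto

lemma grid_index_bounds:
  assumes "0 < h" "T0 \<le> s"
  shows "s \<le> T0 + real (grid_index T0 h s) * h" "T0 + real (grid_index T0 h s) * h \<le> s + h"
proof -
  have "(s - T0) / h \<le> real (grid_index T0 h s)" "real (grid_index T0 h s) \<le> (s - T0) / h + 1"
    using assms by (auto simp: of_nat_ceiling grid_index_def)
  then have "s - T0 \<le> real (grid_index T0 h s) * h" "real (grid_index T0 h s) * h \<le> s - T0 + h"
    using mult_right_mono[of _ _ h] assms by (fastforce simp: distrib_right)+
  then show "s \<le> T0 + real (grid_index T0 h s) * h" "T0 + real (grid_index T0 h s) * h \<le> s + h" by auto
qed

lemma grid_index_lim:
  assumes "\<And>m. 0 < h m" "h \<longlonglongrightarrow> 0" "\<And>m. T0 m \<le> s m" "s \<longlonglongrightarrow> u"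
  shows "(\<lambda>m. T0 m + real (grid_index (T0 m) (h m) (s m)) * h m) \<longlonglongrightarrow> u"
proof (rule tendsto_sandwich[where f=s and h="\<lambda>m. s m + h m"])
  show "(\<lambda>m. s m + h m) \<longlonglongrightarrow> u" using tendsto_add[OF assms(4,2)] by simp
qed (use grid_index_bounds[OF assms(1,3)] assms(4) in auto)

definition scheme_pos :: "(nat \<Rightarrow> real \<times> real) \<Rightarrow> nat \<Rightarrow> real \<Rightarrow> real \<Rightarrow> real \<Rightarrow> (nat \<Rightarrow> nat) \<Rightarrow> (nat \<times> nat \<Rightarrow> real) \<Rightarrow> real \<Rightarrow> nat \<Rightarrow> real" where
  "scheme_pos z J T0 T1 h \<rho> \<zeta> s a = pos J (\<lambda>a. grid_index T0 h (snd (z a))) (\<lambda>a. fst (z a)) (rank_sel \<rho>) \<zeta> (grid_index T0 h s) a"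

definition scheme_drive :: "(nat \<Rightarrow> real \<times> real) \<Rightarrow> real \<Rightarrow> real \<Rightarrow> real \<Rightarrow> (nat \<Rightarrow> nat) \<Rightarrow> (nat \<Rightarrow> real \<times> real) \<Rightarrow> (nat \<Rightarrow> real \<Rightarrow> real) \<Rightarrow> nat \<times> nat \<Rightarrow> real" where
  "scheme_drive z T0 T1 h q z' b = drive z' h (\<lambda>a. grid_index T0 h (snd (z a))) (grid_index T0 h T1) q b"

lemma scheme_drive_small:
  assumes h: "\<And>m. 0 < h m" "h \<longlonglongrightarrow> 0" and T: "T0 \<le> T1"
    and b: "\<And>a. a < J \<Longrightarrow> continuous_on {snd (z' (q a))..} (b (q a))" and e: "0 < e"
  shows "\<forall>\<^sub>F m in sequentially. \<forall>a<J. \<forall>k<grid_index T0 (h m) T1. \<bar>scheme_drive z T0 T1 (h m) q z' b (a, k)\<bar> < e"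
proof -
  \<comment> \<open>Increments assigned before birth come from beyond the horizon, so indices up to
    twice the number of grid steps occur, and uniform continuity is needed on an interval of twice
    the length; the added 1 absorbs the rounding to the mesh.\<close>
  define L where "L = 2 * (T1 - T0 + 1)"
  have "\<forall>\<^sub>F m in sequentially. \<forall>k<grid_index T0 (h m) T1. \<bar>scheme_drive z T0 T1 (h m) q z' b (a, k)\<bar> < e" if a: "a < J" for a
  proof -
    let ?t = "snd (z' (q a))"
    have "uniformly_continuous_on {?t..?t + L} (b (q a))"
      by (intro compact_uniformly_continuous continuous_on_subset[OF b[OF a]]) auto
    then obtain d where d: "0 < d" "\<And>s s'. s \<in> {?t..?t + L} \<Longrightarrow> s' \<in> {?t..?t + L} \<Longrightarrow> dist s' s < d \<Longrightarrow> dist (b (q a) s') (b (q a) s) < e"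
      using e unfolding uniformly_continuous_on_def by blast
    have "\<forall>\<^sub>F m in sequentially. h m < min d 1" using d(1) by (intro order_tendstoD[OF h(2)]) auto
    then show ?thesis
    proof eventually_elim
      case (elim m)
      show ?case
      proof (intro allI impI)
        fix k assume k: "k < grid_index T0 (h m) T1"
        define g where "g = drive_index (\<lambda>a. grid_index T0 (h m) (snd (z a))) (grid_index T0 (h m) T1) a k"
        have "Suc g \<le> 2 * grid_index T0 (h m) T1" using k by (auto simp: g_def drive_index_def)
        then have "real (Suc g) * h m \<le> real (2 * grid_index T0 (h m) T1) * h m"
          using h(1)[of m] by (intro mult_right_mono) (auto simp del: of_nat_Suc of_nat_mult intro: of_nat_mono)
        also have "\<dots> \<le> L" using grid_index_bounds(2)[OF h(1) T, of m] elim by (simp add: L_def)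
        finally have 1: "real (Suc g) * h m \<le> L" .
        have 2: "real (Suc g) * h m = real g * h m + h m" by (simp add: algebra_simps)
        have 3: "0 \<le> real g * h m" using h(1)[of m] by simp
        have "dist (b (q a) (?t + real (Suc g) * h m)) (b (q a) (?t + real g * h m)) < e"
          using 1 2 3 elim h(1)[of m] by (intro d(2)) (auto simp: dist_real_def)
        then show "\<bar>scheme_drive z T0 T1 (h m) q z' b (a, k)\<bar> < e"
          unfolding scheme_drive_def drive_def g_def dist_real_def by simp
      qed
    qed
  qed
  then have "\<forall>\<^sub>F m in sequentially. \<forall>a\<in>{..<J}. \<forall>k<grid_index T0 (h m) T1. \<bar>scheme_drive z T0 T1 (h m) q z' b (a, k)\<bar> < e"
    by (intro eventually_ball_finite) auto
  then show ?thesis by eventually_elim auto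
qed

text \<open>For a fixed number of walks uniform continuity of the drivers makes the error vanish for
  each generic outcome. A growing number of walks requires the exceptional events of
  \<open>coalescing_limit\<close>.\<close>

lemma own_scheme_converges:
  assumes g: "generic J z b w" and T: "\<And>a. a < J \<Longrightarrow> T0 \<le> snd (z a)"
    and l: "l < J" "snd (z l) \<le> s" "s \<le> T1" and h: "\<And>m. 0 < h m" "h \<longlonglongrightarrow> 0"
  shows "(\<lambda>m. scheme_pos z J T0 T1 (h m) (\<lambda>a. a) (scheme_drive z T0 T1 (h m) (\<lambda>a. a) z b) s l) \<longlonglongrightarrow> w l s"
proof -
  let ?\<zeta> = "\<lambda>m. scheme_drive z T0 T1 (h m) (\<lambda>a. a) z b" and ?K = "\<lambda>m. grid_index T0 (h m) T1"
  define e where "e m = Max (insert 0 ((\<lambda>p. \<bar>?\<zeta> m p\<bar>) ` ({..<J} \<times> {..<?K m})))" for m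
  have T01: "T0 \<le> T1" using T[OF l(1)] l by simp
  have c: "continuous_on {snd (z a)..} (b a)" if "a < J" for a using g that by (simp add: generic_def)
  have e0: "e \<longlonglongrightarrow> 0"
  proof (rule LIMSEQ_I)
    fix r :: real assume r: "0 < r"
    have "\<forall>\<^sub>F m in sequentially. \<forall>a<J. \<forall>k<?K m. \<bar>?\<zeta> m (a, k)\<bar> < r"
      using c by (intro scheme_drive_small[OF h T01 _ r]) auto
    then have "\<forall>\<^sub>F m in sequentially. norm (e m - 0) < r"
    proof eventually_elim
      case (elim m)
      have "0 \<le> e m" "e m < r" unfolding e_def using elim r by auto
      then show ?case by simp
    qed
    then show "\<exists>no. \<forall>n\<ge>no. norm (e n - 0) < r" by (simp add: eventually_sequentially)
  qed
  show ?thesis unfolding scheme_pos_def scheme_drive_def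
  proof (rule scheme_converges[where a="\<lambda>m a. a" and e=e and q="\<lambda>m a. a" and J="\<lambda>m. J" and ?T0.0="\<lambda>m. T0", OF g h])
    show "(\<lambda>m. T0 + real (grid_index T0 (h m) (snd (z l))) * h m) \<longlonglongrightarrow> snd (z l)" if "l < J" for l
      using grid_index_lim[where ?T0.0="\<lambda>_. T0", OF h] T[OF that] by auto
    show "\<bar>drive z (h m) (\<lambda>a. grid_index T0 (h m) (snd (z a))) (?K m) (\<lambda>a. a) b (i, k)\<bar> \<le> e m" if "i < J" "k < ?K m" for m i k
      unfolding e_def scheme_drive_def[symmetric] using that by (intro Max_ge) auto
    show "0 \<le> e m" for m unfolding e_def by (intro Max_ge) auto
    show "(\<lambda>m. 2 * (real J * real J) * e m) \<longlonglongrightarrow> 0"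
      using tendsto_mult[OF tendsto_const e0] by simp
    show "(\<lambda>m. T0 + real (grid_index T0 (h m) s) * h m) \<longlonglongrightarrow> s"
      using grid_index_lim[where ?T0.0="\<lambda>_. T0", OF h] T[OF l(1)] l(2) by auto
  qed (use l grid_index_mono[OF h(1)] in auto)
qed

lemma sum_increments: "(\<Sum>k<j. f (Suc (Suc k)) - f (Suc k)) = f (Suc j) - (f (Suc 0) :: real)"
  by (induction j) auto

text \<open>The increment of \<open>B i\<close> up to time \<open>q\<close> shifts all differences
  on \<open>[q, r]\<close> by the same amount, and hence also their minimum. It is independent of
  the later increments of \<open>B i\<close> and of the walks with smaller index. The scheme
  replaces the coalescing path here because it is an explicit function of finitely many
  increments.\<close>

lemma scheme_small_ball:
  fixes z :: "nat \<Rightarrow> real \<times> real" and F :: nat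
  assumes N: "prob_space N" and B: "independent_brownian_motions N z B"
    and l: "l < i" and q: "snd (z i) < q" "q \<le> r" and h: "0 < h" and e: "0 < e" and c: "c \<in> {1, -1::real}" and T1: "r \<le> T1"
  defines "s \<equiv> \<lambda>j. q + (r - q) * real j / real F"
  shows "measure N {\<omega>\<in>space N. \<bar>MIN j\<in>{..F}. c * (fst (z i) + (B i \<omega> (s j) - B i \<omega> (snd (z i)))
      - scheme_pos z i T0 T1 h (\<lambda>a. a) (scheme_drive z T0 T1 h (\<lambda>a. a) z (\<lambda>a. B a \<omega>)) (s j) l)\<bar> < e}
    \<le> 2 * e / sqrt (2 * pi * (q - snd (z i)))"
proof -
  interpret prob_space N by fact
  define K where "K = grid_index T0 h T1"
  define \<kappa> where "\<kappa> a = grid_index T0 h (snd (z a))" for a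
  \<comment> \<open>In row \<open>i\<close> the grid jumps directly from the start to
    \<open>s 0 = q\<close>, so that the entry \<open>(i, 0)\<close> of the increment array is the
    distinguished Gaussian increment.\<close>
  define \<tau> where "\<tau> a k = (if a = i then (if k = 0 then snd (z i) else s (k - 1)) else snd (z a) + real k * h)" for a k
  define X where "X p \<omega> = B (fst p) \<omega> (\<tau> (fst p) (Suc (snd p))) - B (fst p) \<omega> (\<tau> (fst p) (snd p))" for p \<omega>
  have s0: "s 0 = q" by (simp add: s_def)
  have s_mono: "s j \<le> s k" if "j \<le> k" for j k
    using that q unfolding s_def by (intro add_left_mono divide_right_mono mult_left_mono) auto
  have s_le: "s j \<le> r" if "j \<le> F" for j
  proof (cases "F = 0")
    case False
    then have "(r - q) * real j / real F \<le> (r - q) * real F / real F"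
      using that q by (intro divide_right_mono mult_left_mono) auto
    then show ?thesis using False by (simp add: s_def)
  qed (use q in \<open>simp add: s_def\<close>)
  have iv: "indep_vars (\<lambda>_. borel) X UNIV"
    unfolding X_def
  proof (rule ibm_array_indep[OF N B])
    show "mono (\<tau> a)" for a
    proof (rule monoI)
      fix j k :: nat assume "j \<le> k"
      moreover have "snd (z i) \<le> s (k - 1)" using s_mono[of 0 "k - 1"] s0 q by simp
      ultimately show "\<tau> a j \<le> \<tau> a k" using h s_mono[of "j - 1" "k - 1"] by (auto simp: \<tau>_def)
    qed
    show "snd (z a) \<le> \<tau> a 0" for a by (simp add: \<tau>_def)
  qed
  let ?A = "{(i, 0::nat)}" and ?P = "- {(i, 0::nat)}"
  have ir: "indep_var (PiM ?A (\<lambda>_. borel)) (\<lambda>\<omega>. restrict (\<lambda>p. X p \<omega>) ?A) (PiM ?P (\<lambda>_. borel)) (\<lambda>\<omega>. restrict (\<lambda>p. X p \<omega>) ?P)"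
    by (rule indep_var_restrict[OF iv]) auto
  \<comment> \<open>Since \<open>c * c = 1\<close>, the outer factor \<open>c\<close> writes the
    full minimum as \<open>c * (U + R)\<close>, whose absolute value is that of a Gaussian plus an
    independent variable.\<close>
  define f where "f x = c * (MIN j\<in>{..F}. c * (fst (z i) + (\<Sum>k<j. x (i, Suc k))
      - pos i \<kappa> (\<lambda>a. fst (z a)) (rank_sel (\<lambda>a. a)) (\<lambda>(a, k). x (a, drive_index \<kappa> K a k)) (grid_index T0 h (s j)) l))" for x :: "nat \<times> nat \<Rightarrow> real"
  have fm: "f \<in> borel_measurable (PiM ?P (\<lambda>_. borel))"
  proof -
    \<comment> \<open>A point mass serves as the probability measure in
      \<open>chain_measurable\<close>; only its sigma-algebra matters here.\<close>
    let ?N = "return borel (0::real)" and ?I = "{..<i} \<times> {..<K}"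
    have gi: "grid_index T0 h (s j) \<le> K" if "j \<le> F" for j
      unfolding K_def using s_le[OF that] T1 h by (intro grid_index_mono) auto
    have comp: "(\<lambda>x. x (a, k)) \<in> borel_measurable (PiM ?P (\<lambda>_. borel::real measure))" if "(a, k) \<in> ?P" for a k
      using that by (rule measurable_component_singleton)
    have "(\<lambda>x. \<lambda>(a, k)\<in>?I. x (a, drive_index \<kappa> K a k)) \<in> measurable (PiM ?P (\<lambda>_. borel)) (PiM ?I (\<lambda>_. borel::real measure))"
    proof (rule measurable_restrict)
      fix p assume "p \<in> ?I"
      then show "(\<lambda>x. case p of (a, k) \<Rightarrow> x (a, drive_index \<kappa> K a k)) \<in> borel_measurable (PiM ?P (\<lambda>_. borel::real measure))"
        by (auto intro!: comp split: prod.splits)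
    qed
    moreover have "sets (PiM ?I (\<lambda>_. ?N)) = sets (PiM ?I (\<lambda>_. borel))" by (intro sets_PiM_cong) auto
    ultimately have m1: "(\<lambda>x. \<lambda>(a, k)\<in>?I. x (a, drive_index \<kappa> K a k)) \<in> measurable (PiM ?P (\<lambda>_. borel)) (PiM ?I (\<lambda>_. ?N))"
      by (simp cong: measurable_cong_sets)
    have "(\<lambda>x. pos i \<kappa> (\<lambda>a. fst (z a)) (rank_sel (\<lambda>a. a)) (\<lambda>(a, k). x (a, drive_index \<kappa> K a k)) (grid_index T0 h (s j)) l) \<in> borel_measurable (PiM ?P (\<lambda>_. borel))"
      if j: "j \<le> F" for j
    proof -
      have "(\<lambda>\<zeta>. pos i \<kappa> (\<lambda>a. fst (z a)) (rank_sel (\<lambda>a. a)) \<zeta> (grid_index T0 h (s j)) l) \<in> borel_measurable (PiM ?I (\<lambda>_. ?N))"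
        using chain_measurable[of ?N, OF prob_space_return _ valid_rank_sel gi[OF j]] by simp
      from measurable_compose[OF m1 this] show ?thesis
      proof (rule measurable_cong[THEN iffD1, rotated])
        fix x
        show "pos i \<kappa> (\<lambda>a. fst (z a)) (rank_sel (\<lambda>a. a)) (\<lambda>(a, k)\<in>?I. x (a, drive_index \<kappa> K a k)) (grid_index T0 h (s j)) l =
          pos i \<kappa> (\<lambda>a. fst (z a)) (rank_sel (\<lambda>a. a)) (\<lambda>(a, k). x (a, drive_index \<kappa> K a k)) (grid_index T0 h (s j)) l"
          by (subst chain_cong[OF valid_rank_sel, where \<zeta>'="\<lambda>(a, k). x (a, drive_index \<kappa> K a k)"]) (use gi[OF j] in auto)
      qed
    qed
    note this[measurable]
    have [measurable]: "(\<lambda>x. \<Sum>k<j. x (i, Suc k)) \<in> borel_measurable (PiM ?P (\<lambda>_. borel::real measure))" for j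
      by (intro borel_measurable_sum comp) auto
    show ?thesis unfolding f_def
      by (intro borel_measurable_times borel_measurable_Min borel_measurable_diff borel_measurable_add) auto
  qed
  define U where "U \<omega> = X (i, 0) \<omega>" for \<omega>
  define R where "R \<omega> = f (restrict (\<lambda>p. X p \<omega>) ?P)" for \<omega>
  have "indep_var borel ((\<lambda>x. x (i, 0)) \<circ> (\<lambda>\<omega>. restrict (\<lambda>p. X p \<omega>) ?A)) borel (f \<circ> (\<lambda>\<omega>. restrict (\<lambda>p. X p \<omega>) ?P))"
    by (rule indep_var_compose[OF ir _ fm]) (rule measurable_component_singleton, simp)
  then have ind: "indep_var borel U borel R" by (simp add: U_def[abs_def] R_def[abs_def] o_def)
  have U: "U \<omega> = B i \<omega> q - B i \<omega> (snd (z i))" for \<omega> by (simp add: U_def X_def \<tau>_def s0)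
  have D: "distributed N lborel U (normal_density 0 (sqrt (q - snd (z i))))"
    using brownian_motionD(4)[OF ibmD[OF B, of i] order_refl q(1)] by (simp add: U[abs_def])
  have Rw: "R \<omega> = c * (MIN j\<in>{..F}. c * (fst (z i) + (B i \<omega> (s j) - B i \<omega> q)
      - scheme_pos z i T0 T1 h (\<lambda>a. a) (scheme_drive z T0 T1 h (\<lambda>a. a) z (\<lambda>a. B a \<omega>)) (s j) l))" for \<omega>
  proof -
    have "(\<Sum>k<j. X (i, Suc k) \<omega>) = B i \<omega> (s j) - B i \<omega> q" for j
      using sum_increments[of "\<lambda>k. B i \<omega> (\<tau> i k)" j] by (simp add: X_def \<tau>_def s0)
    moreover have "pos i \<kappa> (\<lambda>a. fst (z a)) (rank_sel (\<lambda>a. a)) (\<lambda>(a, k). restrict (\<lambda>p. X p \<omega>) ?P (a, drive_index \<kappa> K a k)) (grid_index T0 h (s j)) l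
       = scheme_pos z i T0 T1 h (\<lambda>a. a) (scheme_drive z T0 T1 h (\<lambda>a. a) z (\<lambda>a. B a \<omega>)) (s j) l" for j
      unfolding scheme_pos_def scheme_drive_def \<kappa>_def[abs_def, symmetric] K_def[symmetric]
      by (subst chain_cong[OF valid_rank_sel, where \<zeta>'="drive z h \<kappa> K (\<lambda>a. a) (\<lambda>a. B a \<omega>)"]) (auto simp: X_def \<tau>_def drive_def)
    ultimately show ?thesis unfolding R_def f_def by simp
  qed
  have cc: "c * c = 1" "\<bar>c * x\<bar> = \<bar>x\<bar>" for x using c by auto
  have Min_add: "(MIN j\<in>{..F}. c * U \<omega> + Y j) = c * U \<omega> + (MIN j\<in>{..F}. Y j)" for Y :: "nat \<Rightarrow> real" and \<omega>
    using Min_add_commute[of "{..F}" Y "c * U \<omega>"] by (simp add: add.commute)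
  have "\<bar>MIN j\<in>{..F}. c * (fst (z i) + (B i \<omega> (s j) - B i \<omega> (snd (z i)))
      - scheme_pos z i T0 T1 h (\<lambda>a. a) (scheme_drive z T0 T1 h (\<lambda>a. a) z (\<lambda>a. B a \<omega>)) (s j) l)\<bar> = \<bar>U \<omega> + R \<omega>\<bar>" for \<omega>
  proof -
    let ?S = "\<lambda>j. scheme_pos z i T0 T1 h (\<lambda>a. a) (scheme_drive z T0 T1 h (\<lambda>a. a) z (\<lambda>a. B a \<omega>)) (s j) l"
    have "c * (fst (z i) + (B i \<omega> (s j) - B i \<omega> (snd (z i))) - ?S j) = c * U \<omega> + c * (fst (z i) + (B i \<omega> (s j) - B i \<omega> q) - ?S j)" for j
      by (simp add: U algebra_simps)
    then have "(MIN j\<in>{..F}. c * (fst (z i) + (B i \<omega> (s j) - B i \<omega> (snd (z i))) - ?S j)) = c * U \<omega> + c * R \<omega>"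
      unfolding Rw using Min_add by (simp add: cc(1) mult.assoc[symmetric])
    then show ?thesis using cc(2)[of "U \<omega> + R \<omega>"] by (simp add: distrib_left)
  qed
  then show ?thesis using normal_small_ball_indep[OF D _ e ind] q(1) by simp
qed

lemma tendsto_Min_image:
  fixes f :: "'b \<Rightarrow> 'a \<Rightarrow> real"
  assumes "finite A" "A \<noteq> {}" "\<And>j. j \<in> A \<Longrightarrow> ((\<lambda>m. f m j) \<longlongrightarrow> g j) M"
  shows "((\<lambda>m. MIN j\<in>A. f m j) \<longlongrightarrow> (MIN j\<in>A. g j)) M"
  using assms
proof (induction A rule: finite_ne_induct)
  case (insert j A)
  then show ?case by (simp add: tendsto_min)
qed simp

lemma scheme_pos_measurable:
  assumes \<zeta>: "\<And>a k. a < J \<Longrightarrow> k < grid_index T0 h T1 \<Longrightarrow> (\<lambda>\<omega>. \<zeta> \<omega> (a, k)) \<in> borel_measurable M"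
    and h: "0 < h" "s \<le> T1"
  shows "(\<lambda>\<omega>. scheme_pos z J T0 T1 h \<rho> (\<zeta> \<omega>) s l) \<in> borel_measurable M"
proof -
  let ?N = "return borel (0::real)" and ?I = "{..<J} \<times> {..<grid_index T0 h T1}"
  have gi: "grid_index T0 h s \<le> grid_index T0 h T1" using h by (intro grid_index_mono)
  have "(\<lambda>\<omega>. \<lambda>p\<in>?I. \<zeta> \<omega> p) \<in> measurable M (PiM ?I (\<lambda>_. borel::real measure))"
    using \<zeta> by (intro measurable_restrict) auto
  moreover have "sets (PiM ?I (\<lambda>_. ?N)) = sets (PiM ?I (\<lambda>_. borel))" by (intro sets_PiM_cong) auto
  ultimately have m1: "(\<lambda>\<omega>. \<lambda>p\<in>?I. \<zeta> \<omega> p) \<in> measurable M (PiM ?I (\<lambda>_. ?N))"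
    by (simp cong: measurable_cong_sets)
  have "(\<lambda>\<omega>. scheme_pos z J T0 T1 h \<rho> (\<lambda>p\<in>?I. \<zeta> \<omega> p) s l) \<in> borel_measurable M"
    unfolding scheme_pos_def
    by (rule measurable_compose[OF m1]) (use chain_measurable[of ?N, OF prob_space_return _ valid_rank_sel gi] in simp)
  moreover have "scheme_pos z J T0 T1 h \<rho> (\<lambda>p\<in>?I. \<zeta> \<omega> p) s l = scheme_pos z J T0 T1 h \<rho> (\<zeta> \<omega>) s l" for \<omega>
    unfolding scheme_pos_def by (subst chain_cong[OF valid_rank_sel, where \<zeta>'="\<zeta> \<omega>"]) (use gi in auto)
  ultimately show ?thesis by simp
qed

lemma scheme_drive_measurable:
  assumes "\<And>a t. snd (z' a) \<le> t \<Longrightarrow> (\<lambda>\<omega>. B a \<omega> t) \<in> borel_measurable M" "0 < h"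
  shows "(\<lambda>\<omega>. scheme_drive z T0 T1 h q z' (\<lambda>a. B a \<omega>) p) \<in> borel_measurable M"
  unfolding scheme_drive_def drive_def using assms(2)
  by (cases p) (auto intro!: borel_measurable_diff assms(1))

section \<open>Genericity of coalescing Brownian motions\<close>

text \<open>A contact without crossing makes the minimum of \<open>c * (B i - C l)\<close> over
  \<open>[q, r]\<close> equal to 0. The small-ball bound passes by Fatou from the scheme to the
  minimum over a finite set of times, and again when these times are refined; it is linear in
  \<open>e\<close>, so such contacts have probability 0. Genericity is needed only below
  \<open>i\<close>, where it makes the scheme converge.\<close>

lemma no_touch_AE:
  assumes N: "prob_space N" and B: "independent_brownian_motions N z B"
    and l: "l < i" and g: "AE \<omega> in N. generic i z (\<lambda>j. B j \<omega>) (\<lambda>j. C j \<omega>)"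
    and C: "\<And>t. snd (z l) \<le> t \<Longrightarrow> (\<lambda>\<omega>. C l \<omega> t) \<in> borel_measurable N"
  shows "AE \<omega> in N. no_touch (max (snd (z l)) (snd (z i))) (B i \<omega>) (C l \<omega>)"
proof -
  interpret prob_space N by fact
  let ?t0 = "max (snd (z l)) (snd (z i))"
  have "AE \<omega> in N. \<not> ((\<forall>s\<in>{q..r}. 0 \<le> c * (B i \<omega> s - C l \<omega> s)) \<and> (\<exists>s\<in>{q..r}. c * (B i \<omega> s - C l \<omega> s) = 0))"
    if c: "c \<in> {1, -1}" and q: "?t0 < q" "q < r" for q r c
  proof -
    define T0 where "T0 = Min (insert 0 ((\<lambda>a. snd (z a)) ` {..<i}))"
    have T0: "T0 \<le> snd (z a)" if "a < i" for a unfolding T0_def using that by (intro Min_le) auto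
    define h where "h m = 1 / real (Suc m)" for m
    have h: "\<And>m. 0 < h m" "h \<longlonglongrightarrow> 0" unfolding h_def using LIMSEQ_Suc[OF lim_1_over_n] by auto
    define F where "F p = (2::nat) ^ p" for p
    have F0: "0 < F p" for p by (simp add: F_def)
    define s where "s p j = q + (r - q) * real j / real (F p)" for p j
    define S where "S p m \<omega> j = scheme_pos z i T0 r (h m) (\<lambda>a. a) (scheme_drive z T0 r (h m) (\<lambda>a. a) z (\<lambda>a. B a \<omega>)) (s p j) l" for p m \<omega> j
    define Y where "Y p m \<omega> = (MIN j\<in>{..F p}. c * (fst (z i) + (B i \<omega> (s p j) - B i \<omega> (snd (z i))) - S p m \<omega> j))" for p m \<omega>
    define X where "X p \<omega> = (MIN j\<in>{..F p}. c * (fst (z i) + (B i \<omega> (s p j) - B i \<omega> (snd (z i))) - C l \<omega> (s p j)))" for p \<omega>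
    define D where "D = 2 / sqrt (2 * pi * (q - snd (z i)))"
    have s: "q \<le> s p j" "s p j \<le> r" if "j \<le> F p" for p j
    proof -
      show "q \<le> s p j" using q by (simp add: s_def)
      have "(r - q) * real j / real (F p) \<le> (r - q) * real (F p) / real (F p)"
        using that q by (intro divide_right_mono mult_left_mono) auto
      then show "s p j \<le> r" using F0[of p] by (simp add: s_def)
    qed
    have "snd (z i) < q" using q by simp
    have ball: "prob {\<omega>\<in>space N. \<bar>Y p m \<omega>\<bar> < e} \<le> D * e" if "0 < e" for p m e
      using scheme_small_ball[OF N B l \<open>snd (z i) < q\<close> less_imp_le[OF q(2)] h(1)[of m] that c order_refl, where F="F p" and ?T0.0=T0]
      by (simp add: Y_def S_def s_def D_def mult.commute)
    have Bm: "(\<lambda>\<omega>. B i \<omega> t) \<in> borel_measurable N" if "snd (z i) \<le> t" for t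
      by (rule brownian_motionD(1)[OF ibmD[OF B] that])
    have Xm[measurable]: "X p \<in> borel_measurable N" for p
      unfolding X_def using s q
      by (intro borel_measurable_Min borel_measurable_times borel_measurable_diff borel_measurable_add Bm C) force+
    have Ym[measurable]: "Y p m \<in> borel_measurable N" for p m
    proof -
      have "(\<lambda>\<omega>. S p m \<omega> j) \<in> borel_measurable N" if "j \<le> F p" for j
        unfolding S_def using s[OF that] h(1)[of m]
        by (intro scheme_pos_measurable scheme_drive_measurable brownian_motionD(1)[OF ibmD[OF B]])
      then show ?thesis unfolding Y_def using s q
        by (intro borel_measurable_Min borel_measurable_times borel_measurable_diff borel_measurable_add Bm) force+
    qed
    \<comment> \<open>A continuous minorant of the indicator of \<open>(-e, e)\<close> that equals 1
      at 0, so that it can be followed through both limits.\<close>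
    define \<phi> where "\<phi> e x = max 0 (1 - \<bar>x\<bar> / e)" for e x :: real
    have \<phi>: "0 \<le> \<phi> e x" "\<phi> e x \<le> 1" "isCont (\<phi> e) x" if "0 < e" for e x
      unfolding \<phi>_def using that by (auto intro!: continuous_intros)
    have \<phi>m[measurable]: "\<phi> e \<in> borel_measurable borel" for e unfolding \<phi>_def by measurable
    have YX: "AE \<omega> in N. (\<lambda>m. Y p m \<omega>) \<longlonglongrightarrow> X p \<omega>" for p
      using g
    proof eventually_elim
      case (elim \<omega>)
      have "(\<lambda>m. S p m \<omega> j) \<longlonglongrightarrow> C l \<omega> (s p j)" if "j \<le> F p" for j
        unfolding S_def using s[OF that] q by (intro own_scheme_converges[OF elim T0 l _ _ h]) auto
      then show ?case unfolding Y_def X_def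
        by (intro tendsto_Min_image tendsto_intros) auto
    qed
    have Eb: "(\<integral>\<^sup>+\<omega>. \<phi> e (X p \<omega>) \<partial>N) \<le> ennreal (D * e)" if e: "0 < e" for e p
    proof -
      have "(\<integral>\<^sup>+\<omega>. \<phi> e (X p \<omega>) \<partial>N) = (\<integral>\<^sup>+\<omega>. liminf (\<lambda>m. ennreal (\<phi> e (Y p m \<omega>))) \<partial>N)"
      proof (rule nn_integral_cong_AE)
        show "AE \<omega> in N. ennreal (\<phi> e (X p \<omega>)) = liminf (\<lambda>m. ennreal (\<phi> e (Y p m \<omega>)))"
          using YX[of p]
        proof eventually_elim
          case (elim \<omega>)
          then have "(\<lambda>m. ennreal (\<phi> e (Y p m \<omega>))) \<longlonglongrightarrow> ennreal (\<phi> e (X p \<omega>))"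
            using \<phi>(3)[OF e] by (intro tendsto_ennrealI isCont_tendsto_compose[of _ "\<phi> e"])
          then show ?case by (subst lim_imp_Liminf) auto
        qed
      qed
      also have "\<dots> \<le> liminf (\<lambda>m. \<integral>\<^sup>+\<omega>. \<phi> e (Y p m \<omega>) \<partial>N)"
        by (intro nn_integral_liminf) measurable
      also have "\<dots> \<le> liminf (\<lambda>m::nat. ennreal (D * e))"
      proof (intro Liminf_mono always_eventually allI)
        fix m
        have "(\<integral>\<^sup>+\<omega>. \<phi> e (Y p m \<omega>) \<partial>N) \<le> (\<integral>\<^sup>+\<omega>. indicator {\<omega>\<in>space N. \<bar>Y p m \<omega>\<bar> < e} \<omega> \<partial>N)"
        proof (rule nn_integral_mono)
          fix \<omega> assume "\<omega> \<in> space N"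
          moreover have "\<phi> e (Y p m \<omega>) = 0" if "\<not> \<bar>Y p m \<omega>\<bar> < e" using that e by (simp add: \<phi>_def)
          moreover have "ennreal (\<phi> e (Y p m \<omega>)) \<le> 1" using \<phi>(2)[OF e] by simp
          ultimately show "ennreal (\<phi> e (Y p m \<omega>)) \<le> indicator {\<omega>\<in>space N. \<bar>Y p m \<omega>\<bar> < e} \<omega>"
            by (auto split: split_indicator)
        qed
        also have "\<dots> = emeasure N {\<omega>\<in>space N. \<bar>Y p m \<omega>\<bar> < e}"
          by (intro nn_integral_indicator) measurable
        also have "\<dots> \<le> ennreal (D * e)" using ball[OF e] by (simp add: emeasure_eq_measure ennreal_leI)
        finally show "(\<integral>\<^sup>+\<omega>. \<phi> e (Y p m \<omega>) \<partial>N) \<le> ennreal (D * e)" .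
      qed
      finally have "(\<integral>\<^sup>+\<omega>. \<phi> e (X p \<omega>) \<partial>N) \<le> liminf (\<lambda>m::nat. ennreal (D * e))" .
      then show ?thesis by (simp add: Liminf_const)
    qed
    define G where "G e \<omega> = liminf (\<lambda>p. ennreal (\<phi> e (X p \<omega>)))" for e \<omega>
    have Gm[measurable]: "G e \<in> borel_measurable N" for e unfolding G_def by measurable
    have GI: "(\<integral>\<^sup>+\<omega>. G e \<omega> \<partial>N) \<le> ennreal (D * e)" if "0 < e" for e
    proof -
      have "(\<integral>\<^sup>+\<omega>. G e \<omega> \<partial>N) \<le> liminf (\<lambda>p. \<integral>\<^sup>+\<omega>. \<phi> e (X p \<omega>) \<partial>N)"
        unfolding G_def by (intro nn_integral_liminf) measurable
      also have "\<dots> \<le> liminf (\<lambda>p::nat. ennreal (D * e))"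
        using Eb[OF that] by (intro Liminf_mono) auto
      finally show ?thesis by (simp add: Liminf_const)
    qed
    \<comment> \<open>A contact drives the grid minima to 0 and so makes \<open>G e\<close> equal to
      1 for every \<open>e\<close>. Almost all outcomes with a contact thus lie in the measurable
      set \<open>Z\<close>, whose probability is at most \<open>D / (k + 1)\<close> for every
      \<open>k\<close>.\<close>
    define Z where "Z = {\<omega>\<in>space N. \<forall>k. 1 \<le> G (1 / real (Suc k)) \<omega>}"
    have Zm: "Z \<in> sets N" unfolding Z_def by measurable
    have "emeasure N Z \<le> ennreal (D * (1 / real (Suc k)))" for k
    proof -
      have "emeasure N Z = (\<integral>\<^sup>+\<omega>. indicator Z \<omega> \<partial>N)" using Zm by simp
      also have "\<dots> \<le> (\<integral>\<^sup>+\<omega>. G (1 / real (Suc k)) \<omega> \<partial>N)"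
        by (intro nn_integral_mono) (auto simp: Z_def split: split_indicator)
      also have "\<dots> \<le> ennreal (D * (1 / real (Suc k)))" by (rule GI) simp
      finally show ?thesis .
    qed
    then have "prob Z \<le> D * (1 / real (Suc k))" for k
      using q by (simp add: emeasure_eq_measure D_def)
    moreover have "(\<lambda>k. D * (1 / real (Suc k))) \<longlonglongrightarrow> D * 0"
      using h(2) unfolding h_def by (intro tendsto_intros)
    ultimately have "prob Z \<le> 0" by (intro LIMSEQ_le_const[of _ "D * 0", simplified]) auto
    then have "emeasure N Z = 0" by (simp add: emeasure_eq_measure measure_le_0_iff)
    then have "AE \<omega> in N. \<omega> \<notin> Z" using Zm by (intro AE_not_in) (auto simp: null_sets_def)
    moreover have "AE \<omega> in N. \<omega> \<in> space N" by (rule AE_space)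
    ultimately show ?thesis using g brownian_motionD(2)[OF ibmD[OF B, of i]] brownian_motionD(3)[OF ibmD[OF B, of i]]
    proof eventually_elim
      case (elim \<omega>)
      show ?case
      proof
        assume t: "(\<forall>s\<in>{q..r}. 0 \<le> c * (B i \<omega> s - C l \<omega> s)) \<and> (\<exists>s\<in>{q..r}. c * (B i \<omega> s - C l \<omega> s) = 0)"
        then obtain u where u: "q \<le> u" "u \<le> r" "c * (B i \<omega> u - C l \<omega> u) = 0" by auto
        have Xw: "X p \<omega> = (MIN j\<in>{..F p}. c * (B i \<omega> (s p j) - C l \<omega> (s p j)))" for p
          unfolding X_def using elim by simp
        have X0: "0 \<le> X p \<omega>" for p unfolding Xw using t s by (subst Min_ge_iff) auto
        \<comment> \<open>The last grid time not after the contact time \<open>u\<close>.\<close>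
        define j where "j p = nat \<lfloor>(u - q) / (r - q) * real (F p)\<rfloor>" for p
        have jr: "real (j p) \<le> (u - q) / (r - q) * real (F p)" "(u - q) / (r - q) * real (F p) - 1 \<le> real (j p)" for p
          using u q by (auto simp: j_def)
        have jF: "j p \<le> F p" for p
        proof -
          have "(u - q) / (r - q) * real (F p) \<le> 1 * real (F p)" using u q by (intro mult_right_mono) auto
          then show ?thesis using jr(1)[of p] by simp
        qed
        have sj: "(\<lambda>p. s p (j p)) \<longlonglongrightarrow> u"
        proof (rule tendsto_sandwich[where f="\<lambda>p. u - (r - q) / real (F p)" and h="\<lambda>p. u"])
          have "(\<lambda>p. u - (r - q) * (1/2) ^ p) \<longlonglongrightarrow> u - (r - q) * 0"
            by (intro tendsto_intros LIMSEQ_power_zero) auto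
          then show "(\<lambda>p. u - (r - q) / real (F p)) \<longlonglongrightarrow> u" by (simp add: F_def power_divide)
          have "s p (j p) \<le> u \<and> u - (r - q) / real (F p) \<le> s p (j p)" for p
          proof -
            have "(r - q) * real (j p) \<le> (u - q) * real (F p)" "(u - q) * real (F p) - (r - q) \<le> (r - q) * real (j p)"
            proof -
              have e: "(r - q) * ((u - q) / (r - q) * x) = (u - q) * x" for x using q by simp
              show "(r - q) * real (j p) \<le> (u - q) * real (F p)"
                using mult_left_mono[OF jr(1)[of p], of "r - q"] q unfolding e by simp
              show "(u - q) * real (F p) - (r - q) \<le> (r - q) * real (j p)"
                using mult_left_mono[OF jr(2)[of p], of "r - q"] q unfolding right_diff_distrib[of "r - q"] e by simp
            qed
            from divide_right_mono[OF this(1), of "real (F p)"] divide_right_mono[OF this(2), of "real (F p)"]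
            have "(r - q) * real (j p) / real (F p) \<le> u - q" "u - q - (r - q) / real (F p) \<le> (r - q) * real (j p) / real (F p)"
              using F0[of p] by (auto simp: diff_divide_distrib)
            then show ?thesis by (simp add: s_def)
          qed
          then show "\<forall>\<^sub>F p in sequentially. u - (r - q) / real (F p) \<le> s p (j p)" "\<forall>\<^sub>F p in sequentially. s p (j p) \<le> u" by auto
        qed auto
        have cc: "continuous_on {snd (z l)..} (C l \<omega>)" using elim(3) l unfolding generic_def by (blast dest: coalescence_belowD(1))
        have "(\<lambda>p. B i \<omega> (s p (j p))) \<longlonglongrightarrow> B i \<omega> u" "(\<lambda>p. C l \<omega> (s p (j p))) \<longlonglongrightarrow> C l \<omega> u"
        proof -
          have "q \<le> s p (j p)" for p using s(1)[OF jF] .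
          then have ge: "snd (z i) \<le> s p (j p)" "snd (z l) \<le> s p (j p)" for p using q by (meson max.strict_boundedE less_imp_le order_trans)+
          show "(\<lambda>p. B i \<omega> (s p (j p))) \<longlonglongrightarrow> B i \<omega> u"
            by (rule continuous_on_tendsto_compose[OF elim(5) sj]) (use u q ge in auto)
          show "(\<lambda>p. C l \<omega> (s p (j p))) \<longlonglongrightarrow> C l \<omega> u"
            by (rule continuous_on_tendsto_compose[OF cc sj]) (use u q ge in auto)
        qed
        then have "(\<lambda>p. c * (B i \<omega> (s p (j p)) - C l \<omega> (s p (j p)))) \<longlonglongrightarrow> c * (B i \<omega> u - C l \<omega> u)" by (intro tendsto_intros)
        then have l0: "(\<lambda>p. c * (B i \<omega> (s p (j p)) - C l \<omega> (s p (j p)))) \<longlonglongrightarrow> 0" using u(3) by simp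
        have "X p \<omega> \<le> c * (B i \<omega> (s p (j p)) - C l \<omega> (s p (j p)))" for p
          unfolding Xw using jF by (intro Min_le) auto
        then have "(\<lambda>p. X p \<omega>) \<longlonglongrightarrow> 0"
          using X0 by (intro tendsto_sandwich[OF _ _ tendsto_const l0]) auto
        have "G e \<omega> = 1" if "0 < e" for e
        proof -
          have "(\<lambda>p. ennreal (\<phi> e (X p \<omega>))) \<longlonglongrightarrow> ennreal (\<phi> e 0)"
            using \<phi>(3)[OF that, of 0] \<open>(\<lambda>p. X p \<omega>) \<longlonglongrightarrow> 0\<close> by (intro tendsto_ennrealI isCont_tendsto_compose[of _ "\<phi> e"]) auto
          then show ?thesis unfolding G_def by (subst lim_imp_Liminf) (auto simp: \<phi>_def)
        qed
        then have "\<omega> \<in> Z" using elim by (auto simp: Z_def)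
        then show False using elim by simp
      qed
    qed
  qed
  then have "AE \<omega> in N. \<forall>q\<in>\<rat>. \<forall>r\<in>\<rat>. \<forall>c\<in>{1,-1}. ?t0 < q \<longrightarrow> q < r \<longrightarrow>
    \<not> ((\<forall>s\<in>{q..r}. 0 \<le> c * (B i \<omega> s - C l \<omega> s)) \<and> (\<exists>s\<in>{q..r}. c * (B i \<omega> s - C l \<omega> s) = 0))"
    by (intro AE_ball_countable' countable_rat AE_impI countable_finite) auto
  then show ?thesis
  proof eventually_elim
    case (elim \<omega>)
    then show ?case unfolding no_touch_def by (metis order_le_less)
  qed
qed

text \<open>When \<open>i\<close> is born, a path born earlier sits on a driver born earlier, which
  almost surely misses the fixed starting point of \<open>i\<close>. Paths born at the same time
  start at different places.\<close>

lemma apart_AE: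
  assumes N: "prob_space N" and B: "independent_brownian_motions N z B" and inj: "inj_on z {..<n}"
    and c: "AE \<omega> in N. coalescence_below n z (\<lambda>j. B j \<omega>) (\<lambda>j. C j \<omega>)"
  shows "AE \<omega> in N. \<forall>i<n. \<forall>l<n. i \<noteq> l \<longrightarrow> snd (z l) \<le> snd (z i) \<longrightarrow> C l \<omega> (snd (z i)) \<noteq> C i \<omega> (snd (z i))"
proof -
  have "AE \<omega> in N. \<forall>p i. snd (z p) < snd (z i) \<longrightarrow> B p \<omega> (snd (z i)) \<noteq> fst (z i)"
    unfolding AE_all_countable using brownian_no_atom[OF N ibmD[OF B]] by (intro allI AE_impI) auto
  moreover have "AE \<omega> in N. \<forall>p. continuous_on {snd (z p)..} (B p \<omega>)"
    unfolding AE_all_countable using brownian_motionD(3)[OF ibmD[OF B]] by auto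
  ultimately show ?thesis using c
  proof eventually_elim
    case (elim \<omega>)
    show ?case
    proof (intro allI impI)
      fix i l assume il: "i < n" "l < n" "i \<noteq> l" "snd (z l) \<le> snd (z i)"
      have Ci: "C i \<omega> (snd (z i)) = fst (z i)" by (rule coalescence_belowD(2)[OF elim(3) il(1)])
      show "C l \<omega> (snd (z i)) \<noteq> C i \<omega> (snd (z i))"
      proof (cases "snd (z l) = snd (z i)")
        case True
        then have "C l \<omega> (snd (z i)) = fst (z l)" using coalescence_belowD(2)[OF elim(3) il(2)] by simp
        moreover have "z l \<noteq> z i" using inj_onD[OF inj, of l i] il by auto
        ultimately show ?thesis using Ci True by (auto simp: prod_eq_iff)
      next
        case False
        then obtain p where "snd (z p) < snd (z i)" "C l \<omega> (snd (z i)) = B p \<omega> (snd (z i))"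
          using coalescence_values[OF elim(3) _ il(2), of "snd (z i)"] elim(2) il by auto
        then show ?thesis using elim(1) Ci by auto
      qed
    qed
  qed
qed

text \<open>Induction on the number of paths: excluding contacts of driver \<open>i\<close> with the
  earlier paths uses convergence of the scheme for these, that is, genericity below
  \<open>i\<close>.\<close>

theorem generic_AE:
  assumes N: "prob_space N" and B: "independent_brownian_motions N z B" and inj: "inj_on z {..<n}"
    and c: "AE \<omega> in N. coalescence_below n z (\<lambda>j. B j \<omega>) (\<lambda>j. C j \<omega>)"
    and C: "\<And>l t. l < n \<Longrightarrow> snd (z l) \<le> t \<Longrightarrow> (\<lambda>\<omega>. C l \<omega> t) \<in> borel_measurable N"
  shows "AE \<omega> in N. generic n z (\<lambda>j. B j \<omega>) (\<lambda>j. C j \<omega>)"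
proof -
  have cont: "AE \<omega> in N. \<forall>p. continuous_on {snd (z p)..} (B p \<omega>) \<and> B p \<omega> (snd (z p)) = fst (z p)"
    unfolding AE_all_countable using brownian_motionD(2,3)[OF ibmD[OF B]] by auto
  have "i \<le> n \<Longrightarrow> AE \<omega> in N. generic i z (\<lambda>j. B j \<omega>) (\<lambda>j. C j \<omega>)" for i
  proof (induction i)
    case 0
    then show ?case by (simp add: generic_def coalescence_below_def)
  next
    case (Suc i)
    have g: "AE \<omega> in N. generic i z (\<lambda>j. B j \<omega>) (\<lambda>j. C j \<omega>)" using Suc by simp
    have "AE \<omega> in N. \<forall>l\<in>{..<i}. no_touch (max (snd (z l)) (snd (z i))) (B i \<omega>) (C l \<omega>)"
      using Suc.prems by (intro AE_ball_countable' no_touch_AE[OF N B _ g] C countable_finite) auto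
    with g cont c apart_AE[OF N B inj c] show ?case
    proof eventually_elim
      case (elim \<omega>)
      have c': "coalescence_below (Suc i) z (\<lambda>j. B j \<omega>) (\<lambda>j. C j \<omega>)"
        by (rule coalescence_below_mono[OF elim(3) Suc.prems])
      have ap: "C l \<omega> (max (snd (z l)) (snd (z i'))) \<noteq> C i' \<omega> (max (snd (z l)) (snd (z i')))" if "i' < Suc i" "l < i'" for i' l
      proof (cases "snd (z l) \<le> snd (z i')")
        case True
        then show ?thesis using elim(4) that Suc.prems by (simp add: max_def)
      next
        case False
        then have "C i' \<omega> (snd (z l)) \<noteq> C l \<omega> (snd (z l))" using elim(4) that Suc.prems by simp
        then show ?thesis using False by (simp add: max_def)
      qed
      show ?case using elim(1,2,5) c' ap unfolding generic_def by (auto simp: less_Suc_eq)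
    qed
  qed
  then show ?thesis by simp
qed

section \<open>The law of the scheme and its limit\<close>

text \<open>The drive is an injective relabelling of Gaussian increments over disjoint intervals.
  Injectivity is the point of sending the entries before birth to indices beyond the
  horizon.\<close>

lemma scheme_drive_distr:
  assumes N: "prob_space N" and B: "independent_brownian_motions N z' B" and q: "inj q" and h: "0 < h"
    and J: "0 < J" and K: "0 < grid_index T0 h T1"
  defines "\<nu> \<equiv> density lborel (normal_density 0 (sqrt h))" and "I \<equiv> {..<J} \<times> {..<grid_index T0 h T1}"
  shows "distr N (PiM I (\<lambda>_. \<nu>)) (\<lambda>\<omega>. \<lambda>p\<in>I. scheme_drive z T0 T1 h q z' (\<lambda>a. B a \<omega>) p) = PiM I (\<lambda>_. \<nu>)"
    and "(\<lambda>\<omega>. \<lambda>p\<in>I. scheme_drive z T0 T1 h q z' (\<lambda>a. B a \<omega>) p) \<in> measurable N (PiM I (\<lambda>_. \<nu>))"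
proof -
  interpret prob_space N by fact
  define K where "K = grid_index T0 h T1"
  define \<kappa> where "\<kappa> a = grid_index T0 h (snd (z a))" for a
  define \<tau> where "\<tau> a k = snd (z' (q a)) + real k * h" for a k
  define X where "X p \<omega> = B (q (fst p)) \<omega> (\<tau> (fst p) (Suc (snd p))) - B (q (fst p)) \<omega> (\<tau> (fst p) (snd p))" for p \<omega>
  define U where "U = {..<J} \<times> {..<2 * K}"
  define f where "f p = (fst p, drive_index \<kappa> K (fst p) (snd p))" for p :: "nat \<times> nat"
  note Bq = ibm_reindex[OF N B q]
  have \<nu>: "prob_space \<nu>" "sets \<nu> = sets borel" unfolding \<nu>_def using h by (auto intro: prob_space_normal_density)
  have iv: "indep_vars (\<lambda>_. borel) X UNIV"
    unfolding X_def
    by (rule ibm_array_indep[OF N Bq, where \<tau>=\<tau>]) (use h in \<open>auto simp: \<tau>_def intro!: monoI mult_right_mono\<close>)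
  have Xm: "X p \<in> borel_measurable N" for p using iv unfolding indep_vars_def by blast
  have Xd: "distr N borel (X p) = \<nu>" for p
  proof -
    have "distributed N lborel (X p) (normal_density 0 (sqrt (\<tau> (fst p) (Suc (snd p)) - \<tau> (fst p) (snd p))))"
      unfolding X_def using h by (intro brownian_motionD(4)[OF ibmD[OF B]]) (auto simp: \<tau>_def distrib_right)
    moreover have "\<tau> (fst p) (Suc (snd p)) - \<tau> (fst p) (snd p) = h" by (simp add: \<tau>_def distrib_right)
    ultimately have "distr N lborel (X p) = \<nu>" using distributed_distr_eq_density by (fastforce simp: \<nu>_def)
    then show ?thesis by (simp cong: distr_cong)
  qed
  have "(0, 0) \<in> U" using J K by (simp add: U_def K_def)
  then have Une: "U \<noteq> {}" by blast
  have "indep_vars (\<lambda>_. borel) X U" using iv by (rule indep_vars_subset) simp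
  then have D1: "distr N (PiM U (\<lambda>_. borel)) (\<lambda>\<omega>. \<lambda>p\<in>U. X p \<omega>) = PiM U (\<lambda>_. \<nu>)"
    using indep_vars_iff_distr_eq_PiM[OF Une Xm] by (simp add: Xd)
  have sU: "sets (PiM U (\<lambda>_. borel)) = sets (PiM U (\<lambda>_. \<nu>))" using \<nu> by (intro sets_PiM_cong) auto
  have mU: "(\<lambda>\<omega>. \<lambda>p\<in>U. X p \<omega>) \<in> measurable N (PiM U (\<lambda>_. \<nu>))"
    using measurable_restrict[of U X N "\<lambda>_. borel"] Xm sU by (simp cong: measurable_cong_sets)
  have inj: "inj_on f I"
    by (rule inj_onI) (auto simp: f_def I_def K_def[symmetric] drive_index_def split: if_splits)
  have fU: "f \<in> I \<rightarrow> U" by (auto simp: f_def I_def U_def K_def[symmetric] drive_index_def)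
  have mf: "(\<lambda>x. \<lambda>p\<in>I. x (f p)) \<in> measurable (PiM U (\<lambda>_. \<nu>)) (PiM I (\<lambda>_. \<nu>))"
    using fU by (intro measurable_restrict measurable_component_singleton) auto
  have eq: "(\<lambda>p\<in>I. scheme_drive z T0 T1 h q z' (\<lambda>a. B a \<omega>) p) = (\<lambda>p\<in>I. restrict (\<lambda>p. X p \<omega>) U (f p))" for \<omega>
  proof (rule restrict_ext)
    fix p assume "p \<in> I"
    then have "restrict (\<lambda>p. X p \<omega>) U (f p) = X (f p) \<omega>" using fU by auto
    then show "scheme_drive z T0 T1 h q z' (\<lambda>a. B a \<omega>) p = restrict (\<lambda>p. X p \<omega>) U (f p)"
      by (cases p) (simp add: scheme_drive_def drive_def X_def \<tau>_def f_def \<kappa>_def[abs_def] K_def)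
  qed
  show m: "(\<lambda>\<omega>. \<lambda>p\<in>I. scheme_drive z T0 T1 h q z' (\<lambda>a. B a \<omega>) p) \<in> measurable N (PiM I (\<lambda>_. \<nu>))"
    unfolding eq by (rule measurable_compose[OF mU mf])
  have "distr N (PiM I (\<lambda>_. \<nu>)) (\<lambda>\<omega>. \<lambda>p\<in>I. scheme_drive z T0 T1 h q z' (\<lambda>a. B a \<omega>) p) =
     distr (distr N (PiM U (\<lambda>_. \<nu>)) (\<lambda>\<omega>. \<lambda>p\<in>U. X p \<omega>)) (PiM I (\<lambda>_. \<nu>)) (\<lambda>x. \<lambda>p\<in>I. x (f p))"
    unfolding eq using distr_distr[OF mf mU] by (simp add: o_def)
  also have "distr N (PiM U (\<lambda>_. \<nu>)) (\<lambda>\<omega>. \<lambda>p\<in>U. X p \<omega>) = PiM U (\<lambda>_. \<nu>)"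
    using D1 sU by (metis distr_cong)
  also have "distr (PiM U (\<lambda>_. \<nu>)) (PiM I (\<lambda>_. \<nu>)) (\<lambda>x. \<lambda>p\<in>I. x (f p)) = PiM I (\<lambda>_. \<nu>)"
    by (rule distr_PiM_reindex[OF _ inj fU]) (rule \<nu>)
  finally show "distr N (PiM I (\<lambda>_. \<nu>)) (\<lambda>\<omega>. \<lambda>p\<in>I. scheme_drive z T0 T1 h q z' (\<lambda>a. B a \<omega>) p) = PiM I (\<lambda>_. \<nu>)" .
qed

text \<open>Drivers enter only through increments of common variance \<open>h\<close>, so their
  starting points and the underlying probability space disappear, and both sides become integrals
  over the same i.i.d. array. The two rankings are then linked by \<open>exchange\<close>.\<close>

lemma scheme_law_unique:
  fixes \<phi> :: "nat \<Rightarrow> real \<Rightarrow> real"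
  assumes N1: "prob_space N1" "independent_brownian_motions N1 z1 B1" "inj q1"
    and N2: "prob_space N2" "independent_brownian_motions N2 z2 B2" "inj q2"
    and h: "0 < h" and J: "0 < J" and K: "0 < grid_index T0 h T1"
    and \<phi>: "\<And>p. \<phi> p \<in> borel_measurable borel" and s: "\<And>p. p < P \<Longrightarrow> s p \<le> T1"
  shows "(\<integral>\<omega>. (\<Prod>p<P. \<phi> p (scheme_pos z J T0 T1 h \<rho>1 (scheme_drive z T0 T1 h q1 z1 (\<lambda>a. B1 a \<omega>)) (s p) (a p))) \<partial>N1) =
    (\<integral>\<omega>. (\<Prod>p<P. \<phi> p (scheme_pos z J T0 T1 h \<rho>2 (scheme_drive z T0 T1 h q2 z2 (\<lambda>a. B2 a \<omega>)) (s p) (a p))) \<partial>N2)"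
proof -
  define \<nu> where "\<nu> = density lborel (normal_density 0 (sqrt h))"
  define K where "K = grid_index T0 h T1"
  let ?I = "{..<J} \<times> {..<K}"
  let ?\<mu> = "PiM ?I (\<lambda>_. \<nu>)"
  have \<nu>: "prob_space \<nu>" "sets \<nu> = sets borel" unfolding \<nu>_def using h by (auto intro: prob_space_normal_density)
  define G where "G \<rho> \<zeta> = (\<Prod>p<P. \<phi> p (scheme_pos z J T0 T1 h \<rho> \<zeta> (s p) (a p)))" for \<rho> \<zeta>
  have gi: "grid_index T0 h (s p) \<le> K" if "p < P" for p
    unfolding K_def using s[OF that] h by (intro grid_index_mono)
  have Gcong: "G \<rho> \<zeta> = G \<rho> (restrict \<zeta> ?I)" for \<rho> \<zeta>
    unfolding G_def scheme_pos_def
    by (intro prod.cong refl arg_cong[where f="\<phi> _"] arg_cong[where f="\<lambda>c. fst c _"] chain_cong valid_rank_sel)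
       (use gi in force)
  have Gm: "G \<rho> \<in> borel_measurable ?\<mu>" for \<rho>
    unfolding G_def scheme_pos_def
    using chain_measurable[OF \<nu> valid_rank_sel gi] by (intro borel_measurable_prod measurable_compose[OF _ \<phi>]) auto
  have 1: "(\<integral>\<omega>. G \<rho> (scheme_drive z T0 T1 h q z' (\<lambda>a. B a \<omega>)) \<partial>N) = (\<integral>\<zeta>. G \<rho> \<zeta> \<partial>?\<mu>)"
    if N: "prob_space N" "independent_brownian_motions N z' B" "inj q" for N :: "'z measure" and z' B q \<rho>
  proof -
    note d = scheme_drive_distr[OF N h J K, of z, folded \<nu>_def K_def]
    have "(\<integral>\<zeta>. G \<rho> \<zeta> \<partial>?\<mu>) = (\<integral>\<zeta>. G \<rho> \<zeta> \<partial>distr N ?\<mu> (\<lambda>\<omega>. \<lambda>p\<in>?I. scheme_drive z T0 T1 h q z' (\<lambda>a. B a \<omega>) p))"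
      by (simp only: d(1))
    also have "\<dots> = (\<integral>\<omega>. G \<rho> (\<lambda>p\<in>?I. scheme_drive z T0 T1 h q z' (\<lambda>a. B a \<omega>) p) \<partial>N)"
      by (rule integral_distr[OF d(2) Gm])
    finally show ?thesis using Gcong by simp
  qed
  have "(\<integral>\<zeta>. G \<rho>1 \<zeta> \<partial>?\<mu>) = (\<integral>\<zeta>. G \<rho>2 \<zeta> \<partial>?\<mu>)"
  proof -
    let ?\<kappa> = "\<lambda>a. grid_index T0 h (snd (z a))" and ?\<xi> = "\<lambda>a. fst (z a)"
    let ?e = "exchange J ?\<kappa> ?\<xi> (rank_sel \<rho>1) (rank_sel \<rho>2) K"
    have "(\<integral>\<zeta>. G \<rho>1 \<zeta> \<partial>?\<mu>) = (\<integral>\<zeta>. G \<rho>1 \<zeta> \<partial>distr ?\<mu> ?\<mu> ?e)"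
      by (simp only: distr_exchange[OF \<nu> valid_rank_sel valid_rank_sel])
    also have "\<dots> = (\<integral>\<zeta>. G \<rho>1 (?e \<zeta>) \<partial>?\<mu>)"
      by (rule integral_distr[OF exchange_measurable[OF \<nu> valid_rank_sel valid_rank_sel] Gm])
    also have "\<dots> = (\<integral>\<zeta>. G \<rho>2 \<zeta> \<partial>?\<mu>)"
      unfolding G_def scheme_pos_def
      by (intro Bochner_Integration.integral_cong prod.cong refl arg_cong[where f="\<phi> _"] arg_cong[where f="\<lambda>c. fst c _"]
          chain_exchange valid_rank_sel gi) simp
    finally show ?thesis .
  qed
  then show ?thesis using 1[OF N1, of \<rho>1] 1[OF N2, of \<rho>2] unfolding G_def by simp
qed

lemma rank_exists:
  assumes "inj_on a {..<n::nat}"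
  shows "\<exists>q :: nat \<Rightarrow> nat. inj q \<and> (\<forall>l<n. q (a l) = l)"
proof (intro exI conjI allI impI)
  \<comment> \<open>Adding \<open>n\<close> ranks every untracked label after all tracked
    ones.\<close>
  let ?q = "\<lambda>x. if x \<in> a ` {..<n} then the_inv_into {..<n} a x else n + x"
  have lt: "the_inv_into {..<n} a x < n" if "x \<in> a ` {..<n}" for x
    using the_inv_into_into[OF assms that order_refl] by simp
  show "inj ?q"
  proof (rule injI)
    fix x y assume "?q x = ?q y"
    then show "x = y" using lt[of x] lt[of y] inj_on_the_inv_into[OF assms]
      by (auto split: if_splits simp: inj_on_def)
  qed
  show "?q (a l) = l" if "l < n" for l using that the_inv_into_f_f[OF assms] by auto
qed

lemma (in prob_space) prob_eventually_0:
  assumes A: "\<And>m. A m \<in> events" and ae: "AE \<omega> in M. \<forall>\<^sub>F m in sequentially. \<omega> \<notin> A m"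
  shows "(\<lambda>m. prob (A m)) \<longlonglongrightarrow> 0"
proof -
  have "(\<lambda>m. \<integral>\<omega>. indicat_real (A m) \<omega> \<partial>M) \<longlonglongrightarrow> (\<integral>\<omega>. 0 \<partial>M)"
  proof (rule integral_dominated_convergence[where w="\<lambda>_. 1"])
    show "AE \<omega> in M. (\<lambda>m. indicat_real (A m) \<omega>) \<longlonglongrightarrow> 0"
      using ae
    proof eventually_elim
      case (elim \<omega>)
      then show ?case by (intro tendsto_eventually) (auto elim!: eventually_mono)
    qed
  qed (use A in \<open>auto split: split_indicator\<close>)
  then show ?thesis using A by simp
qed

lemma prod_tendsto_integral:
  fixes \<phi> :: "nat \<Rightarrow> real \<Rightarrow> real" and X :: "nat \<Rightarrow> nat \<Rightarrow> 'a \<Rightarrow> real"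
  assumes "prob_space M" and \<phi>: "\<And>p. continuous_on UNIV (\<phi> p)" "\<And>p x. \<bar>\<phi> p x\<bar> \<le> 1"
    and m: "\<And>m p. p < P \<Longrightarrow> X m p \<in> borel_measurable M" "\<And>p. p < P \<Longrightarrow> Y p \<in> borel_measurable M"
    and lim: "AE \<omega> in M. \<forall>p<P. (\<lambda>m. X m p \<omega>) \<longlonglongrightarrow> Y p \<omega>"
  shows "(\<lambda>m. \<integral>\<omega>. (\<Prod>p<P. \<phi> p (X m p \<omega>)) \<partial>M) \<longlonglongrightarrow> (\<integral>\<omega>. (\<Prod>p<P. \<phi> p (Y p \<omega>)) \<partial>M)"
proof -
  interpret prob_space M by fact
  have \<phi>m: "\<phi> p \<in> borel_measurable borel" for p by (rule borel_measurable_continuous_onI[OF \<phi>(1)])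
  show ?thesis
  proof (rule integral_dominated_convergence[where w="\<lambda>_. 1"])
    show "(\<lambda>\<omega>. \<Prod>p<P. \<phi> p (Y p \<omega>)) \<in> borel_measurable M" "(\<lambda>\<omega>. \<Prod>p<P. \<phi> p (X m p \<omega>)) \<in> borel_measurable M" for m
      using m by (auto intro!: borel_measurable_prod measurable_compose[OF _ \<phi>m])
    show "AE \<omega> in M. (\<lambda>m. \<Prod>p<P. \<phi> p (X m p \<omega>)) \<longlonglongrightarrow> (\<Prod>p<P. \<phi> p (Y p \<omega>))"
      using lim by eventually_elim
        (auto intro!: tendsto_prod continuous_on_tendsto_compose[OF \<phi>(1)])
    show "AE \<omega> in M. norm (\<Prod>p<P. \<phi> p (X m p \<omega>)) \<le> 1" for m
      using \<phi>(2) by (intro always_eventually allI) (auto simp: abs_prod intro!: prod_le_1)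
  qed auto
qed

text \<open>The scheme for the starting points \<open>z'\<close> is run on the space that carries the limiting system, with its Brownian
  motions \<open>B\<close> as drivers, the tracked particles \<open>a k l\<close> leading all others. Its mesh is then chosen so fine,
  depending on \<open>k\<close>, that the scheme is close in law to the coalescing system started from \<open>z'\<close>.\<close>

theorem coalescing_limit:
  fixes N' :: "'a measure" and N :: "'b measure" and \<phi> :: "nat \<Rightarrow> real \<Rightarrow> real"
  assumes N': "prob_space N'" "independent_brownian_motions N' z' B'" "inj z'"
      "\<And>n. AE \<omega> in N'. coalescence_below n z' (\<lambda>j. B' j \<omega>) (\<lambda>j. C' j \<omega>)"
      "\<And>l t. snd (z' l) \<le> t \<Longrightarrow> (\<lambda>\<omega>. C' l \<omega> t) \<in> borel_measurable N'"
    and N: "prob_space N" "independent_brownian_motions N z B" "inj_on z {..<n}"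
      "AE \<omega> in N. coalescence_below n z (\<lambda>j. B j \<omega>) (\<lambda>j. C j \<omega>)"
      "\<And>l t. l < n \<Longrightarrow> snd (z l) \<le> t \<Longrightarrow> (\<lambda>\<omega>. C l \<omega> t) \<in> borel_measurable N"
    and a: "\<And>k. inj_on (a k) {..<n}" "\<And>l. l < n \<Longrightarrow> (\<lambda>k. z' (a k l)) \<longlonglongrightarrow> z l"
    and P: "\<And>p. p < P \<Longrightarrow> l p < n" "\<And>k p. p < P \<Longrightarrow> snd (z' (a k (l p))) \<le> s p"
    and \<phi>: "\<And>p. continuous_on UNIV (\<phi> p)" "\<And>p x. \<bar>\<phi> p x\<bar> \<le> 1"
  shows "(\<lambda>k. \<integral>\<omega>. (\<Prod>p<P. \<phi> p (C' (a k (l p)) \<omega> (s p))) \<partial>N') \<longlonglongrightarrow> (\<integral>\<omega>. (\<Prod>p<P. \<phi> p (C (l p) \<omega> (s p))) \<partial>N)"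
proof (cases "P = 0")
  case True
  then show ?thesis using N(1) N'(1) by (simp add: prob_space.prob_space)
next
  case False
  then have n: "0 < n" using P(1)[of 0] by simp
  interpret N: prob_space N by fact
  note B = brownian_motionD[OF ibmD[OF N(2)]]
  note B' = brownian_motionD[OF ibmD[OF N'(2)]]
  have \<phi>m: "\<phi> p \<in> borel_measurable borel" for p by (rule borel_measurable_continuous_onI[OF \<phi>(1)])
  \<comment> \<open>All particles up to the largest tracked label are kept, since in the order of
    \<open>z'\<close> each of them may lead a tracked one. This number is not bounded in
    \<open>k\<close>.\<close>
  define J where "J k = Suc (Max (a k ` {..<n}))" for k
  have aJ: "a k l < J k" if "l < n" for k l using that by (auto simp: J_def less_Suc_eq_le)
  obtain q where q: "\<And>k. inj (q k)" "\<And>k l. l < n \<Longrightarrow> q k (a k l) = l"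
    using rank_exists[OF a(1)] by metis
  define T1 where "T1 = Max (s ` {..<P})"
  have sT: "s p \<le> T1" if "p < P" for p using that by (auto simp: T1_def)
  \<comment> \<open>Subtracting 1 puts \<open>T0 k\<close> strictly before \<open>T1\<close>, so
    that the grid has at least one step.\<close>
  define T0 where "T0 k = Min (insert T1 ((\<lambda>i. snd (z' i)) ` {..<J k})) - 1" for k
  have T0: "T0 k \<le> snd (z' i)" if "i < J k" for k i
  proof -
    have "Min (insert T1 ((\<lambda>i. snd (z' i)) ` {..<J k})) \<le> snd (z' i)" using that by (intro Min_le) auto
    then show ?thesis by (simp add: T0_def)
  qed
  have T01: "T0 k < T1" for k
  proof -
    have "Min (insert T1 ((\<lambda>i. snd (z' i)) ` {..<J k})) \<le> T1" by (intro Min_le) auto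
    then show ?thesis unfolding T0_def by linarith
  qed
  define h where "h m = 1 / real (Suc m)" for m
  have h: "\<And>m. 0 < h m" "h \<longlonglongrightarrow> 0" unfolding h_def using LIMSEQ_Suc[OF lim_1_over_n] by auto
  have K: "0 < grid_index (T0 k) (h m) T1" for k m
    using grid_index_bounds(1)[OF h(1) less_imp_le[OF T01], of k m] T01[of k] by (cases "grid_index (T0 k) (h m) T1 = 0") auto
  define S where "S k m p \<omega> = scheme_pos z' (J k) (T0 k) T1 (h m) (q k) (scheme_drive z' (T0 k) T1 (h m) (q k) z (\<lambda>i. B i \<omega>)) (s p) (a k (l p))" for k m p \<omega>
  define A where "A k m = (\<integral>\<omega>. (\<Prod>p<P. \<phi> p (S k m p \<omega>)) \<partial>N)" for k m
  define E where "E k = (\<integral>\<omega>. (\<Prod>p<P. \<phi> p (C' (a k (l p)) \<omega> (s p))) \<partial>N')" for k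
  have dm: "(\<lambda>\<omega>. scheme_drive z' (T0 k) T1 (h m) (q k) z (\<lambda>i. B i \<omega>) p) \<in> borel_measurable N" for k m p
    by (rule scheme_drive_measurable[OF B(1) h(1)])
  have Sm: "S k m p \<in> borel_measurable N" if "p < P" for k m p
    unfolding S_def by (rule scheme_pos_measurable[OF dm h(1) sT[OF that]])
  have AE: "(\<lambda>m. A k m) \<longlonglongrightarrow> E k" for k
  proof -
    define S' where "S' m p \<omega> = scheme_pos z' (J k) (T0 k) T1 (h m) (\<lambda>i. i) (scheme_drive z' (T0 k) T1 (h m) (\<lambda>i. i) z' (\<lambda>i. B' i \<omega>)) (s p) (a k (l p))" for m p \<omega>
    \<comment> \<open>The ranking and the drivers are changed together: \<open>A\<close> uses the
      drivers of the limiting system with tracked particles first, \<open>S'\<close> the drivers of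
      \<open>N'\<close> in their own order, for which convergence is already known.\<close>
    have "A k m = (\<integral>\<omega>. (\<Prod>p<P. \<phi> p (S' m p \<omega>)) \<partial>N')" for m
      unfolding A_def S_def S'_def
      by (rule scheme_law_unique[OF N(1,2) q(1) N'(1,2) _ h(1) _ K \<phi>m sT]) (auto simp: J_def)
    moreover have "(\<lambda>m. \<integral>\<omega>. (\<Prod>p<P. \<phi> p (S' m p \<omega>)) \<partial>N') \<longlonglongrightarrow> E k"
      unfolding E_def
    proof (rule prod_tendsto_integral[OF N'(1) \<phi>])
      show "S' m p \<in> borel_measurable N'" if "p < P" for m p
        unfolding S'_def by (intro scheme_pos_measurable[OF scheme_drive_measurable[OF B'(1) h(1)] h(1) sT[OF that]])
      show "(\<lambda>\<omega>. C' (a k (l p)) \<omega> (s p)) \<in> borel_measurable N'" if "p < P" for p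
        by (rule N'(5)[OF P(2)[OF that]])
      have "AE \<omega> in N'. generic (J k) z' (\<lambda>j. B' j \<omega>) (\<lambda>j. C' j \<omega>)"
        using N'(3) by (intro generic_AE[OF N'(1,2) _ N'(4) N'(5)]) (auto intro: inj_on_subset)
      then show "AE \<omega> in N'. \<forall>p<P. (\<lambda>m. S' m p \<omega>) \<longlonglongrightarrow> C' (a k (l p)) \<omega> (s p)"
      proof eventually_elim
        case (elim \<omega>)
        show ?case unfolding S'_def
          using own_scheme_converges[OF elim T0 aJ[OF P(1)] P(2) sT h] by blast
      qed
    qed
    ultimately show ?thesis by simp
  qed
  \<comment> \<open>Chosen so that the distance within a cluster, at most
    \<open>2 * (J k * J k) * \<epsilon> k\<close>, is at most \<open>1 / (k + 1)\<close>.\<close>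
  define \<epsilon> where "\<epsilon> k = 1 / (2 * (real (J k) * real (J k)) * real (Suc k))" for k
  have J0: "0 < J k" for k by (simp add: J_def)
  have \<epsilon>: "0 < \<epsilon> k" for k unfolding \<epsilon>_def using J0[of k] by simp
  define bad where "bad k m = {\<omega>\<in>space N. \<exists>i<J k. \<exists>j<grid_index (T0 k) (h m) T1. \<epsilon> k \<le> \<bar>scheme_drive z' (T0 k) T1 (h m) (q k) z (\<lambda>i. B i \<omega>) (i, j)\<bar>}" for k m
  have badm: "bad k m \<in> sets N" for k m
  proof -
    have "{\<omega>\<in>space N. \<exists>i\<in>{..<J k}. \<exists>j\<in>{..<grid_index (T0 k) (h m) T1}. \<epsilon> k \<le> \<bar>scheme_drive z' (T0 k) T1 (h m) (q k) z (\<lambda>i. B i \<omega>) (i, j)\<bar>} \<in> sets N"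
      using dm by (intro sets.sets_Collect_finite_Ex) auto
    then show ?thesis unfolding bad_def Bex_def lessThan_iff .
  qed
  have contB: "AE \<omega> in N. \<forall>i. continuous_on {snd (z i)..} (B i \<omega>)"
    unfolding AE_all_countable using B(3) by auto
  have bad0: "(\<lambda>m. N.prob (bad k m)) \<longlonglongrightarrow> 0" for k
  proof (rule N.prob_eventually_0[OF badm])
    show "AE \<omega> in N. \<forall>\<^sub>F m in sequentially. \<omega> \<notin> bad k m"
      using contB
    proof eventually_elim
      case (elim \<omega>)
      have "\<forall>\<^sub>F m in sequentially. \<forall>i<J k. \<forall>j<grid_index (T0 k) (h m) T1. \<bar>scheme_drive z' (T0 k) T1 (h m) (q k) z (\<lambda>i. B i \<omega>) (i, j)\<bar> < \<epsilon> k"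
        using elim by (intro scheme_drive_small[OF h less_imp_le[OF T01] _ \<epsilon>]) auto
      then show ?case by eventually_elim (force simp: bad_def)
    qed
  qed
  \<comment> \<open>The mesh is fixed once \<open>J k\<close> is known. The bound
    \<open>k \<le> m\<close> makes it tend to 0, and the geometric bound makes the bad events
    summable for Borel-Cantelli.\<close>
  have "\<exists>m\<ge>k. \<bar>A k m - E k\<bar> < 1 / real (Suc k) \<and> N.prob (bad k m) < (1/2) ^ k" for k
  proof -
    have "\<forall>\<^sub>F m in sequentially. dist (A k m) (E k) < 1 / real (Suc k)"
      using AE[of k] by (rule tendstoD) simp
    moreover have "\<forall>\<^sub>F m in sequentially. N.prob (bad k m) < (1/2) ^ k"
      using bad0[of k] by (rule order_tendstoD) simp
    moreover have "\<forall>\<^sub>F m in sequentially. k \<le> m" by (rule eventually_ge_at_top)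
    ultimately have "\<forall>\<^sub>F m in sequentially. k \<le> m \<and> \<bar>A k m - E k\<bar> < 1 / real (Suc k) \<and> N.prob (bad k m) < (1/2) ^ k"
      by eventually_elim (simp add: dist_real_def)
    then have "\<exists>m. k \<le> m \<and> \<bar>A k m - E k\<bar> < 1 / real (Suc k) \<and> N.prob (bad k m) < (1/2) ^ k"
      by (rule eventually_happens'[OF sequentially_bot])
    then show ?thesis by blast
  qed
  then obtain m where m: "\<And>k. k \<le> m k" "\<And>k. \<bar>A k (m k) - E k\<bar> < 1 / real (Suc k)" "\<And>k. N.prob (bad k (m k)) < (1/2) ^ k"
    by metis
  define H where "H k = h (m k)" for k
  have H: "\<And>k. 0 < H k" "H \<longlonglongrightarrow> 0"
  proof -
    show "0 < H k" for k using h by (simp add: H_def)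
    have "H k \<le> h k" for k unfolding H_def h_def using m(1)[of k] by (intro divide_left_mono) auto
    moreover have "0 \<le> H k" for k using h(1)[of "m k"] by (simp add: H_def)
    ultimately show "H \<longlonglongrightarrow> 0"
      by (intro tendsto_sandwich[OF _ _ tendsto_const h(2)] always_eventually allI)
  qed
  have "AE \<omega> in N. \<forall>\<^sub>F k in sequentially. \<omega> \<in> space N - bad k (m k)"
  proof (rule borel_cantelli_AE1[OF badm])
    show "summable (\<lambda>k. N.prob (bad k (m k)))"
      by (rule summable_comparison_test[OF _ summable_geometric[of "1/2::real"]]) (use m(3) in \<open>auto intro!: exI[of _ 0] less_imp_le\<close>)
  qed (simp add: N.emeasure_eq_measure)
  moreover have "AE \<omega> in N. generic n z (\<lambda>j. B j \<omega>) (\<lambda>j. C j \<omega>)"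
    by (rule generic_AE[OF N])
  ultimately have lim: "AE \<omega> in N. \<forall>p<P. (\<lambda>k. S k (m k) p \<omega>) \<longlonglongrightarrow> C (l p) \<omega> (s p)"
  proof eventually_elim
    case (elim \<omega>)
    let ?\<zeta> = "\<lambda>k. scheme_drive z' (T0 k) T1 (H k) (q k) z (\<lambda>i. B i \<omega>)" and ?K = "\<lambda>k. grid_index (T0 k) (H k) T1"
    define e where "e k = Max (insert 0 ((\<lambda>p. \<bar>?\<zeta> k p\<bar>) ` ({..<J k} \<times> {..<?K k})))" for k
    have e0: "0 \<le> e k" for k unfolding e_def by (intro Max_ge) auto
    have "\<forall>\<^sub>F k in sequentially. 2 * (real (J k) * real (J k)) * e k \<le> 1 / real (Suc k)"
      using elim(1)
    proof eventually_elim
      case (elim k)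
      have "e k \<le> \<epsilon> k" unfolding e_def
      proof (rule Max.boundedI)
        fix x assume "x \<in> insert 0 ((\<lambda>p. \<bar>?\<zeta> k p\<bar>) ` ({..<J k} \<times> {..<?K k}))"
        then consider "x = 0" | i j where "i < J k" "j < ?K k" "x = \<bar>?\<zeta> k (i, j)\<bar>" by auto
        then show "x \<le> \<epsilon> k"
        proof cases
          case 1
          then show ?thesis using \<epsilon>[of k] by simp
        next
          case 2
          then have "\<not> \<epsilon> k \<le> x" using elim unfolding bad_def H_def by blast
          then show ?thesis by simp
        qed
      qed auto
      then have "2 * (real (J k) * real (J k)) * e k \<le> 2 * (real (J k) * real (J k)) * \<epsilon> k"
        by (intro mult_left_mono) auto
      also have "\<dots> = 1 / real (Suc k)" unfolding \<epsilon>_def using J0[of k] by simp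
      finally show ?case .
    qed
    then have elim0: "(\<lambda>k. 2 * (real (J k) * real (J k)) * e k) \<longlonglongrightarrow> 0"
      using e0 by (intro tendsto_sandwich[OF _ _ tendsto_const h(2)]) (auto simp: h_def)
    show ?case
    proof (intro allI impI)
      fix p assume p: "p < P"
      have tl: "(\<lambda>k. snd (z' (a k l))) \<longlonglongrightarrow> snd (z l)" if "l < n" for l by (rule tendsto_snd[OF a(2)[OF that]])
      have Ts: "T0 k \<le> s p" for k using T0[OF aJ[OF P(1)[OF p]]] P(2)[OF p] order_trans by blast
      show "(\<lambda>k. S k (m k) p \<omega>) \<longlonglongrightarrow> C (l p) \<omega> (s p)"
        unfolding S_def H_def[symmetric] scheme_pos_def scheme_drive_def
      proof (rule scheme_converges[where a=a and e=e and q=q and J=J and ?T0.0=T0, OF elim(2) H q(1) q(2) aJ])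
        show "(\<lambda>k. T0 k + real (grid_index (T0 k) (H k) (snd (z' (a k l)))) * H k) \<longlonglongrightarrow> snd (z l)" if "l < n" for l
          by (rule grid_index_lim[OF H T0[OF aJ[OF that]] tl[OF that]])
        show "(\<lambda>k. fst (z' (a k l))) \<longlonglongrightarrow> fst (z l)" if "l < n" for l by (rule tendsto_fst[OF a(2)[OF that]])
        show "\<bar>drive z (H k) (\<lambda>a. grid_index (T0 k) (H k) (snd (z' a))) (?K k) (q k) (\<lambda>i. B i \<omega>) (i, j)\<bar> \<le> e k" if "i < J k" "j < ?K k" for k i j
          unfolding e_def scheme_drive_def[symmetric] using that by (intro Max_ge) auto
        show "(\<lambda>k. T0 k + real (grid_index (T0 k) (H k) (s p)) * H k) \<longlonglongrightarrow> s p"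
          by (rule grid_index_lim[OF H Ts tendsto_const])
        show "grid_index (T0 k) (H k) (snd (z' (a k (l p)))) \<le> grid_index (T0 k) (H k) (s p)" for k
          using P(2)[OF p] by (intro grid_index_mono H)
        show "grid_index (T0 k) (H k) (s p) \<le> ?K k" for k by (intro grid_index_mono H sT p)
      qed (assumption | fact e0 elim0 P(1)[OF p])+
    qed
  qed
  have "(\<lambda>k. A k (m k)) \<longlonglongrightarrow> (\<integral>\<omega>. (\<Prod>p<P. \<phi> p (C (l p) \<omega> (s p))) \<partial>N)"
    unfolding A_def
  proof (rule prod_tendsto_integral[OF N(1) \<phi> Sm _ lim])
    show "(\<lambda>\<omega>. C (l p) \<omega> (s p)) \<in> borel_measurable N" if "p < P" for p
    proof (rule N(5)[OF P(1)[OF that]])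
      show "snd (z (l p)) \<le> s p"
        by (rule LIMSEQ_le_const2[OF tendsto_snd[OF a(2)[OF P(1)[OF that]]]]) (use P(2)[OF that] in auto)
    qed
  qed
  moreover have "(\<lambda>k. E k - A k (m k)) \<longlonglongrightarrow> 0"
    by (rule Lim_null_comparison[OF _ h(2)]) (use m(2) in \<open>auto simp: h_def abs_minus_commute intro!: always_eventually less_imp_le\<close>)
  ultimately have "(\<lambda>k. A k (m k) + (E k - A k (m k))) \<longlonglongrightarrow> (\<integral>\<omega>. (\<Prod>p<P. \<phi> p (C (l p) \<omega> (s p))) \<partial>N) + 0"
    by (rule tendsto_add)
  then show ?thesis by (simp add: E_def)
qed

section \<open>Continuous dependence on the starting points\<close>

definition cut_off :: "real \<Rightarrow> nat \<Rightarrow> real \<Rightarrow> real" where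
  "cut_off c m x = max 0 (min 1 (1 - real m * (x - c)))"

lemma cut_off: "continuous_on UNIV (cut_off c m)" "\<bar>cut_off c m x\<bar> \<le> 1"
  "(\<lambda>m. cut_off c m x) \<longlonglongrightarrow> indicat_real {..c} x"
proof -
  show "continuous_on UNIV (cut_off c m)" unfolding cut_off_def by (intro continuous_intros)
  show "\<bar>cut_off c m x\<bar> \<le> 1" by (simp add: cut_off_def)
  show "(\<lambda>m. cut_off c m x) \<longlonglongrightarrow> indicat_real {..c} x"
  proof (cases "x \<le> c")
    case True
    then have "cut_off c m x = 1" for m using mult_nonneg_nonpos[of "real m" "x - c"] by (simp add: cut_off_def)
    then show ?thesis using True by simp
  next
    case False
    then obtain M :: nat where M: "1 / (x - c) < real M" using reals_Archimedean2 by blast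
    have "cut_off c m x = 0" if "m \<ge> M" for m
    proof -
      have "1 / (x - c) \<le> real m" using M that by simp
      then have "1 \<le> real m * (x - c)" using False by (simp add: divide_le_eq)
      then show ?thesis by (simp add: cut_off_def)
    qed
    then have "\<forall>\<^sub>F m in sequentially. cut_off c m x = 0" unfolding eventually_sequentially by blast
    then show ?thesis using False by (simp add: tendsto_eventually)
  qed
qed

text \<open>Products of continuous functions of single coordinates suffice: with
  \<open>cut_off\<close> they converge to indicators of boxes, which generate the product
  sigma-algebra and are stable under intersection.\<close>

lemma distr_PiM_eqI:
  fixes X :: "'i \<Rightarrow> 'a \<Rightarrow> real" and Y :: "'i \<Rightarrow> 'b \<Rightarrow> real"
  assumes M: "prob_space M" "prob_space M'"
    and X: "\<And>i. i \<in> I \<Longrightarrow> X i \<in> borel_measurable M" and Y: "\<And>i. i \<in> I \<Longrightarrow> Y i \<in> borel_measurable M'"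
    and eq: "\<And>P idx \<phi>. (\<And>p. p < (P::nat) \<Longrightarrow> idx p \<in> I) \<Longrightarrow> (\<And>p. continuous_on UNIV (\<phi> p)) \<Longrightarrow> (\<And>p x. \<bar>\<phi> p x\<bar> \<le> (1::real)) \<Longrightarrow>
      (\<integral>\<omega>. (\<Prod>p<P. \<phi> p (X (idx p) \<omega>)) \<partial>M) = (\<integral>\<omega>. (\<Prod>p<P. \<phi> p (Y (idx p) \<omega>)) \<partial>M')"
  shows "distr M (PiM I (\<lambda>_. borel)) (\<lambda>\<omega>. \<lambda>i\<in>I. X i \<omega>) = distr M' (PiM I (\<lambda>_. borel)) (\<lambda>\<omega>. \<lambda>i\<in>I. Y i \<omega>)"
proof -
  interpret M: prob_space M by fact
  interpret M': prob_space M' by fact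
  let ?\<Pi> = "PiM I (\<lambda>_. borel :: real measure)"
  define box where "box xs = {f \<in> space ?\<Pi>. \<forall>(i, c)\<in>set xs. f i \<le> c}" for xs
  define G where "G = box ` {xs. fst ` set xs \<subseteq> I}"
  have Xm: "(\<lambda>\<omega>. \<lambda>i\<in>I. X i \<omega>) \<in> measurable M ?\<Pi>" and Ym: "(\<lambda>\<omega>. \<lambda>i\<in>I. Y i \<omega>) \<in> measurable M' ?\<Pi>"
    using X Y by (auto intro: measurable_restrict)
  have box_sets: "box xs \<in> sets ?\<Pi>" if "fst ` set xs \<subseteq> I" for xs
  proof -
    have "{f \<in> space ?\<Pi>. f i \<le> c} \<in> sets ?\<Pi>" if "i \<in> I" for i c
      using measurable_component_singleton[OF that, of "\<lambda>_. borel::real measure"] by measurable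
    then have "{f \<in> space ?\<Pi>. \<forall>p\<in>set xs. f (fst p) \<le> snd p} \<in> sets ?\<Pi>"
      using that by (intro sets.sets_Collect_finite_All) auto
    then show ?thesis by (simp add: box_def case_prod_beta')
  qed
  have gen: "sets ?\<Pi> = sigma_sets (space ?\<Pi>) G"
  proof
    have GP: "G \<subseteq> Pow (space ?\<Pi>)" by (auto simp: G_def box_def)
    let ?S = "sigma (space ?\<Pi>) G"
    have "sets ?\<Pi> \<subseteq> sets ?S"
    proof (rule sets_PiM_in_sets)
      show "space ?S = (\<Pi>\<^sub>E i\<in>I. space borel)" using GP by (simp add: space_PiM)
      fix i A assume i: "i \<in> I" and A: "A \<in> sets (borel :: real measure)"
      have "(\<lambda>x. x i) \<in> borel_measurable ?S"
        unfolding borel_measurable_iff_le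
      proof
        fix a
        have "{x \<in> space ?S. x i \<le> a} = box [(i, a)]" using GP by (auto simp: box_def)
        also have "\<dots> \<in> sets ?S" using GP i by (auto simp: G_def intro!: sigma_sets.Basic image_eqI[of _ _ "[(i, a)]"])
        finally show "{x \<in> space ?S. x i \<le> a} \<in> sets ?S" .
      qed
      from measurable_sets[OF this A] show "{x \<in> space ?S. x i \<in> A} \<in> sets ?S"
        by (simp add: vimage_def Int_def conj_commute)
    qed
    then show "sets ?\<Pi> \<subseteq> sigma_sets (space ?\<Pi>) G" using GP by simp
    show "sigma_sets (space ?\<Pi>) G \<subseteq> sets ?\<Pi>"
      using box_sets by (intro sets.sigma_sets_subset) (auto simp: G_def)
  qed
  have val: "measure M {\<omega>\<in>space M. \<forall>(i, c)\<in>set xs. X i \<omega> \<le> c} = measure M' {\<omega>\<in>space M'. \<forall>(i, c)\<in>set xs. Y i \<omega> \<le> c}"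
    if xs: "fst ` set xs \<subseteq> I" for xs
  proof -
    define idx where "idx p = fst (xs ! p)" for p
    define c where "c p = snd (xs ! p)" for p
    have idx: "idx p \<in> I" if "p < length xs" for p using xs that nth_mem[of p xs] by (force simp: idx_def)
    have conv: "(\<lambda>m. \<integral>\<omega>. (\<Prod>p<length xs. cut_off (c p) m (Z (idx p) \<omega>)) \<partial>L) \<longlonglongrightarrow> measure L {\<omega>\<in>space L. \<forall>(i, c)\<in>set xs. Z i \<omega> \<le> c}"
      if L: "prob_space L" and Z: "\<And>i. i \<in> I \<Longrightarrow> Z i \<in> borel_measurable L" for L :: "'z measure" and Z
    proof -
      interpret L: prob_space L by fact
      have set: "{\<omega>\<in>space L. \<forall>(i, c)\<in>set xs. Z i \<omega> \<le> c} = {\<omega>\<in>space L. \<forall>p\<in>{..<length xs}. Z (idx p) \<omega> \<le> c p}"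
        by (auto simp: idx_def c_def all_set_conv_all_nth case_prod_beta')
      have sm: "{\<omega>\<in>space L. \<forall>p\<in>{..<length xs}. Z (idx p) \<omega> \<le> c p} \<in> sets L"
        using Z idx by (intro sets.sets_Collect_finite_All) auto
      have "(\<lambda>m. \<integral>\<omega>. (\<Prod>p<length xs. cut_off (c p) m (Z (idx p) \<omega>)) \<partial>L) \<longlonglongrightarrow> (\<integral>\<omega>. indicat_real {\<omega>\<in>space L. \<forall>p\<in>{..<length xs}. Z (idx p) \<omega> \<le> c p} \<omega> \<partial>L)"
      proof (rule integral_dominated_convergence[where w="\<lambda>_. 1"])
        show "AE \<omega> in L. (\<lambda>m. \<Prod>p<length xs. cut_off (c p) m (Z (idx p) \<omega>)) \<longlonglongrightarrow> indicat_real {\<omega>\<in>space L. \<forall>p\<in>{..<length xs}. Z (idx p) \<omega> \<le> c p} \<omega>"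
        proof (rule AE_I2)
          fix \<omega> assume "\<omega> \<in> space L"
          then have "indicat_real {\<omega>\<in>space L. \<forall>p\<in>{..<length xs}. Z (idx p) \<omega> \<le> c p} \<omega> = (\<Prod>p<length xs. indicat_real {..c p} (Z (idx p) \<omega>))"
            by (auto simp: indicator_def prod_zero_iff)
          then show "(\<lambda>m. \<Prod>p<length xs. cut_off (c p) m (Z (idx p) \<omega>)) \<longlonglongrightarrow> indicat_real {\<omega>\<in>space L. \<forall>p\<in>{..<length xs}. Z (idx p) \<omega> \<le> c p} \<omega>"
            by (auto intro!: tendsto_prod cut_off)
        qed
        show "AE \<omega> in L. norm (\<Prod>p<length xs. cut_off (c p) m (Z (idx p) \<omega>)) \<le> 1" for m
          using cut_off(2) by (intro always_eventually allI) (auto simp: abs_prod intro!: prod_le_1)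
        show "(\<lambda>\<omega>. \<Prod>p<length xs. cut_off (c p) m (Z (idx p) \<omega>)) \<in> borel_measurable L" for m
          using Z idx by (intro borel_measurable_prod measurable_compose[OF _ borel_measurable_continuous_onI[OF cut_off(1)]]) auto
      qed (use sm in auto)
      then show ?thesis unfolding set using sm by simp
    qed
    have "(\<integral>\<omega>. (\<Prod>p<length xs. cut_off (c p) m (X (idx p) \<omega>)) \<partial>M) = (\<integral>\<omega>. (\<Prod>p<length xs. cut_off (c p) m (Y (idx p) \<omega>)) \<partial>M')" for m
      by (rule eq[OF idx cut_off(1,2)])
    then show ?thesis using LIMSEQ_unique[OF conv[OF M(1), of X, OF X]] conv[OF M(2), of Y, OF Y] by simp
  qed
  show ?thesis
  proof (rule measure_eqI_generator_eq[where E=G and \<Omega>="space ?\<Pi>" and A="\<lambda>_. space ?\<Pi>"])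
    show "Int_stable G"
    proof (rule Int_stableI)
      fix a b assume "a \<in> G" "b \<in> G"
      then obtain xs ys where "a = box xs" "b = box ys" "fst ` set xs \<subseteq> I" "fst ` set ys \<subseteq> I" by (auto simp: G_def)
      then show "a \<inter> b \<in> G" unfolding G_def by (intro image_eqI[of _ _ "xs @ ys"]) (auto simp: box_def)
    qed
    show "range (\<lambda>_::nat. space ?\<Pi>) \<subseteq> G" unfolding G_def by (auto intro!: image_eqI[of _ _ "[]"] simp: box_def)
    fix A assume "A \<in> G"
    then obtain xs where xs: "fst ` set xs \<subseteq> I" "A = box xs" by (auto simp: G_def)
    have "(\<lambda>\<omega>. \<lambda>i\<in>I. X i \<omega>) -` box xs \<inter> space M = {\<omega>\<in>space M. \<forall>(i, c)\<in>set xs. X i \<omega> \<le> c}"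
      "(\<lambda>\<omega>. \<lambda>i\<in>I. Y i \<omega>) -` box xs \<inter> space M' = {\<omega>\<in>space M'. \<forall>(i, c)\<in>set xs. Y i \<omega> \<le> c}"
      using xs(1) unfolding box_def by (force simp: space_PiM)+
    then show "emeasure (distr M ?\<Pi> (\<lambda>\<omega>. \<lambda>i\<in>I. X i \<omega>)) A = emeasure (distr M' ?\<Pi> (\<lambda>\<omega>. \<lambda>i\<in>I. Y i \<omega>)) A"
      using val[OF xs(1)] box_sets[OF xs(1)] Xm Ym by (simp add: xs(2) emeasure_distr M.emeasure_eq_measure M'.emeasure_eq_measure)
  next
    show "emeasure (distr M ?\<Pi> (\<lambda>\<omega>. \<lambda>i\<in>I. X i \<omega>)) (space ?\<Pi>) \<noteq> \<infinity>" for i :: nat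
      using Xm by (simp add: emeasure_distr M.emeasure_eq_measure)
  qed (use gen sets.space_closed in \<open>auto simp: G_def box_def\<close>)
qed

lemma continuous_pathsD:
  assumes "continuous_paths M z W"
  shows "\<And>j t. snd (z j) \<le> t \<Longrightarrow> (\<lambda>\<omega>. W j \<omega> t) \<in> borel_measurable M"
    and "AE \<omega> in M. \<forall>j. continuous_on {snd (z j)..} (W j \<omega>)"
  using assms unfolding continuous_paths_def AE_all_countable by auto

lemma paths_law_prod:
  assumes "paths_law M z W = paths_law N z C" "continuous_paths M z W" "continuous_paths N z C"
    and idx: "\<And>p. p < P \<Longrightarrow> snd (z (l p)) \<le> s p" and \<phi>: "\<And>p. \<phi> p \<in> borel_measurable borel"
  shows "(\<integral>\<omega>. (\<Prod>p<(P::nat). \<phi> p (W (l p) \<omega> (s p)) :: real) \<partial>M) = (\<integral>\<omega>. (\<Prod>p<P. \<phi> p (C (l p) \<omega> (s p))) \<partial>N)"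
proof -
  let ?I = "{(j, t). snd (z j) \<le> t}"
  let ?\<Pi> = "PiM ?I (\<lambda>_. borel :: real measure)"
  let ?G = "\<lambda>f. \<Prod>p<P. \<phi> p (f (l p, s p))"
  have G: "?G \<in> borel_measurable ?\<Pi>"
    using idx by (intro borel_measurable_prod measurable_compose[OF _ \<phi>] measurable_component_singleton) auto
  have "(\<integral>\<omega>. (\<Prod>p<P. \<phi> p (V (l p) \<omega> (s p))) \<partial>L) = (\<integral>f. ?G f \<partial>paths_law L z V)"
    if "continuous_paths L z V" for L :: "'z measure" and V
  proof -
    have m: "(\<lambda>\<omega>. \<lambda>(j, t)\<in>?I. V j \<omega> t) \<in> measurable L ?\<Pi>"
      using continuous_pathsD(1)[OF that] by (intro measurable_restrict) auto
    have "(\<integral>f. ?G f \<partial>paths_law L z V) = (\<integral>\<omega>. ?G (\<lambda>(j, t)\<in>?I. V j \<omega> t) \<partial>L)"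
      unfolding paths_law_def Let_def by (rule integral_distr[OF m G])
    also have "\<dots> = (\<integral>\<omega>. (\<Prod>p<P. \<phi> p (V (l p) \<omega> (s p))) \<partial>L)"
      using idx by (intro Bochner_Integration.integral_cong prod.cong refl) simp
    finally show ?thesis ..
  qed
  from this[OF assms(2)] this[OF assms(3)] assms(1) show ?thesis by simp
qed

lemma cbmE:
  assumes "coalescing_brownian_motions M z W"
  obtains N :: "(nat \<Rightarrow> real \<Rightarrow> real) measure" and B C where "continuous_paths M z W" "prob_space N" "independent_brownian_motions N z B"
    "continuous_paths N z C" "\<And>n. AE \<omega> in N. coalescence_below n z (\<lambda>j. B j \<omega>) (\<lambda>j. C j \<omega>)"
    "paths_law M z W = paths_law N z C"
proof -
  from assms obtain N :: "(nat \<Rightarrow> real \<Rightarrow> real) measure" and B C where 1: "continuous_paths M z W" "prob_space N" "independent_brownian_motions N z B"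
    "continuous_paths N z C" "AE \<omega> in N. coalescence_of z (\<lambda>j. B j \<omega>) (\<lambda>j. C j \<omega>)"
    "paths_law M z W = paths_law N z C"
    unfolding coalescing_brownian_motions_def by blast
  have "AE \<omega> in N. coalescence_below n z (\<lambda>j. B j \<omega>) (\<lambda>j. C j \<omega>)" for n
    using 1(5) by eventually_elim (rule coalescence_belowI)
  with 1 that show ?thesis by blast
qed

text \<open>\<open>paths_law\<close> carries the statement over from the auxiliary systems, where
  the driving Brownian motions live, to the given families.\<close>

lemma cbm_limit:
  fixes M' :: "'a measure" and M :: "'b measure" and \<phi> :: "nat \<Rightarrow> real \<Rightarrow> real"
  assumes "coalescing_brownian_motions M' z' W'" "inj z'" "coalescing_brownian_motions M z W" "inj z"
    and a: "\<And>k. inj (a k)" "\<And>l. (\<lambda>k. z' (a k l)) \<longlonglongrightarrow> z l"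
    and P: "\<And>k p. p < P \<Longrightarrow> snd (z' (a k (l p))) \<le> s p"
    and \<phi>: "\<And>p. continuous_on UNIV (\<phi> p)" "\<And>p x. \<bar>\<phi> p x\<bar> \<le> 1"
  shows "(\<lambda>k. \<integral>\<omega>. (\<Prod>p<P. \<phi> p (W' (a k (l p)) \<omega> (s p))) \<partial>M') \<longlonglongrightarrow> (\<integral>\<omega>. (\<Prod>p<P. \<phi> p (W (l p) \<omega> (s p))) \<partial>M)"
proof -
  obtain N' :: "(nat \<Rightarrow> real \<Rightarrow> real) measure" and B' C' where N': "continuous_paths M' z' W'" "prob_space N'" "independent_brownian_motions N' z' B'"
    "continuous_paths N' z' C'" "\<And>n. AE \<omega> in N'. coalescence_below n z' (\<lambda>j. B' j \<omega>) (\<lambda>j. C' j \<omega>)"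
    "paths_law M' z' W' = paths_law N' z' C'" by (rule cbmE[OF assms(1)]) (rule that)
  obtain N :: "(nat \<Rightarrow> real \<Rightarrow> real) measure" and B C where N: "continuous_paths M z W" "prob_space N" "independent_brownian_motions N z B"
    "continuous_paths N z C" "\<And>n. AE \<omega> in N. coalescence_below n z (\<lambda>j. B j \<omega>) (\<lambda>j. C j \<omega>)"
    "paths_law M z W = paths_law N z C" by (rule cbmE[OF assms(3)]) (rule that)
  have \<phi>m: "\<phi> p \<in> borel_measurable borel" for p by (rule borel_measurable_continuous_onI[OF \<phi>(1)])
  have Ps: "snd (z (l p)) \<le> s p" if "p < P" for p
    by (rule LIMSEQ_le_const2[OF tendsto_snd[OF a(2)]]) (use P[OF that] in auto)
  obtain n where n: "\<And>p. p < P \<Longrightarrow> l p < n"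
    using finite_nat_iff_bounded[of "l ` {..<P}"] by auto
  have "(\<lambda>k. \<integral>\<omega>. (\<Prod>p<P. \<phi> p (C' (a k (l p)) \<omega> (s p))) \<partial>N') \<longlonglongrightarrow> (\<integral>\<omega>. (\<Prod>p<P. \<phi> p (C (l p) \<omega> (s p))) \<partial>N)"
    by (rule coalescing_limit[OF N'(2,3) assms(2) N'(5) continuous_pathsD(1)[OF N'(4)] N(2,3) _ N(5) continuous_pathsD(1)[OF N(4)] _ a(2) n P \<phi>])
       (use a(1) assms(4) in \<open>auto intro: inj_on_subset\<close>)
  moreover have "(\<integral>\<omega>. (\<Prod>p<P. \<phi> p (W' (a k (l p)) \<omega> (s p))) \<partial>M') = (\<integral>\<omega>. (\<Prod>p<P. \<phi> p (C' (a k (l p)) \<omega> (s p))) \<partial>N')" for k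
    by (rule paths_law_prod[OF N'(6,1,4) P \<phi>m])
  moreover have "(\<integral>\<omega>. (\<Prod>p<P. \<phi> p (W (l p) \<omega> (s p))) \<partial>M) = (\<integral>\<omega>. (\<Prod>p<P. \<phi> p (C (l p) \<omega> (s p))) \<partial>N)"
    by (rule paths_law_prod[OF N(6,1,4) Ps \<phi>m])
  ultimately show ?thesis by simp
qed

text \<open>By exchangeability, the path \<open>j\<close> may be put first in the coalescence order, where it follows its own Brownian motion.\<close>

lemma cbm_single:
  assumes M: "prob_space M" and "coalescing_brownian_motions M z W" "inj z"
  obtains N :: "(nat \<Rightarrow> real \<Rightarrow> real) measure" and B where "prob_space N" "brownian_motion N (z j) B"
    "distr M (PiM {snd (z j)..} (\<lambda>_. borel)) (\<lambda>\<omega>. restrict (W j \<omega>) {snd (z j)..}) =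
     distr N (PiM {snd (z j)..} (\<lambda>_. borel)) (\<lambda>\<omega>. restrict (B \<omega>) {snd (z j)..})"
proof -
  obtain N :: "(nat \<Rightarrow> real \<Rightarrow> real) measure" and B C where N: "continuous_paths M z W" "prob_space N" "independent_brownian_motions N z B"
    "continuous_paths N z C" "\<And>n. AE \<omega> in N. coalescence_below n z (\<lambda>j. B j \<omega>) (\<lambda>j. C j \<omega>)"
    "paths_law M z W = paths_law N z C" by (rule cbmE[OF assms(2)]) (rule that)
  \<comment> \<open>The transposition of 0 and \<open>j\<close> puts path \<open>j\<close>
    first.\<close>
  define f where "f i = (if i = 0 then j else if i = j then 0 else i)" for i
  have f: "inj f" "f 0 = j" by (auto simp: f_def inj_def)
  note Bf = ibm_reindex[OF N(2,3) f(1)]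
  note b = brownian_motionD[OF ibmD[OF N(3), of j]]
  have c1: "AE \<omega> in N. coalescence_below 1 (\<lambda>i. z (f i)) (\<lambda>i. B (f i) \<omega>) (\<lambda>i. B (f i) \<omega>)"
    using b(2,3) by eventually_elim (auto simp: coalescence_below_def f(2))
  have "distr M (PiM {snd (z j)..} (\<lambda>_. borel)) (\<lambda>\<omega>. \<lambda>s\<in>{snd (z j)..}. W j \<omega> s) =
     distr N (PiM {snd (z j)..} (\<lambda>_. borel)) (\<lambda>\<omega>. \<lambda>s\<in>{snd (z j)..}. B j \<omega> s)"
  proof (rule distr_PiM_eqI[OF M N(2)])
    show "(\<lambda>\<omega>. W j \<omega> s) \<in> borel_measurable M" if "s \<in> {snd (z j)..}" for s
      using continuous_pathsD(1)[OF N(1)] that by simp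
    show "(\<lambda>\<omega>. B j \<omega> s) \<in> borel_measurable N" if "s \<in> {snd (z j)..}" for s
      using b(1) that by simp
    fix P and s :: "nat \<Rightarrow> real" and \<phi> :: "nat \<Rightarrow> real \<Rightarrow> real"
    assume s: "\<And>p. p < P \<Longrightarrow> s p \<in> {snd (z j)..}" and \<phi>: "\<And>p. continuous_on UNIV (\<phi> p)" "\<And>p x. \<bar>\<phi> p x\<bar> \<le> 1"
    have \<phi>m: "\<phi> p \<in> borel_measurable borel" for p by (rule borel_measurable_continuous_onI[OF \<phi>(1)])
    \<comment> \<open>A constant approximating sequence with one tracked label: the limit theorem
      becomes an identity of laws between the coalescing path and its own driver.\<close>
    have "(\<lambda>k::nat. \<integral>\<omega>. (\<Prod>p<P. \<phi> p (C ((\<lambda>k l. j) k ((\<lambda>p. 0::nat) p)) \<omega> (s p))) \<partial>N) \<longlonglongrightarrow> (\<integral>\<omega>. (\<Prod>p<P. \<phi> p (B (f ((\<lambda>p. 0) p)) \<omega> (s p))) \<partial>N)"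
    proof (rule coalescing_limit[OF N(2,3) assms(3) N(5) continuous_pathsD(1)[OF N(4)] N(2) Bf _ c1 _ _ _ _ _ \<phi>])
      show "(\<lambda>\<omega>. B (f l) \<omega> t) \<in> borel_measurable N" if "l < 1" "snd (z (f l)) \<le> t" for l t
        using b(1) that by (simp add: f(2))
      show "inj_on (\<lambda>i. z (f i)) {..<1}" "inj_on (\<lambda>l. j) {..<1::nat}" by (auto simp: inj_on_def)
    qed (use s f(2) in auto)
    then have "(\<integral>\<omega>. (\<Prod>p<P. \<phi> p (C j \<omega> (s p))) \<partial>N) = (\<integral>\<omega>. (\<Prod>p<P. \<phi> p (B j \<omega> (s p))) \<partial>N)"
      using LIMSEQ_unique[OF tendsto_const] by (simp add: f(2))
    then show "(\<integral>\<omega>. (\<Prod>p<P. \<phi> p (W j \<omega> (s p))) \<partial>M) = (\<integral>\<omega>. (\<Prod>p<P. \<phi> p (B j \<omega> (s p))) \<partial>N)"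
      using paths_law_prod[OF N(6,1,4), of P "\<lambda>_. j" s \<phi>] s \<phi>m by simp
  qed
  with that[OF N(2) ibmD[OF N(3)]] show ?thesis by simp
qed

section \<open>Properties transferred from a single Brownian motion\<close>

lemma cbm_prob:
  assumes M: "prob_space M" and W: "coalescing_brownian_motions M z W" "inj z"
  obtains N :: "(nat \<Rightarrow> real \<Rightarrow> real) measure" and B where "prob_space N" "brownian_motion N (z j) B"
    "\<And>A. A \<in> sets (PiM {snd (z j)..} (\<lambda>_. borel)) \<Longrightarrow>
      measure M {\<omega>\<in>space M. restrict (W j \<omega>) {snd (z j)..} \<in> A} = measure N {\<omega>\<in>space N. restrict (B \<omega>) {snd (z j)..} \<in> A}"
proof -
  obtain N :: "(nat \<Rightarrow> real \<Rightarrow> real) measure" and B where N: "prob_space N" "brownian_motion N (z j) B"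
    "distr M (PiM {snd (z j)..} (\<lambda>_. borel)) (\<lambda>\<omega>. restrict (W j \<omega>) {snd (z j)..}) =
     distr N (PiM {snd (z j)..} (\<lambda>_. borel)) (\<lambda>\<omega>. restrict (B \<omega>) {snd (z j)..})" by (rule cbm_single[OF assms]) (rule that)
  have Wm: "(\<lambda>\<omega>. restrict (W j \<omega>) {snd (z j)..}) \<in> measurable M (PiM {snd (z j)..} (\<lambda>_. borel))"
    using W(1) unfolding coalescing_brownian_motions_def continuous_paths_def by (intro measurable_restrict) auto
  have Bm: "(\<lambda>\<omega>. restrict (B \<omega>) {snd (z j)..}) \<in> measurable N (PiM {snd (z j)..} (\<lambda>_. borel))"
    using brownian_motionD(1)[OF N(2)] by (intro measurable_restrict) auto
  have "measure M {\<omega>\<in>space M. restrict (W j \<omega>) {snd (z j)..} \<in> A} = measure N {\<omega>\<in>space N. restrict (B \<omega>) {snd (z j)..} \<in> A}"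
    if A: "A \<in> sets (PiM {snd (z j)..} (\<lambda>_. borel))" for A
    using measure_distr[OF Wm A] measure_distr[OF Bm A] N(3) by (simp add: vimage_def Int_def conj_commute)
  with that[OF N(1,2)] show ?thesis by blast
qed

text \<open>The starting value is decided by one coordinate and can be read off the law of the path.
  Continuity is not an event of the product sigma-algebra and comes from
  \<open>continuous_paths\<close> instead.\<close>

lemma cbm_start:
  assumes M: "prob_space M" and W: "coalescing_brownian_motions M z W" "inj z"
  shows "AE \<omega> in M. \<forall>j. continuous_on {snd (z j)..} (W j \<omega>) \<and> W j \<omega> (snd (z j)) = fst (z j)"
proof -
  interpret prob_space M by fact
  have "AE \<omega> in M. W j \<omega> (snd (z j)) = fst (z j)" for j
  proof -
    obtain N :: "(nat \<Rightarrow> real \<Rightarrow> real) measure" and B where N: "prob_space N" "brownian_motion N (z j) B"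
      "\<And>A. A \<in> sets (PiM {snd (z j)..} (\<lambda>_. borel)) \<Longrightarrow>
        measure M {\<omega>\<in>space M. restrict (W j \<omega>) {snd (z j)..} \<in> A} = measure N {\<omega>\<in>space N. restrict (B \<omega>) {snd (z j)..} \<in> A}"
      by (rule cbm_prob[OF assms]) (rule that)
    interpret N: prob_space N by fact
    let ?\<Pi> = "PiM {snd (z j)..} (\<lambda>_. borel :: real measure)"
    let ?A = "{f\<in>space ?\<Pi>. f (snd (z j)) = fst (z j)}"
    have [measurable]: "(\<lambda>f. f (snd (z j))) \<in> borel_measurable ?\<Pi>" by (rule measurable_component_singleton) simp
    have A: "?A \<in> sets ?\<Pi>" by measurable
    have [measurable]: "(\<lambda>\<omega>. B \<omega> (snd (z j))) \<in> borel_measurable N" "(\<lambda>\<omega>. W j \<omega> (snd (z j))) \<in> borel_measurable M"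
      using brownian_motionD(1)[OF N(2)] W(1) unfolding coalescing_brownian_motions_def continuous_paths_def by auto
    have "measure N {\<omega>\<in>space N. restrict (B \<omega>) {snd (z j)..} \<in> ?A} = 1"
      using brownian_motionD(2)[OF N(2)] by (subst N.prob_Collect_eq_1) (auto simp: space_PiM)
    then have "prob {\<omega>\<in>space M. restrict (W j \<omega>) {snd (z j)..} \<in> ?A} = 1" using N(3)[OF A] by simp
    then show ?thesis by (subst (asm) prob_Collect_eq_1) (auto simp: space_PiM)
  qed
  moreover have "AE \<omega> in M. \<forall>j. continuous_on {snd (z j)..} (W j \<omega>)"
    using W(1) unfolding coalescing_brownian_motions_def by (blast intro: continuous_pathsD)
  ultimately show ?thesis unfolding AE_all_countable by (auto intro: AE_conjI)
qed

lemma cbm_no_atom: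
  assumes M: "prob_space M" and W: "coalescing_brownian_motions M z W" "inj z" and s: "snd (z j) < s"
  shows "AE \<omega> in M. W j \<omega> s \<noteq> x"
proof -
  interpret prob_space M by fact
  obtain N :: "(nat \<Rightarrow> real \<Rightarrow> real) measure" and B where N: "prob_space N" "brownian_motion N (z j) B"
    "\<And>A. A \<in> sets (PiM {snd (z j)..} (\<lambda>_. borel)) \<Longrightarrow>
      measure M {\<omega>\<in>space M. restrict (W j \<omega>) {snd (z j)..} \<in> A} = measure N {\<omega>\<in>space N. restrict (B \<omega>) {snd (z j)..} \<in> A}"
    by (rule cbm_prob[OF M W]) (rule that)
  interpret N: prob_space N by fact
  let ?\<Pi> = "PiM {snd (z j)..} (\<lambda>_. borel :: real measure)"
  let ?A = "{f\<in>space ?\<Pi>. f s \<noteq> x}"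
  have [measurable]: "(\<lambda>f. f s) \<in> borel_measurable ?\<Pi>" by (rule measurable_component_singleton) (use s in simp)
  have A: "?A \<in> sets ?\<Pi>" by measurable
  have [measurable]: "(\<lambda>\<omega>. B \<omega> s) \<in> borel_measurable N" "(\<lambda>\<omega>. W j \<omega> s) \<in> borel_measurable M"
    using brownian_motionD(1)[OF N(2)] W(1) s unfolding coalescing_brownian_motions_def continuous_paths_def by auto
  have "measure N {\<omega>\<in>space N. restrict (B \<omega>) {snd (z j)..} \<in> ?A} = 1"
    using brownian_no_atom[OF N(1,2) s, of x] s by (subst N.prob_Collect_eq_1) (auto simp: space_PiM)
  then have "prob {\<omega>\<in>space M. restrict (W j \<omega>) {snd (z j)..} \<in> ?A} = 1" using N(3)[OF A] by simp
  then show ?thesis using s by (subst (asm) prob_Collect_eq_1) (auto simp: space_PiM)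
qed

text \<open>The bound holds uniformly for nested dyadic sets of times, hence for their union, and
  continuity extends it to the whole interval. An exceptional set is stated explicitly because a
  supremum over uncountably many times need not be measurable.\<close>

lemma cbm_max:
  assumes M: "prob_space M" and W: "coalescing_brownian_motions M z W" "inj z" and e: "0 < e" and d: "0 < d"
  shows "\<exists>Bad\<in>sets M. measure M Bad \<le> 6 * d\<^sup>2 / e ^ 4 \<and>
    (AE \<omega> in M. \<omega> \<notin> Bad \<longrightarrow> (\<forall>s\<in>{snd (z j)..snd (z j) + d}. \<bar>W j \<omega> s - fst (z j)\<bar> \<le> 2 * e))"
proof -
  interpret prob_space M by fact
  obtain N :: "(nat \<Rightarrow> real \<Rightarrow> real) measure" and B where N: "prob_space N" "brownian_motion N (z j) B"
    "\<And>A. A \<in> sets (PiM {snd (z j)..} (\<lambda>_. borel)) \<Longrightarrow>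
      measure M {\<omega>\<in>space M. restrict (W j \<omega>) {snd (z j)..} \<in> A} = measure N {\<omega>\<in>space N. restrict (B \<omega>) {snd (z j)..} \<in> A}"
    by (rule cbm_prob[OF M W]) (rule that)
  let ?t = "snd (z j)"
  let ?\<Pi> = "PiM {?t..} (\<lambda>_. borel :: real measure)"
  define F where "F m = (\<lambda>k. ?t + d * real k / 2 ^ m) ` {..2 ^ m}" for m :: nat
  have F: "finite (F m)" "F m \<subseteq> {?t..?t + d}" for m
  proof -
    show "finite (F m)" by (simp add: F_def)
    show "F m \<subseteq> {?t..?t + d}"
    proof
      fix s assume "s \<in> F m"
      then obtain k where k: "k \<le> 2 ^ m" "s = ?t + d * real k / 2 ^ m" by (auto simp: F_def)
      have "real k \<le> 2 ^ m" using k(1) by (metis of_nat_le_iff of_nat_numeral of_nat_power)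
      then have "d * real k \<le> d * 2 ^ m" using d by simp
      then have "d * real k / 2 ^ m \<le> d" by (simp add: divide_le_eq)
      then show "s \<in> {?t..?t + d}" using k d by simp
    qed
  qed
  define E where "E m = {\<omega>\<in>space M. \<exists>s\<in>F m. \<bar>W j \<omega> s - W j \<omega> ?t\<bar> > 2 * e}" for m
  have Wm: "(\<lambda>\<omega>. W j \<omega> s) \<in> borel_measurable M" if "?t \<le> s" for s
    using W(1) that unfolding coalescing_brownian_motions_def continuous_paths_def by auto
  have Em: "E m \<in> events" for m
  proof -
    have "{\<omega>\<in>space M. \<bar>W j \<omega> s - W j \<omega> ?t\<bar> > 2 * e} \<in> events" if "s \<in> F m" for s
    proof -
      have [measurable]: "(\<lambda>\<omega>. W j \<omega> s) \<in> borel_measurable M" "(\<lambda>\<omega>. W j \<omega> ?t) \<in> borel_measurable M"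
        using Wm F(2)[of m] that by auto
      show ?thesis by measurable
    qed
    then show ?thesis unfolding E_def by (intro sets.sets_Collect_finite_Ex F) auto
  qed
  have Eb: "prob (E m) \<le> 6 * d\<^sup>2 / e ^ 4" for m
  proof -
    let ?A = "{f\<in>space ?\<Pi>. \<exists>s\<in>F m. \<bar>f s - f ?t\<bar> > 2 * e}"
    have A: "?A \<in> sets ?\<Pi>"
    proof (intro sets.sets_Collect_finite_Ex F)
      fix s assume "s \<in> F m"
      then have [measurable]: "(\<lambda>f. f s) \<in> borel_measurable ?\<Pi>" "(\<lambda>f. f ?t) \<in> borel_measurable ?\<Pi>"
        using F(2)[of m] by (auto intro!: measurable_component_singleton)
      show "{f\<in>space ?\<Pi>. \<bar>f s - f ?t\<bar> > 2 * e} \<in> sets ?\<Pi>" by measurable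
    qed
    have r: "{\<omega>\<in>space L. restrict (V \<omega>) {?t..} \<in> ?A} = {\<omega>\<in>space L. \<exists>s\<in>F m. \<bar>V \<omega> s - V \<omega> ?t\<bar> > 2 * e}"
      for L :: "'z measure" and V :: "'z \<Rightarrow> real \<Rightarrow> real"
      using F(2)[of m] by (force simp: space_PiM)
    show ?thesis using N(3)[OF A] brownian_max_finite[OF N(1,2) F e d, of m] unfolding r E_def by simp
  qed
  have inc: "incseq E"
  proof (rule incseq_SucI)
    fix m
    have "F m \<subseteq> F (Suc m)"
    proof
      fix s assume "s \<in> F m"
      then obtain k where "k \<le> 2 ^ m" "s = ?t + d * real k / 2 ^ m" by (auto simp: F_def)
      then show "s \<in> F (Suc m)" unfolding F_def by (intro image_eqI[of _ _ "2 * k"]) auto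
    qed
    then show "E m \<subseteq> E (Suc m)" by (auto simp: E_def)
  qed
  have "(\<lambda>m. prob (E m)) \<longlonglongrightarrow> prob (\<Union>m. E m)"
    using Em inc by (intro finite_Lim_measure_incseq) auto
  then have "prob (\<Union>m. E m) \<le> 6 * d\<^sup>2 / e ^ 4" using Eb by (intro LIMSEQ_le_const2) auto
  moreover have "AE \<omega> in M. \<omega> \<notin> (\<Union>m. E m) \<longrightarrow> (\<forall>s\<in>{?t..?t + d}. \<bar>W j \<omega> s - fst (z j)\<bar> \<le> 2 * e)"
    using cbm_start[OF M W] AE_space
  proof eventually_elim
    case (elim \<omega>)
    show ?case
    proof (intro impI ballI)
      fix s assume nb: "\<omega> \<notin> (\<Union>m. E m)" and s: "s \<in> {?t..?t + d}"
      define u where "u m = ?t + d * real (nat \<lfloor>(s - ?t) / d * 2 ^ m\<rfloor>) / 2 ^ m" for m :: nat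
      have bounds: "u m \<le> s \<and> s - d * (1/2) ^ m \<le> u m" and uF: "u m \<in> F m" for m
      proof -
        let ?x = "(s - ?t) / d * 2 ^ m" let ?k = "nat \<lfloor>?x\<rfloor>"
        have x0: "0 \<le> ?x" using s d by simp
        then have k: "real ?k \<le> ?x" "?x \<le> real ?k + 1" by auto
        have "d * real ?k / 2 ^ m \<le> d * ?x / 2 ^ m" "d * ?x / 2 ^ m \<le> d * (real ?k + 1) / 2 ^ m"
          using divide_right_mono[OF mult_left_mono[OF k(1)], of d "2 ^ m"] divide_right_mono[OF mult_left_mono[OF k(2)], of d "2 ^ m"] d
          by simp_all
        moreover have "d * ?x / 2 ^ m = s - ?t" using d by simp
        moreover have "d * (real ?k + 1) / 2 ^ m = d * real ?k / 2 ^ m + d * (1/2) ^ m"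
          by (simp add: distrib_left add_divide_distrib power_divide)
        ultimately show "u m \<le> s \<and> s - d * (1/2) ^ m \<le> u m" unfolding u_def by linarith
        have "?x \<le> 1 * 2 ^ m" using s d by (intro mult_right_mono) auto
        from order_trans[OF k(1) this] have "real ?k \<le> real (2 ^ m)" by (simp only: mult_1 of_nat_power of_nat_numeral)
        then have "?k \<le> 2 ^ m" by (simp only: of_nat_le_iff)
        then show "u m \<in> F m" unfolding F_def u_def by blast
      qed
      have "u \<longlonglongrightarrow> s"
      proof (rule tendsto_sandwich[where f="\<lambda>m. s - d * (1/2) ^ m" and h="\<lambda>m. s"])
        have "(\<lambda>m. s - d * (1/2) ^ m) \<longlonglongrightarrow> s - d * 0" by (intro tendsto_intros LIMSEQ_power_zero) auto
        then show "(\<lambda>m. s - d * (1/2) ^ m) \<longlonglongrightarrow> s" by simp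
      qed (use bounds in auto)
      then have "(\<lambda>m. W j \<omega> (u m)) \<longlonglongrightarrow> W j \<omega> s"
      proof (rule continuous_on_tendsto_compose[of "{?t..}" "W j \<omega>", rotated])
        have "u m \<in> {?t..}" for m using F(2)[of m] uF[of m] by auto
        then show "\<forall>\<^sub>F m in sequentially. u m \<in> {?t..}" by simp
      qed (use elim(1) s in auto)
      then have "(\<lambda>m. \<bar>W j \<omega> (u m) - fst (z j)\<bar>) \<longlonglongrightarrow> \<bar>W j \<omega> s - fst (z j)\<bar>" by (intro tendsto_intros)
      moreover have "\<bar>W j \<omega> (u m) - fst (z j)\<bar> \<le> 2 * e" for m
        using nb uF[of m] elim by (auto simp: E_def not_less)
      ultimately show "\<bar>W j \<omega> s - fst (z j)\<bar> \<le> 2 * e" by (intro LIMSEQ_le_const2) auto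
    qed
  qed
  ultimately show ?thesis using Em by (intro bexI[of _ "\<Union>m. E m"]) auto
qed

section \<open>Compactness of the web\<close>

lemma tanh_lipschitz: "\<bar>tanh a - tanh b\<bar> \<le> \<bar>a - b :: real\<bar>"
proof -
  have "tanh y - tanh x \<le> y - x" if "x \<le> y" for x y :: real
  proof -
    have "(\<lambda>t. t - tanh t) x \<le> (\<lambda>t. t - tanh t) y"
      by (rule DERIV_nonneg_imp_nondecreasing[OF that])
         (auto intro!: derivative_eq_intros exI[of _ "tanh _ ^ 2"])
    then show ?thesis by simp
  qed
  from this[of a b] this[of b a] show ?thesis
    by (cases "a \<le> b") (auto simp: abs_if tanh_real_le_iff not_le less_imp_le)
qed

lemma abs_diff_triangle: "\<bar>a - b\<bar> \<le> \<bar>a - c\<bar> + \<bar>b - c :: real\<bar>"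
  by linarith

text \<open>A path above a fence post at time \<open>s\<close> is not below it at time
  \<open>u\<close>. Where no post is available, at the far ends of the fence, the coordinate
  \<open>tanh\<close> is within \<open>e\<close> of its extreme value.\<close>

lemma fence_lower:
  fixes f :: "int \<Rightarrow> real \<Rightarrow> real"
  assumes e: "0 < e" and A: "1 - e \<le> tanh (real_of_int (A - 1) * e)" "1 \<le> A"
    and f: "\<And>i. i \<in> {-A..A} \<Longrightarrow> f i s < real_of_int i * e + e / 2" "\<And>i. i \<in> {-A..A} \<Longrightarrow> real_of_int i * e - e / 2 < f i u"
    and g: "\<And>i. i \<in> {-A..A} \<Longrightarrow> f i s < g s \<Longrightarrow> f i u \<le> g u"
  shows "tanh (g s) - 3 * e \<le> tanh (g u :: real)"
proof -
  have low: "real_of_int i * e - e / 2 < g u" if "i \<in> {-A..A}" "real_of_int i * e + e / 2 \<le> g s" for i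
    using f[OF that(1)] g[OF that(1)] that(2) by linarith
  \<comment> \<open>Lowering the index by 2 puts \<open>g s\<close> above
    \<open>(i + 1) * e\<close>, hence above the post in spite of its fluctuation
    \<open>e / 2\<close>, and at most \<open>2 * e\<close> above height \<open>i * e\<close>. The
    loss is thus at most \<open>2 * e + e / 2\<close>.\<close>
  define i where "i = \<lceil>g s / e\<rceil> - 2"
  have "g s / e \<le> real_of_int i + 2" "real_of_int i + 1 < g s / e" unfolding i_def by linarith+
  then have i: "g s \<le> (real_of_int i + 2) * e" "(real_of_int i + 1) * e < g s"
    using e by (simp_all add: divide_le_eq less_divide_eq)
  have b: "tanh (g s) \<le> 1" "- 1 \<le> tanh (g u)" using tanh_real_lt_1[of "g s"] tanh_real_gt_neg1[of "g u"] by auto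
  consider "i < - A" | "i > A" | "i \<in> {-A..A}" by fastforce
  then show ?thesis
  proof cases
    case 1
    then have "real_of_int i + 2 \<le> - real_of_int (A - 1)" by simp
    then have "(real_of_int i + 2) * e \<le> - real_of_int (A - 1) * e" using e by (intro mult_right_mono) auto
    from order_trans[OF i(1) this] have "g s \<le> - (real_of_int (A - 1) * e)" by (simp only: mult_minus_left)
    then have "tanh (g s) \<le> - tanh (real_of_int (A - 1) * e)" by (simp only: tanh_minus[symmetric] tanh_real_le_iff)
    then show ?thesis using A b e by linarith
  next
    case 2
    then have "(real_of_int A + 1) * e \<le> (real_of_int i + 1) * e" using e by (intro mult_right_mono) auto
    then have "(real_of_int A + 1) * e \<le> g s" using i(2) by linarith
    then have "real_of_int A * e + e / 2 \<le> g s" using e unfolding distrib_right by linarith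
    then have "real_of_int A * e - e / 2 < g u" using low[of A] A by simp
    then have "real_of_int (A - 1) * e \<le> g u" using e by (simp add: algebra_simps)
    then have "1 - e \<le> tanh (g u)" using A(1) order_trans tanh_real_le_iff by blast
    then show ?thesis using b e by linarith
  next
    case 3
    have "real_of_int i * e + e / 2 \<le> g s" using i(2) e by (simp add: distrib_right)
    then have "real_of_int i * e - e / 2 < g u" by (rule low[OF 3])
    then have "g s - 3 * e \<le> g u" using i(1) e by (simp add: distrib_right)
    then have "g s - g u \<le> 3 * e" by simp
    show ?thesis
    proof (cases "g u \<le> g s")
      case True
      then show ?thesis using tanh_lipschitz[of "g s" "g u"] \<open>g s - g u \<le> 3 * e\<close> by (simp add: abs_if split: if_splits)
    next
      case False
      then have "tanh (g s) \<le> tanh (g u)" by (simp add: tanh_real_le_iff)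
      then show ?thesis using e by linarith
    qed
  qed
qed

lemma fence:
  fixes f :: "int \<Rightarrow> real \<Rightarrow> real"
  assumes e: "0 < e" and A: "1 - e \<le> tanh (real_of_int (A - 1) * e)" "1 \<le> A"
    and f: "\<And>i. i \<in> {-A..A} \<Longrightarrow> \<bar>f i s - real_of_int i * e\<bar> < e / 2" "\<And>i. i \<in> {-A..A} \<Longrightarrow> \<bar>f i u - real_of_int i * e\<bar> < e / 2"
    and g: "\<And>i. i \<in> {-A..A} \<Longrightarrow> f i s < g s \<Longrightarrow> f i u \<le> g u" "\<And>i. i \<in> {-A..A} \<Longrightarrow> g s < f i s \<Longrightarrow> g u \<le> f i u"
  shows "\<bar>tanh (g u) - tanh (g s)\<bar> \<le> 3 * (e :: real)"
proof -
  have 1: "tanh (g s) - 3 * e \<le> tanh (g u)"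
  proof (rule fence_lower[OF e A, where f=f and g=g and s=s and u=u])
    fix i assume i: "i \<in> {- A..A}"
    show "f i s < real_of_int i * e + e / 2" using f(1)[OF i] unfolding abs_less_iff by linarith
    show "real_of_int i * e - e / 2 < f i u" using f(2)[OF i] unfolding abs_less_iff by linarith
    show "f i u \<le> g u" if "f i s < g s" using g(1)[OF i that] .
  qed
  \<comment> \<open>Reflection in space, with post \<open>- i\<close> in the role of post
    \<open>i\<close>.\<close>
  have "tanh (- g s) - 3 * e \<le> tanh (- g u)"
  proof (rule fence_lower[OF e A, where f="\<lambda>i r. - f (- i) r" and g="\<lambda>r. - g r" and s=s and u=u])
    fix i assume "i \<in> {- A..A}"
    then have i: "- i \<in> {- A..A}" by auto
    show "- f (- i) s < real_of_int i * e + e / 2" using f(1)[OF i] unfolding abs_less_iff by simp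
    show "real_of_int i * e - e / 2 < - f (- i) u" using f(2)[OF i] unfolding abs_less_iff by simp
    show "- f (- i) u \<le> - g u" if "- f (- i) s < - g s" using g(2)[OF i] that by simp
  qed
  then show ?thesis using 1 by (simp add: abs_le_iff)
qed

section \<open>Equicontinuity of the skeleton\<close>

lemma dense_enumerationD:
  assumes "dense_enumeration z" "a < b" "c < (d::real)"
  shows "\<exists>j. a < fst (z j) \<and> fst (z j) < b \<and> c < snd (z j) \<and> snd (z j) < d"
proof -
  let ?U = "{a<..<b} \<times> {c<..<d}"
  have "open ?U" by (intro open_Times) auto
  moreover have "((a + b) / 2, (c + d) / 2) \<in> ?U \<inter> closure (range z)"
    using assms by (auto simp: dense_enumeration_def)
  ultimately have "?U \<inter> range z \<noteq> {}" using open_Int_closure_eq_empty by blast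
  then obtain p where p: "p \<in> ?U \<inter> range z" by fast
  then obtain j where "p = z j" by fast
  with p have "z j \<in> ?U" by simp
  then show ?thesis by (cases "z j") (auto intro!: exI[of _ j])
qed

lemma double_web_skeletonD:
  assumes "double_web_skeleton M z W Wb"
  shows "prob_space M" "coalescing_brownian_motions M z W"
    "coalescing_brownian_motions M (\<lambda>j. - z j) (\<lambda>j \<omega> t. - Wb j \<omega> (- t))"
    "AE \<omega> in M. \<forall>i j. \<not> cross_on ({snd (z i)..} \<inter> {..snd (z j)}) (W i \<omega>) (Wb j \<omega>)"
  using assms by (auto simp: double_web_skeleton_def backward_coalescing_brownian_motions_def)

lemma dense_enumeration_reverse: "dense_enumeration z \<Longrightarrow> dense_enumeration (\<lambda>j. - z j)"
proof -
  assume z: "dense_enumeration z"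
  have "x \<in> closure (range (\<lambda>j. - z j))" for x
    unfolding closure_approachable
  proof (intro allI impI)
    fix e :: real assume "0 < e"
    moreover have "- x \<in> closure (range z)" using z by (simp add: dense_enumeration_def)
    ultimately obtain j where "dist (z j) (- x) < e" unfolding closure_approachable by auto
    moreover have "dist (- z j) x = dist (z j) (- x)" using dist_minus[of "z j" "- x"] by simp
    ultimately show "\<exists>y\<in>range (\<lambda>j. - z j). dist y x < e" by (metis rangeI)
  qed
  then have "closure (range (\<lambda>j. - z j)) = UNIV" by auto
  then show ?thesis using z by (simp add: dense_enumeration_def inj_def)
qed

text \<open>The rotation \<open>(x, t)\<close> to \<open>(- x, - t)\<close> interchanges the forward
  and backward families and preserves non-crossing, so every estimate for backward paths yields one
  for forward paths.\<close>

lemma double_web_skeleton_reverse: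
  assumes "double_web_skeleton M z W Wb"
  shows "double_web_skeleton M (\<lambda>j. - z j) (\<lambda>j \<omega> t. - Wb j \<omega> (- t)) (\<lambda>j \<omega> t. - W j \<omega> (- t))"
proof -
  note d = double_web_skeletonD[OF assms]
  have "AE \<omega> in M. \<forall>i j. \<not> cross_on ({snd (- z i)..} \<inter> {..snd (- z j)}) (\<lambda>t. - Wb i \<omega> (- t)) (\<lambda>t. - W j \<omega> (- t))"
    using d(4)
  proof eventually_elim
    case (elim \<omega>)
    show ?case
    proof (intro allI notI)
      fix i j assume "cross_on ({snd (- z i)..} \<inter> {..snd (- z j)}) (\<lambda>t. - Wb i \<omega> (- t)) (\<lambda>t. - W j \<omega> (- t))"
      then obtain s t where st: "- snd (z i) \<le> s" "s \<le> - snd (z j)" "- snd (z i) \<le> t" "t \<le> - snd (z j)"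
        "W j \<omega> (- s) - Wb i \<omega> (- s) > 0" "W j \<omega> (- t) - Wb i \<omega> (- t) < 0" by (auto simp: cross_on_def)
      then have "cross_on ({snd (z j)..} \<inter> {..snd (z i)}) (W j \<omega>) (Wb i \<omega>)"
        unfolding cross_on_def by (intro bexI[of _ "- s"] bexI[of _ "- t"]) auto
      then show False using elim by blast
    qed
  qed
  then show ?thesis using d unfolding double_web_skeleton_def backward_coalescing_brownian_motions_def by simp
qed

text \<open>A fence of forward paths, started just below the times \<open>k d\<close>, confines every backward path during \<open>[k d, (k + 1) d]\<close>.\<close>

lemma backward_modulus:
  assumes W: "double_web_skeleton M z W Wb" and z: "dense_enumeration z" and e: "0 < e" and T: "0 < T"
  shows "AE \<omega> in M. \<exists>d>0. \<forall>j u s. \<bar>u\<bar> \<le> T \<longrightarrow> \<bar>s\<bar> \<le> T \<longrightarrow> u \<le> s \<longrightarrow> s \<le> snd (z j) \<longrightarrow> s - u \<le> d \<longrightarrow>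
     \<bar>tanh (Wb j \<omega> u) - tanh (Wb j \<omega> s)\<bar> \<le> 6 * e"
proof -
  note d = double_web_skeletonD[OF W]
  interpret prob_space M by fact
  have inj: "inj z" using z by (simp add: dense_enumeration_def)
  obtain x where x: "1 - e \<le> tanh x"
  proof -
    have "\<forall>\<^sub>F x in at_top. 1 - e < tanh (x :: real)" using e by (intro order_tendstoD(1)[OF tanh_real_at_top]) simp
    then show ?thesis using that by (meson eventually_happens' less_imp_le trivial_limit_at_top_linorder)
  qed
  define A where "A = max 1 (\<lceil>x / e\<rceil> + 1)"
  have A: "1 \<le> A" "1 - e \<le> tanh (real_of_int (A - 1) * e)"
  proof -
    have "x / e \<le> real_of_int (A - 1)" unfolding A_def by linarith
    then have "x \<le> real_of_int (A - 1) * e" using e by (simp add: divide_le_eq)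
    then show "1 - e \<le> tanh (real_of_int (A - 1) * e)" using x order_trans tanh_real_le_iff by blast
  qed (simp add: A_def)
  define h where "h m = 1 / real (Suc m)" for m
  have h: "\<And>m. 0 < h m" "h \<longlonglongrightarrow> 0" unfolding h_def using LIMSEQ_Suc[OF lim_1_over_n] by auto
  \<comment> \<open>The cells must cover \<open>[-T, T]\<close> and the following cell, into which
    an interval of length at most \<open>h m\<close> may reach.\<close>
  define N where "N m = \<lceil>T / h m\<rceil> + 2" for m
  define J where "J m k i = (SOME j. real_of_int i * e - e / 4 < fst (z j) \<and> fst (z j) < real_of_int i * e + e / 4 \<and>
      real_of_int k * h m - h m < snd (z j) \<and> snd (z j) < real_of_int k * h m)" for m and k i :: int
  have J: "\<forall>m k i. real_of_int i * e - e / 4 < fst (z (J m k i)) \<and> fst (z (J m k i)) < real_of_int i * e + e / 4 \<and>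
      real_of_int k * h m - h m < snd (z (J m k i)) \<and> snd (z (J m k i)) < real_of_int k * h m"
    unfolding J_def by (intro allI, rule someI_ex, rule dense_enumerationD[OF z]) (use e h(1) in auto)
  \<comment> \<open>The duration \<open>2 * h m\<close> reaches from the start of a post, less than
    \<open>h m\<close> before the cell, to the end of the cell. The deviation \<open>e / 4\<close>
    and the tolerance \<open>e / 4\<close> of the starting height keep the post within
    \<open>e / 2\<close> of height \<open>i * e\<close>.\<close>
  define Q where "Q m j Bad \<longleftrightarrow> Bad \<in> events \<and> prob Bad \<le> 6 * (2 * h m)\<^sup>2 / (e / 8) ^ 4 \<and>
    (AE \<omega> in M. \<omega> \<notin> Bad \<longrightarrow> (\<forall>s\<in>{snd (z j)..snd (z j) + 2 * h m}. \<bar>W j \<omega> s - fst (z j)\<bar> \<le> 2 * (e / 8)))" for m j Bad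
  define Bad where "Bad m j = (SOME B. Q m j B)" for m j
  have "Q m j (Bad m j)" for m j
    unfolding Bad_def
  proof (rule someI_ex)
    show "\<exists>B. Q m j B" unfolding Q_def
      using cbm_max[OF d(1,2) inj, of "e / 8" "2 * h m" j] e h(1)[of m] by auto
  qed
  then have Bad: "Bad m j \<in> events" "prob (Bad m j) \<le> 6 * (2 * h m)\<^sup>2 / (e / 8) ^ 4"
    "AE \<omega> in M. \<omega> \<notin> Bad m j \<longrightarrow> (\<forall>s\<in>{snd (z j)..snd (z j) + 2 * h m}. \<bar>W j \<omega> s - fst (z j)\<bar> \<le> 2 * (e / 8))" for m j
    unfolding Q_def by blast+
  define D where "D m = (\<Union>(k, i)\<in>{- N m..N m} \<times> {-A..A}. Bad m (J m k i))" for m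
  have Dm: "D m \<in> events" for m unfolding D_def using Bad(1) by (intro sets.finite_UN) auto
  define c where "c = (2 * real_of_int A + 1) * 24 / (e / 8) ^ 4"
  have N1: "real_of_int (N m) \<le> T / h m + 3" "1 \<le> N m" for m
  proof -
    show "real_of_int (N m) \<le> T / h m + 3" unfolding N_def by linarith
    have "0 < T / h m" using T h(1)[of m] by simp
    then show "1 \<le> N m" unfolding N_def by linarith
  qed
  have "prob (D m) \<le> c * (2 * T * h m + 7 * (h m)\<^sup>2)" for m
  proof -
    have "prob (D m) \<le> (\<Sum>p\<in>{- N m..N m} \<times> {-A..A}. prob (case p of (k, i) \<Rightarrow> Bad m (J m k i)))"
      unfolding D_def using Bad(1) by (intro finite_measure_subadditive_finite) auto
    also have "\<dots> \<le> (\<Sum>p\<in>{- N m..N m} \<times> {-A..A}. 6 * (2 * h m)\<^sup>2 / (e / 8) ^ 4)"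
      using Bad(2) by (intro sum_mono) (auto split: prod.splits)
    also have "\<dots> = (2 * real_of_int (N m) + 1) * (2 * real_of_int A + 1) * (6 * (2 * h m)\<^sup>2 / (e / 8) ^ 4)"
      using N1(2)[of m] A by (simp add: card_cartesian_product of_nat_nat)
    also have "\<dots> \<le> (2 * (T / h m + 3) + 1) * (2 * real_of_int A + 1) * (6 * (2 * h m)\<^sup>2 / (e / 8) ^ 4)"
      using N1(1)[of m] A by (intro mult_right_mono add_mono mult_left_mono) auto
    also have "\<dots> = c * ((2 * (T / h m + 3) + 1) * (h m)\<^sup>2)"
      unfolding c_def by (simp add: power_mult_distrib)
    also have "(2 * (T / h m + 3) + 1) * (h m)\<^sup>2 = 2 * T * h m + 7 * (h m)\<^sup>2"
      using h(1)[of m] by (simp add: field_simps power2_eq_square)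
    finally show ?thesis .
  qed
  note ub = this
  have "(\<lambda>m. c * (2 * T * h m + 7 * (h m)\<^sup>2)) \<longlonglongrightarrow> c * (2 * T * 0 + 7 * 0\<^sup>2)"
    by (intro tendsto_intros h)
  then have lim0: "(\<lambda>m. c * (2 * T * h m + 7 * (h m)\<^sup>2)) \<longlonglongrightarrow> 0" by simp
  have lim: "(\<lambda>m. prob (D m)) \<longlonglongrightarrow> 0"
  proof (rule tendsto_sandwich[OF _ _ tendsto_const lim0])
    show "\<forall>\<^sub>F m in sequentially. 0 \<le> prob (D m)" by simp
    show "\<forall>\<^sub>F m in sequentially. prob (D m) \<le> c * (2 * T * h m + 7 * (h m)\<^sup>2)" using ub by (rule always_eventually[OF allI])
  qed
  \<comment> \<open>The bounds are only of order \<open>h m\<close> and not summable, but a single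
    good \<open>m\<close> suffices: the modulus \<open>d\<close> may depend on the outcome.\<close>
  have "prob (\<Inter>m. D m) \<le> prob (D m)" for m using Dm by (intro finite_measure_mono) auto
  then have "prob (\<Inter>m. D m) \<le> 0" by (intro LIMSEQ_le_const[OF lim]) auto
  then have "AE \<omega> in M. \<omega> \<notin> (\<Inter>m. D m)"
    using Dm by (intro AE_not_in) (auto simp: null_sets_def emeasure_eq_measure measure_le_0_iff)
  moreover have "AE \<omega> in M. \<forall>m j. \<omega> \<notin> Bad m j \<longrightarrow> (\<forall>s\<in>{snd (z j)..snd (z j) + 2 * h m}. \<bar>W j \<omega> s - fst (z j)\<bar> \<le> 2 * (e / 8))"
    unfolding AE_all_countable using Bad(3) by blast
  ultimately show ?thesis using d(4)
  proof eventually_elim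
    case (elim \<omega>)
    obtain m where m: "\<omega> \<notin> D m" using elim(1) by auto
    have fen: "\<bar>W (J m k i) \<omega> s - real_of_int i * e\<bar> < e / 2"
      if "k \<in> {- N m..N m}" "i \<in> {-A..A}" "real_of_int k * h m \<le> s" "s \<le> (real_of_int k + 1) * h m" for k i s
    proof -
      have "\<omega> \<notin> Bad m (J m k i)" using m that by (auto simp: D_def)
      moreover have "s \<in> {snd (z (J m k i))..snd (z (J m k i)) + 2 * h m}"
        using J[THEN spec, of m, THEN spec, of k, THEN spec, of i] that by (simp add: distrib_right)
      ultimately have "\<bar>W (J m k i) \<omega> s - fst (z (J m k i))\<bar> \<le> 2 * (e / 8)" using elim(2) by blast
      then show ?thesis using J[THEN spec, of m, THEN spec, of k, THEN spec, of i]
        unfolding abs_le_iff abs_less_iff by linarith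
    qed
    have cell: "\<bar>tanh (Wb j \<omega> u) - tanh (Wb j \<omega> s)\<bar> \<le> 3 * e"
      if k: "k \<in> {- N m..N m}" and us: "real_of_int k * h m \<le> u" "u \<le> s" "s \<le> (real_of_int k + 1) * h m" "s \<le> snd (z j)" for k u s j
    proof (rule fence[OF e A(2,1), where f="\<lambda>i. W (J m k i) \<omega>" and g="Wb j \<omega>" and s=s and u=u])
      show "\<bar>W (J m k i) \<omega> s - real_of_int i * e\<bar> < e / 2" "\<bar>W (J m k i) \<omega> u - real_of_int i * e\<bar> < e / 2" if "i \<in> {-A..A}" for i
        using fen[OF k that] us by auto
      have dom: "u \<in> {snd (z (J m k i))..} \<inter> {..snd (z j)}" "s \<in> {snd (z (J m k i))..} \<inter> {..snd (z j)}" for i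
        using us J[THEN spec, of m, THEN spec, of k, THEN spec, of i] by auto
      have nc: "\<not> cross_on ({snd (z (J m k i))..} \<inter> {..snd (z j)}) (W (J m k i) \<omega>) (Wb j \<omega>)" for i using elim(3) by blast
      show "W (J m k i) \<omega> u \<le> Wb j \<omega> u" if "W (J m k i) \<omega> s < Wb j \<omega> s" for i
        using nc[of i] dom[of i] that unfolding cross_on_def by (meson diff_gt_0_iff_gt diff_less_0_iff_less not_le)
      show "Wb j \<omega> u \<le> W (J m k i) \<omega> u" if "Wb j \<omega> s < W (J m k i) \<omega> s" for i
        using nc[of i] dom[of i] that unfolding cross_on_def by (meson diff_gt_0_iff_gt diff_less_0_iff_less not_le)
    qed
    show ?case
    proof (intro exI[of _ "h m"] conjI allI impI)
      show "0 < h m" by (rule h(1))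
      fix j u s assume us: "\<bar>u\<bar> \<le> T" "\<bar>s\<bar> \<le> T" "u \<le> s" "s \<le> snd (z j)" "s - u \<le> h m"
      define k where "k = \<lfloor>u / h m\<rfloor>"
      have "real_of_int k \<le> u / h m" "u / h m < real_of_int k + 1" unfolding k_def by linarith+
      then have ku: "real_of_int k * h m \<le> u" "u \<le> (real_of_int k + 1) * h m"
        using h(1)[of m] by (simp_all add: le_divide_eq divide_less_eq)
      have "\<bar>u / h m\<bar> \<le> T / h m" using us(1) h(1)[of m] by (simp add: divide_right_mono)
      then have "- (T / h m) \<le> u / h m" "u / h m \<le> T / h m" by linarith+
      then have "- \<lceil>T / h m\<rceil> \<le> k" "k \<le> \<lceil>T / h m\<rceil>" unfolding k_def by linarith+
      then have kN: "k \<in> {- N m..N m}" "k + 1 \<in> {- N m..N m}" unfolding N_def by auto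
      show "\<bar>tanh (Wb j \<omega> u) - tanh (Wb j \<omega> s)\<bar> \<le> 6 * e"
      proof (cases "s \<le> (real_of_int k + 1) * h m")
        case True
        then show ?thesis using cell[OF kN(1) ku(1) us(3) True us(4)] e by simp
      next
        case False
        let ?v = "(real_of_int k + 1) * h m"
        have "\<bar>tanh (Wb j \<omega> u) - tanh (Wb j \<omega> ?v)\<bar> \<le> 3 * e"
          by (rule cell[OF kN(1) ku(1) ku(2)]) (use False us in auto)
        moreover have "\<bar>tanh (Wb j \<omega> ?v) - tanh (Wb j \<omega> s)\<bar> \<le> 3 * e"
          by (rule cell[OF kN(2)]) (use False us ku in \<open>auto simp: distrib_right\<close>)
        ultimately show ?thesis by linarith
      qed
    qed
  qed
qed

lemma forward_modulus:
  assumes W: "double_web_skeleton M z W Wb" and z: "dense_enumeration z" and e: "0 < e" and T: "0 < T"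
  shows "AE \<omega> in M. \<exists>d>0. \<forall>j u s. \<bar>u\<bar> \<le> T \<longrightarrow> \<bar>s\<bar> \<le> T \<longrightarrow> snd (z j) \<le> s \<longrightarrow> s \<le> u \<longrightarrow> u - s \<le> d \<longrightarrow>
     \<bar>tanh (W j \<omega> u) - tanh (W j \<omega> s)\<bar> \<le> 6 * e"
  using backward_modulus[OF double_web_skeleton_reverse[OF W] dense_enumeration_reverse[OF z] e T]
proof eventually_elim
  case (elim \<omega>)
  then obtain d where d: "0 < d" "\<And>j u s. \<bar>u\<bar> \<le> T \<Longrightarrow> \<bar>s\<bar> \<le> T \<Longrightarrow> u \<le> s \<Longrightarrow> s \<le> snd (- z j) \<Longrightarrow> s - u \<le> d \<Longrightarrow>
     \<bar>tanh (- W j \<omega> (- u)) - tanh (- W j \<omega> (- s))\<bar> \<le> 6 * e" by blast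
  have "\<bar>tanh (W j \<omega> u) - tanh (W j \<omega> s)\<bar> \<le> 6 * e"
    if "\<bar>u\<bar> \<le> T" "\<bar>s\<bar> \<le> T" "snd (z j) \<le> s" "s \<le> u" "u - s \<le> d" for j u s
    using d(2)[of "- u" "- s" j] that by (simp add: abs_minus_commute)
  then show ?case using d(1) by blast
qed

text \<open>The almost sure properties of the skeleton are gathered for one outcome, so that
  compactness and the study of limit paths become deterministic.\<close>

definition skeleton_regular :: "(nat \<Rightarrow> real \<times> real) \<Rightarrow> (nat \<Rightarrow> real \<Rightarrow> real) \<Rightarrow> (nat \<Rightarrow> real \<Rightarrow> real) \<Rightarrow> bool" where
  "skeleton_regular z w wb \<longleftrightarrow>
     (\<forall>j. continuous_on {snd (z j)..} (w j) \<and> w j (snd (z j)) = fst (z j)) \<and>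
     (\<forall>j. continuous_on {..snd (z j)} (wb j) \<and> wb j (snd (z j)) = fst (z j)) \<and>
     (\<forall>i j. \<not> cross_on ({snd (z i)..} \<inter> {..snd (z j)}) (w i) (wb j)) \<and>
     (\<forall>e>0. \<forall>T>0. \<exists>d>0. \<forall>j u s. \<bar>u\<bar> \<le> T \<longrightarrow> \<bar>s\<bar> \<le> T \<longrightarrow> u \<le> s \<longrightarrow> s \<le> snd (z j) \<longrightarrow> s - u \<le> d \<longrightarrow>
       \<bar>tanh (wb j u) - tanh (wb j s)\<bar> \<le> e) \<and>
     (\<forall>e>0. \<forall>T>0. \<exists>d>0. \<forall>j u s. \<bar>u\<bar> \<le> T \<longrightarrow> \<bar>s\<bar> \<le> T \<longrightarrow> snd (z j) \<le> s \<longrightarrow> s \<le> u \<longrightarrow> u - s \<le> d \<longrightarrow>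
       \<bar>tanh (w j u) - tanh (w j s)\<bar> \<le> e)"

text \<open>Monotonicity in both parameters reduces the uncountable quantifiers to a
  sequence.\<close>

lemma AE_pos_real:
  assumes mono: "\<And>\<omega> e e' T T'. P \<omega> e T \<Longrightarrow> e \<le> e' \<Longrightarrow> T' \<le> T \<Longrightarrow> P \<omega> e' T'"
    and ae: "\<And>e T. 0 < e \<Longrightarrow> 0 < T \<Longrightarrow> AE \<omega> in M. P \<omega> (e::real) (T::real)"
  shows "AE \<omega> in M. \<forall>e>0. \<forall>T>0. P \<omega> e T"
proof -
  have "AE \<omega> in M. \<forall>n. P \<omega> (1 / real (Suc n)) (real (Suc n))"
    unfolding AE_all_countable by (intro allI ae) auto
  then show ?thesis
  proof eventually_elim
    case (elim \<omega>)
    show ?case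
    proof (intro allI impI)
      fix e T :: real assume eT: "0 < e" "0 < T"
      obtain n :: nat where n: "max (1 / e) T < real n" using reals_Archimedean2 by blast
      then have "1 / e < real (Suc n)" "T \<le> real (Suc n)" by auto
      then have "1 / real (Suc n) \<le> e" using eT by (simp add: field_simps)
      with elim \<open>T \<le> real (Suc n)\<close> show "P \<omega> e T" using mono by blast
    qed
  qed
qed

theorem skeleton_regular_AE:
  assumes W: "double_web_skeleton M z W Wb" and z: "dense_enumeration z"
  shows "AE \<omega> in M. skeleton_regular z (\<lambda>j. W j \<omega>) (\<lambda>j. Wb j \<omega>)"
proof -
  note d = double_web_skeletonD[OF W]
  have inj: "inj z" "inj (\<lambda>j. - z j)" using z by (simp_all add: dense_enumeration_def inj_def)
  have b: "AE \<omega> in M. \<forall>j. continuous_on {..snd (z j)} (Wb j \<omega>) \<and> Wb j \<omega> (snd (z j)) = fst (z j)"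
    using cbm_start[OF d(1,3) inj(2)]
  proof eventually_elim
    case (elim \<omega>)
    show ?case
    proof
      fix j
      have c: "continuous_on {- snd (z j)..} (\<lambda>t. - Wb j \<omega> (- t))" and v: "- Wb j \<omega> (snd (z j)) = - fst (z j)"
        using elim[rule_format, of j] by auto
      have "continuous_on {..snd (z j)} (\<lambda>t. - (\<lambda>t. - Wb j \<omega> (- t)) (- t))"
        by (intro continuous_on_minus continuous_on_compose2[OF c]) (auto intro!: continuous_intros)
      then show "continuous_on {..snd (z j)} (Wb j \<omega>) \<and> Wb j \<omega> (snd (z j)) = fst (z j)" using v by simp
    qed
  qed
  have m1: "AE \<omega> in M. \<forall>e>0. \<forall>T>0. \<exists>d>0. \<forall>j u s. \<bar>u\<bar> \<le> T \<longrightarrow> \<bar>s\<bar> \<le> T \<longrightarrow> u \<le> s \<longrightarrow> s \<le> snd (z j) \<longrightarrow> s - u \<le> d \<longrightarrow>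
       \<bar>tanh (Wb j \<omega> u) - tanh (Wb j \<omega> s)\<bar> \<le> e"
  proof (rule AE_pos_real)
    fix e T :: real assume "0 < e" "0 < T"
    then show "AE \<omega> in M. \<exists>d>0. \<forall>j u s. \<bar>u\<bar> \<le> T \<longrightarrow> \<bar>s\<bar> \<le> T \<longrightarrow> u \<le> s \<longrightarrow> s \<le> snd (z j) \<longrightarrow> s - u \<le> d \<longrightarrow>
       \<bar>tanh (Wb j \<omega> u) - tanh (Wb j \<omega> s)\<bar> \<le> e"
      using backward_modulus[OF W z, of "e / 6" T] by simp
  qed (meson order_trans)
  have m2: "AE \<omega> in M. \<forall>e>0. \<forall>T>0. \<exists>d>0. \<forall>j u s. \<bar>u\<bar> \<le> T \<longrightarrow> \<bar>s\<bar> \<le> T \<longrightarrow> snd (z j) \<le> s \<longrightarrow> s \<le> u \<longrightarrow> u - s \<le> d \<longrightarrow>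
       \<bar>tanh (W j \<omega> u) - tanh (W j \<omega> s)\<bar> \<le> e"
  proof (rule AE_pos_real)
    fix e T :: real assume "0 < e" "0 < T"
    then show "AE \<omega> in M. \<exists>d>0. \<forall>j u s. \<bar>u\<bar> \<le> T \<longrightarrow> \<bar>s\<bar> \<le> T \<longrightarrow> snd (z j) \<le> s \<longrightarrow> s \<le> u \<longrightarrow> u - s \<le> d \<longrightarrow>
       \<bar>tanh (W j \<omega> u) - tanh (W j \<omega> s)\<bar> \<le> e"
      using forward_modulus[OF W z, of "e / 6" T] by simp
  qed (meson order_trans)
  show ?thesis
    using cbm_start[OF d(1,2) inj(1)] b d(4) m1 m2 unfolding skeleton_regular_def by eventually_elim blast
qed

lemma skeleton_regularD:
  assumes "skeleton_regular z w wb"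
  shows "\<And>j. continuous_on {snd (z j)..} (w j)" "\<And>j. w j (snd (z j)) = fst (z j)"
    "\<And>j. continuous_on {..snd (z j)} (wb j)" "\<And>j. wb j (snd (z j)) = fst (z j)"
    "\<And>i j. \<not> cross_on ({snd (z i)..} \<inter> {..snd (z j)}) (w i) (wb j)"
  using assms unfolding skeleton_regular_def by blast+

lemma skeleton_regular_modulus:
  assumes "skeleton_regular z w wb"
  shows "\<forall>e>0. \<forall>T>0. \<exists>d>0. \<forall>j u s. \<bar>u\<bar> \<le> T \<longrightarrow> \<bar>s\<bar> \<le> T \<longrightarrow> u \<le> s \<longrightarrow> s \<le> snd (z j) \<longrightarrow> s - u \<le> d \<longrightarrow>
       \<bar>tanh (wb j u) - tanh (wb j s)\<bar> \<le> e"
    and "\<forall>e>0. \<forall>T>0. \<exists>d>0. \<forall>j u s. \<bar>u\<bar> \<le> T \<longrightarrow> \<bar>s\<bar> \<le> T \<longrightarrow> snd (z j) \<le> s \<longrightarrow> s \<le> u \<longrightarrow> u - s \<le> d \<longrightarrow>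
       \<bar>tanh (w j u) - tanh (w j s)\<bar> \<le> e"
  using assms unfolding skeleton_regular_def by - (elim conjE, assumption)+

abbreviation full_path :: "(nat \<Rightarrow> real \<times> real) \<Rightarrow> (nat \<Rightarrow> real \<Rightarrow> real) \<Rightarrow> (nat \<Rightarrow> real \<Rightarrow> real) \<Rightarrow> nat \<Rightarrow> bipath" where
  "full_path z w wb j \<equiv> glue_paths (snd (z j)) (wb j) (w j)"

lemma val_full_path:
  assumes "skeleton_regular z w wb"
  shows "val (full_path z w wb j) r = tanh (if r \<le> snd (z j) then wb j r else w j r)"
  using skeleton_regularD[OF assms] by (intro val_glue_paths) auto

lemma skeleton_modulus:
  assumes r: "skeleton_regular z w wb" and e: "0 < e"
  shows "\<exists>d>0. range (full_path z w wb) \<subseteq> bipath_modulus e T d"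
proof -
  define T' where "T' = max 1 T"
  have T': "0 < T'" "T \<le> T'" by (auto simp: T'_def)
  have e2: "0 < e / 2" using e by simp
  obtain d1 where d1: "0 < d1" "\<And>j u s. \<bar>u\<bar> \<le> T' \<Longrightarrow> \<bar>s\<bar> \<le> T' \<Longrightarrow> u \<le> s \<Longrightarrow> s \<le> snd (z j) \<Longrightarrow> s - u \<le> d1 \<Longrightarrow>
       \<bar>tanh (wb j u) - tanh (wb j s)\<bar> \<le> e / 2"
    using skeleton_regular_modulus(1)[OF r, rule_format, OF e2 T'(1)] by blast
  obtain d2 where d2: "0 < d2" "\<And>j u s. \<bar>u\<bar> \<le> T' \<Longrightarrow> \<bar>s\<bar> \<le> T' \<Longrightarrow> snd (z j) \<le> s \<Longrightarrow> s \<le> u \<Longrightarrow> u - s \<le> d2 \<Longrightarrow>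
       \<bar>tanh (w j u) - tanh (w j s)\<bar> \<le> e / 2"
    using skeleton_regular_modulus(2)[OF r, rule_format, OF e2 T'(1)] by blast
  define d where "d = min d1 d2"
  have one: "\<bar>val (full_path z w wb j) u - val (full_path z w wb j) s\<bar> \<le> e"
    if us: "\<bar>u\<bar> \<le> T" "\<bar>s\<bar> \<le> T" "u \<le> s" "s - u \<le> d" for j u s
  proof -
    consider "s \<le> snd (z j)" | "snd (z j) < u" | "u \<le> snd (z j)" "snd (z j) < s" by linarith
    then show ?thesis
    proof cases
      case 1
      then show ?thesis using d1(2)[of u s j] us T' e by (simp add: val_full_path[OF r] d_def)
    next
      case 2
      then show ?thesis using d2(2)[of s u j] us T' e by (simp add: val_full_path[OF r] d_def abs_minus_commute)
    next
      \<comment> \<open>An interval containing the gluing time is split there, which is why each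
        half is given \<open>e / 2\<close>.\<close>
      case 3
      have "\<bar>tanh (wb j u) - tanh (wb j (snd (z j)))\<bar> \<le> e / 2"
        by (rule d1(2)) (use us T' 3 in \<open>auto simp: d_def\<close>)
      moreover have "\<bar>tanh (w j s) - tanh (w j (snd (z j)))\<bar> \<le> e / 2"
        by (rule d2(2)) (use us T' 3 in \<open>auto simp: d_def\<close>)
      moreover have "wb j (snd (z j)) = w j (snd (z j))" using skeleton_regularD(2,4)[OF r] by simp
      moreover have "val (full_path z w wb j) u = tanh (wb j u)" "val (full_path z w wb j) s = tanh (w j s)"
        using 3 by (simp_all add: val_full_path[OF r])
      ultimately show ?thesis
        using abs_diff_triangle[of "tanh (wb j u)" "tanh (w j s)" "tanh (wb j (snd (z j)))"] by simp
    qed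
  qed
  have "full_path z w wb j \<in> bipath_modulus e T d" for j
    unfolding bipath_modulus_def
  proof (intro CollectI allI impI)
    fix s t assume st: "\<bar>s\<bar> \<le> T" "\<bar>t\<bar> \<le> T" "\<bar>s - t\<bar> \<le> d"
    show "\<bar>val (full_path z w wb j) s - val (full_path z w wb j) t\<bar> \<le> e"
    proof (cases "s \<le> t")
      case True then show ?thesis using one[of s t j] st by simp
    next
      case False then show ?thesis using one[of t s j] st by (simp add: abs_minus_commute)
    qed
  qed
  then show ?thesis using d1(1) d2(1) by (intro exI[of _ d]) (auto simp: d_def)
qed

lemma compact_skeleton:
  assumes "skeleton_regular z w wb"
  shows "compact (closure (range (full_path z w wb)))"
  using skeleton_modulus[OF assms] by (intro compact_closure_bipath) auto

section \<open>Reconstruction from the forward paths\<close>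

text \<open>The backward path from \<open>z j\<close> is determined by the forward paths: it separates those passing below \<open>z j\<close>
  from those passing above. Positions are in the coordinate \<open>tanh\<close>; the truncation to \<open>[-1, 1]\<close> makes the supremum exist
  for every \<open>\<xi>\<close>.\<close>

definition backward_of :: "(nat \<Rightarrow> real \<times> real) \<Rightarrow> (nat \<times> real \<Rightarrow> real) \<Rightarrow> nat \<Rightarrow> real \<Rightarrow> real" where
  "backward_of z \<xi> j s = (SUP i. if snd (z i) \<le> s \<and> \<xi> (i, snd (z j)) < tanh (fst (z j)) then max (-1) (min 1 (\<xi> (i, s))) else -1)"

definition full_value :: "(nat \<Rightarrow> real \<times> real) \<Rightarrow> (nat \<times> real \<Rightarrow> real) \<Rightarrow> nat \<Rightarrow> real \<Rightarrow> real" where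
  "full_value z \<xi> j s = (if s < snd (z j) then backward_of z \<xi> j s else \<xi> (j, s))"

text \<open>Strictness at starting points decides on which side a forward path passes, and density
  at rational times leaves no gap for a second separating value. Both are conditions on the field
  \<open>\<xi>\<close> alone, so they can be transferred by equality in law.\<close>

definition separating :: "(nat \<Rightarrow> real \<times> real) \<Rightarrow> (nat \<times> real \<Rightarrow> real) \<Rightarrow> bool" where
  "separating z \<xi> \<longleftrightarrow> (\<forall>i j. snd (z i) < snd (z j) \<longrightarrow> \<xi> (i, snd (z j)) \<noteq> tanh (fst (z j))) \<and>
     (\<forall>s\<in>\<rat>. \<forall>a\<in>\<rat>. \<forall>b\<in>\<rat>. -1 \<le> a \<longrightarrow> a < b \<longrightarrow> b \<le> 1 \<longrightarrow> (\<exists>i. snd (z i) \<le> s \<and> a < \<xi> (i, s) \<and> \<xi> (i, s) < b))"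

text \<open>Paths passing below stay at or below \<open>\<beta>\<close>. If their supremum were
  smaller, some forward path would lie strictly between it and \<open>\<beta>\<close> at time
  \<open>s\<close>; passing below it contradicts the supremum, passing above it contradicts
  \<open>above\<close>.\<close>

lemma backward_of_eq:
  assumes sep: "separating z \<xi>" and s: "s \<in> \<rat>" "s < snd (z j)" and \<beta>: "-1 \<le> \<beta>" "\<beta> \<le> 1"
    and below: "\<And>i. snd (z i) \<le> s \<Longrightarrow> \<xi> (i, snd (z j)) < tanh (fst (z j)) \<Longrightarrow> \<xi> (i, s) \<le> \<beta>"
    and above: "\<And>i. snd (z i) \<le> s \<Longrightarrow> tanh (fst (z j)) < \<xi> (i, snd (z j)) \<Longrightarrow> \<beta> \<le> \<xi> (i, s)"
  shows "backward_of z \<xi> j s = \<beta>"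
proof (rule antisym)
  let ?F = "\<lambda>i. if snd (z i) \<le> s \<and> \<xi> (i, snd (z j)) < tanh (fst (z j)) then max (-1) (min 1 (\<xi> (i, s))) else -1"
  have bdd: "bdd_above (range ?F)" by (rule bdd_aboveI[of _ 1]) auto
  show le: "backward_of z \<xi> j s \<le> \<beta>"
    unfolding backward_of_def using below \<beta> by (intro cSUP_least) (auto simp: min_le_iff_disj)
  show "\<beta> \<le> backward_of z \<xi> j s"
  proof (rule ccontr)
    assume "\<not> \<beta> \<le> backward_of z \<xi> j s"
    then have lt: "backward_of z \<xi> j s < \<beta>" by simp
    have m1: "-1 \<le> backward_of z \<xi> j s"
      unfolding backward_of_def using cSUP_upper2[OF bdd UNIV_I, of "-1" 0] by simp
    obtain a where a: "a \<in> \<rat>" "backward_of z \<xi> j s < a" "a < \<beta>" using Rats_dense_in_real[OF lt] by blast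
    obtain b where b: "b \<in> \<rat>" "a < b" "b < \<beta>" using Rats_dense_in_real[OF a(3)] by blast
    obtain i where i: "snd (z i) \<le> s" "a < \<xi> (i, s)" "\<xi> (i, s) < b"
    proof -
      have "-1 \<le> a" "b \<le> 1" using m1 a b \<beta> by linarith+
      then show ?thesis using that sep s(1) a b unfolding separating_def by blast
    qed
    have ne: "\<xi> (i, snd (z j)) \<noteq> tanh (fst (z j))" using sep i(1) s(2) unfolding separating_def by auto
    show False
    proof (cases "\<xi> (i, snd (z j)) < tanh (fst (z j))")
      case True
      then have "?F i = \<xi> (i, s)" using i a b \<beta> m1 by (simp add: max_def min_def)
      then have "\<xi> (i, s) \<le> backward_of z \<xi> j s"
        unfolding backward_of_def using cSUP_upper[OF UNIV_I bdd, of i] by simp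
      then show False using i(2) a(2) by simp
    next
      case False
      then show False using above[OF i(1)] ne i b by force
    qed
  qed
qed

lemma forward_dense:
  assumes r: "skeleton_regular z w wb" and z: "dense_enumeration z" and ab: "-1 \<le> a" "a < b" "b \<le> 1"
  shows "\<exists>i. snd (z i) \<le> s \<and> a < tanh (w i s) \<and> tanh (w i s) < b"
proof -
  have "\<bar>(a + b) / 2\<bar> < 1" using ab by (auto simp: abs_less_iff)
  then obtain x where "tanh_ereal x = (a + b) / 2" using tanh_ereal_surj[of "(a + b) / 2"] by auto
  then obtain y where y: "tanh y = (a + b) / 2" using \<open>\<bar>(a + b) / 2\<bar> < 1\<close> by (cases x) (auto simp: tanh_ereal_def)
  \<comment> \<open>The starting height and the motion up to time \<open>s\<close> each cost
    \<open>e\<close>, in total a quarter of the length of the interval, which stays within half of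
    it around the midpoint.\<close>
  define e where "e = (b - a) / 8"
  have e: "0 < e" using ab by (simp add: e_def)
  obtain d where d: "0 < d" "\<And>j u v. \<bar>u\<bar> \<le> \<bar>s\<bar> + 1 \<Longrightarrow> \<bar>v\<bar> \<le> \<bar>s\<bar> + 1 \<Longrightarrow> snd (z j) \<le> v \<Longrightarrow> v \<le> u \<Longrightarrow> u - v \<le> d \<Longrightarrow>
       \<bar>tanh (w j u) - tanh (w j v)\<bar> \<le> e"
    using skeleton_regular_modulus(2)[OF r, rule_format, OF e, of "\<bar>s\<bar> + 1"] by force
  obtain i where i: "y - e < fst (z i)" "fst (z i) < y + e" "s - min d 1 < snd (z i)" "snd (z i) < s"
    using dense_enumerationD[OF z, of "y - e" "y + e" "s - min d 1" s] e d(1) by auto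
  have "\<bar>tanh (w i s) - tanh (w i (snd (z i)))\<bar> \<le> e" using i by (intro d(2)) auto
  then have "\<bar>tanh (w i s) - tanh (fst (z i))\<bar> \<le> e" by (simp add: skeleton_regularD(2)[OF r])
  moreover have "\<bar>tanh (fst (z i)) - tanh y\<bar> \<le> e" using tanh_lipschitz[of "fst (z i)" y] i by linarith
  ultimately have "\<bar>tanh (w i s) - (a + b) / 2\<bar> \<le> 2 * e" using y by linarith
  then have "a < tanh (w i s)" "tanh (w i s) < b" using ab unfolding e_def abs_le_iff by - (elim conjE, simp add: field_simps)+
  then show ?thesis using i(4) by (intro exI[of _ i]) auto
qed

lemma nocross_below:
  assumes "skeleton_regular z w wb" "snd (z i) \<le> s" "snd (z i) \<le> u" "s \<le> snd (z j)" "u \<le> snd (z j)" "w i u < wb j u"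
  shows "w i s \<le> wb j s"
  using skeleton_regularD(5)[OF assms(1), of i j] assms(2-6) unfolding cross_on_def
  by (meson IntI atLeast_iff atMost_iff diff_gt_0_iff_gt diff_less_0_iff_less not_le)

lemma nocross_above:
  assumes "skeleton_regular z w wb" "snd (z i) \<le> s" "snd (z i) \<le> u" "s \<le> snd (z j)" "u \<le> snd (z j)" "wb j u < w i u"
  shows "wb j s \<le> w i s"
  using skeleton_regularD(5)[OF assms(1), of i j] assms(2-6) unfolding cross_on_def
  by (meson IntI atLeast_iff atMost_iff diff_gt_0_iff_gt diff_less_0_iff_less not_le)

lemma full_value_skeleton:
  assumes r: "skeleton_regular z w wb" and z: "dense_enumeration z"
    and nohit: "\<And>i j. snd (z i) < snd (z j) \<Longrightarrow> w i (snd (z j)) \<noteq> fst (z j)"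
  shows "separating z (\<lambda>(i, s). tanh (w i s))"
    and "s \<in> \<rat> \<Longrightarrow> full_value z (\<lambda>(i, s). tanh (w i s)) j s = val (full_path z w wb j) s"
proof -
  show sep: "separating z (\<lambda>(i, s). tanh (w i s))"
    unfolding separating_def using nohit forward_dense[OF r z] by simp
  assume s: "s \<in> \<rat>"
  show "full_value z (\<lambda>(i, s). tanh (w i s)) j s = val (full_path z w wb j) s"
  proof (cases "s < snd (z j)")
    case True
    have "backward_of z (\<lambda>(i, s). tanh (w i s)) j s = tanh (wb j s)"
    proof (rule backward_of_eq[OF sep s True])
      fix i assume i: "snd (z i) \<le> s"
      show "(case (i, s) of (i, s) \<Rightarrow> tanh (w i s)) \<le> tanh (wb j s)"
        if "(case (i, snd (z j)) of (i, s) \<Rightarrow> tanh (w i s)) < tanh (fst (z j))"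
        using nocross_below[OF r i _ _ order_refl, of j] that True i skeleton_regularD(4)[OF r, of j] by (simp add: tanh_real_le_iff tanh_real_less_iff)
      show "tanh (wb j s) \<le> (case (i, s) of (i, s) \<Rightarrow> tanh (w i s))"
        if "tanh (fst (z j)) < (case (i, snd (z j)) of (i, s) \<Rightarrow> tanh (w i s))"
        using nocross_above[OF r i _ _ order_refl, of j] that True i skeleton_regularD(4)[OF r, of j] by (simp add: tanh_real_le_iff tanh_real_less_iff)
    qed (use tanh_real_lt_1[of "wb j s"] tanh_real_gt_neg1[of "wb j s"] in auto)
    then show ?thesis using True by (simp add: full_value_def val_full_path[OF r])
  next
    case False
    then show ?thesis using skeleton_regularD(2,4)[OF r, of j] by (auto simp: full_value_def val_full_path[OF r])
  qed
qed

section \<open>Limits of doubly infinite paths\<close>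

text \<open>If \<open>F\<close> were below \<open>G\<close> at \<open>s\<close>, a backward path
  started between them slightly before \<open>s\<close> would be trapped between the limits down to
  time \<open>t\<close>. Both limits meet at \<open>(x, t)\<close>, so it would pass through this
  point, which \<open>nohit\<close> forbids.\<close>

lemma limit_order_after:
  assumes r: "skeleton_regular z w wb" and z: "dense_enumeration z"
    and nohit: "\<And>q. t < snd (z q) \<Longrightarrow> wb q t \<noteq> x"
    and F: "continuous_on UNIV F" "F t = tanh x" and G: "continuous_on UNIV G" "G t = tanh x" "\<And>u. \<bar>F u\<bar> \<le> 1" "\<And>u. \<bar>G u\<bar> \<le> 1"
    and jf: "(\<lambda>k. snd (z (jf k))) \<longlonglongrightarrow> t" "\<And>u. t < u \<Longrightarrow> (\<lambda>k. tanh (w (jf k) u)) \<longlonglongrightarrow> F u"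
    and jg: "(\<lambda>k. snd (z (jg k))) \<longlonglongrightarrow> t" "\<And>u. t < u \<Longrightarrow> (\<lambda>k. tanh (w (jg k) u)) \<longlonglongrightarrow> G u"
    and s: "t < s"
  shows "G s \<le> F s"
proof (rule ccontr)
  assume "\<not> G s \<le> F s"
  then have lt: "F s < G s" by simp
  define c where "c = (F s + G s) / 2"
  have c: "F s < c" "c < G s" using lt by (auto simp: c_def)
  have "\<bar>c\<bar> < 1" using c G(3,4)[of s] by (auto simp: abs_less_iff abs_le_iff)
  then obtain y' where "tanh_ereal y' = c" using tanh_ereal_surj[of c] by auto
  then obtain y where y: "tanh y = c" using \<open>\<bar>c\<bar> < 1\<close> by (cases y') (auto simp: tanh_ereal_def)
  \<comment> \<open>The midpoint \<open>c\<close> is at distance \<open>2 * e\<close> from both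
    values: one \<open>e\<close> is spent on the height of the starting point, the other on moving
    \<open>F\<close> and \<open>G\<close> to its time.\<close>
  define e where "e = (G s - F s) / 4"
  have e: "0 < e" using lt by (simp add: e_def)
  obtain d1 where d1: "0 < d1" "\<And>u. \<bar>u - s\<bar> < d1 \<Longrightarrow> \<bar>F u - F s\<bar> < e"
    using F(1) e unfolding continuous_on_iff dist_real_def by (metis UNIV_I)
  obtain d2 where d2: "0 < d2" "\<And>u. \<bar>u - s\<bar> < d2 \<Longrightarrow> \<bar>G u - G s\<bar> < e"
    using G(1) e unfolding continuous_on_iff dist_real_def by (metis UNIV_I)
  define d where "d = min (s - t) (min d1 d2)"
  have d: "0 < d" using d1 d2 s by (simp add: d_def)
  obtain q where q: "y - e < fst (z q)" "fst (z q) < y + e" "s - d < snd (z q)" "snd (z q) < s"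
    using dense_enumerationD[OF z, of "y - e" "y + e" "s - d" s] e d by auto
  let ?v = "snd (z q)"
  have tv: "t < ?v" using q d by (auto simp: d_def)
  have "\<bar>tanh (fst (z q)) - c\<bar> < e" using tanh_lipschitz[of "fst (z q)" y] q y by linarith
  moreover have "\<bar>F ?v - F s\<bar> < e" "\<bar>G ?v - G s\<bar> < e" using q d by (auto intro!: d1(2) d2(2) simp: d_def)
  ultimately have FG: "F ?v < tanh (fst (z q))" "tanh (fst (z q)) < G ?v"
    unfolding c_def e_def abs_less_iff by - (elim conjE, simp add: field_simps)+
  have mid: "F u \<le> tanh (wb q u) \<and> tanh (wb q u) \<le> G u" if u: "t < u" "u \<le> ?v" for u
  proof
    have "\<forall>\<^sub>F k in sequentially. tanh (w (jf k) ?v) < tanh (fst (z q))"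
      using jf(2)[OF tv] FG(1) by (rule order_tendstoD)
    moreover have "\<forall>\<^sub>F k in sequentially. snd (z (jf k)) < u" using jf(1) u(1) by (rule order_tendstoD)
    ultimately have "\<forall>\<^sub>F k in sequentially. tanh (w (jf k) u) \<le> tanh (wb q u)"
    proof eventually_elim
      case (elim k)
      then show ?case using nocross_below[OF r, of "jf k" u ?v q] u skeleton_regularD(4)[OF r, of q]
        by (simp add: tanh_real_le_iff tanh_real_less_iff)
    qed
    then show "F u \<le> tanh (wb q u)" by (intro tendsto_upperbound[OF jf(2)[OF u(1)]]) auto
    have "\<forall>\<^sub>F k in sequentially. tanh (fst (z q)) < tanh (w (jg k) ?v)"
      using jg(2)[OF tv] FG(2) by (rule order_tendstoD)
    moreover have "\<forall>\<^sub>F k in sequentially. snd (z (jg k)) < u" using jg(1) u(1) by (rule order_tendstoD)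
    ultimately have "\<forall>\<^sub>F k in sequentially. tanh (wb q u) \<le> tanh (w (jg k) u)"
    proof eventually_elim
      case (elim k)
      then show ?case using nocross_above[OF r, of "jg k" u ?v q] u skeleton_regularD(4)[OF r, of q]
        by (simp add: tanh_real_le_iff tanh_real_less_iff)
    qed
    then show "tanh (wb q u) \<le> G u" by (intro tendsto_lowerbound[OF jg(2)[OF u(1)]]) auto
  qed
  define U where "U n = t + (?v - t) / real (Suc n)" for n
  have U: "t < U n" "U n \<le> ?v" for n
  proof -
    show "t < U n" using tv by (simp add: U_def)
    have "(?v - t) / real (Suc n) \<le> (?v - t) / 1" using tv by (intro divide_left_mono) auto
    then show "U n \<le> ?v" by (simp add: U_def)
  qed
  have "(\<lambda>n. t + (?v - t) * (1 / real (Suc n))) \<longlonglongrightarrow> t + (?v - t) * 0"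
    by (intro tendsto_intros LIMSEQ_Suc[OF lim_1_over_n])
  then have Ut: "U \<longlonglongrightarrow> t" by (simp add: U_def[abs_def])
  have wbc: "(\<lambda>n. tanh (wb q (U n))) \<longlonglongrightarrow> tanh (wb q t)"
    using U tv by (intro tendsto_tanh continuous_on_tendsto_compose[OF skeleton_regularD(3)[OF r] Ut]) auto
  have "(\<lambda>n. F (U n)) \<longlonglongrightarrow> F t" "(\<lambda>n. G (U n)) \<longlonglongrightarrow> G t"
    by (auto intro!: continuous_on_tendsto_compose[OF F(1) Ut] continuous_on_tendsto_compose[OF G(1) Ut])
  then have "F t \<le> tanh (wb q t)" "tanh (wb q t) \<le> G t"
    using mid[OF U] by (auto intro!: LIMSEQ_le[OF _ wbc] LIMSEQ_le[OF wbc])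
  then have "tanh (wb q t) = tanh x" using F(2) G(2) by simp
  then show False using nohit[OF tv] by simp
qed

lemma skeleton_regular_reverse:
  assumes r: "skeleton_regular z w wb"
  shows "skeleton_regular (\<lambda>j. - z j) (\<lambda>j t. - wb j (- t)) (\<lambda>j t. - w j (- t))"
  unfolding skeleton_regular_def
proof (intro conjI allI)
  note D = skeleton_regularD[OF r]
  fix j
  show "- wb j (- snd (- z j)) = fst (- z j)" "- w j (- snd (- z j)) = fst (- z j)" by (simp_all add: D)
  show "continuous_on {snd (- z j)..} (\<lambda>t. - wb j (- t))"
    by (intro continuous_on_minus continuous_on_compose2[OF D(3)[of j]]) (auto intro!: continuous_intros)
  show "continuous_on {..snd (- z j)} (\<lambda>t. - w j (- t))"
    by (intro continuous_on_minus continuous_on_compose2[OF D(1)[of j]]) (auto intro!: continuous_intros)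
next
  fix i j
  show "\<not> cross_on ({snd (- z i)..} \<inter> {..snd (- z j)}) (\<lambda>t. - wb i (- t)) (\<lambda>t. - w j (- t))"
  proof
    assume "cross_on ({snd (- z i)..} \<inter> {..snd (- z j)}) (\<lambda>t. - wb i (- t)) (\<lambda>t. - w j (- t))"
    then obtain s t where st: "- snd (z i) \<le> s" "s \<le> - snd (z j)" "- snd (z i) \<le> t" "t \<le> - snd (z j)"
      "w j (- s) - wb i (- s) > 0" "w j (- t) - wb i (- t) < 0" by (auto simp: cross_on_def)
    then have "cross_on ({snd (z j)..} \<inter> {..snd (z i)}) (w j) (wb i)"
      unfolding cross_on_def by (intro bexI[of _ "- s"] bexI[of _ "- t"]) auto
    then show False using skeleton_regularD(5)[OF r] by blast
  qed
next
  fix e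
  show "0 < e \<longrightarrow> (\<forall>T>0. \<exists>d>0. \<forall>j u s. \<bar>u\<bar> \<le> T \<longrightarrow> \<bar>s\<bar> \<le> T \<longrightarrow> u \<le> s \<longrightarrow> s \<le> snd (- z j) \<longrightarrow> s - u \<le> d \<longrightarrow>
       \<bar>tanh (- w j (- u)) - tanh (- w j (- s))\<bar> \<le> e)"
  proof (intro allI impI)
    fix T assume "0 < e" "0 < (T::real)"
    then obtain d where d: "0 < d" "\<And>j u s. \<bar>u\<bar> \<le> T \<Longrightarrow> \<bar>s\<bar> \<le> T \<Longrightarrow> snd (z j) \<le> s \<Longrightarrow> s \<le> u \<Longrightarrow> u - s \<le> d \<Longrightarrow>
       \<bar>tanh (w j u) - tanh (w j s)\<bar> \<le> e"
      using skeleton_regular_modulus(2)[OF r, rule_format, of e T] by blast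
    have "\<bar>tanh (- w j (- u)) - tanh (- w j (- s))\<bar> \<le> e"
      if "\<bar>u\<bar> \<le> T" "\<bar>s\<bar> \<le> T" "u \<le> s" "s \<le> snd (- z j)" "s - u \<le> d" for j u s
      using d(2)[of "- u" "- s" j] that by (simp add: abs_minus_commute)
    then show "\<exists>d>0. \<forall>j u s. \<bar>u\<bar> \<le> T \<longrightarrow> \<bar>s\<bar> \<le> T \<longrightarrow> u \<le> s \<longrightarrow> s \<le> snd (- z j) \<longrightarrow> s - u \<le> d \<longrightarrow>
       \<bar>tanh (- w j (- u)) - tanh (- w j (- s))\<bar> \<le> e" using d(1) by blast
  qed
  show "0 < e \<longrightarrow> (\<forall>T>0. \<exists>d>0. \<forall>j u s. \<bar>u\<bar> \<le> T \<longrightarrow> \<bar>s\<bar> \<le> T \<longrightarrow> snd (- z j) \<le> s \<longrightarrow> s \<le> u \<longrightarrow> u - s \<le> d \<longrightarrow>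
       \<bar>tanh (- wb j (- u)) - tanh (- wb j (- s))\<bar> \<le> e)"
  proof (intro allI impI)
    fix T assume "0 < e" "0 < (T::real)"
    then obtain d where d: "0 < d" "\<And>j u s. \<bar>u\<bar> \<le> T \<Longrightarrow> \<bar>s\<bar> \<le> T \<Longrightarrow> u \<le> s \<Longrightarrow> s \<le> snd (z j) \<Longrightarrow> s - u \<le> d \<Longrightarrow>
       \<bar>tanh (wb j u) - tanh (wb j s)\<bar> \<le> e"
      using skeleton_regular_modulus(1)[OF r, rule_format, of e T] by blast
    have "\<bar>tanh (- wb j (- u)) - tanh (- wb j (- s))\<bar> \<le> e"
      if "\<bar>u\<bar> \<le> T" "\<bar>s\<bar> \<le> T" "snd (- z j) \<le> s" "s \<le> u" "u - s \<le> d" for j u s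
      using d(2)[of "- u" "- s" j] that by (simp add: abs_minus_commute)
    then show "\<exists>d>0. \<forall>j u s. \<bar>u\<bar> \<le> T \<longrightarrow> \<bar>s\<bar> \<le> T \<longrightarrow> snd (- z j) \<le> s \<longrightarrow> s \<le> u \<longrightarrow> u - s \<le> d \<longrightarrow>
       \<bar>tanh (- wb j (- u)) - tanh (- wb j (- s))\<bar> \<le> e" using d(1) by blast
  qed
qed

lemma val_inj: "(\<And>t. val f t = val g t) \<Longrightarrow> f = g"
  using dist_bipath_le[of 0 f g] by simp

lemma val_converges:
  assumes f: "f \<longlonglongrightarrow> F" and u: "u \<longlonglongrightarrow> v"
  shows "(\<lambda>k. val (f k) (u k)) \<longlonglongrightarrow> val F v"
proof -
  have "(\<lambda>k. dist (f k) F * (1 + \<bar>u k\<bar>)) \<longlonglongrightarrow> 0 * (1 + \<bar>v\<bar>)"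
    by (intro tendsto_mult tendsto_dist_iff[THEN iffD1, OF f] tendsto_intros u)
  then have "(\<lambda>k. dist (f k) F * (1 + \<bar>u k\<bar>)) \<longlonglongrightarrow> 0" by simp
  then have 1: "(\<lambda>k. val (f k) (u k) - val F (u k)) \<longlonglongrightarrow> 0"
    by (rule Lim_null_comparison[rotated]) (auto intro!: always_eventually val_dist)
  have 2: "(\<lambda>k. val F (u k)) \<longlonglongrightarrow> val F v"
    by (rule continuous_on_tendsto_compose[OF continuous_val u]) auto
  show ?thesis using tendsto_add[OF 1 2] by simp
qed

lemma full_path_limit:
  assumes r: "skeleton_regular z w wb" and j: "(\<lambda>k. z (j k)) \<longlonglongrightarrow> (x, t)" and F: "(\<lambda>k. full_path z w wb (j k)) \<longlonglongrightarrow> F"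
  shows "val F t = tanh x"
    and "t < u \<Longrightarrow> (\<lambda>k. tanh (w (j k) u)) \<longlonglongrightarrow> val F u"
    and "u < t \<Longrightarrow> (\<lambda>k. tanh (wb (j k) u)) \<longlonglongrightarrow> val F u"
proof -
  have tk: "(\<lambda>k. snd (z (j k))) \<longlonglongrightarrow> t" and xk: "(\<lambda>k. fst (z (j k))) \<longlonglongrightarrow> x"
    using tendsto_snd[OF j] tendsto_fst[OF j] by simp_all
  have "(\<lambda>k. tanh (fst (z (j k)))) \<longlonglongrightarrow> val F t"
    using val_converges[OF F tk] by (simp add: val_full_path[OF r] skeleton_regularD(4)[OF r])
  moreover have "(\<lambda>k. tanh (fst (z (j k)))) \<longlonglongrightarrow> tanh x" by (intro tendsto_tanh xk) simp
  ultimately show "val F t = tanh x" by (rule LIMSEQ_unique)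
  note v = val_converges[OF F tendsto_const[of u]]
  show "(\<lambda>k. tanh (w (j k) u)) \<longlonglongrightarrow> val F u" if "t < u"
  proof (rule Lim_transform_eventually[OF v])
    show "\<forall>\<^sub>F k in sequentially. val (full_path z w wb (j k)) u = tanh (w (j k) u)"
      using order_tendstoD(2)[OF tk that] by eventually_elim (simp add: val_full_path[OF r])
  qed
  show "(\<lambda>k. tanh (wb (j k) u)) \<longlonglongrightarrow> val F u" if "u < t"
  proof (rule Lim_transform_eventually[OF v])
    show "\<forall>\<^sub>F k in sequentially. val (full_path z w wb (j k)) u = tanh (wb (j k) u)"
      using order_tendstoD(1)[OF tk that] by eventually_elim (simp add: val_full_path[OF r])
  qed
qed

text \<open>After \<open>t\<close> the forward halves are compared in both orders, with the backward
  paths as separators. Before \<open>t\<close> the same argument is applied to the rotated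
  skeleton.\<close>

lemma limit_unique:
  assumes r: "skeleton_regular z w wb" and z: "dense_enumeration z"
    and nohit: "\<And>q. t < snd (z q) \<Longrightarrow> wb q t \<noteq> x" "\<And>q. snd (z q) < t \<Longrightarrow> w q t \<noteq> x"
    and f: "(\<lambda>k. z (jf k)) \<longlonglongrightarrow> (x, t)" "(\<lambda>k. full_path z w wb (jf k)) \<longlonglongrightarrow> F"
    and g: "(\<lambda>k. z (jg k)) \<longlonglongrightarrow> (x, t)" "(\<lambda>k. full_path z w wb (jg k)) \<longlonglongrightarrow> G"
  shows "F = G"
proof (rule val_inj)
  fix s
  have tf: "(\<lambda>k. snd (z (jf k))) \<longlonglongrightarrow> t" and tg: "(\<lambda>k. snd (z (jg k))) \<longlonglongrightarrow> t"
    using tendsto_snd[OF f(1)] tendsto_snd[OF g(1)] by simp_all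
  note F = full_path_limit[OF r f] and G = full_path_limit[OF r g]
  consider "s = t" | "t < s" | "s < t" by linarith
  then show "val F s = val G s"
  proof cases
    case 1 then show ?thesis using F(1) G(1) by simp
  next
    case 2
    show ?thesis
    proof (rule antisym)
      show "val F s \<le> val G s"
        by (rule limit_order_after[OF r z nohit(1) continuous_val G(1) continuous_val F(1) abs_val_le abs_val_le tg G(2) tf F(2) 2])
      show "val G s \<le> val F s"
        by (rule limit_order_after[OF r z nohit(1) continuous_val F(1) continuous_val G(1) abs_val_le abs_val_le tf F(2) tg G(2) 2])
    qed
  next
    case 3
    note r' = skeleton_regular_reverse[OF r] and z' = dense_enumeration_reverse[OF z]
    have c: "continuous_on UNIV (\<lambda>u. - val H (- u))" for H
      by (intro continuous_on_minus continuous_on_compose2[OF continuous_val]) (auto intro!: continuous_intros)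
    have n: "- w q (- (- t)) \<noteq> - x" if "- t < snd (- z q)" for q using nohit(2)[of q] that by simp
    have b: "\<bar>- val H (- u)\<bar> \<le> 1" for H u using abs_val_le[of H "- u"] by simp
    have tf': "(\<lambda>k. snd (- z (jf k))) \<longlonglongrightarrow> - t" and tg': "(\<lambda>k. snd (- z (jg k))) \<longlonglongrightarrow> - t"
      using tendsto_minus[OF tf] tendsto_minus[OF tg] by simp_all
    have F0: "- val F (- (- t)) = tanh (- x)" and G0: "- val G (- (- t)) = tanh (- x)" using F(1) G(1) by simp_all
    have Fu: "(\<lambda>k. tanh (- wb (jf k) (- u))) \<longlonglongrightarrow> - val F (- u)" if "- t < u" for u
      using tendsto_minus[OF F(3)[of "- u"]] that by simp
    have Gu: "(\<lambda>k. tanh (- wb (jg k) (- u))) \<longlonglongrightarrow> - val G (- u)" if "- t < u" for u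
      using tendsto_minus[OF G(3)[of "- u"]] that by simp
    have s': "- t < - s" using 3 by simp
    have "- val F (- (- s)) \<le> - val G (- (- s))"
      by (rule limit_order_after[OF r' z' n c G0 c F0 b b tg' Gu tf' Fu s'])
    moreover have "- val G (- (- s)) \<le> - val F (- (- s))"
      by (rule limit_order_after[OF r' z' n c F0 c G0 b b tf' Fu tg' Gu s'])
    ultimately show ?thesis by simp
  qed
qed

text \<open>Compactness provides limits along subsequences, and \<open>limit_unique\<close>
  identifies them. This gives an almost sure limit on the given space, with no change of probability
  space.\<close>

lemma full_path_converges:
  assumes r: "skeleton_regular z w wb" and z: "dense_enumeration z"
    and nohit: "\<And>q. t < snd (z q) \<Longrightarrow> wb q t \<noteq> x" "\<And>q. snd (z q) < t \<Longrightarrow> w q t \<noteq> x"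
    and j: "(\<lambda>k. z (j k)) \<longlonglongrightarrow> (x, t)"
  shows "\<exists>V\<in>closure (range (full_path z w wb)). (\<lambda>k. full_path z w wb (j k)) \<longlonglongrightarrow> V"
proof -
  let ?f = "\<lambda>k. full_path z w wb (j k)" and ?C = "closure (range (full_path z w wb))"
  have C: "seq_compact ?C" using compact_skeleton[OF r] by (simp add: compact_eq_seq_compact_metric)
  have fC: "?f k \<in> ?C" for k by (rule closure_subset[THEN subsetD]) auto
  have sub: "\<exists>V\<in>?C. \<exists>r. strict_mono r \<and> (\<lambda>k. ?f (s (r k))) \<longlonglongrightarrow> V" for s :: "nat \<Rightarrow> nat"
    using C fC unfolding seq_compact_def by (force simp: o_def dest: spec[of _ "\<lambda>k. ?f (s k)"])
  obtain V r0 where V: "V \<in> ?C" "strict_mono r0" "(\<lambda>k. ?f (r0 k)) \<longlonglongrightarrow> V" using sub[of "\<lambda>k. k"] by auto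
  have jV: "(\<lambda>k. z (j (r0 k))) \<longlonglongrightarrow> (x, t)" using LIMSEQ_subseq_LIMSEQ[OF j V(2)] by (simp add: o_def)
  have "?f \<longlonglongrightarrow> V"
  proof (rule LIMSEQ_subseqI)
    fix s :: "nat \<Rightarrow> nat" assume s: "strict_mono s"
    obtain G r1 where G: "strict_mono r1" "(\<lambda>k. ?f (s (r1 k))) \<longlonglongrightarrow> G" using sub[of s] by auto
    have "strict_mono (\<lambda>k. s (r1 k))" using s G(1) by (auto simp: strict_mono_def)
    then have "(\<lambda>k. z (j (s (r1 k)))) \<longlonglongrightarrow> (x, t)" using LIMSEQ_subseq_LIMSEQ[OF j, of "\<lambda>k. s (r1 k)"] by (simp add: o_def)
    then have "G = V" using limit_unique[OF r z nohit _ G(2) jV V(3)] by blast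
    then show "\<exists>s'. strict_mono s' \<and> (\<lambda>m. ?f (s (s' m))) \<longlonglongrightarrow> V" using G by blast
  qed
  then show ?thesis using V(1) by blast
qed

text \<open>The approximating paths are compared at the starting time of the second one, which moves
  with \<open>k\<close>. A strict inequality in the limit is strict eventually, non-crossing carries
  it to time \<open>s\<close>, and there the weak inequality survives the limit.\<close>

lemma limit_paths_ordered:
  assumes r: "skeleton_regular z w wb"
    and i: "(\<lambda>k. full_path z w wb (ji k)) \<longlonglongrightarrow> Vi" "\<And>k. snd (z (ji k)) \<le> s"
    and j: "(\<lambda>k. full_path z w wb (jj k)) \<longlonglongrightarrow> Vj" "(\<lambda>k. z (jj k)) \<longlonglongrightarrow> (x, t)" and s: "s < t"
  shows "val Vi t < tanh x \<Longrightarrow> val Vi s \<le> val Vj s" and "tanh x < val Vi t \<Longrightarrow> val Vj s \<le> val Vi s"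
proof -
  have tk: "(\<lambda>k. snd (z (jj k))) \<longlonglongrightarrow> t" and xk: "(\<lambda>k. tanh (fst (z (jj k)))) \<longlonglongrightarrow> tanh x"
    using tendsto_snd[OF j(2)] tendsto_tanh[OF tendsto_fst[OF j(2)]] by simp_all
  have d: "(\<lambda>k. tanh (fst (z (jj k))) - val (full_path z w wb (ji k)) (snd (z (jj k)))) \<longlonglongrightarrow> tanh x - val Vi t"
    by (intro tendsto_diff xk val_converges[OF i(1) tk])
  note si = val_converges[OF i(1) tendsto_const[of s]] and sj = val_converges[OF j(1) tendsto_const[of s]]
  have vi: "val (full_path z w wb (ji k)) u = tanh (w (ji k) u)" if "s \<le> u" for k u
  proof (cases "u = snd (z (ji k))")
    case True then show ?thesis using skeleton_regularD(2,4)[OF r, of "ji k"] by (simp add: val_full_path[OF r])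
  next
    case False then show ?thesis using i(2)[of k] that by (simp add: val_full_path[OF r])
  qed
  have vj: "val (full_path z w wb (jj k)) s = tanh (wb (jj k) s)" if "s < snd (z (jj k))" for k
    using that by (simp add: val_full_path[OF r])
  have st: "\<forall>\<^sub>F k in sequentially. s < snd (z (jj k))" using tk s by (rule order_tendstoD)
  show "val Vi s \<le> val Vj s" if "val Vi t < tanh x"
  proof (rule tendsto_le[OF sequentially_bot sj si])
    have "\<forall>\<^sub>F k in sequentially. 0 < tanh (fst (z (jj k))) - val (full_path z w wb (ji k)) (snd (z (jj k)))"
      using d that by (intro order_tendstoD) auto
    then show "\<forall>\<^sub>F k in sequentially. val (full_path z w wb (ji k)) s \<le> val (full_path z w wb (jj k)) s"
      using st
    proof eventually_elim
      case (elim k)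
      then have "w (ji k) (snd (z (jj k))) < wb (jj k) (snd (z (jj k)))"
        by (simp add: vi skeleton_regularD(4)[OF r] tanh_real_less_iff)
      then have "w (ji k) s \<le> wb (jj k) s"
        using elim(2) i(2)[of k] by (intro nocross_below[OF r, where u="snd (z (jj k))"]) auto
      then show ?case using elim(2) by (simp add: vi vj tanh_real_le_iff)
    qed
  qed
  show "val Vj s \<le> val Vi s" if "tanh x < val Vi t"
  proof (rule tendsto_le[OF sequentially_bot si sj])
    have "\<forall>\<^sub>F k in sequentially. tanh (fst (z (jj k))) - val (full_path z w wb (ji k)) (snd (z (jj k))) < 0"
      using d that by (intro order_tendstoD) auto
    then show "\<forall>\<^sub>F k in sequentially. val (full_path z w wb (jj k)) s \<le> val (full_path z w wb (ji k)) s"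
      using st
    proof eventually_elim
      case (elim k)
      then have "wb (jj k) (snd (z (jj k))) < w (ji k) (snd (z (jj k)))"
        by (simp add: vi skeleton_regularD(4)[OF r] tanh_real_less_iff)
      then have "wb (jj k) s \<le> w (ji k) s"
        using elim(2) i(2)[of k] by (intro nocross_above[OF r, where u="snd (z (jj k))"]) auto
      then show ?case using elim(2) by (simp add: vi vj tanh_real_le_iff)
    qed
  qed
qed

section \<open>Approximation of one starting set by another\<close>

lemma infinite_inj_choice:
  assumes "\<And>l::nat. infinite {j::nat. P l j}"
  shows "\<exists>a. inj a \<and> (\<forall>l. P l (a l))"
proof -
  have "\<exists>f. \<forall>n. P n (f n) \<and> f n < f (Suc n)"
  proof (rule dependent_nat_choice)
    show "\<exists>x. P 0 x" using assms[of 0] by (metis (mono_tags) Collect_empty_eq finite.emptyI)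
    show "\<exists>y. P (Suc n) y \<and> x < y" for x n
      using assms[of "Suc n"] unfolding infinite_nat_iff_unbounded by auto
  qed
  then obtain f where f: "\<And>n. P n (f n)" "\<And>n. f n < f (Suc n)" by blast
  have "strict_mono f" by (rule strict_monoI_Suc) (rule f(2))
  then show ?thesis using f(1) strict_mono_imp_inj_on by blast
qed

lemma dense_enumeration_infinite:
  assumes z: "dense_enumeration z" and "a < b" "c < (d::real)"
  shows "infinite {j. a < fst (z j) \<and> fst (z j) < b \<and> c < snd (z j) \<and> snd (z j) < d}" (is "infinite ?S")
proof
  assume fin: "finite ?S"
  \<comment> \<open>Below the earliest time among finitely many points, density still provides a
    further point of the box.\<close>
  define d' where "d' = Min (insert d ((\<lambda>j. snd (z j)) ` ?S))"
  have "c < d'" unfolding d'_def using fin assms(3) by (subst Min_gr_iff) auto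
  then obtain j where j: "a < fst (z j)" "fst (z j) < b" "c < snd (z j)" "snd (z j) < d'"
    using dense_enumerationD[OF z assms(2)] by blast
  have "d' \<le> d" unfolding d'_def using fin by (intro Min_le) auto
  then have "j \<in> ?S" using j by simp
  then have "d' \<le> snd (z j)" unfolding d'_def using fin by (intro Min_le) auto
  then show False using j by simp
qed

text \<open>Approximation from below in time, so that the approximating forward paths are defined wherever the limit is.\<close>

lemma approximating_labels:
  fixes z :: "nat \<Rightarrow> real \<times> real"
  assumes z': "dense_enumeration z'"
  shows "\<exists>a :: nat \<Rightarrow> nat \<Rightarrow> nat. (\<forall>k. inj (a k)) \<and> (\<forall>l. (\<lambda>k. z' (a k l)) \<longlonglongrightarrow> z l) \<and> (\<forall>k l. snd (z' (a k l)) \<le> snd (z l))"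
proof -
  define P where "P k l j \<longleftrightarrow> fst (z l) - 1 / real (Suc k) < fst (z' j) \<and> fst (z' j) < fst (z l) + 1 / real (Suc k) \<and>
     snd (z l) - 1 / real (Suc k) < snd (z' j) \<and> snd (z' j) < snd (z l)" for k l j
  have "\<exists>b. inj b \<and> (\<forall>l. P k l (b l))" for k
    unfolding P_def by (intro infinite_inj_choice dense_enumeration_infinite[OF z']) (auto intro: less_trans)
  then have "\<forall>k. \<exists>b. inj b \<and> (\<forall>l. P k l (b l))" by blast
  then obtain a where a: "\<forall>k. inj (a k) \<and> (\<forall>l. P k l (a k l))" using choice[of "\<lambda>k b. inj b \<and> (\<forall>l. P k l (b l))"] by blast
  have "(\<lambda>k. z' (a k l)) \<longlonglongrightarrow> z l" for l
  proof -
    have h: "(\<lambda>k. 1 / real (Suc k)) \<longlonglongrightarrow> 0" by (rule LIMSEQ_Suc[OF lim_1_over_n])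
    have p: "P k l (a k l)" for k using a by blast
    have b: "\<bar>fst (z' (a k l)) - fst (z l)\<bar> \<le> 1 / real (Suc k) \<and> \<bar>snd (z' (a k l)) - snd (z l)\<bar> \<le> 1 / real (Suc k)" for k
    proof -
      have "0 < 1 / real (Suc k)" by simp
      then show ?thesis using p[of k] unfolding P_def abs_le_iff by linarith
    qed
    have "(\<lambda>k. fst (z' (a k l)) - fst (z l)) \<longlonglongrightarrow> 0"
      by (rule Lim_null_comparison[OF always_eventually h]) (use b in simp)
    moreover have "(\<lambda>k. snd (z' (a k l)) - snd (z l)) \<longlonglongrightarrow> 0"
      by (rule Lim_null_comparison[OF always_eventually h]) (use b in simp)
    ultimately have "(\<lambda>k. (fst (z' (a k l)), snd (z' (a k l)))) \<longlonglongrightarrow> (fst (z l), snd (z l))"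
      by (intro tendsto_Pair) (simp_all add: LIM_zero_iff)
    then show ?thesis by simp
  qed
  then show ?thesis using a by (intro exI[of _ a]) (auto simp: P_def less_imp_le)
qed

section \<open>The law of the web\<close>

text \<open>Countably many coordinates, namely those read by \<open>full_value\<close> at rational
  times and by \<open>separating\<close>. The starting times are included because sides are compared
  there.\<close>

definition index_set :: "(nat \<Rightarrow> real \<times> real) \<Rightarrow> (nat \<times> real) set" where
  "index_set z = {(i, s). snd (z i) \<le> s \<and> (s \<in> \<rat> \<or> s \<in> range (\<lambda>j. snd (z j)))}"

text \<open>Membership in an open set expressed by countably many coordinates: rational closed balls
  contained in \<open>U\<close> about points of \<open>D\<close>, with distances tested at rational
  times. This makes it an event for the field \<open>\<xi>\<close>.\<close>

definition hits :: "bipath set \<Rightarrow> (nat \<Rightarrow> real \<times> real) \<Rightarrow> bipath set \<Rightarrow> (nat \<times> real \<Rightarrow> real) \<Rightarrow> bool" where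
  "hits D z U \<xi> \<longleftrightarrow> (\<exists>j. \<exists>c\<in>D. \<exists>r\<in>{r\<in>\<rat>. 0 \<le> r \<and> cball c r \<subseteq> U}. \<forall>s\<in>\<rat>. \<bar>full_value z \<xi> j s - val c s\<bar> \<le> r * (1 + \<bar>s\<bar>))"

lemma full_value_cong:
  assumes "\<And>p. p \<in> index_set z \<Longrightarrow> \<xi> p = \<xi>' p" "s \<in> \<rat>"
  shows "full_value z \<xi> j s = full_value z \<xi>' j s"
proof -
  have "backward_of z \<xi> j s = backward_of z \<xi>' j s" if "s < snd (z j)"
  proof -
    have "\<xi> (i, s) = \<xi>' (i, s)" "\<xi> (i, snd (z j)) = \<xi>' (i, snd (z j))" if "snd (z i) \<le> s" for i
      using assms that \<open>s < snd (z j)\<close> by (auto simp: index_set_def)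
    then show ?thesis unfolding backward_of_def by (intro SUP_cong) auto
  qed
  moreover have "\<xi> (j, s) = \<xi>' (j, s)" if "\<not> s < snd (z j)"
    using assms that by (auto simp: index_set_def)
  ultimately show ?thesis by (simp add: full_value_def)
qed

lemma hits_cong: "(\<And>p. p \<in> index_set z \<Longrightarrow> \<xi> p = \<xi>' p) \<Longrightarrow> hits D z U \<xi> \<longleftrightarrow> hits D z U \<xi>'"
  unfolding hits_def using full_value_cong[of z \<xi> \<xi>'] by simp

lemma separating_cong:
  assumes "\<And>p. p \<in> index_set z \<Longrightarrow> \<xi> p = \<xi>' p"
  shows "separating z \<xi> \<longleftrightarrow> separating z \<xi>'"
proof -
  have 1: "\<xi> (i, snd (z j)) = \<xi>' (i, snd (z j))" if "snd (z i) < snd (z j)" for i j using assms that by (auto simp: index_set_def)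
  have 2: "\<xi> (i, s) = \<xi>' (i, s)" if "snd (z i) \<le> s" "s \<in> \<rat>" for i s using assms that by (auto simp: index_set_def)
  show ?thesis unfolding separating_def
    by (intro arg_cong2[of _ _ _ _ "(\<and>)"] all_cong1 ball_cong imp_cong ex_cong1 refl conj_cong) (simp_all add: 1 2)
qed

lemma mem_open_bipath:
  assumes "open U" "closure D = UNIV"
  shows "f \<in> U \<longleftrightarrow> (\<exists>c\<in>D. \<exists>r\<in>{r\<in>\<rat>. 0 \<le> r \<and> cball c r \<subseteq> U}. \<forall>s\<in>\<rat>. \<bar>val f s - val c s\<bar> \<le> r * (1 + \<bar>s\<bar>))"
proof
  assume "f \<in> U"
  then obtain e where e: "0 < e" "ball f e \<subseteq> U" using assms(1) open_contains_ball by blast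
  have "f \<in> closure D" using assms(2) by simp
  then obtain c where c: "c \<in> D" "dist c f < e / 3" using e(1) unfolding closure_approachable by (meson divide_pos_pos zero_less_numeral)
  obtain r where r: "r \<in> \<rat>" "dist c f < r" "r < e / 3" using Rats_dense_in_real[OF c(2)] by blast
  have "cball c r \<subseteq> U"
  proof
    fix g assume "g \<in> cball c r"
    then have "dist f g < e" using r e(1) dist_triangle[of f g c] dist_commute[of c f] unfolding mem_cball by linarith
    then show "g \<in> U" using e(2) by auto
  qed
  moreover have "0 \<le> r" using r(2) by (meson zero_le_dist less_imp_le order_trans)
  moreover have "\<bar>val f s - val c s\<bar> \<le> r * (1 + \<bar>s\<bar>)" for s
  proof -
    have "dist f c * (1 + \<bar>s\<bar>) \<le> r * (1 + \<bar>s\<bar>)" using r(2) by (intro mult_right_mono) (auto simp: dist_commute)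
    then show ?thesis using val_dist[of f s c] by linarith
  qed
  ultimately show "\<exists>c\<in>D. \<exists>r\<in>{r\<in>\<rat>. 0 \<le> r \<and> cball c r \<subseteq> U}. \<forall>s\<in>\<rat>. \<bar>val f s - val c s\<bar> \<le> r * (1 + \<bar>s\<bar>)"
    using c(1) r(1) by blast
next
  assume "\<exists>c\<in>D. \<exists>r\<in>{r\<in>\<rat>. 0 \<le> r \<and> cball c r \<subseteq> U}. \<forall>s\<in>\<rat>. \<bar>val f s - val c s\<bar> \<le> r * (1 + \<bar>s\<bar>)"
  then obtain c r where r: "0 \<le> r" "cball c r \<subseteq> U" "\<And>s. s \<in> \<rat> \<Longrightarrow> \<bar>val f s - val c s\<bar> \<le> r * (1 + \<bar>s\<bar>)" by blast
  have "closed {s. \<bar>val f s - val c s\<bar> \<le> r * (1 + \<bar>s\<bar>)}"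
    by (intro closed_Collect_le continuous_intros continuous_val)
  then have "closure \<rat> \<subseteq> {s. \<bar>val f s - val c s\<bar> \<le> r * (1 + \<bar>s\<bar>)}"
    using r(3) by (intro closure_minimal) auto
  then have "dist c f \<le> r" using r(1) by (subst dist_commute, subst dist_bipath_le) (auto simp: Rats_closure_real)
  then show "f \<in> U" using r(2) by auto
qed

lemma hits_iff:
  assumes "open U" "closure D = UNIV" "\<And>j s. s \<in> \<rat> \<Longrightarrow> full_value z \<xi> j s = val (V j) s"
  shows "hits D z U \<xi> \<longleftrightarrow> (\<exists>j. V j \<in> U)"
  unfolding hits_def mem_open_bipath[OF assms(1,2)] using assms(3) by simp

lemma full_value_measurable:
  assumes "s \<in> \<rat>"
  shows "(\<lambda>\<xi>. full_value z \<xi> j s) \<in> borel_measurable (PiM (index_set z) (\<lambda>_. borel))"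
proof (cases "s < snd (z j)")
  case True
  let ?M = "PiM (index_set z) (\<lambda>_. borel :: real measure)"
  have "(\<lambda>\<xi>. SUP i\<in>UNIV. if snd (z i) \<le> s \<and> \<xi> (i, snd (z j)) < tanh (fst (z j)) then max (-1) (min 1 (\<xi> (i, s))) else -1) \<in> borel_measurable ?M"
  proof (rule borel_measurable_cSUP)
    fix i
    show "(\<lambda>\<xi>. if snd (z i) \<le> s \<and> \<xi> (i, snd (z j)) < tanh (fst (z j)) then max (-1) (min 1 (\<xi> (i, s))) else -1) \<in> borel_measurable ?M"
    proof (cases "snd (z i) \<le> s")
      case le: True
      have [measurable]: "(\<lambda>\<xi>. \<xi> (i, s)) \<in> borel_measurable ?M" "(\<lambda>\<xi>. \<xi> (i, snd (z j))) \<in> borel_measurable ?M"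
        using le True assms by (auto intro!: measurable_component_singleton simp: index_set_def)
      show ?thesis by measurable
    qed simp
  next
    fix \<xi> :: "nat \<times> real \<Rightarrow> real"
    show "bdd_above (range (\<lambda>i. if snd (z i) \<le> s \<and> \<xi> (i, snd (z j)) < tanh (fst (z j)) then max (-1) (min 1 (\<xi> (i, s))) else -1))"
      by (rule bdd_aboveI[of _ 1]) auto
  qed auto
  then show ?thesis using True by (simp add: full_value_def backward_of_def)
next
  case False
  then have "(\<lambda>\<xi>. \<xi> (j, s)) \<in> borel_measurable (PiM (index_set z) (\<lambda>_. borel :: real measure))"
    using assms by (intro measurable_component_singleton) (auto simp: index_set_def)
  then show ?thesis using False by (simp add: full_value_def)
qed

lemma hits_measurable:
  assumes "countable D"
  shows "{\<xi>\<in>space (PiM (index_set z) (\<lambda>_. borel)). hits D z U \<xi>} \<in> sets (PiM (index_set z) (\<lambda>_. borel))"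
  unfolding hits_def
proof (intro sets.sets_Collect_countable_Ex sets.sets_Collect_countable_Ex' sets.sets_Collect_countable_All' assms countable_rat)
  show "countable {r \<in> \<rat>. 0 \<le> r \<and> cball c r \<subseteq> U}" for c by (rule countable_subset[OF _ countable_rat]) auto
  fix j c r and s :: real assume "s \<in> \<rat>"
  note full_value_measurable[OF this, measurable]
  show "{\<xi>\<in>space (PiM (index_set z) (\<lambda>_. borel)). \<bar>full_value z \<xi> j s - val c s\<bar> \<le> r * (1 + \<bar>s\<bar>)} \<in> sets (PiM (index_set z) (\<lambda>_. borel))"
    by measurable
qed

lemma separating_measurable:
  "{\<xi>\<in>space (PiM (index_set z) (\<lambda>_. borel)). separating z \<xi>} \<in> sets (PiM (index_set z) (\<lambda>_. borel))"
proof -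
  let ?M = "PiM (index_set z) (\<lambda>_. borel :: real measure)"
  have c: "(\<lambda>\<xi>. \<xi> p) \<in> borel_measurable ?M" if "p \<in> index_set z" for p
    using that by (rule measurable_component_singleton)
  have 1: "{\<xi>\<in>space ?M. snd (z i) < snd (z j) \<longrightarrow> \<xi> (i, snd (z j)) \<noteq> tanh (fst (z j))} \<in> sets ?M" for i j
  proof (cases "snd (z i) < snd (z j)")
    case True
    have [measurable]: "(\<lambda>\<xi>. \<xi> (i, snd (z j))) \<in> borel_measurable ?M" using True by (intro c) (auto simp: index_set_def)
    show ?thesis by measurable
  qed simp
  have 2: "{\<xi>\<in>space ?M. snd (z i) \<le> s \<and> a < \<xi> (i, s) \<and> \<xi> (i, s) < b} \<in> sets ?M" if "s \<in> \<rat>" for i s a b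
  proof (cases "snd (z i) \<le> s")
    case True
    have [measurable]: "(\<lambda>\<xi>. \<xi> (i, s)) \<in> borel_measurable ?M" using True that by (intro c) (auto simp: index_set_def)
    show ?thesis by measurable
  qed simp
  have 3: "{\<xi>\<in>space ?M. \<forall>i j. snd (z i) < snd (z j) \<longrightarrow> \<xi> (i, snd (z j)) \<noteq> tanh (fst (z j))} \<in> sets ?M"
    by (intro sets.sets_Collect_countable_All 1)
  have 4: "{\<xi>\<in>space ?M. \<forall>s\<in>\<rat>. \<forall>a\<in>\<rat>. \<forall>b\<in>\<rat>. -1 \<le> a \<longrightarrow> a < b \<longrightarrow> b \<le> 1 \<longrightarrow> (\<exists>i. snd (z i) \<le> s \<and> a < \<xi> (i, s) \<and> \<xi> (i, s) < b)} \<in> sets ?M"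
    by (intro sets.sets_Collect_countable_All' sets.sets_Collect_imp sets.sets_Collect_const sets.sets_Collect_countable_Ex 2 countable_rat)
  have "{\<xi>\<in>space ?M. separating z \<xi>} = {\<xi>\<in>space ?M. \<forall>i j. snd (z i) < snd (z j) \<longrightarrow> \<xi> (i, snd (z j)) \<noteq> tanh (fst (z j))} \<inter>
     {\<xi>\<in>space ?M. \<forall>s\<in>\<rat>. \<forall>a\<in>\<rat>. \<forall>b\<in>\<rat>. -1 \<le> a \<longrightarrow> a < b \<longrightarrow> b \<le> 1 \<longrightarrow> (\<exists>i. snd (z i) \<le> s \<and> a < \<xi> (i, s) \<and> \<xi> (i, s) < b)}"
    unfolding separating_def by blast
  then show ?thesis by (simp only: sets.Int[OF 3 4])
qed

text \<open>For the limiting forward halves \<open>separating\<close> is a hypothesis on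
  \<open>\<xi>\<close> rather than a pathwise conclusion; it will be supplied by equality in law.
  Granted this, the limits of the backward halves are reconstructed by the same formula as in a
  skeleton.\<close>

lemma limit_system:
  assumes r: "skeleton_regular z' w wb" and z': "dense_enumeration z'"
    and nohit: "\<forall>q l. (snd (z l) < snd (z' q) \<longrightarrow> wb q (snd (z l)) \<noteq> fst (z l)) \<and> (snd (z' q) < snd (z l) \<longrightarrow> w q (snd (z l)) \<noteq> fst (z l))"
    and a: "\<And>l. (\<lambda>k. z' (a k l)) \<longlonglongrightarrow> z l" "\<And>k l. snd (z' (a k l)) \<le> snd (z l)"
  obtains V where "\<And>l. V l \<in> closure (range (full_path z' w wb))"
    and "\<And>l s. snd (z l) \<le> s \<Longrightarrow> (\<lambda>k. tanh (w (a k l) s)) \<longlonglongrightarrow> val (V l) s"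
    and "\<And>\<xi> j s. separating z \<xi> \<Longrightarrow> \<forall>i u. snd (z i) \<le> u \<longrightarrow> \<xi> (i, u) = val (V i) u \<Longrightarrow> s \<in> \<rat> \<Longrightarrow> full_value z \<xi> j s = val (V j) s"
proof -
  have "\<exists>V\<in>closure (range (full_path z' w wb)). (\<lambda>k. full_path z' w wb (a k l)) \<longlonglongrightarrow> V" for l
  proof -
    have "(\<lambda>k. z' (a k l)) \<longlonglongrightarrow> (fst (z l), snd (z l))" using a(1)[of l] by simp
    moreover have "\<And>q. snd (z l) < snd (z' q) \<Longrightarrow> wb q (snd (z l)) \<noteq> fst (z l)" "\<And>q. snd (z' q) < snd (z l) \<Longrightarrow> w q (snd (z l)) \<noteq> fst (z l)"
      using nohit by blast+
    ultimately show ?thesis by (intro full_path_converges[OF r z'])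
  qed
  then have "\<exists>V. \<forall>l. V l \<in> closure (range (full_path z' w wb)) \<and> (\<lambda>k. full_path z' w wb (a k l)) \<longlonglongrightarrow> V l"
    by (intro choice allI) blast
  then obtain V where V: "\<And>l. V l \<in> closure (range (full_path z' w wb))" "\<And>l. (\<lambda>k. full_path z' w wb (a k l)) \<longlonglongrightarrow> V l" by blast
  have lim: "(\<lambda>k. tanh (w (a k l) s)) \<longlonglongrightarrow> val (V l) s" if s: "snd (z l) \<le> s" for l s
  proof -
    have "val (full_path z' w wb (a k l)) s = tanh (w (a k l) s)" for k
    proof (cases "s = snd (z' (a k l))")
      case True then show ?thesis using skeleton_regularD(2,4)[OF r, of "a k l"] by (simp add: val_full_path[OF r])
    next
      case False then show ?thesis using a(2)[of k l] s by (simp add: val_full_path[OF r])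
    qed
    then show ?thesis using val_converges[OF V(2)[of l] tendsto_const[of s]] by simp
  qed
  have full: "full_value z \<xi> j s = val (V j) s"
    if sep: "separating z \<xi>" and \<xi>: "\<forall>i u. snd (z i) \<le> u \<longrightarrow> \<xi> (i, u) = val (V i) u" and s: "s \<in> \<rat>" for \<xi> j s
  proof (cases "s < snd (z j)")
    case True
    have zj: "(\<lambda>k. z' (a k j)) \<longlonglongrightarrow> (fst (z j), snd (z j))" using a(1) by simp
    have "backward_of z \<xi> j s = val (V j) s"
    proof (rule backward_of_eq[OF sep s True])
      fix i assume i: "snd (z i) \<le> s"
      have le: "snd (z' (a k i)) \<le> s" for k using a(2)[of k i] i by simp
      note ord = limit_paths_ordered[OF r V(2)[of i] le V(2)[of j] zj True]
      show "\<xi> (i, s) \<le> val (V j) s" if "\<xi> (i, snd (z j)) < tanh (fst (z j))"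
        using ord(1) that i True by (simp add: \<xi>)
      show "val (V j) s \<le> \<xi> (i, s)" if "tanh (fst (z j)) < \<xi> (i, snd (z j))"
        using ord(2) that i True by (simp add: \<xi>)
    qed (use abs_val_le[of "V j" s] in auto)
    then show ?thesis using True by (simp add: full_value_def)
  next
    case False
    then show ?thesis using \<xi> by (simp add: full_value_def)
  qed
  show ?thesis by (rule that[OF V(1) lim full])
qed

definition forward_field :: "(nat \<Rightarrow> real \<times> real) \<Rightarrow> (nat \<Rightarrow> 'a \<Rightarrow> real \<Rightarrow> real) \<Rightarrow> 'a \<Rightarrow> nat \<times> real \<Rightarrow> real" where
  "forward_field z W \<omega> = (\<lambda>p\<in>index_set z. tanh (W (fst p) \<omega> (snd p)))"

lemma forward_field_measurable:
  assumes "coalescing_brownian_motions M z W"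
  shows "forward_field z W \<in> measurable M (PiM (index_set z) (\<lambda>_. borel))"
proof -
  have "(\<lambda>\<omega>. tanh (W (fst p) \<omega> (snd p))) \<in> borel_measurable M" if "p \<in> index_set z" for p
    using assms that
    by (intro measurable_compose[OF _ borel_measurable_continuous_onI[of tanh]] continuous_on_tanh)
       (auto simp: coalescing_brownian_motions_def continuous_paths_def index_set_def)
  then show ?thesis unfolding forward_field_def by (intro measurable_restrict)
qed

lemma skeleton_no_atom_AE:
  fixes y :: "nat \<Rightarrow> real \<times> real"
  assumes W: "double_web_skeleton M z W Wb" and z: "dense_enumeration z"
  shows "AE \<omega> in M. \<forall>q l. (snd (y l) < snd (z q) \<longrightarrow> Wb q \<omega> (snd (y l)) \<noteq> fst (y l)) \<and>
    (snd (z q) < snd (y l) \<longrightarrow> W q \<omega> (snd (y l)) \<noteq> fst (y l))"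
proof -
  note d = double_web_skeletonD[OF W]
  have inj: "inj z" "inj (\<lambda>j. - z j)" using z by (simp_all add: dense_enumeration_def inj_def)
  have "AE \<omega> in M. snd (y l) < snd (z q) \<longrightarrow> Wb q \<omega> (snd (y l)) \<noteq> fst (y l)" for q l
  proof (cases "snd (y l) < snd (z q)")
    case True
    then show ?thesis using cbm_no_atom[OF d(1,3) inj(2), of q "- snd (y l)" "- fst (y l)"] by simp
  qed simp
  moreover have "AE \<omega> in M. snd (z q) < snd (y l) \<longrightarrow> W q \<omega> (snd (y l)) \<noteq> fst (y l)" for q l
  proof (cases "snd (z q) < snd (y l)")
    case True
    then show ?thesis using cbm_no_atom[OF d(1,2) inj(1)] by simp
  qed simp
  ultimately show ?thesis unfolding AE_all_countable by (intro allI AE_conjI)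
qed

text \<open>An open set meets the closure exactly when it meets the skeleton itself, so the hitting
  events of the web are decided by the countable forward field.\<close>

lemma forward_field_AE:
  assumes W: "double_web_skeleton M z W Wb" and z: "dense_enumeration z" and D: "closure D = UNIV"
  shows "AE \<omega> in M. separating z (forward_field z W \<omega>) \<and>
    (\<forall>U. open U \<longrightarrow> (hits D z U (forward_field z W \<omega>) \<longleftrightarrow> closure (full_skeleton z W Wb \<omega>) \<inter> U \<noteq> {}))"
  using skeleton_regular_AE[OF W z] skeleton_no_atom_AE[OF W z, of z]
proof eventually_elim
  case (elim \<omega>)
  let ?f = "\<lambda>(i, s). tanh (W i \<omega> s)" and ?V = "full_path z (\<lambda>j. W j \<omega>) (\<lambda>j. Wb j \<omega>)"
  have nohit: "W i \<omega> (snd (z j)) \<noteq> fst (z j)" if "snd (z i) < snd (z j)" for i j using elim(2) that by blast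
  note V = full_value_skeleton[OF elim(1) z nohit]
  have f: "forward_field z W \<omega> p = ?f p" if "p \<in> index_set z" for p
    using that by (simp add: forward_field_def case_prod_beta)
  have "hits D z U (forward_field z W \<omega>) \<longleftrightarrow> closure (full_skeleton z W Wb \<omega>) \<inter> U \<noteq> {}" if U: "open U" for U
  proof -
    have "hits D z U (forward_field z W \<omega>) \<longleftrightarrow> hits D z U ?f" by (rule hits_cong[OF f])
    also have "\<dots> \<longleftrightarrow> (\<exists>j. ?V j \<in> U)" by (rule hits_iff[OF U D V(2)])
    also have "\<dots> \<longleftrightarrow> U \<inter> range ?V \<noteq> {}" by blast
    also have "\<dots> \<longleftrightarrow> U \<inter> closure (range ?V) \<noteq> {}" using open_Int_closure_eq_empty[OF U] by simp
    finally show ?thesis by (simp only: full_skeleton_def Int_commute)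
  qed
  moreover have "separating z (forward_field z W \<omega>)" using V(1) separating_cong[OF f] by simp
  ultimately show ?case by blast
qed

text \<open>Enumerating the starting points \<open>z\<close> by approximating points of \<open>z'\<close> transports the forward paths to the second
  skeleton. There the law determines which paths are separated, so each open set hit by the first web is hit by the second.\<close>

lemma limit_field:
  fixes M :: "'a measure" and M' :: "'b measure"
  assumes W: "double_web_skeleton M z W Wb" and z: "dense_enumeration z"
    and W': "double_web_skeleton M' z' W' Wb'" and z': "dense_enumeration z'" and D: "closure D = UNIV"
  obtains Y :: "'b \<Rightarrow> nat \<times> real \<Rightarrow> real" where
    "Y \<in> measurable M' (PiM (index_set z) (\<lambda>_. borel))"
    "distr M (PiM (index_set z) (\<lambda>_. borel)) (forward_field z W) = distr M' (PiM (index_set z) (\<lambda>_. borel)) Y"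
    "AE \<omega> in M'. \<forall>U. open U \<longrightarrow> hits D z U (Y \<omega>) \<longrightarrow> closure (full_skeleton z' W' Wb' \<omega>) \<inter> U \<noteq> {}"
proof -
  note d = double_web_skeletonD[OF W] and d' = double_web_skeletonD[OF W']
  have inj: "inj z" "inj z'" using z z' by (simp_all add: dense_enumeration_def)
  obtain a :: "nat \<Rightarrow> nat \<Rightarrow> nat" where a: "\<And>k. inj (a k)" "\<And>l. (\<lambda>k. z' (a k l)) \<longlonglongrightarrow> z l" "\<And>k l. snd (z' (a k l)) \<le> snd (z l)"
    using approximating_labels[OF z', of z] by blast
  \<comment> \<open>\<open>lim\<close> is total, so \<open>y\<close> is measurable before anything
    is known about convergence.\<close>
  define y where "y p \<omega> = lim (\<lambda>k. tanh (W' (a k (fst p)) \<omega> (snd p)))" for p \<omega>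
  have W'm: "(\<lambda>\<omega>. tanh (W' (a k (fst p)) \<omega> (snd p))) \<in> borel_measurable M'" if "snd (z (fst p)) \<le> snd p" for p k
    using d'(2) order_trans[OF a(3) that, of k]
    by (intro measurable_compose[OF _ borel_measurable_continuous_onI[of tanh]] continuous_on_tanh)
       (auto simp: coalescing_brownian_motions_def continuous_paths_def)
  have ym: "y p \<in> borel_measurable M'" if "snd (z (fst p)) \<le> snd p" for p
    unfolding y_def[abs_def] using W'm[OF that] by (intro borel_measurable_lim_metric)
  have good: "AE \<omega> in M'. (\<forall>p. snd (z (fst p)) \<le> snd p \<longrightarrow> (\<lambda>k. tanh (W' (a k (fst p)) \<omega> (snd p))) \<longlonglongrightarrow> y p \<omega>) \<and>
    (separating z (\<lambda>p. y p \<omega>) \<longrightarrow> (\<forall>U. open U \<longrightarrow> hits D z U (\<lambda>p. y p \<omega>) \<longrightarrow> closure (full_skeleton z' W' Wb' \<omega>) \<inter> U \<noteq> {}))"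
    using skeleton_regular_AE[OF W' z'] skeleton_no_atom_AE[OF W' z', of z]
  proof eventually_elim
    case (elim \<omega>)
    obtain V where V: "\<And>l. V l \<in> closure (range (full_path z' (\<lambda>j. W' j \<omega>) (\<lambda>j. Wb' j \<omega>)))"
      "\<And>l s. snd (z l) \<le> s \<Longrightarrow> (\<lambda>k. tanh (W' (a k l) \<omega> s)) \<longlonglongrightarrow> val (V l) s"
      "\<And>\<xi> j s. separating z \<xi> \<Longrightarrow> \<forall>i u. snd (z i) \<le> u \<longrightarrow> \<xi> (i, u) = val (V i) u \<Longrightarrow> s \<in> \<rat> \<Longrightarrow> full_value z \<xi> j s = val (V j) s"
      by (rule limit_system[OF elim(1) z' elim(2) a(2,3)]) (rule that)
    have yV: "y (i, u) \<omega> = val (V i) u" if "snd (z i) \<le> u" for i u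
      unfolding y_def using limI[OF V(2)[OF that]] by simp
    have "closure (full_skeleton z' W' Wb' \<omega>) \<inter> U \<noteq> {}"
      if sep: "separating z (\<lambda>p. y p \<omega>)" and U: "open U" "hits D z U (\<lambda>p. y p \<omega>)" for U
    proof -
      have "full_value z (\<lambda>p. y p \<omega>) j s = val (V j) s" if "s \<in> \<rat>" for j s
        using that yV by (intro V(3)[OF sep]) auto
      from hits_iff[OF U(1) D this] U(2) obtain j where "V j \<in> U" by blast
      then show ?thesis using V(1)[of j] unfolding full_skeleton_def by blast
    qed
    moreover have "(\<lambda>k. tanh (W' (a k (fst p)) \<omega> (snd p))) \<longlonglongrightarrow> y p \<omega>" if "snd (z (fst p)) \<le> snd p" for p
      using V(2)[OF that] yV[OF that] by simp
    ultimately show ?case by blast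
  qed
  define Y where "Y \<omega> = (\<lambda>p\<in>index_set z. y p \<omega>)" for \<omega>
  have Ym: "Y \<in> measurable M' (PiM (index_set z) (\<lambda>_. borel))"
    unfolding Y_def[abs_def] using ym by (intro measurable_restrict) (auto simp: index_set_def)
  have law: "distr M (PiM (index_set z) (\<lambda>_. borel)) (forward_field z W) = distr M' (PiM (index_set z) (\<lambda>_. borel)) Y"
    unfolding Y_def[abs_def] forward_field_def[abs_def]
  proof (rule distr_PiM_eqI[OF d(1) d'(1)])
    show "(\<lambda>\<omega>. tanh (W (fst p) \<omega> (snd p))) \<in> borel_measurable M" if "p \<in> index_set z" for p
      using measurable_compose[OF forward_field_measurable[OF d(2)] measurable_component_singleton[OF that]] that
      by (simp add: forward_field_def)
    show "y p \<in> borel_measurable M'" if "p \<in> index_set z" for p using ym that by (auto simp: index_set_def)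
    fix P and idx :: "nat \<Rightarrow> nat \<times> real" and \<phi> :: "nat \<Rightarrow> real \<Rightarrow> real"
    assume idx: "\<And>p. p < P \<Longrightarrow> idx p \<in> index_set z" and \<phi>: "\<And>p. continuous_on UNIV (\<phi> p)" "\<And>p x. \<bar>\<phi> p x\<bar> \<le> 1"
    have le: "snd (z (fst (idx p))) \<le> snd (idx p)" if "p < P" for p using idx[OF that] by (auto simp: index_set_def)
    have \<phi>t: "continuous_on UNIV (\<lambda>x. \<phi> p (tanh x))" for p
      by (intro continuous_on_compose2[OF \<phi>(1)] continuous_on_tanh continuous_on_id) auto
    \<comment> \<open>The same integrals have two limits: continuous dependence on the starting
      points gives the law of the forward paths of \<open>z\<close>, dominated convergence the law
      of the pathwise limit \<open>y\<close>.\<close>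
    have "(\<lambda>k. \<integral>\<omega>. (\<Prod>p<P. \<phi> p (tanh (W' (a k (fst (idx p))) \<omega> (snd (idx p))))) \<partial>M') \<longlonglongrightarrow>
        (\<integral>\<omega>. (\<Prod>p<P. \<phi> p (tanh (W (fst (idx p)) \<omega> (snd (idx p))))) \<partial>M)"
      using order_trans[OF a(3) le]
      by (intro cbm_limit[OF d'(2) inj(2) d(2) inj(1) a(1,2), where \<phi>="\<lambda>p x. \<phi> p (tanh x)"] \<phi>t \<phi>(2))
    moreover have "(\<lambda>k. \<integral>\<omega>. (\<Prod>p<P. \<phi> p (tanh (W' (a k (fst (idx p))) \<omega> (snd (idx p))))) \<partial>M') \<longlonglongrightarrow>
        (\<integral>\<omega>. (\<Prod>p<P. \<phi> p (y (idx p) \<omega>)) \<partial>M')"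
    proof (rule prod_tendsto_integral[OF d'(1) \<phi>, where X="\<lambda>k p \<omega>. tanh (W' (a k (fst (idx p))) \<omega> (snd (idx p)))" and Y="\<lambda>p. y (idx p)"])
      show "AE \<omega> in M'. \<forall>p<P. (\<lambda>k. tanh (W' (a k (fst (idx p))) \<omega> (snd (idx p)))) \<longlonglongrightarrow> y (idx p) \<omega>"
        using good by eventually_elim (use le in blast)
    qed (use le W'm ym in auto)
    ultimately show "(\<integral>\<omega>. (\<Prod>p<P. \<phi> p (tanh (W (fst (idx p)) \<omega> (snd (idx p))))) \<partial>M) = (\<integral>\<omega>. (\<Prod>p<P. \<phi> p (y (idx p) \<omega>)) \<partial>M')"
      by (rule LIMSEQ_unique)
  qed
  \<comment> \<open>Separation is an event of the product sigma-algebra with probability 1 for the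
    forward field on \<open>M\<close>, hence also for \<open>Y\<close>.\<close>
  have "AE \<omega> in M. separating z (forward_field z W \<omega>)"
    using forward_field_AE[OF W z D] by eventually_elim blast
  then have "AE \<xi> in distr M (PiM (index_set z) (\<lambda>_. borel)) (forward_field z W). separating z \<xi>"
    by (subst AE_distr_iff[OF forward_field_measurable[OF d(2)] separating_measurable])
  then have "AE \<omega> in M'. separating z (Y \<omega>)"
    unfolding law by (subst (asm) AE_distr_iff[OF Ym separating_measurable])
  then have "AE \<omega> in M'. \<forall>U. open U \<longrightarrow> hits D z U (Y \<omega>) \<longrightarrow> closure (full_skeleton z' W' Wb' \<omega>) \<inter> U \<noteq> {}"
    using good
  proof eventually_elim
    case (elim \<omega>)
    have eq: "Y \<omega> p = y p \<omega>" if "p \<in> index_set z" for p using that by (simp add: Y_def)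
    have "separating z (\<lambda>p. y p \<omega>)" using elim(1) separating_cong[OF eq] by simp
    moreover have "hits D z U (Y \<omega>) \<longleftrightarrow> hits D z U (\<lambda>p. y p \<omega>)" for U by (rule hits_cong[OF eq])
    ultimately show ?case using elim(2) by simp
  qed
  then show ?thesis by (rule that[OF Ym law])
qed

section \<open>Comparison of hitting probabilities\<close>

lemma hits_all_measurable:
  assumes "countable D"
  shows "{\<xi>\<in>space (PiM (index_set z) (\<lambda>_. borel)). \<forall>U\<in>set Us. hits D z U \<xi>} \<in> sets (PiM (index_set z) (\<lambda>_. borel))"
  by (intro sets.sets_Collect_finite_All hits_measurable assms) simp

lemma mem_hit_all: "K \<in> hit_all Us \<longleftrightarrow> (\<forall>U\<in>set Us. set_of_compacts K \<inter> U \<noteq> {})"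
  by (auto simp: hit_all_def hitting_def)

lemma hit_all_measurable:
  assumes "X \<in> borel_measurable M" "\<forall>U\<in>set Us. open U"
  shows "{\<omega>\<in>space M. X \<omega> \<in> hit_all Us} \<in> sets M"
proof -
  have "hit_all Us \<in> sets borel"
    unfolding hit_all_def using assms(2) by (intro borel_open open_INT) (auto intro: open_hitting)
  from measurable_sets[OF assms(1) this] show ?thesis by (simp add: vimage_def Int_def conj_commute)
qed

text \<open>The copy of the first skeleton is known only to lie inside the second web, so hitting by
  the first implies hitting by the second and not conversely.\<close>

lemma hit_all_le:
  fixes M :: "'a measure" and M' :: "'b measure"
  assumes W: "double_web_skeleton M z W Wb" and z: "dense_enumeration z"
    and W': "double_web_skeleton M' z' W' Wb'" and z': "dense_enumeration z'"
    and X: "random_compact_of M (\<lambda>\<omega>. closure (full_skeleton z W Wb \<omega>)) X"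
    and X': "random_compact_of M' (\<lambda>\<omega>. closure (full_skeleton z' W' Wb' \<omega>)) X'"
    and Us: "\<forall>U\<in>set Us. open U"
  shows "measure M {\<omega>\<in>space M. X \<omega> \<in> hit_all Us} \<le> measure M' {\<omega>\<in>space M'. X' \<omega> \<in> hit_all Us}"
proof -
  note d = double_web_skeletonD[OF W] and d' = double_web_skeletonD[OF W']
  interpret M: prob_space M by (rule d(1))
  interpret M': prob_space M' by (rule d'(1))
  obtain D :: "bipath set" where D: "countable D" "closure D = UNIV" using separable_bipath by blast
  obtain Y :: "'b \<Rightarrow> nat \<times> real \<Rightarrow> real" where Y:
    "Y \<in> measurable M' (PiM (index_set z) (\<lambda>_. borel))"
    "distr M (PiM (index_set z) (\<lambda>_. borel)) (forward_field z W) = distr M' (PiM (index_set z) (\<lambda>_. borel)) Y"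
    "AE \<omega> in M'. \<forall>U. open U \<longrightarrow> hits D z U (Y \<omega>) \<longrightarrow> closure (full_skeleton z' W' Wb' \<omega>) \<inter> U \<noteq> {}"
    by (rule limit_field[OF W z W' z' D(2)]) (rule that)
  let ?H = "{\<xi>\<in>space (PiM (index_set z) (\<lambda>_. borel)). \<forall>U\<in>set Us. hits D z U \<xi>}"
  note H = hits_all_measurable[OF D(1), of z Us] and F = forward_field_measurable[OF d(2)]
  note Xm = X[unfolded random_compact_of_def] and X'm = X'[unfolded random_compact_of_def]
  have "AE \<omega> in M. \<omega> \<in> {\<omega>\<in>space M. X \<omega> \<in> hit_all Us} \<longrightarrow> \<omega> \<in> forward_field z W -` ?H \<inter> space M"
    using forward_field_AE[OF W z D(2)] conjunct2[OF Xm]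
  proof eventually_elim
    case (elim \<omega>)
    show ?case
    proof
      assume \<omega>: "\<omega> \<in> {\<omega>\<in>space M. X \<omega> \<in> hit_all Us}"
      then have "\<forall>U\<in>set Us. hits D z U (forward_field z W \<omega>)" using elim Us by (simp add: mem_hit_all)
      then show "\<omega> \<in> forward_field z W -` ?H \<inter> space M" using \<omega> measurable_space[OF F] by simp
    qed
  qed
  then have "M.prob {\<omega>\<in>space M. X \<omega> \<in> hit_all Us} \<le> M.prob (forward_field z W -` ?H \<inter> space M)"
    by (rule M.finite_measure_mono_AE) (rule measurable_sets[OF F H])
  also have "\<dots> = M'.prob (Y -` ?H \<inter> space M')"
    using measure_distr[OF F H] measure_distr[OF Y(1) H] Y(2) by simp
  also have "\<dots> \<le> M'.prob {\<omega>\<in>space M'. X' \<omega> \<in> hit_all Us}"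
  proof (rule M'.finite_measure_mono_AE)
    show "AE \<omega> in M'. \<omega> \<in> Y -` ?H \<inter> space M' \<longrightarrow> \<omega> \<in> {\<omega>\<in>space M'. X' \<omega> \<in> hit_all Us}"
      using Y(3) conjunct2[OF X'm] by eventually_elim (use Us in \<open>auto simp: mem_hit_all\<close>)
    show "{\<omega>\<in>space M'. X' \<omega> \<in> hit_all Us} \<in> sets M'" using X'm Us by (intro hit_all_measurable) auto
  qed
  finally show ?thesis .
qed

lemma skeleton_closure_compact_AE:
  assumes W: "double_web_skeleton M z W Wb" and z: "dense_enumeration z"
  shows "AE \<omega> in M. compact (closure (full_skeleton z W Wb \<omega>))"
  using skeleton_regular_AE[OF W z] by eventually_elim (simp add: full_skeleton_def compact_skeleton)

lemma ex_random_compact: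
  assumes W: "double_web_skeleton M z W Wb" and z: "dense_enumeration z"
  shows "\<exists>X. random_compact_of M (\<lambda>\<omega>. closure (full_skeleton z W Wb \<omega>)) X"
proof -
  note F = forward_field_measurable[OF double_web_skeletonD(2)[OF W]]
  obtain D :: "bipath set" where D: "countable D" "closure D = UNIV" using separable_bipath by blast
  let ?K = "\<lambda>\<omega>. closure (full_skeleton z W Wb \<omega>)"
  have "AE \<omega> in M. compact (?K \<omega>) \<and> (\<forall>U. open U \<longrightarrow> (hits D z U (forward_field z W \<omega>) \<longleftrightarrow> ?K \<omega> \<inter> U \<noteq> {}))"
    using skeleton_closure_compact_AE[OF W z] forward_field_AE[OF W z D(2)] by eventually_elim blast
  then obtain N where N: "N \<in> null_sets M"
    "\<And>\<omega>. \<omega> \<in> space M - N \<Longrightarrow> compact (?K \<omega>) \<and> (\<forall>U. open U \<longrightarrow> (hits D z U (forward_field z W \<omega>) \<longleftrightarrow> ?K \<omega> \<inter> U \<noteq> {}))"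
    by (rule AE_E3) (rule that)
  \<comment> \<open>A constant value on the measurable null set \<open>N\<close> makes
    \<open>X\<close> measurable without completing \<open>M\<close>.\<close>
  define X where "X \<omega> = (if \<omega> \<in> N then undefined else Compacts (?K \<omega>))" for \<omega>
  have X: "set_of_compacts (X \<omega>) = ?K \<omega>" if "\<omega> \<in> space M - N" for \<omega>
    using N(2)[OF that] that by (auto simp: X_def full_skeleton_def intro!: Compacts_inverse)
  have "X \<in> borel_measurable M"
  proof (rule measurable_compacts[OF D])
    fix U :: "bipath set" assume U: "open U"
    let ?H = "{\<xi>\<in>space (PiM (index_set z) (\<lambda>_. borel)). hits D z U \<xi>}"
    have "{\<omega>\<in>space M. X \<omega> \<in> hitting U} = ((forward_field z W -` ?H \<inter> space M) - N) \<union> (if undefined \<in> hitting U then N else {})"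
    proof (intro set_eqI)
      fix \<omega>
      show "\<omega> \<in> {\<omega>\<in>space M. X \<omega> \<in> hitting U} \<longleftrightarrow> \<omega> \<in> ((forward_field z W -` ?H \<inter> space M) - N) \<union> (if undefined \<in> hitting U then N else {})"
      proof (cases "\<omega> \<in> N")
        case True
        then show ?thesis using null_setsD2[OF N(1)] sets.sets_into_space by (auto simp: X_def)
      next
        case False
        then show ?thesis using X[of \<omega>] N(2)[of \<omega>] U measurable_space[OF F, of \<omega>] by (auto simp: hitting_def)
      qed
    qed
    also have "\<dots> \<in> sets M"
      using null_setsD2[OF N(1)] by (intro sets.Un sets.Diff measurable_sets[OF F] hits_measurable D(1)) auto
    finally show "{\<omega>\<in>space M. X \<omega> \<in> hitting U} \<in> sets M" .
  qed
  moreover have "AE \<omega> in M. set_of_compacts (X \<omega>) = ?K \<omega>"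
    using AE_not_in[OF N(1)] AE_space by eventually_elim (intro X, simp)
  ultimately show ?thesis unfolding random_compact_of_def by blast
qed

theorem proposition2p4:
  fixes M :: "'s measure" and z :: "nat \<Rightarrow> real \<times> real" and W Wb :: "nat \<Rightarrow> 's \<Rightarrow> real \<Rightarrow> real"
  assumes "dense_enumeration z" and "double_web_skeleton M z W Wb"
  shows "(AE \<omega> in M. compact (closure (full_skeleton z W Wb \<omega>))) \<and>
    (\<exists>X. random_compact_of M (\<lambda>\<omega>. closure (full_skeleton z W Wb \<omega>)) X) \<and>
    (\<forall>(M' :: 't measure) z' W' Wb' X X'.
       dense_enumeration z' \<longrightarrow> double_web_skeleton M' z' W' Wb' \<longrightarrow>
       random_compact_of M (\<lambda>\<omega>. closure (full_skeleton z W Wb \<omega>)) X \<longrightarrow>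
       random_compact_of M' (\<lambda>\<omega>. closure (full_skeleton z' W' Wb' \<omega>)) X' \<longrightarrow>
       distr M borel X = distr M' borel X')"
proof (intro conjI allI impI)
  show "AE \<omega> in M. compact (closure (full_skeleton z W Wb \<omega>))"
    by (rule skeleton_closure_compact_AE[OF assms(2,1)])
  show "\<exists>X. random_compact_of M (\<lambda>\<omega>. closure (full_skeleton z W Wb \<omega>)) X"
    by (rule ex_random_compact[OF assms(2,1)])
  fix M' :: "'t measure" and z' W' Wb' X X'
  assume z': "dense_enumeration z'" and W': "double_web_skeleton M' z' W' Wb'"
    and X: "random_compact_of M (\<lambda>\<omega>. closure (full_skeleton z W Wb \<omega>)) X"
    and X': "random_compact_of M' (\<lambda>\<omega>. closure (full_skeleton z' W' Wb' \<omega>)) X'"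
  obtain D :: "bipath set" where D: "countable D" "closure D = UNIV" using separable_bipath by blast
  show "distr M borel X = distr M' borel X'"
  proof (rule distr_compacts_eqI[OF D double_web_skeletonD(1)[OF assms(2)] double_web_skeletonD(1)[OF W']])
    show "X \<in> borel_measurable M" "X' \<in> borel_measurable M'" using X X' by (simp_all add: random_compact_of_def)
    fix Us :: "bipath set list" assume "\<forall>U\<in>set Us. open U"
    then show "measure M {\<omega>\<in>space M. X \<omega> \<in> hit_all Us} = measure M' {\<omega>\<in>space M'. X' \<omega> \<in> hit_all Us}"
      by (intro antisym hit_all_le[OF assms(2,1) W' z' X X'] hit_all_le[OF W' z' assms(2,1) X' X])
  qed
qed

end
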